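(* Let $n\ge 3$, let $\lambda\in\mathbb{R}$, and let $V:\mathbb{R}\to\mathbb{R}$ be a function of class $C^{3,1}$. Let $U$ and $\bar U$ be smooth manifolds of dimension $n$. Let $(g,\phi)$ and $(\bar g,\bar\phi)$ be smooth solutions of the Einstein-scalar-field equations (with the same $\lambda$ and $V$) on $U$ and $\bar U$ respectively; that is, $g$ is a smooth Riemannian metric on $U$ and $\phi:U\to\mathbb{R}$ is a smooth function such that $$R_{ij}=\nabla_i\phi\,\nabla_j\phi+g_{ij}V(\phi)+\lambda g_{ij},\qquad \triangle_g\phi=V'(\phi)\quad\text{on }U,$$ and likewise for $(\bar g,\bar\phi)$ on $\bar U$. Assume that there are points $p\in U$, $\bar p\in\bar U$ and a vector-space isomorphism $\Psi:T_pU\to T_{\bar p}\bar U$ such that, for every integer $k\ge 0$ and all $X_{(1)},X_{(2)},\ldots\in T_pU$, $$g(X_{(1)},X_{(2)})=\bar g(\Psi X_{(1)},\Psi X_{(2)}),$$ $$\nabla^{(k)}_{X_{(1)}\cdots X_{(k)}}\phi=\bar\nabla^{(k)}_{\Psi X_{(1)}\cdots\Psi X_{(k)}}\bar\phi,$$ $$\nabla^{(k)}_{X_{(1)}\cdots X_{(k)}}R(X_{(k+1)},\ldots,X_{(k+4)})=\bar\nabla^{(k)}_{\Psi X_{(1)}\cdots\Psi X_{(k)}}\bar R(\Psi X_{(k+1)},\ldots,\Psi X_{(k+4)}),$$ where the left-hand sides are evaluated at $p$ and the right-hand sides at $\bar p$. Then there exist neighborhoods $W$ of $p$ in $U$ and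 $\bar W$ of $\bar p$ in $\bar U$ and a diffeomorphism $f:W\to\bar W$ such that $g=f^*\bar g$ and $\phi=f^*\bar\phi$ on $W$.
   Context: $\nabla$ is the Levi-Civita connection of $g$, $\triangle_g=g^{ij}\nabla_i\nabla_j$ is its Laplacian, $R_{ij}$ is the Ricci curvature of $g$, and $R(\cdot,\cdot,\cdot,\cdot)$ is the Riemann curvature tensor of $g$ viewed as a covariant 4-tensor; $\bar\nabla$, $\bar R$, etc. are the corresponding objects for $\bar g$. $\nabla^{(k)}$ denotes the $k$-fold iterated covariant derivative, and $\nabla^{(0)}$ is the identity. $C^{3,1}$ means three times continuously differentiable with locally Lipschitz third derivative. $f^*\bar\phi=\bar\phi\circ f$. The constant $\lambda$ is the cosmological constant and $V$ is the potential of the scalar field. *)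

theory Defs
  imports "HOL-Analysis.Analysis"
begin

section \<open>Differentiability classes on open subsets of Euclidean space\<close>

text \<open>
  For open \<^term>\<open>S\<close> in a finite-dimensional space this is the usual class of \<open>k\<close> times continuously
  differentiable maps: all iterated directional derivatives up to order \<open>k\<close> exist and are continuous.
\<close>

fun C_on :: "nat \<Rightarrow> 'a::euclidean_space set \<Rightarrow> ('a \<Rightarrow> 'b::real_normed_vector) \<Rightarrow> bool" where
  "C_on 0 S f \<longleftrightarrow> continuous_on S f"
| "C_on (Suc k) S f \<longleftrightarrow>
     (\<forall>x\<in>S. f differentiable (at x)) \<and> (\<forall>v. C_on k S (\<lambda>x. frechet_derivative f (at x) v))"

definition smooth_on :: "'a::euclidean_space set \<Rightarrow> ('a \<Rightarrow> 'b::real_normed_vector) \<Rightarrow> bool" where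
  "smooth_on S f \<longleftrightarrow> (\<forall>k. C_on k S f)"

definition C31 :: "(real \<Rightarrow> real) \<Rightarrow> bool" where
  "C31 V \<longleftrightarrow> C_on 3 UNIV V \<and> (\<forall>x. \<exists>u>0. \<exists>L. L-lipschitz_on (cball x u) ((deriv ^^ 3) V))"


section \<open>Smooth manifolds\<close>

text \<open>
  A chart is a pair of its domain and its coordinate map; the values of the map off the domain are
  irrelevant. The dimension of the manifold is the cardinality of the index type \<^typ>\<open>'n\<close>.
\<close>

type_synonym ('a, 'n) chart = "'a set \<times> ('a \<Rightarrow> real^'n)"

definition chart_inv :: "('a, 'n::finite) chart \<Rightarrow> real^'n \<Rightarrow> 'a" where
  "chart_inv c = inv_into (fst c) (snd c)"

definition chart_image :: "('a, 'n::finite) chart \<Rightarrow> (real^'n) set" where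
  "chart_image c = snd c ` fst c"

definition transition :: "('a, 'n::finite) chart \<Rightarrow> ('a, 'n) chart \<Rightarrow> real^'n \<Rightarrow> real^'n" where
  "transition c d = snd d \<circ> chart_inv c"

text \<open>The atlas is not required to be maximal; every notion below depends only on the smooth
  structure that it generates.\<close>

locale smooth_manifold =
  fixes X :: "'a topology" and A :: "('a, 'n::finite) chart set"
  assumes Hausdorff: "Hausdorff_space X"
    and second_countable: "second_countable X"
    and chart_dom_open: "\<And>c. c \<in> A \<Longrightarrow> openin X (fst c)"
    and chart_image_open: "\<And>c. c \<in> A \<Longrightarrow> open (chart_image c)"
    and chart_homeo:
      "\<And>c. c \<in> A \<Longrightarrow> homeomorphic_map (subtopology X (fst c)) (top_of_set (chart_image c)) (snd c)"
    and charts_cover: "(\<Union>c\<in>A. fst c) = topspace X"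
    and charts_compatible:
      "\<And>c d. c \<in> A \<Longrightarrow> d \<in> A \<Longrightarrow> smooth_on (snd c ` (fst c \<inter> fst d)) (transition c d)"

definition charts_at :: "('a, 'n::finite) chart set \<Rightarrow> 'a \<Rightarrow> ('a, 'n) chart set" where
  "charts_at A p = {c \<in> A. p \<in> fst c}"

definition chart_at :: "('a, 'n::finite) chart set \<Rightarrow> 'a \<Rightarrow> ('a, 'n) chart" where
  "chart_at A p = (SOME c. c \<in> charts_at A p)"

definition smooth_fun :: "('a, 'n::finite) chart set \<Rightarrow> ('a \<Rightarrow> real) \<Rightarrow> bool" where
  "smooth_fun A \<phi> \<longleftrightarrow> (\<forall>c\<in>A. smooth_on (chart_image c) (\<phi> \<circ> chart_inv c))"

definition smooth_map_on ::
  "'a topology \<Rightarrow> ('a, 'n::finite) chart set \<Rightarrow> 'b topology \<Rightarrow> ('b, 'm::finite) chart set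
    \<Rightarrow> 'a set \<Rightarrow> ('a \<Rightarrow> 'b) \<Rightarrow> bool" where
  "smooth_map_on X A X' A' W f \<longleftrightarrow>
     continuous_map (subtopology X W) X' f \<and>
     (\<forall>c\<in>A. \<forall>d\<in>A'. smooth_on (snd c ` {q \<in> W \<inter> fst c. f q \<in> fst d}) (snd d \<circ> f \<circ> chart_inv c))"

definition diffeomorphism_on ::
  "'a topology \<Rightarrow> ('a, 'n::finite) chart set \<Rightarrow> 'b topology \<Rightarrow> ('b, 'n) chart set
    \<Rightarrow> 'a set \<Rightarrow> 'b set \<Rightarrow> ('a \<Rightarrow> 'b) \<Rightarrow> bool" where
  "diffeomorphism_on X A X' A' W W' f \<longleftrightarrow>
     openin X W \<and> openin X' W' \<and> bij_betw f W W' \<and>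
     smooth_map_on X A X' A' W f \<and> smooth_map_on X' A' X A W' (inv_into W f)"


section \<open>Tangent vectors\<close>

text \<open>
  A tangent vector at \<open>p\<close> assigns to every chart around \<open>p\<close> its components in that chart, subject to
  the transformation law. Charts not containing \<open>p\<close> are sent to 0, so that vectors at \<open>p\<close> are equal
  as soon as their components in the charts around \<open>p\<close> are. Vector space operations are pointwise.
\<close>

type_synonym ('a, 'n) tvec = "('a, 'n) chart \<Rightarrow> real^'n"

definition tangent_space :: "('a, 'n::finite) chart set \<Rightarrow> 'a \<Rightarrow> ('a, 'n) tvec set" where
  "tangent_space A p =
     {v. (\<forall>c. c \<notin> charts_at A p \<longrightarrow> v c = 0) \<and>
         (\<forall>c\<in>charts_at A p. \<forall>d\<in>charts_at A p.
            v d = frechet_derivative (transition c d) (at (snd c p)) (v c))}"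

definition lin_comb :: "real \<Rightarrow> ('a, 'n::finite) tvec \<Rightarrow> real \<Rightarrow> ('a, 'n) tvec \<Rightarrow> ('a, 'n) tvec" where
  "lin_comb a v b w = (\<lambda>c. a *\<^sub>R v c + b *\<^sub>R w c)"

definition tangent_isomorphism ::
  "('a, 'n::finite) chart set \<Rightarrow> 'a \<Rightarrow> ('b, 'n) chart set \<Rightarrow> 'b
    \<Rightarrow> (('a, 'n) tvec \<Rightarrow> ('b, 'n) tvec) \<Rightarrow> bool" where
  "tangent_isomorphism A p A' p' \<Psi> \<longleftrightarrow>
     bij_betw \<Psi> (tangent_space A p) (tangent_space A' p') \<and>
     (\<forall>a b. \<forall>v\<in>tangent_space A p. \<forall>w\<in>tangent_space A p.
        \<Psi> (lin_comb a v b w) = lin_comb a (\<Psi> v) b (\<Psi> w))"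

text \<open>The tangent vector at \<open>q\<close> with components \<open>v\<close> in the chart \<open>c\<close> around \<open>q\<close>.\<close>

definition coord_vec ::
  "('a, 'n::finite) chart set \<Rightarrow> ('a, 'n) chart \<Rightarrow> 'a \<Rightarrow> real^'n \<Rightarrow> ('a, 'n) tvec" where
  "coord_vec A c q v =
     (\<lambda>d. if d \<in> charts_at A q then frechet_derivative (transition c d) (at (snd c q)) v else 0)"

definition differential ::
  "('a, 'n::finite) chart set \<Rightarrow> ('b, 'm::finite) chart set \<Rightarrow> ('a \<Rightarrow> 'b) \<Rightarrow> 'a
    \<Rightarrow> ('a, 'n) tvec \<Rightarrow> ('b, 'm) tvec" where
  "differential A A' f q v =
     (let c = chart_at A q in
      (\<lambda>d. if d \<in> charts_at A' (f q)
           then frechet_derivative (snd d \<circ> f \<circ> chart_inv c) (at (snd c q)) (v c) else 0))"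

lemma (in smooth_manifold) chart_inj: "c \<in> A \<Longrightarrow> inj_on (snd c) (fst c)"
  using homeomorphic_imp_injective_map[OF chart_homeo] chart_dom_open openin_subset
  by (metis topspace_subtopology_subset)

lemma (in smooth_manifold) chart_inv_chart [simp]:
  "c \<in> A \<Longrightarrow> q \<in> fst c \<Longrightarrow> chart_inv c (snd c q) = q"
  by (simp add: chart_inv_def chart_inj)

lemma (in smooth_manifold) open_overlap:
  assumes "c \<in> A" "d \<in> A"
  shows "open (snd c ` (fst c \<inter> fst d))"
proof -
  have "openin (subtopology X (fst c)) (fst c \<inter> fst d)"
    using chart_dom_open assms by (metis inf_commute openin_subtopology_Int)
  then have "openin (top_of_set (chart_image c)) (snd c ` (fst c \<inter> fst d))"
    using homeomorphic_imp_open_map[OF chart_homeo[OF assms(1)]] by (simp add: open_map_def)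
  then show ?thesis
    using chart_image_open[OF assms(1)] openin_open_trans by blast
qed

lemma (in smooth_manifold) transition_has_derivative:
  assumes "c \<in> charts_at A q" "d \<in> charts_at A q"
  shows "(transition c d has_derivative frechet_derivative (transition c d) (at (snd c q)))
           (at (snd c q))"
proof -
  have m: "c \<in> A" "d \<in> A" "snd c q \<in> snd c ` (fst c \<inter> fst d)"
    using assms by (auto simp: charts_at_def)
  have "C_on (Suc 0) (snd c ` (fst c \<inter> fst d)) (transition c d)"
    using charts_compatible[OF m(1,2)] unfolding smooth_on_def by blast
  then have "transition c d differentiable at (snd c q)"
    unfolding C_on.simps using m(3) by blast
  then show ?thesis
    by (simp add: frechet_derivative_works)
qed

text \<open>Taking components in a chart around \<open>q\<close> identifies the tangent space at \<open>q\<close> with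
  \<^typ>\<open>real^'n\<close>.\<close>

lemma (in smooth_manifold) coord_vec_self:
  assumes c: "c \<in> charts_at A q"
  shows "coord_vec A c q v c = v"
proof -
  have "c \<in> A" "q \<in> fst c" using c by (auto simp: charts_at_def)
  have "frechet_derivative (transition c c) (at (snd c q)) = (\<lambda>v. v)"
  proof (rule frechet_derivative_at[symmetric], rule has_derivative_transform_within_open)
    show "((\<lambda>x. x) has_derivative (\<lambda>v. v)) (at (snd c q))" by simp
    show "open (chart_image c)" using \<open>c \<in> A\<close> by (rule chart_image_open)
    show "snd c q \<in> chart_image c" using \<open>q \<in> fst c\<close> by (simp add: chart_image_def)
    show "x = transition c c x" if "x \<in> chart_image c" for x
      using that \<open>c \<in> A\<close> by (auto simp: chart_image_def transition_def)
  qed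
  then show ?thesis using c by (simp add: coord_vec_def)
qed

lemma (in smooth_manifold) coord_vec_in_tangent_space:
  assumes c: "c \<in> charts_at A q"
  shows "coord_vec A c q v \<in> tangent_space A q"
proof -
  have *: "frechet_derivative (transition c e) (at (snd c q)) v =
        frechet_derivative (transition d e) (at (snd d q))
          (frechet_derivative (transition c d) (at (snd c q)) v)"
    if d: "d \<in> charts_at A q" and e: "e \<in> charts_at A q" for d e
  proof -
    have m: "c \<in> A" "d \<in> A" "e \<in> A" "q \<in> fst c" "q \<in> fst d" "q \<in> fst e"
      using c d e by (auto simp: charts_at_def)
    have q: "transition c d (snd c q) = snd d q" using m by (simp add: transition_def)
    have "(transition d e \<circ> transition c d has_derivative
            frechet_derivative (transition d e) (at (snd d q)) \<circ>
            frechet_derivative (transition c d) (at (snd c q))) (at (snd c q))"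
      using transition_has_derivative[OF c d] transition_has_derivative[OF d e]
      unfolding q[symmetric] by (rule diff_chain_at)
    then have "(transition c e has_derivative
            frechet_derivative (transition d e) (at (snd d q)) \<circ>
            frechet_derivative (transition c d) (at (snd c q))) (at (snd c q))"
    proof (rule has_derivative_transform_within_open)
      show "open (snd c ` (fst c \<inter> fst d))" using m(1,2) by (rule open_overlap)
      show "snd c q \<in> snd c ` (fst c \<inter> fst d)" using m(4,5) by (intro imageI IntI)
      show "(transition d e \<circ> transition c d) x = transition c e x"
        if "x \<in> snd c ` (fst c \<inter> fst d)" for x
        using that m by (auto simp: transition_def)
    qed
    from fun_cong[OF frechet_derivative_at[OF this], of v] show ?thesis by simp
  qed
  show ?thesis
    unfolding tangent_space_def
  proof (intro CollectI conjI allI ballI impI)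
    show "coord_vec A c q v d = 0" if "d \<notin> charts_at A q" for d
      using that by (simp add: coord_vec_def)
    show "coord_vec A c q v e =
        frechet_derivative (transition d e) (at (snd d q)) (coord_vec A c q v d)"
      if "d \<in> charts_at A q" "e \<in> charts_at A q" for d e
      unfolding coord_vec_def if_P[OF that(1)] if_P[OF that(2)] by (rule *[OF that])
  qed
qed

lemma (in smooth_manifold) coord_vec_components:
  assumes "v \<in> tangent_space A q" "c \<in> charts_at A q"
  shows "coord_vec A c q (v c) = v"
proof
  fix d
  show "coord_vec A c q (v c) d = v d"
  proof (cases "d \<in> charts_at A q")
    case True
    have "\<forall>c\<in>charts_at A q. \<forall>d\<in>charts_at A q.
            v d = frechet_derivative (transition c d) (at (snd c q)) (v c)"
      using assms(1) unfolding tangent_space_def by blast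
    then have "v d = frechet_derivative (transition c d) (at (snd c q)) (v c)"
      using assms(2) True by blast
    then show ?thesis unfolding coord_vec_def if_P[OF True] by (rule sym)
  next
    case False
    have "\<forall>d. d \<notin> charts_at A q \<longrightarrow> v d = 0"
      using assms(1) unfolding tangent_space_def by blast
    then have "v d = 0" using False by blast
    then show ?thesis using False by (simp add: coord_vec_def)
  qed
qed


section \<open>Riemannian metrics and their coordinate components\<close>

type_synonym ('a, 'n) metric_field = "'a \<Rightarrow> ('a, 'n) tvec \<Rightarrow> ('a, 'n) tvec \<Rightarrow> real"

definition metric_matrix ::
  "('a, 'n::finite) chart set \<Rightarrow> ('a, 'n) metric_field \<Rightarrow> ('a, 'n) chart \<Rightarrow> real^'n \<Rightarrow> real^'n^'n" where
  "metric_matrix A g c x =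
     (let q = chart_inv c x
      in \<chi> i j. g q (coord_vec A c q (axis i 1)) (coord_vec A c q (axis j 1)))"

text \<open>Linearity in the second argument follows from symmetry.\<close>

definition riemannian_metric ::
  "'a topology \<Rightarrow> ('a, 'n::finite) chart set \<Rightarrow> ('a, 'n) metric_field \<Rightarrow> bool" where
  "riemannian_metric X A g \<longleftrightarrow>
     (\<forall>q\<in>topspace X.
        (\<forall>u\<in>tangent_space A q. \<forall>v\<in>tangent_space A q. \<forall>w\<in>tangent_space A q. \<forall>a b.
           g q (lin_comb a u b v) w = a * g q u w + b * g q v w) \<and>
        (\<forall>v\<in>tangent_space A q. \<forall>w\<in>tangent_space A q. g q v w = g q w v) \<and>
        (\<forall>v\<in>tangent_space A q. v \<noteq> (\<lambda>_. 0) \<longrightarrow> g q v v > 0)) \<and>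
     (\<forall>c\<in>A. \<forall>i j. smooth_on (chart_image c) (\<lambda>x. metric_matrix A g c x $ i $ j))"


section \<open>The Levi-Civita connection and curvature in coordinates\<close>

text \<open>
  In this section \<open>G\<close> is the matrix field \<open>g\<^sub>i\<^sub>j\<close> of a metric in a fixed chart. The components
  of a covariant \<open>m\<close>-tensor field form a function \<open>T\<close>, where \<open>T x [i1, ..., im]\<close> is the component
  with indices \<open>i1, ..., im\<close> at \<open>x\<close>; values on lists of other lengths play no role.
\<close>

definition partial :: "'n::finite \<Rightarrow> (real^'n \<Rightarrow> real) \<Rightarrow> real^'n \<Rightarrow> real" where
  "partial i f x = frechet_derivative f (at x) (axis i 1)"

definition ginv :: "(real^'n \<Rightarrow> real^'n^'n::finite) \<Rightarrow> 'n \<Rightarrow> 'n \<Rightarrow> real^'n \<Rightarrow> real" where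
  "ginv G i j x = matrix_inv (G x) $ i $ j"

text \<open>\<open>christoffel G k i j\<close> is \<open>\<Gamma>\<^sup>k\<^sub>i\<^sub>j\<close>, that is, \<open>\<nabla>\<^sub>i \<partial>\<^sub>j = \<Sum>k. \<Gamma>\<^sup>k\<^sub>i\<^sub>j \<partial>\<^sub>k\<close>.\<close>

definition christoffel :: "(real^'n \<Rightarrow> real^'n^'n::finite) \<Rightarrow> 'n \<Rightarrow> 'n \<Rightarrow> 'n \<Rightarrow> real^'n \<Rightarrow> real" where
  "christoffel G k i j x =
     (\<Sum>l\<in>UNIV. ginv G k l x *
        (partial i (\<lambda>y. G y $ j $ l) x + partial j (\<lambda>y. G y $ i $ l) x
          - partial l (\<lambda>y. G y $ i $ j) x)) / 2"

text \<open>The new index comes first: \<open>cov_deriv G T x (i # I) = \<nabla>\<^sub>i T\<^sub>I\<close>.\<close>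

fun cov_deriv ::
  "(real^'n \<Rightarrow> real^'n^'n::finite) \<Rightarrow> (real^'n \<Rightarrow> 'n list \<Rightarrow> real) \<Rightarrow> real^'n \<Rightarrow> 'n list \<Rightarrow> real" where
  "cov_deriv G T x [] = 0"
| "cov_deriv G T x (i # I) =
     partial i (\<lambda>y. T y I) x
     - (\<Sum>a<length I. \<Sum>k\<in>UNIV. christoffel G k i (I ! a) x * T x (I[a := k]))"

text \<open>\<open>curvature_op G l i j k\<close> is the \<open>\<partial>\<^sub>l\<close> component of
  \<open>R(\<partial>\<^sub>i, \<partial>\<^sub>j) \<partial>\<^sub>k = \<nabla>\<^sub>i \<nabla>\<^sub>j \<partial>\<^sub>k - \<nabla>\<^sub>j \<nabla>\<^sub>i \<partial>\<^sub>k\<close>.\<close>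

definition curvature_op ::
  "(real^'n \<Rightarrow> real^'n^'n::finite) \<Rightarrow> 'n \<Rightarrow> 'n \<Rightarrow> 'n \<Rightarrow> 'n \<Rightarrow> real^'n \<Rightarrow> real" where
  "curvature_op G l i j k x =
     partial i (christoffel G l j k) x - partial j (christoffel G l i k) x
     + (\<Sum>m\<in>UNIV. christoffel G m j k x * christoffel G l i m x
                 - christoffel G m i k x * christoffel G l j m x)"

text \<open>The covariant 4-tensor \<open>R(Y, Z, U, W) = g(R(Y, Z) U, W)\<close>. The Ricci tensor is the
  trace of \<open>Y \<mapsto> R(Y, Z) U\<close>, which is positive on round spheres.\<close>

definition riemann :: "(real^'n \<Rightarrow> real^'n^'n::finite) \<Rightarrow> real^'n \<Rightarrow> 'n list \<Rightarrow> real" where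
  "riemann G x I = (\<Sum>m\<in>UNIV. curvature_op G m (I ! 0) (I ! 1) (I ! 2) x * G x $ m $ (I ! 3))"

definition ricci :: "(real^'n \<Rightarrow> real^'n^'n::finite) \<Rightarrow> 'n \<Rightarrow> 'n \<Rightarrow> real^'n \<Rightarrow> real" where
  "ricci G j k x = (\<Sum>i\<in>UNIV. curvature_op G i i j k x)"

definition scalar_field :: "(real^'n \<Rightarrow> real) \<Rightarrow> real^'n \<Rightarrow> 'n::finite list \<Rightarrow> real" where
  "scalar_field h x I = h x"

definition laplacian :: "(real^'n \<Rightarrow> real^'n^'n::finite) \<Rightarrow> (real^'n \<Rightarrow> real) \<Rightarrow> real^'n \<Rightarrow> real" where
  "laplacian G h x =
     (\<Sum>i\<in>UNIV. \<Sum>j\<in>UNIV. ginv G i j x * cov_deriv G (cov_deriv G (scalar_field h)) x [i, j])"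

text \<open>
  The symbols above are those of the Levi-Civita connection: they are symmetric (no torsion) and
  make \<open>g\<close> parallel, and they are the only symbols that do so.
\<close>

lemma partial_cong:
  assumes "\<And>y. y \<in> S \<Longrightarrow> f y = h y" "open S" "x \<in> S"
  shows "partial i f x = partial i h x"
proof -
  have "(f has_derivative D) (at x) \<longleftrightarrow> (h has_derivative D) (at x)" for D
    using has_derivative_transform_within_open[of f D x UNIV S h]
      has_derivative_transform_within_open[of h D x UNIV S f] assms by auto
  then show ?thesis by (simp add: partial_def frechet_derivative_def)
qed

lemma christoffel_symmetric:
  assumes sym: "\<And>y i j. y \<in> S \<Longrightarrow> G y $ i $ j = G y $ j $ i" and S: "open S" "x \<in> S"
  shows "christoffel G k i j x = christoffel G k j i x"
proof -
  have "partial l (\<lambda>y. G y $ i $ j) x = partial l (\<lambda>y. G y $ j $ i) x" for l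
    by (rule partial_cong[OF sym S])
  then show ?thesis by (simp add: christoffel_def add.commute)
qed

lemma matrix_inv_mult_sum:
  fixes M :: "real^'n^'n::finite"
  assumes "invertible M"
  shows "(\<Sum>k\<in>UNIV. M $ m $ k * matrix_inv M $ k $ l) = (if m = l then 1 else 0)"
    and "(\<Sum>k\<in>UNIV. matrix_inv M $ m $ k * M $ k $ l) = (if m = l then 1 else 0)"
proof -
  have "M ** matrix_inv M = mat 1" "matrix_inv M ** M = mat 1"
    using someI_ex[OF assms[unfolded invertible_def]] unfolding matrix_inv_def by auto
  then show "(\<Sum>k\<in>UNIV. M $ m $ k * matrix_inv M $ k $ l) = (if m = l then 1 else 0)"
    and "(\<Sum>k\<in>UNIV. matrix_inv M $ m $ k * M $ k $ l) = (if m = l then 1 else 0)"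
    by (auto simp: vec_eq_iff matrix_matrix_mult_def mat_def)
qed

lemma christoffel_lowered:
  fixes G :: "real^'n \<Rightarrow> real^'n^'n::finite"
  assumes "invertible (G x)"
  shows "(\<Sum>k\<in>UNIV. G x $ m $ k * christoffel G k i j x) =
    (partial i (\<lambda>y. G y $ j $ m) x + partial j (\<lambda>y. G y $ i $ m) x - partial m (\<lambda>y. G y $ i $ j) x) / 2"
proof -
  define P where "P l = (partial i (\<lambda>y. G y $ j $ l) x + partial j (\<lambda>y. G y $ i $ l) x
          - partial l (\<lambda>y. G y $ i $ j) x) / 2" for l
  have "(\<Sum>k\<in>UNIV. G x $ m $ k * christoffel G k i j x) =
        (\<Sum>k\<in>UNIV. \<Sum>l\<in>UNIV. (G x $ m $ k * matrix_inv (G x) $ k $ l) * P l)"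
    by (simp add: christoffel_def ginv_def P_def sum_distrib_left sum_divide_distrib mult.assoc)
  also have "\<dots> = (\<Sum>l\<in>UNIV. (\<Sum>k\<in>UNIV. G x $ m $ k * matrix_inv (G x) $ k $ l) * P l)"
    by (subst sum.swap) (simp add: sum_distrib_right)
  also have "\<dots> = (\<Sum>l\<in>UNIV. if m = l then P l else 0)"
    by (rule sum.cong) (simp_all add: matrix_inv_mult_sum[OF assms])
  also have "\<dots> = P m" by simp
  finally show ?thesis by (simp add: P_def)
qed

lemma christoffel_metric:
  fixes G :: "real^'n \<Rightarrow> real^'n^'n::finite"
  assumes sym: "\<And>y i j. y \<in> S \<Longrightarrow> G y $ i $ j = G y $ j $ i" and S: "open S" "x \<in> S"
    and inv: "invertible (G x)"
  shows "cov_deriv G (\<lambda>y I. G y $ (I ! 0) $ (I ! 1)) x [k, i, j] = 0"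
proof -
  have p: "partial l (\<lambda>y. G y $ a $ b) x = partial l (\<lambda>y. G y $ b $ a) x" for l a b
    by (rule partial_cong[OF sym S])
  have "cov_deriv G (\<lambda>y I. G y $ (I ! 0) $ (I ! 1)) x [k, i, j] =
     partial k (\<lambda>y. G y $ i $ j) x - ((\<Sum>l\<in>UNIV. G x $ j $ l * christoffel G l k i x)
       + (\<Sum>l\<in>UNIV. G x $ i $ l * christoffel G l k j x))"
    using sym[OF S(2)] by (simp add: lessThan_Suc mult.commute numeral_2_eq_2)
  then show ?thesis
    unfolding christoffel_lowered[of G, OF inv] using p[of k j i] p[of i k j] p[of j k i]
    by (simp add: field_simps)
qed

lemma christoffel_unique:
  fixes G :: "real^'n \<Rightarrow> real^'n^'n::finite"
  assumes sym: "\<And>y i j. y \<in> S \<Longrightarrow> G y $ i $ j = G y $ j $ i" and S: "open S" "x \<in> S"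
    and inv: "invertible (G x)"
    and torsion_free: "\<And>k i j. \<Gamma> k i j = \<Gamma> k j i"
    and parallel: "\<And>k i j. partial k (\<lambda>y. G y $ i $ j) x =
      (\<Sum>l\<in>UNIV. G x $ j $ l * \<Gamma> l k i) + (\<Sum>l\<in>UNIV. G x $ i $ l * \<Gamma> l k j)"
  shows "\<Gamma> k i j = christoffel G k i j x"
proof -
  have 1: "(\<Sum>l\<in>UNIV. G x $ m $ l * \<Gamma> l i j) =
    (partial i (\<lambda>y. G y $ j $ m) x + partial j (\<lambda>y. G y $ i $ m) x - partial m (\<lambda>y. G y $ i $ j) x) / 2"
    for m
    unfolding parallel using torsion_free by simp
  have 2: "c k = (\<Sum>m\<in>UNIV. matrix_inv (G x) $ k $ m * (\<Sum>l\<in>UNIV. G x $ m $ l * c l))"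
    for c :: "'n \<Rightarrow> real"
  proof -
    have "(\<Sum>m\<in>UNIV. matrix_inv (G x) $ k $ m * (\<Sum>l\<in>UNIV. G x $ m $ l * c l)) =
      (\<Sum>l\<in>UNIV. (\<Sum>m\<in>UNIV. matrix_inv (G x) $ k $ m * G x $ m $ l) * c l)"
      unfolding sum_distrib_left sum_distrib_right by (subst sum.swap) (simp add: mult.assoc)
    also have "\<dots> = (\<Sum>l\<in>UNIV. if k = l then c l else 0)"
      by (rule sum.cong) (simp_all add: matrix_inv_mult_sum[OF inv])
    finally show ?thesis by simp
  qed
  show ?thesis
    unfolding 2[of "\<lambda>k. \<Gamma> k i j"] 2[of "\<lambda>k. christoffel G k i j x"]
      1 christoffel_lowered[of G, OF inv] by (rule refl)
qed


section \<open>Covariant derivatives at a point\<close>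

definition tensor_apply :: "('n::finite list \<Rightarrow> real) \<Rightarrow> (real^'n) list \<Rightarrow> real" where
  "tensor_apply T vs =
     (\<Sum>I | length I = length vs. T I * (\<Prod>a<length vs. (vs ! a) $ (I ! a)))"

text \<open>
  \<open>nabla_scalar A g \<phi> k p [X1, ..., Xk]\<close> is the value at \<open>p\<close> of the \<open>k\<close>-fold covariant derivative
  of \<open>\<phi>\<close> on \<open>X1, ..., Xk\<close>, and \<open>nabla_riemann A g k p [X1, ..., X(k+4)]\<close> is that of the
  curvature tensor, the first \<open>k\<close> vectors being the directions of differentiation. They are
  computed in one chart around \<open>p\<close>; by the tensor transformation law the choice is immaterial.
\<close>

definition nabla_scalar ::
  "('a, 'n::finite) chart set \<Rightarrow> ('a, 'n) metric_field \<Rightarrow> ('a \<Rightarrow> real) \<Rightarrow> nat \<Rightarrow> 'a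
    \<Rightarrow> ('a, 'n) tvec list \<Rightarrow> real" where
  "nabla_scalar A g \<phi> k p Xs =
     (let c = chart_at A p; G = metric_matrix A g c
      in tensor_apply ((cov_deriv G ^^ k) (scalar_field (\<phi> \<circ> chart_inv c)) (snd c p))
           (map (\<lambda>v. v c) Xs))"

definition nabla_riemann ::
  "('a, 'n::finite) chart set \<Rightarrow> ('a, 'n) metric_field \<Rightarrow> nat \<Rightarrow> 'a \<Rightarrow> ('a, 'n) tvec list \<Rightarrow> real" where
  "nabla_riemann A g k p Xs =
     (let c = chart_at A p; G = metric_matrix A g c
      in tensor_apply ((cov_deriv G ^^ k) (riemann G) (snd c p)) (map (\<lambda>v. v c) Xs))"


section \<open>The Einstein-scalar-field equations\<close>

text \<open>As usual, the index equations are required in every chart of the atlas.\<close>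

definition einstein_scalar_solution ::
  "'a topology \<Rightarrow> ('a, 'n::finite) chart set \<Rightarrow> real \<Rightarrow> (real \<Rightarrow> real)
    \<Rightarrow> ('a, 'n) metric_field \<Rightarrow> ('a \<Rightarrow> real) \<Rightarrow> bool" where
  "einstein_scalar_solution X A \<Lambda> V g \<phi> \<longleftrightarrow>
     riemannian_metric X A g \<and> smooth_fun A \<phi> \<and>
     (\<forall>c\<in>A. \<forall>x\<in>chart_image c.
        let G = metric_matrix A g c; h = \<phi> \<circ> chart_inv c in
        (\<forall>i j. ricci G i j x =
           partial i h x * partial j h x + G x $ i $ j * V (h x) + \<Lambda> * G x $ i $ j) \<and>
        laplacian G h x = deriv V (h x))"

end

theory Submission
  imports Defs
begin

text \<open>
  Write both solutions in normal coordinates at the two points, with orthonormal frames that are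
  parallel along the rays. The frame coefficients and connection forms then satisfy transport equations
  along the rays whose sources are the curvature components. Since the Ricci tensor is expressed
  through \<open>\<phi>\<close>, the second Bianchi identity makes the curvature, for its last two indices fixed, a
  two-form with prescribed exterior derivative and divergence; likewise each row of the Hessian of \<open>\<phi>\<close>
  is a one-form with prescribed exterior derivative and divergence. Both are first order systems of
  Dirac type. So the differences of the two sets of unknowns satisfy elliptic and transport
  inequalities with a common right-hand side \<open>Z\<close>, the sum of the squares of all differences.

  Equal jets make \<open>Z\<close> flat to infinite order at the origin. A Carleman estimate with weight
  \<open>exp (\<tau> (\<kappa>|x| - ln |x|))\<close> for the Dirac systems and its elementary analogue for the transport
  equations then force \<open>Z = 0\<close> near the origin, by letting \<open>\<tau>\<close> tend to infinity. The transition
  between the two normal coordinate systems is therefore an isometry preserving the scalar fields. It is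
  a priori only of class C2, but an isometry solves a second order equation, so it is smooth.
\<close>

section \<open>Calculus of the classes C_on\<close>

text \<open>As \<open>V\<close> is only of class C^{3,1}, solutions need not be analytic and equal
  jets cannot be continued by power series; vanishing to infinite order has to be propagated by an
  estimate. Normal coordinates with parallel frames are a gauge in which the unknowns of both
  solutions are scalar functions on one ball and can be subtracted. The price is regularity: the
  radial system is solved in class C^2, so tensor components are C^2, the forms
  \<open>\<theta>\<close> and \<open>\<omega>\<close> are C^1, and the estimates are arranged to ask
  no more. The two systems also differ in their principal parts, since each uses its own frame; the
  derivatives of the second solution along the two frames differ by a bounded factor times the
  difference of the coframes, which is itself one of the unknowns. A pure power weight has an
  exponent linear in \<open>ln |x|\<close> and leaves no positive term; the summand
  \<open>\<kappa>|x|\<close> makes the exponent convex in \<open>ln |x|\<close> and yields a term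
  \<open>\<tau>\<kappa>|x||w|^2\<close> that absorbs the deviation of the frame from the coordinate
  frame.\<close>

abbreviation fd :: "('a::real_normed_vector \<Rightarrow> 'b::real_normed_vector) \<Rightarrow> 'a \<Rightarrow> 'a \<Rightarrow> 'b" where
  "fd f x \<equiv> frechet_derivative f (at x)"

lemma fd_eq: "(f has_derivative f') (at x) \<Longrightarrow> fd f x = f'"
  by (rule frechet_derivative_at[symmetric])

lemma fd_works: "f differentiable at x \<Longrightarrow> (f has_derivative fd f x) (at x)"
  by (simp add: frechet_derivative_works)

lemma fd_bounded_linear: "f differentiable at x \<Longrightarrow> bounded_linear (fd f x)"
  using fd_works has_derivative_bounded_linear by blast

lemma fd_scaleR: "f differentiable at x \<Longrightarrow> fd f x (c *\<^sub>R v) = c *\<^sub>R fd f x v"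
  using linear_cmul[OF bounded_linear.linear[OF fd_bounded_linear]] .

lemma fd_cong:
  assumes "open S" "x \<in> S" "\<And>y. y \<in> S \<Longrightarrow> f y = g y"
  shows "fd f x = fd g x"
proof -
  have "(f has_derivative D) (at x) \<longleftrightarrow> (g has_derivative D) (at x)" for D
    using has_derivative_transform_within_open[of f D x UNIV S g]
      has_derivative_transform_within_open[of g D x UNIV S f] assms by auto
  then show ?thesis by (simp add: frechet_derivative_def)
qed

lemma C_on_continuous: "C_on k S f \<Longrightarrow> continuous_on S f"
  by (cases k) (auto intro!: differentiable_imp_continuous_on simp: differentiable_on_def differentiable_at_withinI)

lemma C_on_SucD: "C_on (Suc k) S f \<Longrightarrow> C_on k S f"
proof (induction k arbitrary: f)
  case 0
  then show ?case using C_on_continuous C_on.simps(1) by blast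
next
  case (Suc k)
  then show ?case using C_on.simps(2) by metis
qed

lemma C_on_mono:
  assumes "C_on k S f" "j \<le> k" shows "C_on j S f"
  using assms(2,1) by (induction rule: inc_induct) (auto intro: C_on_SucD simp del: C_on.simps)

lemma C_on_SucI:
  assumes "\<And>x. x \<in> S \<Longrightarrow> (f has_derivative f' x) (at x)" "\<And>v. C_on k S (\<lambda>x. f' x v)" "open S"
  shows "C_on (Suc k) S f"
  unfolding C_on.simps
proof (intro conjI ballI allI)
  show "f differentiable at x" if "x \<in> S" for x using assms(1)[OF that] differentiableI by blast
next
  fix v
  \<comment> \<open>Congruence on an open set is proved inside, because \<open>C_on_cong\<close>
    below rests on this lemma.\<close>
  have c: "C_on k S g" if "C_on k S h" "\<And>x. x \<in> S \<Longrightarrow> h x = g x" for g h :: "'a \<Rightarrow> 'b"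
    using that
  proof (induction k arbitrary: g h)
    case 0 then show ?case by (simp cong: continuous_on_cong)
  next
    case (Suc k)
    have e: "fd h x = fd g x" if "x \<in> S" for x
      by (rule fd_cong[OF assms(3) that]) (rule Suc.prems(2))
    have "g differentiable at x" if x: "x \<in> S" for x
    proof -
      have "h differentiable at x" using Suc.prems(1) x by auto
      then have "(h has_derivative fd h x) (at x)" by (rule fd_works)
      then have "(g has_derivative fd h x) (at x)"
        by (rule has_derivative_transform_within_open[OF _ assms(3) x]) (use Suc.prems in auto)
      then show ?thesis by (rule differentiableI)
    qed
    then show ?case using Suc.IH[of "\<lambda>x. fd h x v" "\<lambda>x. fd g x v" for v] Suc.prems(1) e by auto
  qed
  show "C_on k S (\<lambda>x. fd f x v)"
    by (rule c[OF assms(2)]) (use fd_eq[OF assms(1)] in auto)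
qed

lemma C_on_cong:
  assumes "C_on k S f" "open S" "\<And>x. x \<in> S \<Longrightarrow> f x = g x"
  shows "C_on k S g"
proof (cases k)
  case 0 then show ?thesis using assms by (simp cong: continuous_on_cong)
next
  case (Suc j)
  have "(g has_derivative fd f x) (at x)" if x: "x \<in> S" for x
    by (rule has_derivative_transform_within_open[OF fd_works assms(2) x])
      (use assms x Suc in auto)
  then show ?thesis unfolding Suc
    by (rule C_on_SucI) (use assms Suc in auto)
qed

lemma C_on_subset: "C_on k S f \<Longrightarrow> T \<subseteq> S \<Longrightarrow> C_on k T f"
  by (induction k arbitrary: f) (auto intro: continuous_on_subset)

lemma C_on_has_derivative: "C_on (Suc k) S f \<Longrightarrow> x \<in> S \<Longrightarrow> (f has_derivative fd f x) (at x)"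
  by (auto intro: fd_works)

lemma C_on_fd: "C_on (Suc k) S f \<Longrightarrow> C_on k S (\<lambda>x. fd f x v)"
  by auto

lemma C_on_const [simp]: "C_on k S (\<lambda>x. c)"
  by (induction k arbitrary: c) auto

lemma C_on_linear:
  assumes "bounded_linear L" shows "C_on k S L"
proof (cases k)
  case 0 then show ?thesis by (simp add: assms linear_continuous_on)
next
  case (Suc j)
  have "(L has_derivative L) (at x)" for x using assms by (rule bounded_linear_imp_has_derivative)
  then show ?thesis unfolding Suc C_on.simps using fd_eq[of L L] by (auto intro: differentiableI)
qed

lemma C_on_linear_compose:
  assumes "bounded_linear L" "C_on k S f" "open S" shows "C_on k S (\<lambda>x. L (f x))"
  using assms(2)
proof (induction k arbitrary: f)
  case 0
  then show ?case using bounded_linear.continuous_on[OF assms(1)] by auto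
next
  case (Suc k)
  show ?case
  proof (rule C_on_SucI[OF _ _ assms(3)])
    show "((\<lambda>x. L (f x)) has_derivative (\<lambda>v. L (fd f x v))) (at x)" if "x \<in> S" for x
      by (rule bounded_linear.has_derivative[OF assms(1) C_on_has_derivative[OF Suc.prems that]])
    show "C_on k S (\<lambda>x. L (fd f x v))" for v
      using Suc.IH[OF C_on_fd[OF Suc.prems]] .
  qed
qed

lemma C_on_add:
  assumes "C_on k S f" "C_on k S g" "open S" shows "C_on k S (\<lambda>x. f x + g x)"
  using assms(1,2)
proof (induction k arbitrary: f g)
  case 0
  then show ?case by (auto intro: continuous_intros)
next
  case (Suc k)
  show ?case
  proof (rule C_on_SucI[OF _ _ assms(3)])
    show "((\<lambda>x. f x + g x) has_derivative (\<lambda>v. fd f x v + fd g x v)) (at x)" if "x \<in> S" for x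
      using C_on_has_derivative[OF Suc.prems(1) that] C_on_has_derivative[OF Suc.prems(2) that]
      by (rule has_derivative_add)
    show "C_on k S (\<lambda>x. fd f x v + fd g x v)" for v
      using Suc.IH[OF C_on_fd C_on_fd] Suc.prems .
  qed
qed

lemma C_on_minus: "C_on k S f \<Longrightarrow> open S \<Longrightarrow> C_on k S (\<lambda>x. - f x)"
  by (rule C_on_linear_compose[of uminus]) (auto intro: bounded_linear_minus bounded_linear_ident)

lemma C_on_diff:
  assumes "C_on k S f" "C_on k S g" "open S" shows "C_on k S (\<lambda>x. f x - g x)"
  using C_on_add[OF assms(1) C_on_minus[OF assms(2,3)] assms(3)] by simp

lemma C_on_sum:
  assumes "\<And>i. i \<in> I \<Longrightarrow> C_on k S (f i)" "open S" shows "C_on k S (\<lambda>x. \<Sum>i\<in>I. f i x)"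
proof (cases "finite I")
  case True
  then show ?thesis using assms(1)
    by (induction I rule: finite_induct) (auto intro!: C_on_add assms(2))
next
  case False then show ?thesis by simp
qed

lemma C_on_bilinear:
  assumes "bounded_bilinear B" "C_on k S f" "C_on k S g" "open S"
  shows "C_on k S (\<lambda>x. B (f x) (g x))"
  using assms(2,3)
proof (induction k arbitrary: f g)
  case 0
  then show ?case using bounded_bilinear.continuous_on[OF assms(1)] by auto
next
  case (Suc k)
  show ?case
  proof (rule C_on_SucI[OF _ _ assms(4)])
    show "((\<lambda>x. B (f x) (g x)) has_derivative (\<lambda>v. B (f x) (fd g x v) + B (fd f x v) (g x))) (at x)"
      if "x \<in> S" for x
      using bounded_bilinear.FDERIV[OF assms(1) C_on_has_derivative[OF Suc.prems(1) that]
          C_on_has_derivative[OF Suc.prems(2) that]] .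
    show "C_on k S (\<lambda>x. B (f x) (fd g x v) + B (fd f x v) (g x))" for v
      by (intro C_on_add assms(4) Suc.IH C_on_fd Suc.prems C_on_SucD[OF Suc.prems(1)]
          C_on_SucD[OF Suc.prems(2)])
  qed
qed

lemmas C_on_mult = C_on_bilinear[OF bounded_bilinear_mult]
lemmas C_on_scaleR = C_on_bilinear[OF bounded_bilinear_scaleR]

lemma C_on_prod:
  fixes f :: "'i \<Rightarrow> 'a::euclidean_space \<Rightarrow> real"
  assumes "\<And>i. i \<in> I \<Longrightarrow> C_on k S (f i)" "open S" shows "C_on k S (\<lambda>x. \<Prod>i\<in>I. f i x)"
proof (cases "finite I")
  case True
  then show ?thesis using assms(1)
    by (induction I rule: finite_induct) (auto intro!: C_on_mult assms(2))
next
  case False then show ?thesis by simp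
qed

lemma C_on_inverse:
  fixes f :: "'a::euclidean_space \<Rightarrow> real"
  assumes "C_on k S f" "open S" "\<And>x. x \<in> S \<Longrightarrow> f x \<noteq> 0"
  shows "C_on k S (\<lambda>x. inverse (f x))"
  using assms(1)
proof (induction k)
  case 0
  then show ?case using assms by (auto intro: continuous_intros)
next
  case (Suc k)
  show ?case
  proof (rule C_on_SucI[OF _ _ assms(2)])
    show "((\<lambda>x. inverse (f x)) has_derivative (\<lambda>v. - (inverse (f x) * fd f x v * inverse (f x)))) (at x)"
      if "x \<in> S" for x
      using Deriv.has_derivative_inverse[OF assms(3)[OF that] C_on_has_derivative[OF Suc.prems that]] .
    show "C_on k S (\<lambda>x. - (inverse (f x) * fd f x v * inverse (f x)))" for v
      using Suc.IH[OF C_on_SucD[OF Suc.prems]] C_on_fd[OF Suc.prems]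
      by (intro C_on_minus C_on_mult assms(2))
  qed
qed

lemma linear_basis_sum:
  fixes f :: "'a::euclidean_space \<Rightarrow> 'b::real_vector"
  assumes "linear f" shows "f x = (\<Sum>b\<in>Basis. (x \<bullet> b) *\<^sub>R f b)"
  by (subst euclidean_representation[of x, symmetric]) (simp only: linear_sum[OF assms] linear_cmul[OF assms])

lemma fd_basis_sum:
  fixes w :: "'a::euclidean_space \<Rightarrow> 'b::real_normed_vector"
  assumes "w differentiable (at x)"
  shows "fd w x u = (\<Sum>b\<in>Basis. (u \<bullet> b) *\<^sub>R fd w x b)"
  by (rule linear_basis_sum[OF bounded_linear.linear[OF fd_bounded_linear[OF assms]]])

text \<open>Expanding \<open>fd g (f x) (fd f x v)\<close> over \<open>Basis\<close> separates the
  moving point from the moving direction: each \<open>fd g (f x) b\<close> is again a composition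
  with \<open>f\<close>, so the induction runs over all \<open>g\<close> at once.\<close>

lemma C_on_compose:
  fixes f :: "'a::euclidean_space \<Rightarrow> 'b::euclidean_space" and g :: "'b \<Rightarrow> 'c::real_normed_vector"
  assumes "C_on k S f" "C_on k T g" "open S" "open T" "\<And>x. x \<in> S \<Longrightarrow> f x \<in> T"
  shows "C_on k S (\<lambda>x. g (f x))"
  using assms(1,2)
proof (induction k arbitrary: g)
  case 0
  then show ?case using assms(5)
    by (auto intro!: continuous_on_compose2[of T g S f])
next
  case (Suc k)
  show ?case
  proof (rule C_on_SucI[OF _ _ assms(3)])
    fix x assume x: "x \<in> S"
    have "((g \<circ> f) has_derivative (fd g (f x) \<circ> fd f x)) (at x)"
      by (rule diff_chain_at[OF C_on_has_derivative[OF Suc.prems(1) x]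
            C_on_has_derivative[OF Suc.prems(2) assms(5)[OF x]]])
    moreover have "fd g (f x) \<circ> fd f x = (\<lambda>v. \<Sum>b\<in>Basis. (fd f x v \<bullet> b) *\<^sub>R fd g (f x) b)"
      unfolding o_def using Suc.prems(2) assms(5)[OF x] by (intro ext fd_basis_sum) simp
    ultimately show "((\<lambda>x. g (f x)) has_derivative (\<lambda>v. \<Sum>b\<in>Basis. (fd f x v \<bullet> b) *\<^sub>R fd g (f x) b)) (at x)"
      by (simp add: o_def)
  next
    show "C_on k S (\<lambda>x. \<Sum>b\<in>Basis. (fd f x v \<bullet> b) *\<^sub>R fd g (f x) b)" for v
      using Suc.IH[OF C_on_SucD[OF Suc.prems(1)] C_on_fd[OF Suc.prems(2)]] C_on_fd[OF Suc.prems(1)]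
      by (intro C_on_sum C_on_scaleR assms(3)
          C_on_linear_compose[OF bounded_linear_inner_left]) auto
  qed
qed

lemma C_on_Pair:
  fixes f :: "'a::euclidean_space \<Rightarrow> 'b::real_normed_vector" and g :: "'a \<Rightarrow> 'c::real_normed_vector"
  assumes "C_on k S f" "C_on k S g" "open S" shows "C_on k S (\<lambda>x. (f x, g x))"
proof -
  have "C_on k S (\<lambda>x. (f x, 0) + (0, g x))"
    using assms by (intro C_on_add C_on_linear_compose[of "\<lambda>x. (x, 0)"] C_on_linear_compose[of "\<lambda>x. (0, x)"])
      (auto intro!: bounded_linear_Pair bounded_linear_ident bounded_linear_zero)
  then show ?thesis by simp
qed

lemmas C_on_snd = C_on_linear_compose[OF bounded_linear_snd]
lemmas C_on_nth = C_on_linear_compose[OF bounded_linear_vec_nth]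

lemma bounded_linear_axis: "bounded_linear (\<lambda>a::'b::real_normed_vector. axis i a :: 'b^'n::finite)"
proof (rule bounded_linear_intro[where K=1])
  show "axis i (a + b) = axis i a + (axis i b :: 'b^'n)" for a b by (simp add: vec_eq_iff axis_def)
  show "axis i (r *\<^sub>R a) = r *\<^sub>R (axis i a :: 'b^'n)" for r a by (simp add: vec_eq_iff axis_def)
  show "norm (axis i a :: 'b^'n) \<le> norm a * 1" for a
    unfolding norm_vec_def axis_def L2_set_def by (simp add: if_distrib[of norm] if_distrib[of "\<lambda>x. x^2"] cong: if_cong)
qed

lemma C_on_vec:
  fixes f :: "'a::euclidean_space \<Rightarrow> 'b::real_normed_vector^'n::finite"
  assumes "\<And>i. C_on k S (\<lambda>x. f x $ i)" "open S" shows "C_on k S f"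
proof -
  have "C_on k S (\<lambda>x. \<Sum>i\<in>UNIV. axis i (f x $ i))"
    using assms by (intro C_on_sum C_on_linear_compose[OF bounded_linear_axis])
  moreover have "(\<Sum>i\<in>UNIV. axis i (f x $ i)) = f x" for x
    by (simp add: vec_eq_iff axis_def)
  ultimately show ?thesis by simp
qed

lemma C_on_deriv_continuous:
  "C_on (Suc k) S f \<Longrightarrow> continuous_on S (\<lambda>x. fd f x v)"
  using C_on_fd C_on_continuous by blast

section \<open>Symmetry of second derivatives\<close>

lemma has_real_derivative_along:
  assumes "(f has_derivative f') (at (z + t *\<^sub>R a))"
  shows "((\<lambda>t. f (z + t *\<^sub>R a)) has_real_derivative f' a) (at t)"
proof -
  have "((\<lambda>t. z + t *\<^sub>R a) has_derivative (\<lambda>r. r *\<^sub>R a)) (at t)" by (auto intro!: derivative_eq_intros)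
  from diff_chain_at[OF this assms] linear_cmul[OF has_derivative_linear[OF assms]] show ?thesis
    by (simp add: has_field_derivative_def o_def mult_commute_abs)
qed

text \<open>The second difference over a small parallelogram with sides \<open>h *\<^sub>R u\<close>
  and \<open>h *\<^sub>R v\<close> equals \<open>h * h\<close> times either mixed derivative at a
  nearby point, by two applications of the mean value theorem; continuity then rules out a gap
  between the two.\<close>

lemma second_derivative_symmetric_real:
  fixes f :: "'a::euclidean_space \<Rightarrow> real"
  assumes f: "C_on 2 S f" and S: "open S" "x \<in> S"
  shows "fd (\<lambda>y. fd f y u) x v = fd (\<lambda>y. fd f y v) x u"
proof (rule ccontr)
  have f2: "C_on (Suc (Suc 0)) S f" using f by (simp add: numeral_2_eq_2)
  define D2 where "D2 a b y = fd (\<lambda>y. fd f y a) y b" for a b y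
  assume ne: "\<not> ?thesis"
  define e where "e = \<bar>D2 u v x - D2 v u x\<bar> / 2"
  have e: "e > 0" using ne by (simp add: e_def D2_def)
  have cont: "continuous_on S (D2 a b)" for a b
    unfolding D2_def using C_on_deriv_continuous[OF C_on_fd[OF f2]] .
  have ev: "\<forall>\<^sub>F y in nhds x. y \<in> S \<and> \<bar>D2 a b y - D2 a b x\<bar> < e" for a b
  proof -
    have "isCont (D2 a b) x" using cont S continuous_on_eq_continuous_at by blast
    then have "\<forall>\<^sub>F y in at x. \<bar>D2 a b y - D2 a b x\<bar> < e"
      using e unfolding isCont_def tendsto_iff dist_real_def by blast
    then have "\<forall>\<^sub>F y in nhds x. \<bar>D2 a b y - D2 a b x\<bar> < e"
      using e by (auto simp: eventually_at_filter elim: eventually_mono)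
    then show ?thesis using eventually_nhds_in_open[OF S] by eventually_elim auto
  qed
  obtain d where d: "d > 0" "\<And>y. dist y x < d \<Longrightarrow> y \<in> S \<and> \<bar>D2 u v y - D2 u v x\<bar> < e \<and> \<bar>D2 v u y - D2 v u x\<bar> < e"
    using eventually_conj[OF ev[of u v] ev[of v u]] unfolding eventually_nhds_metric by blast
  \<comment> \<open>This makes \<open>h * (norm u + norm v + 1)\<close> equal to
    \<open>d / 2\<close>, which keeps the parallelogram in the ball of radius \<open>d\<close>; the
    summand 1 keeps the denominator positive.\<close>
  define h where "h = d / (2 * (norm u + norm v + 1))"
  have nn: "norm u + norm v + 1 > 0" using norm_ge_zero[of u] norm_ge_zero[of v] by linarith
  have h: "h > 0" unfolding h_def using d(1) nn by simp
  have hb: "h * norm u + h * norm v < d"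
  proof -
    have "h * norm u + h * norm v \<le> h * (norm u + norm v + 1)" using h by (simp add: algebra_simps)
    also have "\<dots> = d / 2" unfolding h_def using nn by (simp add: divide_simps)
    finally show ?thesis using d(1) by linarith
  qed
  have near: "dist (x + s *\<^sub>R u + t *\<^sub>R v) x < d" if "0 \<le> s" "s \<le> h" "0 \<le> t" "t \<le> h" for s t
  proof -
    have "norm (s *\<^sub>R u + t *\<^sub>R v) \<le> s * norm u + t * norm v"
      using norm_triangle_ineq[of "s *\<^sub>R u" "t *\<^sub>R v"] that by simp
    also have "\<dots> \<le> h * norm u + h * norm v"
      using that by (intro add_mono mult_right_mono) auto
    finally show ?thesis using hb by (simp add: dist_norm add.assoc)
  qed
  define \<Delta> where "\<Delta> = f (x + h *\<^sub>R u + h *\<^sub>R v) - f (x + h *\<^sub>R u) - f (x + h *\<^sub>R v) + f x"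
  have key: "\<exists>y. dist y x < d \<and> D = h * (h * D2 a b y)"
    if ab: "\<And>s t. 0 \<le> s \<Longrightarrow> s \<le> h \<Longrightarrow> 0 \<le> t \<Longrightarrow> t \<le> h \<Longrightarrow> dist (x + s *\<^sub>R a + t *\<^sub>R b) x < d"
      and D: "D = (f (x + h *\<^sub>R a + h *\<^sub>R b) - f (x + h *\<^sub>R a)) - (f (x + h *\<^sub>R b) - f x)" for a b D
  proof -
    define G where "G s = f (x + s *\<^sub>R a + h *\<^sub>R b) - f (x + s *\<^sub>R a)" for s
    have DG: "(G has_real_derivative (fd f (x + s *\<^sub>R a + h *\<^sub>R b) a - fd f (x + s *\<^sub>R a) a)) (at s)"
      if s: "0 \<le> s" "s \<le> h" for s
    proof -
      note * = has_real_derivative_along[OF C_on_has_derivative[OF f2]]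
      have 1: "x + s *\<^sub>R a + h *\<^sub>R b \<in> S" using d(2)[OF ab[OF s, of h]] h by auto
      have 2: "x + s *\<^sub>R a \<in> S" using d(2)[OF ab[OF s, of 0]] h by auto
      have eq: "x + s *\<^sub>R a + h *\<^sub>R b = (x + h *\<^sub>R b) + s *\<^sub>R a" for s by simp
      show ?thesis unfolding G_def
        using DERIV_diff[OF *[of "x + h *\<^sub>R b"] *[of x]] 1 2 unfolding eq by blast
    qed
    obtain \<xi> where \<xi>: "0 < \<xi>" "\<xi> < h"
      "G h - G 0 = (h - 0) * (fd f (x + \<xi> *\<^sub>R a + h *\<^sub>R b) a - fd f (x + \<xi> *\<^sub>R a) a)"
      using MVT2[OF h DG] by auto
    define K where "K t = fd f (x + \<xi> *\<^sub>R a + t *\<^sub>R b) a" for t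
    have DK: "(K has_real_derivative D2 a b (x + \<xi> *\<^sub>R a + t *\<^sub>R b)) (at t)" if t: "0 \<le> t" "t \<le> h" for t
      unfolding K_def D2_def
      by (rule has_real_derivative_along[OF C_on_has_derivative[OF C_on_fd[OF f2]]]) (use d(2)[OF ab[OF _ _ t, of \<xi>]] \<xi> in auto)
    obtain \<eta> where \<eta>: "0 < \<eta>" "\<eta> < h" "K h - K 0 = (h - 0) * D2 a b (x + \<xi> *\<^sub>R a + \<eta> *\<^sub>R b)"
      using MVT2[OF h DK] by auto
    have "D = G h - G 0" by (simp add: G_def D)
    also have "\<dots> = h * (h * D2 a b (x + \<xi> *\<^sub>R a + \<eta> *\<^sub>R b))"
      using \<xi>(3) \<eta>(3) by (simp add: K_def)
    finally show ?thesis using ab[of \<xi> \<eta>] \<xi> \<eta> by auto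
  qed
  have near': "dist (x + s *\<^sub>R v + t *\<^sub>R u) x < d" if "0 \<le> s" "s \<le> h" "0 \<le> t" "t \<le> h" for s t
    using near[of t s] that by (simp add: algebra_simps)
  obtain y where y: "dist y x < d" "\<Delta> = h * (h * D2 u v y)"
    using key[of u v \<Delta>] near by (auto simp: \<Delta>_def)
  obtain z where z: "dist z x < d" "\<Delta> = h * (h * D2 v u z)"
    using key[of v u \<Delta>] near' by (auto simp: \<Delta>_def add_ac algebra_simps)
  have "D2 u v y = D2 v u z" using y(2) z(2) h by simp
  moreover have "\<bar>D2 u v y - D2 u v x\<bar> < e" "\<bar>D2 v u z - D2 v u x\<bar> < e"
    using d(2) y(1) z(1) by auto
  moreover have "\<bar>D2 u v x - D2 v u x\<bar> \<le> \<bar>D2 u v y - D2 u v x\<bar> + \<bar>D2 v u z - D2 v u x\<bar>" if "D2 u v y = D2 v u z"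
    using that by linarith
  ultimately show False unfolding e_def by auto
qed

lemma second_derivative_symmetric:
  fixes f :: "'a::euclidean_space \<Rightarrow> 'b::euclidean_space"
  assumes f: "C_on 2 S f" and S: "open S" "x \<in> S"
  shows "fd (\<lambda>y. fd f y u) x v = fd (\<lambda>y. fd f y v) x u"
proof (rule euclidean_eqI)
  fix b :: 'b assume b: "b \<in> Basis"
  have f2: "C_on (Suc (Suc 0)) S f" using f by (simp add: numeral_2_eq_2)
  have bl: "bounded_linear (\<lambda>z::'b. z \<bullet> b)" by (rule bounded_linear_inner_left)
  have 1: "fd (\<lambda>y. f y \<bullet> b) y u = fd f y u \<bullet> b" if "y \<in> S" for y u
    using fd_eq[OF bounded_linear.has_derivative[OF bl C_on_has_derivative[OF f2 that]]] by simp
  have 2: "fd (\<lambda>y. fd (\<lambda>y. f y \<bullet> b) y u) x v = fd (\<lambda>y. fd f y u) x v \<bullet> b" for u v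
  proof -
    have "fd (\<lambda>y. fd (\<lambda>y. f y \<bullet> b) y u) x = fd (\<lambda>y. fd f y u \<bullet> b) x"
      by (rule fd_cong[OF S]) (rule 1)
    then show ?thesis
      using fd_eq[OF bounded_linear.has_derivative[OF bl C_on_has_derivative[OF C_on_fd[OF f2] S(2)]]]
      by simp
  qed
  have "C_on 2 S (\<lambda>y. f y \<bullet> b)" by (rule C_on_linear_compose[OF bl f S(1)])
  from second_derivative_symmetric_real[OF this S]
  show "fd (\<lambda>y. fd f y u) x v \<bullet> b = fd (\<lambda>y. fd f y v) x u \<bullet> b"
    unfolding 2 .
qed

lemma smooth_on_C_on: "smooth_on S f \<Longrightarrow> C_on k S f"
  by (simp add: smooth_on_def)

section \<open>Integration by parts\<close>

lemma integrable_compact_support: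
  fixes f :: "'a::euclidean_space \<Rightarrow> real"
  assumes "open \<Omega>" "compact K" "K \<subseteq> \<Omega>" "continuous_on \<Omega> f" "\<And>x. x \<in> \<Omega> - K \<Longrightarrow> f x = 0"
  shows "set_integrable lborel \<Omega> f"
proof -
  have "integrable lborel (\<lambda>x. indicator K x *\<^sub>R f x)"
    using borel_integrable_compact[OF assms(2) continuous_on_subset[OF assms(4,3)]] .
  moreover have "(\<lambda>x. indicator K x *\<^sub>R f x) = (\<lambda>x. indicator \<Omega> x *\<^sub>R f x)"
    using assms(3,5) by (force simp: indicator_def)
  ultimately show ?thesis by (simp add: set_integrable_def)
qed

text \<open>Difference quotients integrate to zero by translation invariance. By the mean value
  theorem they are dominated by a constant on a fixed ball, and the derivative is their pointwise
  limit.\<close>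

lemma integral_derivative_zero:
  fixes f :: "'a::euclidean_space \<Rightarrow> real"
  assumes d: "\<And>x. (f has_derivative f' x) (at x)"
    and b: "\<And>x. \<bar>f' x v\<bar> \<le> C" and z: "\<And>x. R \<le> norm x \<Longrightarrow> f x = 0"
  shows "integrable lborel (\<lambda>x. f' x v)" "integral\<^sup>L lborel (\<lambda>x. f' x v) = 0"
proof -
  define s where "s k x = (f (x + (1 / Suc k) *\<^sub>R v) - f x) * Suc k" for k x
  have cf: "continuous_on UNIV f"
    by (intro continuous_at_imp_continuous_on ballI has_derivative_continuous[OF d])
  have fm [measurable]: "f \<in> borel_measurable borel" by (rule borel_measurable_continuous_onI[OF cf])
  have intf: "integrable lborel f"
  proof -
    have "integrable lborel (\<lambda>x. indicator (cball 0 R) x *\<^sub>R f x)"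
      by (rule borel_integrable_compact) (auto intro: continuous_on_subset[OF cf])
    moreover have "(\<lambda>x. indicator (cball 0 R) x *\<^sub>R f x) = f"
      using z by (auto simp: indicator_def fun_eq_iff)
    ultimately show ?thesis by simp
  qed
  have intt: "integrable lborel (\<lambda>x. f (x + c))" "integral\<^sup>L lborel (\<lambda>x. f (x + c)) = integral\<^sup>L lborel f" for c
  proof -
    have "integrable (distr lborel borel ((+) c)) f" using intf by (simp add: lborel_distr_plus)
    then show "integrable lborel (\<lambda>x. f (x + c))"
      by (subst (asm) integrable_distr_eq) (auto simp: add.commute)
    have "integral\<^sup>L lborel f = integral\<^sup>L (distr lborel borel ((+) c)) f" by (simp add: lborel_distr_plus)
    also have "\<dots> = integral\<^sup>L lborel (\<lambda>x. f (c + x))" by (rule integral_distr) auto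
    finally show "integral\<^sup>L lborel (\<lambda>x. f (x + c)) = integral\<^sup>L lborel f" by (simp add: add.commute)
  qed
  have s0: "integral\<^sup>L lborel (s k) = 0" for k
    unfolding s_def using intf intt by simp
  have sm: "s k \<in> borel_measurable lborel" for k
    unfolding s_def by measurable
  have C: "C \<ge> 0" using b[of 0] by linarith
  have sb: "norm (s k x) \<le> C * indicator (cball 0 (R + norm v)) x" for k x
  proof (cases "norm x \<le> R + norm v")
    case True
    let ?h = "1 / real (Suc k)"
    have "\<exists>\<xi>. 0 < \<xi> \<and> \<xi> < ?h \<and> f (x + ?h *\<^sub>R v) - f (x + 0 *\<^sub>R v) = (?h - 0) * f' (x + \<xi> *\<^sub>R v) v"
      by (rule MVT2[OF _ has_real_derivative_along[OF d]]) simp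
    then obtain \<xi> where "f (x + ?h *\<^sub>R v) - f x = ?h * f' (x + \<xi> *\<^sub>R v) v" by auto
    then have "s k x = f' (x + \<xi> *\<^sub>R v) v" unfolding s_def by simp
    then show ?thesis using b True by (simp add: indicator_def)
  next
    case False
    have "norm (x + (1 / Suc k) *\<^sub>R v) \<ge> norm x - norm ((1 / Suc k) *\<^sub>R v)"
      using norm_triangle_ineq4[of "x + (1 / Suc k) *\<^sub>R v" "(1 / Suc k) *\<^sub>R v"] by simp
    moreover have "norm ((1 / Suc k) *\<^sub>R v) \<le> norm v" by (simp add: divide_simps mult_left_le algebra_simps)
    ultimately have "norm (x + (1 / Suc k) *\<^sub>R v) \<ge> R" "norm x \<ge> R"
      using False norm_ge_zero[of v] by linarith+
    then have "s k x = 0" unfolding s_def using z by simp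
    then show ?thesis using C by simp
  qed
  have lim: "(\<lambda>k. s k x) \<longlonglongrightarrow> f' x v" for x
  proof -
    have "((\<lambda>t. f (x + t *\<^sub>R v)) has_real_derivative f' x v) (at 0)"
      by (rule has_real_derivative_along) (simp add: d)
    then have "((\<lambda>h. (f (x + h *\<^sub>R v) - f x) / h) \<longlongrightarrow> f' x v) (at 0)"
      by (simp add: DERIV_def)
    moreover have "filterlim (\<lambda>k. 1 / real (Suc k)) (at 0) sequentially"
      unfolding filterlim_at using LIMSEQ_inverse_real_of_nat by (simp add: inverse_eq_divide)
    ultimately have "(\<lambda>k. (f (x + (1 / real (Suc k)) *\<^sub>R v) - f x) / (1 / real (Suc k))) \<longlonglongrightarrow> f' x v"
      by (rule filterlim_compose)
    then show ?thesis unfolding s_def by simp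
  qed
  have dom: "integrable lborel (\<lambda>x. C * indicator (cball 0 (R + norm v)) x :: real)"
    by (intro integrable_mult_right integrable_real_indicator) (use emeasure_lborel_cball_finite[of 0 "R + norm v"] in \<open>simp_all add: infinity_ennreal_def\<close>)
  have fm': "(\<lambda>x. f' x v) \<in> borel_measurable lborel"
    by (rule borel_measurable_LIMSEQ_metric[OF sm lim])
  show "integrable lborel (\<lambda>x. f' x v)"
    by (rule integrable_dominated_convergence[where s=s, OF fm' sm dom]) (use lim sb in auto)
  have "(\<lambda>k. integral\<^sup>L lborel (s k)) \<longlonglongrightarrow> integral\<^sup>L lborel (\<lambda>x. f' x v)"
    by (rule integral_dominated_convergence[where s=s, OF fm' sm dom]) (use lim sb in auto)
  then show "integral\<^sup>L lborel (\<lambda>x. f' x v) = 0"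
    unfolding s0 by (rule LIMSEQ_unique) simp
qed

text \<open>The support is compact in \<open>\<Omega>\<close>, so the extension by zero is
  differentiable everywhere with bounded derivative.\<close>

lemma integral_fd_zero:
  fixes f :: "'a::euclidean_space \<Rightarrow> real"
  assumes \<Omega>: "open \<Omega>" and K: "compact K" "K \<subseteq> \<Omega>" and f: "C_on 1 \<Omega> f"
    and z: "\<And>x. x \<in> \<Omega> - K \<Longrightarrow> f x = 0"
  shows "set_integrable lborel \<Omega> (\<lambda>x. fd f x v)" "(LINT x:\<Omega>|lborel. fd f x v) = 0"
proof -
  define F where "F x = (if x \<in> \<Omega> then f x else 0)" for x
  define F' where "F' x = (if x \<in> \<Omega> then fd f x else (\<lambda>_. 0))" for x
  have f1: "C_on (Suc 0) \<Omega> f" using f by simp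
  have oK: "open (- K)" by (intro open_Compl compact_imp_closed K)
  have d: "(F has_derivative F' x) (at x)" for x
  proof (cases "x \<in> \<Omega>")
    case True
    show ?thesis unfolding F'_def using True
      by (auto intro!: has_derivative_transform_within_open[OF C_on_has_derivative[OF f1 True] \<Omega> True] simp: F_def)
  next
    case False
    have "((\<lambda>x. 0) has_derivative (\<lambda>_. 0)) (at x)" by simp
    then have "(F has_derivative (\<lambda>_. 0)) (at x)"
      by (rule has_derivative_transform_within_open[OF _ oK]) (use False K z in \<open>auto simp: F_def\<close>)
    then show ?thesis using False by (simp add: F'_def)
  qed
  have z': "fd f x = (\<lambda>_. 0)" if "x \<in> \<Omega> - K" for x
  proof -
    have "fd f x = fd (\<lambda>_. 0) x"
      by (rule fd_cong[where S="\<Omega> - K"]) (use that z \<Omega> K in \<open>auto intro: open_Diff compact_imp_closed\<close>)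
    then show ?thesis by simp
  qed
  have "compact ((\<lambda>x. fd f x v) ` K)"
    by (rule compact_continuous_image[OF continuous_on_subset[OF C_on_deriv_continuous[OF f1] K(2)] K(1)])
  then obtain C where C: "\<And>x. x \<in> K \<Longrightarrow> \<bar>fd f x v\<bar> \<le> C"
    using compact_imp_bounded[of "(\<lambda>x. fd f x v) ` K"] unfolding bounded_iff by auto
  have b: "\<bar>F' x v\<bar> \<le> max C 0" for x
    using C[of x] z'[of x] by (cases "x \<in> K"; cases "x \<in> \<Omega>") (auto simp: F'_def)
  obtain R where R: "\<And>x. x \<in> K \<Longrightarrow> norm x \<le> R"
    using compact_imp_bounded[OF K(1)] unfolding bounded_iff by auto
  have zz: "F x = 0" if "R + 1 \<le> norm x" for x using R[of x] z[of x] that by (auto simp: F_def)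
  have e: "(\<lambda>x. indicator \<Omega> x *\<^sub>R fd f x v) = (\<lambda>x. F' x v)"
    by (auto simp: F'_def indicator_def)
  show "set_integrable lborel \<Omega> (\<lambda>x. fd f x v)" "(LINT x:\<Omega>|lborel. fd f x v) = 0"
    unfolding set_integrable_def set_lebesgue_integral_def e
    using integral_derivative_zero[where R="R + 1", OF d b] zz by blast+
qed

definition dvg :: "(real^'n \<Rightarrow> real^'n) \<Rightarrow> real^'n::finite \<Rightarrow> real" where
  "dvg F x = (\<Sum>i\<in>UNIV. fd F x (axis i 1) $ i)"

lemma integral_dvg_zero:
  fixes F :: "real^'n::finite \<Rightarrow> real^'n"
  assumes \<Omega>: "open \<Omega>" and K: "compact K" "K \<subseteq> \<Omega>" and f: "C_on 1 \<Omega> F"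
    and z: "\<And>x. x \<in> \<Omega> - K \<Longrightarrow> F x = 0"
  shows "set_integrable lborel \<Omega> (dvg F)" "(LINT x:\<Omega>|lborel. dvg F x) = 0"
proof -
  have f1: "C_on (Suc 0) \<Omega> F" using f by simp
  have e: "fd F x (axis i 1) $ i = fd (\<lambda>x. F x $ i) x (axis i 1)" if "x \<in> \<Omega>" for x i
    using fd_eq[OF bounded_linear.has_derivative[OF bounded_linear_vec_nth[of i] C_on_has_derivative[OF f1 that]]] by simp
  note * = integral_fd_zero[OF \<Omega> K C_on_nth[OF f \<Omega>], of i "axis i 1" for i]
  have int: "set_integrable lborel \<Omega> (\<lambda>x. fd (\<lambda>x. F x $ i) x (axis i 1))"
     "(LINT x:\<Omega>|lborel. fd (\<lambda>x. F x $ i) x (axis i 1)) = 0" for i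
    using *[of i] z by auto
  have \<Omega>m: "\<Omega> \<in> sets lborel" using \<Omega> by simp
  have s: "set_integrable lborel \<Omega> (\<lambda>x. \<Sum>i\<in>UNIV. fd (\<lambda>x. F x $ i) x (axis i 1))"
    unfolding set_integrable_def scaleR_sum_right
    by (rule Bochner_Integration.integrable_sum) (use int(1) in \<open>simp add: set_integrable_def\<close>)
  have ee: "(\<Sum>i\<in>UNIV. fd (\<lambda>x. F x $ i) x (axis i 1)) = dvg F x" if "x \<in> \<Omega>" for x
    unfolding dvg_def using e[OF that] by simp
  show "set_integrable lborel \<Omega> (dvg F)"
    using s ee by (subst (asm) set_integrable_cong[OF refl refl]) auto
  have "(LINT x:\<Omega>|lborel. dvg F x) = (LINT x:\<Omega>|lborel. (\<Sum>i\<in>UNIV. fd (\<lambda>x. F x $ i) x (axis i 1)))"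
    by (rule set_lebesgue_integral_cong) (use \<Omega>m ee in auto)
  also have "\<dots> = (\<Sum>i\<in>UNIV. (LINT x:\<Omega>|lborel. fd (\<lambda>x. F x $ i) x (axis i 1)))"
    unfolding set_lebesgue_integral_def scaleR_sum_right
    by (rule Bochner_Integration.integral_sum) (use int(1) in \<open>simp add: set_integrable_def\<close>)
  finally show "(LINT x:\<Omega>|lborel. dvg F x) = 0" using int(2) by simp
qed

lemma dvg_eq: "(F has_derivative F') (at x) \<Longrightarrow> dvg F x = (\<Sum>i\<in>UNIV. F' (axis i 1) $ i)"
  by (simp add: dvg_def fd_eq)

lemma vec_axis_sum: "(\<Sum>i\<in>UNIV. (v $ i) *\<^sub>R axis i 1) = (v :: real^'n::finite)"
  by (simp add: vec_eq_iff axis_def if_distrib[of "(*) _"] cong: if_cong)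

lemma dvg_scaleR:
  fixes V :: "real^'n::finite \<Rightarrow> real^'n"
  assumes "s differentiable (at x)" "V differentiable (at x)"
  shows "dvg (\<lambda>x. s x *\<^sub>R V x) x = fd s x (V x) + s x * dvg V x"
proof -
  have 1: "((\<lambda>x. s x *\<^sub>R V x) has_derivative (\<lambda>v. s x *\<^sub>R fd V x v + fd s x v *\<^sub>R V x)) (at x)"
    using has_derivative_scaleR[OF fd_works[OF assms(1)] fd_works[OF assms(2)]] .
  interpret bounded_linear "fd s x" by (rule fd_bounded_linear[OF assms(1)])
  have "fd s x (V x) = (\<Sum>i\<in>UNIV. fd s x (axis i 1) * V x $ i)"
    by (subst vec_axis_sum[of "V x", symmetric]) (simp add: sum scaleR mult.commute)
  then show ?thesis unfolding dvg_eq[OF 1]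
    by (simp add: dvg_def sum.distrib sum_distrib_left)
qed

lemma dvg_add:
  fixes V :: "real^'n::finite \<Rightarrow> real^'n"
  assumes "U differentiable (at x)" "V differentiable (at x)"
  shows "dvg (\<lambda>x. U x + V x) x = dvg U x + dvg V x"
  unfolding dvg_eq[OF has_derivative_add[OF fd_works[OF assms(1)] fd_works[OF assms(2)]]]
  by (simp add: dvg_def sum.distrib)

lemma dvg_sum:
  fixes V :: "'i \<Rightarrow> real^'n::finite \<Rightarrow> real^'n"
  assumes "\<And>i. i \<in> I \<Longrightarrow> V i differentiable (at x)"
  shows "dvg (\<lambda>x. \<Sum>i\<in>I. V i x) x = (\<Sum>i\<in>I. dvg (V i) x)"
proof -
  have "((\<lambda>x. \<Sum>i\<in>I. V i x) has_derivative (\<lambda>v. \<Sum>i\<in>I. fd (V i) x v)) (at x)"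
    by (rule has_derivative_sum) (auto intro: fd_works assms)
  then show ?thesis by (simp add: dvg_eq) (simp add: dvg_def, rule sum.swap)
qed

lemma dvg_ident: "dvg (\<lambda>x. x) (x :: real^'n::finite) = CARD('n)"
  by (simp add: dvg_eq[OF has_derivative_ident])

lemma dvg_bound:
  fixes V :: "real^'n::finite \<Rightarrow> real^'n" and C :: real
  assumes "\<And>v. norm (fd V x v) \<le> C * norm v"
  shows "\<bar>dvg V x\<bar> \<le> CARD('n) * C"
proof -
  have "\<bar>fd V x (axis i 1) $ i\<bar> \<le> C" for i
    using component_le_norm_cart[of "fd V x (axis i 1)" i] assms[of "axis i 1"] by simp
  then have "\<bar>dvg V x\<bar> \<le> (\<Sum>i\<in>(UNIV::'n set). C)"
    unfolding dvg_def by (intro order_trans[OF sum_abs] sum_mono)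
  then show ?thesis by simp
qed

section \<open>A Carleman estimate for first order systems\<close>

lemma C_on_exp:
  fixes f :: "'a::euclidean_space \<Rightarrow> real"
  assumes "C_on k S f" "open S" shows "C_on k S (\<lambda>x. exp (f x))"
  using assms(1)
proof (induction k)
  case 0 then show ?case by (auto intro: continuous_intros)
next
  case (Suc k)
  show ?case
  proof (rule C_on_SucI[OF _ _ assms(2)])
    show "((\<lambda>x. exp (f x)) has_derivative (\<lambda>v. fd f x v * exp (f x))) (at x)" if "x \<in> S" for x
      using has_derivative_exp[OF C_on_has_derivative[OF Suc.prems that]] by (simp add: mult.commute)
    show "C_on k S (\<lambda>x. fd f x v * exp (f x))" for v
      by (intro C_on_mult C_on_fd Suc assms C_on_SucD[OF Suc.prems])
  qed
qed

lemma C_on_ln: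
  fixes f :: "'a::euclidean_space \<Rightarrow> real"
  assumes "C_on k S f" "open S" "\<And>x. x \<in> S \<Longrightarrow> f x > 0" shows "C_on k S (\<lambda>x. ln (f x))"
  using assms(1)
proof (cases k)
  case 0 then show ?thesis using assms by (fastforce intro: continuous_intros)
next
  case (Suc j)
  note f = assms(1)[unfolded Suc]
  show ?thesis unfolding Suc
  proof (rule C_on_SucI[OF _ _ assms(2)])
    show "((\<lambda>x. ln (f x)) has_derivative (\<lambda>v. fd f x v * inverse (f x))) (at x)" if "x \<in> S" for x
      using has_derivative_ln[OF assms(3)[OF that] C_on_has_derivative[OF f that]] by (simp add: field_simps)
    show "C_on j S (\<lambda>x. fd f x v * inverse (f x))" for v
      using assms(3) by (intro C_on_mult C_on_fd f assms C_on_inverse C_on_SucD[OF f]) fastforce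
  qed
qed

lemma norm_has_derivative:
  fixes x :: "'a::real_inner"
  assumes "x \<noteq> 0" shows "(norm has_derivative (\<lambda>v. (x \<bullet> v) / norm x)) (at x)"
  using has_derivative_norm[OF assms] by (simp add: sgn_div_norm inner_commute divide_inverse mult.commute)

lemma C_on_norm:
  assumes "open S" "0 \<notin> S" shows "C_on k S (norm :: 'a::euclidean_space \<Rightarrow> real)"
proof (induction k)
  case 0 then show ?case by (auto intro: continuous_intros)
next
  case (Suc k)
  show ?case
  proof (rule C_on_SucI[OF _ _ assms(1)])
    show "(norm has_derivative (\<lambda>v. (x \<bullet> v) * inverse (norm x))) (at x)" if "x \<in> S" for x :: 'a
      using norm_has_derivative[of x] that assms by (auto simp: divide_inverse)
    show "C_on k S (\<lambda>x. (x \<bullet> v) * inverse (norm x))" for v :: 'a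
      using assms by (intro C_on_mult C_on_inverse Suc assms C_on_linear bounded_linear_inner_left) auto
  qed
qed

lemma C_on_power:
  fixes f :: "'a::euclidean_space \<Rightarrow> real"
  assumes "C_on k S f" "open S" shows "C_on k S (\<lambda>x. f x ^ j)"
  by (induction j) (auto intro!: C_on_mult assms)

section \<open>Coordinate Hessians and derivatives in moving directions\<close>

text \<open>The coordinate second derivative, without Christoffel terms, differentiated first along
  \<open>u\<close> and then along \<open>v\<close>. The covariant Hessian is
  \<open>cov_deriv G (cov_deriv G (scalar_field h))\<close>.\<close>

definition hess :: "('a::euclidean_space \<Rightarrow> 'b::euclidean_space) \<Rightarrow> 'a \<Rightarrow> 'a \<Rightarrow> 'a \<Rightarrow> 'b" where
  "hess w x u v = fd (\<lambda>y. fd w y u) x v"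

lemma hess_sym: "C_on 2 S w \<Longrightarrow> open S \<Longrightarrow> x \<in> S \<Longrightarrow> hess w x u v = hess w x v u"
  unfolding hess_def by (rule second_derivative_symmetric)

lemma fd_apply_has_derivative:
  fixes w :: "'a::euclidean_space \<Rightarrow> 'b::euclidean_space"
  assumes w: "C_on 2 S w" and S: "open S" "x \<in> S" and \<xi>: "\<xi> differentiable (at x)"
  shows "((\<lambda>y. fd w y (\<xi> y)) has_derivative (\<lambda>v. fd w x (fd \<xi> x v) + hess w x (\<xi> x) v)) (at x)"
proof -
  have w2: "C_on (Suc (Suc 0)) S w" using w by (simp add: numeral_2_eq_2)
  have *: "((\<lambda>y. fd w y (\<xi> y)) has_derivative
      (\<lambda>v. \<Sum>b\<in>Basis. (\<xi> x \<bullet> b) *\<^sub>R hess w x b v + (fd \<xi> x v \<bullet> b) *\<^sub>R fd w x b)) (at x)"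
    if \<xi>: "\<xi> differentiable (at x)" for \<xi> :: "'a \<Rightarrow> 'a"
  proof (rule has_derivative_transform_within_open[OF _ S])
    show "((\<lambda>y. \<Sum>b\<in>Basis. (\<xi> y \<bullet> b) *\<^sub>R fd w y b) has_derivative
      (\<lambda>v. \<Sum>b\<in>Basis. (\<xi> x \<bullet> b) *\<^sub>R hess w x b v + (fd \<xi> x v \<bullet> b) *\<^sub>R fd w x b)) (at x)"
    proof (rule has_derivative_sum)
      fix b :: 'a assume "b \<in> Basis"
      have "((\<lambda>y. \<xi> y \<bullet> b) has_derivative (\<lambda>v. fd \<xi> x v \<bullet> b)) (at x)"
        by (rule bounded_linear.has_derivative[OF bounded_linear_inner_left fd_works[OF \<xi>]])
      moreover have "((\<lambda>y. fd w y b) has_derivative (\<lambda>v. hess w x b v)) (at x)"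
        unfolding hess_def by (rule C_on_has_derivative[OF C_on_fd[OF w2] S(2)])
      ultimately show "((\<lambda>y. (\<xi> y \<bullet> b) *\<^sub>R fd w y b) has_derivative
        (\<lambda>v. (\<xi> x \<bullet> b) *\<^sub>R hess w x b v + (fd \<xi> x v \<bullet> b) *\<^sub>R fd w x b)) (at x)"
        by (rule has_derivative_scaleR)
    qed
    show "(\<Sum>b\<in>Basis. (\<xi> y \<bullet> b) *\<^sub>R fd w y b) = fd w y (\<xi> y)" if "y \<in> S" for y
      using w2 that by (intro fd_basis_sum[symmetric]) auto
  qed
  \<comment> \<open>A constant field \<open>\<xi>\<close> gives the linearity of \<open>hess\<close>
    in its first direction.\<close>
  have h: "hess w x u v = (\<Sum>b\<in>Basis. (u \<bullet> b) *\<^sub>R hess w x b v)" for u v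
    using fd_eq[OF *[of "\<lambda>_. u"]] by (simp add: hess_def)
  have f: "fd w x u = (\<Sum>b\<in>Basis. (u \<bullet> b) *\<^sub>R fd w x b)" for u
    using w2 S by (intro fd_basis_sum) auto
  have "(\<lambda>v. \<Sum>b\<in>Basis. (\<xi> x \<bullet> b) *\<^sub>R hess w x b v + (fd \<xi> x v \<bullet> b) *\<^sub>R fd w x b)
     = (\<lambda>v. fd w x (fd \<xi> x v) + hess w x (\<xi> x) v)"
    unfolding sum.distrib h[of "\<xi> x"] f[of "fd \<xi> x _"] by (simp add: add.commute)
  then show ?thesis using *[OF \<xi>] by simp
qed

lemma C_on_fd_apply:
  fixes w :: "'a::euclidean_space \<Rightarrow> 'b::real_normed_vector"
  assumes w: "C_on (Suc k) S w" and S: "open S" and \<xi>: "C_on k S \<xi>"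
  shows "C_on k S (\<lambda>y. fd w y (\<xi> y))"
proof (rule C_on_cong[OF _ S])
  show "C_on k S (\<lambda>y. \<Sum>b\<in>Basis. (\<xi> y \<bullet> b) *\<^sub>R fd w y b)"
    by (intro C_on_sum C_on_scaleR S C_on_fd[OF w] C_on_linear_compose[OF bounded_linear_inner_left \<xi>])
  show "(\<Sum>b\<in>Basis. (\<xi> y \<bullet> b) *\<^sub>R fd w y b) = fd w y (\<xi> y)" if "y \<in> S" for y
    using w that by (intro fd_basis_sum[symmetric]) auto
qed

lemma sum_antisym_zero:
  fixes f :: "'i \<Rightarrow> 'i \<Rightarrow> real"
  assumes "\<And>i j. f i j = - f j i"
  shows "(\<Sum>i\<in>I. \<Sum>j\<in>I. f i j) = 0"
proof -
  have "(\<Sum>i\<in>I. \<Sum>j\<in>I. f i j) = (\<Sum>i\<in>I. \<Sum>j\<in>I. - f j i)"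
    by (intro sum.cong refl) (rule assms)
  also have "\<dots> = - (\<Sum>i\<in>I. \<Sum>j\<in>I. f j i)" by (simp add: sum_negf)
  also have "(\<Sum>i\<in>I. \<Sum>j\<in>I. f j i) = (\<Sum>i\<in>I. \<Sum>j\<in>I. f i j)" by (rule sum.swap)
  finally show ?thesis by simp
qed

text \<open>Symbols of Dirac type: \<open>\<Sum>i. \<xi>\<^sub>i A\<^sub>i\<close> is \<open>|\<xi>|\<close> times an isometry on the space \<open>W\<close>.\<close>

locale dirac =
  fixes A :: "'n::finite \<Rightarrow> 'v::euclidean_space \<Rightarrow> 'k::euclidean_space" and W :: "'v set"
  assumes A_linear: "linear (A i)"
    and W: "subspace W"
    and clifford: "w \<in> W \<Longrightarrow> A i w \<bullet> A j w = (if i = j then w \<bullet> w else 0)"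
begin

text \<open>Products of two symbols with the Clifford part removed. On \<open>W\<close> the form is
  antisymmetric both in the indices and in the vectors: the first removes symmetric second
  derivatives in \<open>dvg_F3_raw\<close>, the second merges the quadratic terms in
  \<open>dvg_F2_raw\<close>.\<close>

definition \<beta> :: "'n \<Rightarrow> 'n \<Rightarrow> 'v \<Rightarrow> 'v \<Rightarrow> real" where
  "\<beta> j i w z = A j w \<bullet> A i z - (if i = j then w \<bullet> z else 0)"

lemma A_bounded_linear: "bounded_linear (A i)"
  using A_linear by (simp add: linear_conv_bounded_linear)

lemma \<beta>_bilinear: "bounded_bilinear (\<beta> j i)"
proof -
  have "bilinear (\<beta> j i)"
    unfolding bilinear_def \<beta>_def
    using linear_add[OF A_linear] linear_cmul[OF A_linear]
    by (auto intro!: linearI simp: inner_add_left inner_add_right algebra_simps)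
  then show ?thesis by (simp add: bilinear_conv_bounded_bilinear)
qed

lemma polarized:
  assumes "w \<in> W" "z \<in> W"
  shows "A i w \<bullet> A j z + A i z \<bullet> A j w = (if i = j then 2 * (w \<bullet> z) else 0)"
proof -
  have "w + z \<in> W" using assms W subspace_add by blast
  from clifford[OF this, of i j] clifford[OF assms(1), of i j] clifford[OF assms(2), of i j]
  show ?thesis
    by (auto simp: linear_add[OF A_linear] inner_add_left inner_add_right inner_commute split: if_splits)
qed

lemma \<beta>_anti: "w \<in> W \<Longrightarrow> z \<in> W \<Longrightarrow> \<beta> j i w z = - \<beta> i j w z"
  using polarized[of w z i j] unfolding \<beta>_def by (auto simp: inner_commute split: if_splits)

lemma \<beta>_skew: "w \<in> W \<Longrightarrow> z \<in> W \<Longrightarrow> \<beta> j i w z = - \<beta> j i z w"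
  using polarized[of w z j i] unfolding \<beta>_def by (auto simp: inner_commute split: if_splits)

lemma \<beta>_diag: "w \<in> W \<Longrightarrow> z \<in> W \<Longrightarrow> \<beta> i i w z = 0"
  using \<beta>_anti[of w z i i] by simp

lemma norm_A: "w \<in> W \<Longrightarrow> norm (A i w) = norm w"
  using clifford[of w i i] by (simp add: norm_eq_sqrt_inner)

lemma \<beta>_bound: assumes "w \<in> W" "z \<in> W" shows "\<bar>\<beta> j i w z\<bar> \<le> 2 * (norm w * norm z)"
proof -
  have "\<bar>A j w \<bullet> A i z\<bar> \<le> norm w * norm z"
    using Cauchy_Schwarz_ineq2[of "A j w" "A i z"] norm_A assms by simp
  moreover have "\<bar>w \<bullet> z\<bar> \<le> norm w * norm z" by (rule Cauchy_Schwarz_ineq2)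
  ultimately show ?thesis unfolding \<beta>_def by auto
qed

end

section \<open>Frames in normal coordinates and the radial weight\<close>

text \<open>What the estimates ask of an orthonormal frame in normal coordinates.
  \<open>gauss1\<close> and \<open>gauss2\<close> are two forms of the Gauss lemma: the radial field
  has frame coefficients \<open>x\<close>, and the frame derivative of \<open>|x|\<close> is
  \<open>x $ i / |x|\<close> as in Euclidean space. The other conditions bound the frame, its first
  derivatives and its inverse by one constant.\<close>

locale radial_frame =
  fixes e :: "'n::finite \<Rightarrow> real^'n \<Rightarrow> real^'n" and r K0 :: real
  assumes r: "0 < r" "r \<le> 1" and K0: "K0 \<ge> 1"
    and e_C1: "C_on 1 (ball 0 r) (e i)"
    and gauss1: "x \<in> ball 0 r \<Longrightarrow> (\<Sum>i\<in>UNIV. x $ i *\<^sub>R e i x) = x"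
    and gauss2: "x \<in> ball 0 r \<Longrightarrow> x \<bullet> e i x = x $ i"
    and e_flat: "x \<in> ball 0 r \<Longrightarrow> norm (e i x - axis i 1) \<le> K0 * norm x"
    and e_deriv: "x \<in> ball 0 r \<Longrightarrow> norm (fd (e i) x v) \<le> K0 * norm v"
    and e_span: "x \<in> ball 0 r \<Longrightarrow> \<exists>c. v = (\<Sum>i\<in>UNIV. c i *\<^sub>R e i x) \<and> (\<forall>i. \<bar>c i\<bar> \<le> K0 * norm v)"
begin

text \<open>The constant \<open>\<kappa>\<close> makes the weight convex enough to absorb the errors, bounded through \<open>c2\<close> and
  \<open>c3\<close>, that come from the deviation of the frame from the coordinate frame.\<close>

definition c2 :: real where "c2 = 2*real CARD('n)^2*K0^2 + 2*real CARD('n)^2*K0 + 2*real CARD('n)^3*K0"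
definition c3 :: real where
  "c3 = 2 * real CARD('n)^2 * (real CARD('n) + 3) + 2 * real CARD('n)^2 * K0^2 * (1 + K0) + 2 * real CARD('n)^3 * K0"
definition \<kappa> :: real where "\<kappa> = 3 + real CARD('n)*(c2+c3)^2 + c2^2"

definition \<Omega> :: "(real^'n) set" where "\<Omega> = ball 0 r - {0}"

text \<open>The density, with respect to Lebesgue measure, of \<open>d|x| / |x|\<close> times the
  angular measure. The field \<open>p x *\<^sub>R x\<close> is divergence free, so only derivatives
  of the remaining factor appear in \<open>dvg_radial\<close>.\<close>

definition p :: "real^'n \<Rightarrow> real" where "p x = inverse (norm x ^ CARD('n))"

definition \<psi> :: "real \<Rightarrow> real^'n \<Rightarrow> real" where "\<psi> \<tau> x = exp (\<tau> * (\<kappa> * norm x - ln (norm x)))"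

lemma open_\<Omega>: "open \<Omega>" unfolding \<Omega>_def by auto

lemma \<Omega>D: assumes "x \<in> \<Omega>" shows "x \<in> ball 0 r" "x \<noteq> 0" "norm x > 0" "norm x < 1"
  using assms r unfolding \<Omega>_def by auto

lemma zero_notin_\<Omega>: "0 \<notin> \<Omega>" by (simp add: \<Omega>_def)

lemma e_C1': "C_on 1 \<Omega> (e i)"
  by (rule C_on_subset[OF e_C1]) (auto simp: \<Omega>_def)

lemma e_differentiable: "x \<in> \<Omega> \<Longrightarrow> e i differentiable (at x)"
  using e_C1'[of i] by simp

lemma p_pos: "x \<in> \<Omega> \<Longrightarrow> p x > 0" using \<Omega>D by (simp add: p_def)

lemma \<psi>_pos: "\<psi> \<tau> x > 0" by (simp add: \<psi>_def)

lemma C_on_p: "C_on k \<Omega> p"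
  unfolding p_def by (intro C_on_inverse C_on_power C_on_norm open_\<Omega> zero_notin_\<Omega>) (use \<Omega>D in auto)

lemma C_on_\<psi>: "C_on k \<Omega> (\<psi> \<tau>)"
  unfolding \<psi>_def
  by (intro C_on_exp C_on_diff C_on_mult C_on_ln C_on_norm open_\<Omega> zero_notin_\<Omega> C_on_const) (use \<Omega>D in auto)

lemma p_deriv:
  assumes "x \<in> \<Omega>"
  shows "(p has_derivative (\<lambda>v. - real CARD('n) * (x \<bullet> v) / (norm x)^2 * p x)) (at x)"
proof -
  have x: "norm x \<noteq> 0" "x \<noteq> 0" using \<Omega>D[OF assms] by auto
  have nn: "norm x ^ CARD('n) = norm x * norm x ^ (CARD('n) - 1)"
    by (metis One_nat_def Suc_pred' power_Suc zero_less_card_finite)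
  have *: "((\<lambda>y. norm y ^ CARD('n)) has_derivative (\<lambda>v. real CARD('n) * (x \<bullet> v / norm x) * norm x ^ (CARD('n) - 1))) (at x)"
    by (rule has_derivative_power[OF norm_has_derivative[OF x(2)]])
  have **: "norm x ^ CARD('n) \<noteq> 0" using x by simp
  show ?thesis unfolding p_def
    by (rule has_derivative_eq_rhs[OF Deriv.has_derivative_inverse[OF ** *]])
      (use x in \<open>simp add: fun_eq_iff nn power2_eq_square field_simps\<close>)
qed

lemma \<psi>_deriv:
  assumes "x \<in> \<Omega>"
  shows "(\<psi> \<tau> has_derivative (\<lambda>v. - \<tau> * (1 - \<kappa> * norm x) / (norm x)^2 * (x \<bullet> v) * \<psi> \<tau> x)) (at x)"
proof -
  have x: "norm x \<noteq> 0" "x \<noteq> 0" "norm x > 0" using \<Omega>D[OF assms] by auto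
  note h = norm_has_derivative[OF x(2)]
  show ?thesis unfolding \<psi>_def
    by (rule has_derivative_eq_rhs, (rule derivative_intros h x)+)
      (use x in \<open>simp add: fun_eq_iff power2_eq_square field_simps\<close>)
qed

context
  fixes x assumes x: "x \<in> \<Omega>"
begin

lemma fd_p: "fd p x v = - real CARD('n) * (x \<bullet> v) / (norm x)^2 * p x"
  by (simp add: fd_eq[OF p_deriv[OF x]])

lemma p_diff: "p differentiable (at x)"
  using p_deriv[OF x] by (rule differentiableI)

lemma fd_p_mult:
  assumes "h differentiable (at x)"
  shows "fd (\<lambda>y. p y * h y) x v = p x * (fd h x v - real CARD('n) * (x \<bullet> v) / (norm x)^2 * h x)"
    "(\<lambda>y. p y * h y) differentiable (at x)"
proof -
  have *: "((\<lambda>y. p y * h y) has_derivative (\<lambda>v. p x * fd h x v + fd p x v * h x)) (at x)"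
    by (rule has_derivative_mult[OF fd_works[OF p_diff] fd_works[OF assms]])
  then show "(\<lambda>y. p y * h y) differentiable (at x)" by (rule differentiableI)
  show "fd (\<lambda>y. p y * h y) x v = p x * (fd h x v - real CARD('n) * (x \<bullet> v) / (norm x)^2 * h x)"
    unfolding fd_eq[OF *] fd_p by (simp add: algebra_simps)
qed

lemma xx: "x \<bullet> x / (norm x)^2 = 1"
  using \<Omega>D[OF x] by (simp add: power2_norm_eq_inner)

lemma dvg_radial:
  assumes "h differentiable (at x)"
  shows "dvg (\<lambda>y. (p y * h y) *\<^sub>R y) x = p x * fd h x x"
  using dvg_scaleR[OF fd_p_mult(2)[OF assms], of "\<lambda>y. y"] xx
  by (simp add: fd_p_mult(1)[OF assms] dvg_ident algebra_simps)

end

end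

locale radial_weight = radial_frame e r K0
  for e :: "'n::finite \<Rightarrow> real^'n \<Rightarrow> real^'n" and r K0 +
  assumes small: "2 * r * \<kappa> \<le> 1"

text \<open>Here \<open>\<rho>\<close>, \<open>a\<close>, \<open>q\<close>, \<open>xn\<close>,
  \<open>ff\<close>, \<open>Q\<close> stand for \<open>|x|\<close>, \<open>|w|\<close>, the sum of
  the norms of the frame derivatives, the norm of the radial derivative, \<open>|f|^2\<close> and
  the sum of squares of the frame derivatives. The errors \<open>r2\<close> and \<open>r3\<close> go
  into \<open>xn^2\<close>, into \<open>\<rho>^3 * Q / \<tau>\<close> and into the convexity term.
  Of the coefficient of the latter, 3 pays for \<open>\<tau> * \<rho> * a^2\<close> on the left and
  for twice that amount from \<open>H2\<close>; the rest pays for Young's inequality in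
  \<open>am1\<close> and \<open>am2\<close>.\<close>

lemma carleman_algebra:
  fixes \<rho> \<tau> m N a q xn ff Q c2 c3 :: real
  assumes \<rho>: "0 < \<rho>" "\<rho> \<le> 1" and \<tau>: "1 \<le> \<tau>" and N: "1 \<le> N" and c: "0 \<le> c2" "0 \<le> c3"
    and a: "0 \<le> a" "0 \<le> q" "0 \<le> xn" "0 \<le> ff" and q: "q^2 \<le> N * Q"
    and H1: "xn^2 + 2 * T + 2 * \<tau> * m * XW \<le> \<rho>^2 * ff"
    and H2: "Q + B \<le> 2 * ff + 2 * \<tau>^2 * a^2 / \<rho>^2"
    and R2: "\<bar>r2\<bar> \<le> c2 * (\<rho>^2 * (a * q) + \<rho> * (a * xn))" and R3: "\<bar>r3\<bar> \<le> c3 * (a * q) / \<rho>"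
  shows "\<tau> * \<rho> * a^2 + (2 * \<tau> * m * XW - \<tau> * (3 + N * (c2 + c3)^2 + c2^2) * \<rho> * a^2) + (2 * T + r2)
     + \<rho>^3 * (B + r3) / \<tau> \<le> 3 * (\<rho>^2 * ff)"
proof -
  \<comment> \<open>The small factor \<open>\<rho>^3 / \<tau>\<close> turns the term of
    \<open>H2\<close> in \<open>\<tau>^2\<close> into \<open>2 * \<tau> * \<rho> * a^2\<close> and
    still keeps a multiple of \<open>Q\<close>.\<close>
  have B: "\<rho>^3 * B / \<tau> \<le> 2 * (\<rho>^2 * ff) + 2 * \<tau> * \<rho> * a^2 - \<rho>^3 * Q / \<tau>"
  proof -
    have "\<rho>^3 * B / \<tau> \<le> \<rho>^3 / \<tau> * (2 * ff + 2 * \<tau>^2 * a^2 / \<rho>^2 - Q)"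
      using mult_left_mono[of B "2 * ff + 2 * \<tau>^2 * a^2 / \<rho>^2 - Q" "\<rho>^3 / \<tau>"] H2 \<rho> \<tau> by simp
    also have "\<dots> = (\<rho> / \<tau>) * (2 * (\<rho>^2 * ff)) + 2 * \<tau> * \<rho> * a^2 - \<rho>^3 * Q / \<tau>"
      using \<rho> \<tau> by (simp add: field_simps power2_eq_square power3_eq_cube)
    also have "(\<rho> / \<tau>) * (2 * (\<rho>^2 * ff)) \<le> 1 * (2 * (\<rho>^2 * ff))"
      using \<rho> \<tau> a by (intro mult_right_mono) (auto simp: divide_le_eq)
    finally show ?thesis by simp
  qed
  have r3: "\<rho>^3 * r3 / \<tau> \<le> c3 * (\<rho>^2 * (a * q))"
  proof -
    have "\<rho>^3 * r3 / \<tau> \<le> \<rho>^3 * (c3 * (a * q) / \<rho>) / \<tau>"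
      using R3 \<rho> \<tau> by (intro divide_right_mono mult_left_mono) auto
    also have "\<dots> = (1 / \<tau>) * (c3 * (\<rho>^2 * (a * q)))"
      using \<rho> by (simp add: field_simps power2_eq_square power3_eq_cube)
    also have "\<dots> \<le> 1 * (c3 * (\<rho>^2 * (a * q)))"
      using \<tau> a c by (intro mult_right_mono) auto
    finally show ?thesis by simp
  qed
  define cc where "cc = c2 + c3"
  \<comment> \<open>The square is balanced so that its part in \<open>q^2\<close> is exactly what
    \<open>Q\<close> offers through \<open>q^2 \<le> N * Q\<close>.\<close>
  have am1: "cc * (\<rho>^2 * (a * q)) \<le> \<rho>^3 * Q / \<tau> + N * cc^2 * \<tau> * \<rho> * a^2 / 4"
  proof -
    have "0 \<le> \<rho> / (N * \<tau>) * (\<rho> * q - N * \<tau> * cc * a / 2)^2"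
      using \<rho> N \<tau> by auto
    also have "\<dots> = \<rho>^3 / (N * \<tau>) * q^2 - cc * (\<rho>^2 * (a * q)) + N * cc^2 * \<tau> * \<rho> * a^2 / 4"
      using N \<tau> by (simp add: field_simps power2_eq_square power3_eq_cube)
    also have "\<rho>^3 / (N * \<tau>) * q^2 \<le> \<rho>^3 / (N * \<tau>) * (N * Q)"
      using q \<rho> N \<tau> by (intro mult_left_mono) auto
    finally show ?thesis using N by simp
  qed
  have am2: "c2 * (\<rho> * (a * xn)) \<le> xn^2 + c2^2 * (\<tau> * \<rho> * a^2)"
  proof -
    have "0 \<le> (xn - c2 * \<rho> * a / 2)^2" by simp
    then have "c2 * (\<rho> * (a * xn)) \<le> xn^2 + c2^2 * (\<rho> * \<rho> * a^2) / 4"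
      by (simp add: field_simps power2_eq_square)
    also have "c2^2 * (\<rho> * \<rho> * a^2) / 4 \<le> c2^2 * (\<rho> * \<rho> * a^2)"
    proof -
      have "0 \<le> c2^2 * (\<rho> * \<rho> * a^2)" using \<rho> by (intro mult_nonneg_nonneg) auto
      then show ?thesis by linarith
    qed
    also have "\<dots> \<le> c2^2 * (\<tau> * \<rho> * a^2)"
      using \<rho> \<tau> by (intro mult_left_mono mult_right_mono) auto
    finally show ?thesis by simp
  qed
  have "\<bar>r2\<bar> \<le> c2 * (\<rho>^2 * (a * q)) + c2 * (\<rho> * (a * xn))" using R2 by (simp add: algebra_simps)
  moreover have "cc * (\<rho>^2 * (a * q)) = c2 * (\<rho>^2 * (a * q)) + c3 * (\<rho>^2 * (a * q))"
    by (simp add: cc_def algebra_simps)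
  moreover have "N * cc^2 * \<tau> * \<rho> * a^2 / 4 \<le> N * cc^2 * \<tau> * \<rho> * a^2"
    using N \<tau> \<rho> by simp
  moreover have "\<tau> * (3 + N * cc^2 + c2^2) * \<rho> * a^2
      = 3 * (\<tau> * \<rho> * a^2) + N * cc^2 * \<tau> * \<rho> * a^2 + c2^2 * (\<tau> * \<rho> * a^2)"
    by (simp add: algebra_simps)
  moreover have "\<rho>^3 * (B + r3) / \<tau> = \<rho>^3 * B / \<tau> + \<rho>^3 * r3 / \<tau>"
    by (simp add: algebra_simps add_divide_distrib)
  ultimately show ?thesis using B r3 am1 am2 H1 unfolding cc_def[symmetric] by linarith
qed

section \<open>Lower bounds for the conjugated Dirac operator\<close>

context dirac begin

lemma radial_inner:
  assumes "X \<in> W" "z \<in> W"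
  shows "(\<Sum>j\<in>UNIV. x $ j *\<^sub>R A j X) \<bullet> A i z = (\<Sum>j\<in>UNIV. x $ j * \<beta> j i X z) + x $ i * (X \<bullet> z)"
proof -
  have "(\<Sum>j\<in>UNIV. x $ j *\<^sub>R A j X) \<bullet> A i z = (\<Sum>j\<in>UNIV. x $ j * \<beta> j i X z + (if i = j then x $ j * (X \<bullet> z) else 0))"
    unfolding inner_sum_left by (rule sum.cong) (auto simp: \<beta>_def algebra_simps)
  then show ?thesis by (simp add: sum.distrib)
qed

lemma radial_inner_radial:
  assumes "X \<in> W" "z \<in> W"
  shows "(\<Sum>j\<in>UNIV. x $ j *\<^sub>R A j X) \<bullet> (\<Sum>j\<in>UNIV. x $ j *\<^sub>R A j z) = (norm x)^2 * (X \<bullet> z)"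
proof -
  have z: "(\<Sum>i\<in>UNIV. \<Sum>j\<in>UNIV. x $ i * (x $ j * \<beta> j i X z)) = 0"
    by (rule sum_antisym_zero) (subst \<beta>_anti[OF assms], simp add: algebra_simps)
  have n: "(norm x)^2 = (\<Sum>i\<in>UNIV. x $ i * x $ i)"
    by (simp add: power2_norm_eq_inner inner_vec_def)
  have "(\<Sum>j\<in>UNIV. x $ j *\<^sub>R A j X) \<bullet> (\<Sum>j\<in>UNIV. x $ j *\<^sub>R A j z)
    = (\<Sum>i\<in>UNIV. x $ i * ((\<Sum>j\<in>UNIV. x $ j *\<^sub>R A j X) \<bullet> A i z))"
    by (simp add: inner_sum_right)
  also have "\<dots> = (\<Sum>i\<in>UNIV. \<Sum>j\<in>UNIV. x $ i * (x $ j * \<beta> j i X z)) + (norm x)^2 * (X \<bullet> z)"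
    unfolding radial_inner[OF assms] n
    by (simp add: distrib_left sum.distrib sum_distrib_left sum_distrib_right mult.assoc)
  finally show ?thesis using z by simp
qed

text \<open>With \<open>g i\<close> the frame derivatives of \<open>w\<close> and \<open>X\<close>
  its radial derivative, \<open>f\<close> is the operator conjugated with the weight. The first
  bound pairs \<open>f\<close> with the radial symbol of \<open>X\<close>, whose norm is
  \<open>|x||X|\<close>, and expands a square. The second is
  \<open>|f - cw|^2 \<le> 2|f|^2 + 2|cw|^2\<close>, where \<open>cw\<close> is the part of
  \<open>f\<close> without derivatives.\<close>

lemma dirac_lower:
  fixes x :: "real^'n"
  assumes w: "w \<in> W" and g: "\<And>i. g i \<in> W" and x: "x \<noteq> 0" and X: "X = (\<Sum>i\<in>UNIV. x $ i *\<^sub>R g i)"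
    and f: "f = (\<Sum>i\<in>UNIV. A i (g i)) + (\<mu> / (norm x)^2) *\<^sub>R (\<Sum>i\<in>UNIV. x $ i *\<^sub>R A i w)"
  shows "(norm X)^2 + 2 * (\<Sum>i\<in>UNIV. \<Sum>j\<in>UNIV. x $ j * \<beta> j i X (g i)) + 2 * \<mu> * (X \<bullet> w)
      \<le> (norm x)^2 * (norm f)^2" (is ?th1)
    and "(\<Sum>i\<in>UNIV. (norm (g i))^2) + (\<Sum>i\<in>UNIV. \<Sum>j\<in>UNIV. \<beta> j i (g j) (g i))
      \<le> 2 * (norm f)^2 + 2 * \<mu>^2 * (norm w)^2 / (norm x)^2" (is ?th2)
proof -
  define \<rho> where "\<rho> = norm x"
  have \<rho>: "\<rho> > 0" using x by (simp add: \<rho>_def)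
  have XW: "X \<in> W" unfolding X by (intro subspace_sum subspace_scale W g)
  define c where "c = (\<Sum>j\<in>UNIV. x $ j *\<^sub>R A j X)"
  have "c \<bullet> (\<Sum>i\<in>UNIV. A i (g i)) = (\<Sum>i\<in>UNIV. \<Sum>j\<in>UNIV. x $ j * \<beta> j i X (g i)) + X \<bullet> X"
    unfolding inner_sum_right c_def radial_inner[OF XW g] sum.distrib
    by (subst (3) X) (simp add: inner_sum_right)
  then have cf: "c \<bullet> f = (\<Sum>i\<in>UNIV. \<Sum>j\<in>UNIV. x $ j * \<beta> j i X (g i)) + X \<bullet> X + \<mu> * (X \<bullet> w)"
    unfolding f inner_add_right inner_scaleR_right
    using radial_inner_radial[OF XW w, of x] \<rho> by (simp add: c_def \<rho>_def)
  have cc: "c \<bullet> c = \<rho>^2 * (X \<bullet> X)"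
    unfolding c_def \<rho>_def by (rule radial_inner_radial[OF XW XW])
  have "0 \<le> (c /\<^sub>R \<rho> - \<rho> *\<^sub>R f) \<bullet> (c /\<^sub>R \<rho> - \<rho> *\<^sub>R f)" by simp
  also have "\<dots> = (c \<bullet> c) / \<rho>^2 - 2 * (c \<bullet> f) + \<rho>^2 * (f \<bullet> f)"
    using \<rho> by (simp add: inner_diff_left inner_diff_right inner_commute power2_eq_square field_simps)
  finally show ?th1
    using \<rho> by (simp add: cc cf \<rho>_def[symmetric] power2_norm_eq_inner)
  define h where "h = (\<Sum>i\<in>UNIV. A i (g i))"
  define cw where "cw = (\<mu> / \<rho>^2) *\<^sub>R (\<Sum>i\<in>UNIV. x $ i *\<^sub>R A i w)"
  have hh: "(norm h)^2 = (\<Sum>i\<in>UNIV. (norm (g i))^2) + (\<Sum>i\<in>UNIV. \<Sum>j\<in>UNIV. \<beta> j i (g j) (g i))"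
  proof -
    have "(norm h)^2 = (\<Sum>i\<in>UNIV. \<Sum>j\<in>UNIV. A j (g j) \<bullet> A i (g i))"
      unfolding h_def power2_norm_eq_inner inner_sum_right inner_sum_left by simp
    also have "\<dots> = (\<Sum>i\<in>UNIV. \<Sum>j\<in>UNIV. \<beta> j i (g j) (g i) + (if i = j then g i \<bullet> g i else 0))"
      by (intro sum.cong refl) (auto simp: \<beta>_def)
    finally show ?thesis by (simp add: sum.distrib power2_norm_eq_inner)
  qed
  have cw: "(norm cw)^2 = \<mu>^2 * (norm w)^2 / \<rho>^2"
    unfolding cw_def power2_norm_eq_inner[of "_ *\<^sub>R _"] inner_scaleR_left inner_scaleR_right radial_inner_radial[OF w w]
      \<rho>_def[symmetric] power2_norm_eq_inner[of w]
    using \<rho> by (simp add: power2_eq_square)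
  have h: "h = f - cw" by (simp add: h_def f cw_def \<rho>_def)
  have "0 \<le> (norm (f + cw))^2" by simp
  then have "(norm h)^2 \<le> 2 * (norm f)^2 + 2 * (norm cw)^2"
    unfolding h power2_norm_eq_inner by (simp add: inner_diff_left inner_diff_right inner_add_left inner_add_right inner_commute)
  then show ?th2 unfolding hh cw \<rho>_def by simp
qed

end

section \<open>Divergence identities behind the Carleman estimate\<close>

locale carleman = dirac A W + radial_weight e r K0
  for A :: "'n::finite \<Rightarrow> 'v::euclidean_space \<Rightarrow> 'k::euclidean_space" and W
    and e :: "'n \<Rightarrow> real^'n \<Rightarrow> real^'n" and r K0
begin

definition P :: "(real^'n \<Rightarrow> 'v) \<Rightarrow> real^'n \<Rightarrow> 'k" where
  "P u x = (\<Sum>i\<in>UNIV. A i (fd u x (e i x)))"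

definition a :: "(real^'n \<Rightarrow> 'v) \<Rightarrow> real^'n \<Rightarrow> real" where
  "a w x = (\<Sum>i\<in>UNIV. \<Sum>j\<in>UNIV. x $ j * \<beta> j i (w x) (fd w x (e i x)))"

definition s :: "(real^'n \<Rightarrow> 'v) \<Rightarrow> 'n \<Rightarrow> real^'n \<Rightarrow> real" where
  "s w i x = (\<Sum>j\<in>UNIV. x $ j * \<beta> j i (w x) (fd w x x))"

text \<open>Up to the factor \<open>p\<close>, its divergence is the term
  \<open>2 * \<tau> * (1 - \<kappa>|x|) * (X \<bullet> w)\<close> of \<open>dirac_lower\<close>
  minus the gain \<open>\<tau> * \<kappa> * |x||w|^2\<close> from the convexity of the
  weight.\<close>

definition F1 :: "real \<Rightarrow> (real^'n \<Rightarrow> 'v) \<Rightarrow> real^'n \<Rightarrow> real^'n" where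
  "F1 \<tau> w x = (p x * (\<tau> * (1 - \<kappa> * norm x) * (w x \<bullet> w x))) *\<^sub>R x"

text \<open>Its divergence yields twice the double sum in the first bound of
  \<open>dirac_lower\<close>, up to errors. The radial derivative of \<open>a w\<close> contains
  second derivatives, and the part with \<open>s\<close> cancels them by symmetry of
  \<open>hess\<close>.\<close>

definition F2 :: "(real^'n \<Rightarrow> 'v) \<Rightarrow> real^'n \<Rightarrow> real^'n" where
  "F2 w x = (p x * a w x) *\<^sub>R x - (\<Sum>i\<in>UNIV. (p x * s w i x) *\<^sub>R e i x)"

text \<open>Its divergence yields the double sum in the second bound of \<open>dirac_lower\<close>,
  up to errors. The power \<open>norm x^3\<close> is the one with which that bound enters
  \<open>carleman_algebra\<close>.\<close>

definition F3 :: "(real^'n \<Rightarrow> 'v) \<Rightarrow> real^'n \<Rightarrow> real^'n" where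
  "F3 w x = (\<Sum>j\<in>UNIV. (norm x^3 * p x * (\<Sum>i\<in>UNIV. \<beta> j i (w x) (fd w x (e i x)))) *\<^sub>R e j x)"

lemma C_on_fields:
  assumes w: "C_on 2 \<Omega> w"
  shows "C_on 1 \<Omega> (F1 \<tau> w)" "C_on 1 \<Omega> (F2 w)" "C_on 1 \<Omega> (F3 w)"
proof -
  have w1: "C_on 1 \<Omega> w" by (rule C_on_mono[OF w]) simp
  have w2: "C_on (Suc 1) \<Omega> w" using w by (simp only: Suc_1)
  have id: "C_on k \<Omega> (\<lambda>x. x)" for k by (rule C_on_linear) (rule bounded_linear_ident)
  note i = C_on_bilinear[OF bounded_bilinear_inner] C_on_scaleR C_on_mult C_on_p C_on_norm C_on_power open_\<Omega>
    zero_notin_\<Omega> C_on_const C_on_diff C_on_sum w1 C_on_bilinear[OF \<beta>_bilinear] C_on_nth id e_C1'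
    C_on_fd_apply[OF w2]
  show "C_on 1 \<Omega> (F1 \<tau> w)" unfolding F1_def by (intro i)
  show "C_on 1 \<Omega> (F2 w)" unfolding F2_def a_def s_def by (intro i)
  show "C_on 1 \<Omega> (F3 w)" unfolding F3_def by (intro i)
qed

lemma \<beta>_add_right: "\<beta> j i w (y + z) = \<beta> j i w y + \<beta> j i w z"
  by (rule bounded_bilinear.add_right[OF \<beta>_bilinear])

context
  fixes w :: "real^'n \<Rightarrow> 'v" and x :: "real^'n"
  assumes w: "C_on 2 \<Omega> w" and x: "x \<in> \<Omega>"
begin

lemma w_diff: "w differentiable (at x)"
  using C_on_mono[OF w, of 1] x by simp

lemma g_deriv: "((\<lambda>y. fd w y (e i y)) has_derivative (\<lambda>v. fd w x (fd (e i) x v) + hess w x (e i x) v)) (at x)"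
  by (rule fd_apply_has_derivative[OF w open_\<Omega> x e_differentiable[OF x]])

lemma X_deriv: "((\<lambda>y. fd w y y) has_derivative (\<lambda>v. fd w x v + hess w x x v)) (at x)"
  using fd_apply_has_derivative[OF w open_\<Omega> x, of "\<lambda>y. y"] by simp

lemma a_deriv: "(a w has_derivative (\<lambda>v. \<Sum>i\<in>UNIV. \<Sum>j\<in>UNIV.
     x $ j * (\<beta> j i (w x) (fd w x (fd (e i) x v) + hess w x (e i x) v) + \<beta> j i (fd w x v) (fd w x (e i x)))
     + v $ j * \<beta> j i (w x) (fd w x (e i x)))) (at x)"
  unfolding a_def
  by (intro has_derivative_sum has_derivative_mult bounded_bilinear.FDERIV[OF \<beta>_bilinear]
      fd_works[OF w_diff] g_deriv bounded_linear_imp_has_derivative bounded_linear_vec_nth)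

lemma s_deriv: "(s w i has_derivative (\<lambda>v. \<Sum>j\<in>UNIV.
     x $ j * (\<beta> j i (w x) (fd w x v + hess w x x v) + \<beta> j i (fd w x v) (fd w x x))
     + v $ j * \<beta> j i (w x) (fd w x x))) (at x)"
  unfolding s_def
  by (intro has_derivative_sum has_derivative_mult bounded_bilinear.FDERIV[OF \<beta>_bilinear]
      fd_works[OF w_diff] X_deriv bounded_linear_imp_has_derivative bounded_linear_vec_nth)

lemma dvg_F1: "dvg (F1 \<tau> w) x = p x * (2 * \<tau> * (1 - \<kappa> * norm x) * (fd w x x \<bullet> w x) - \<tau> * \<kappa> * norm x * (norm (w x))^2)"
proof -
  have n: "norm x \<noteq> 0" "x \<noteq> 0" using \<Omega>D[OF x] by auto
  have h: "((\<lambda>y. \<tau> * (1 - \<kappa> * norm y) * (w y \<bullet> w y)) has_derivative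
      (\<lambda>v. \<tau> * (1 - \<kappa> * norm x) * (w x \<bullet> fd w x v + fd w x v \<bullet> w x)
         + \<tau> * (0 - \<kappa> * ((x \<bullet> v) / norm x)) * (w x \<bullet> w x))) (at x)"
    by (intro has_derivative_mult has_derivative_mult_right has_derivative_diff has_derivative_inner
        norm_has_derivative fd_works[OF w_diff] has_derivative_const n)
  have "x \<bullet> x / norm x = norm x" using n by (simp add: power2_norm_eq_inner[symmetric] power2_eq_square)
  then show ?thesis unfolding F1_def dvg_radial[OF x differentiableI[OF h]] fd_eq[OF h]
    by (simp add: inner_commute power2_norm_eq_inner algebra_simps)
qed

lemma F2_alg:
  "(\<Sum>i\<in>UNIV. \<Sum>j\<in>UNIV.
     x $ j * (\<beta> j i (w x) (fd w x (fd (e i) x x) + hess w x (e i x) x) + \<beta> j i (fd w x x) (fd w x (e i x)))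
     + x $ j * \<beta> j i (w x) (fd w x (e i x)))
  - (\<Sum>i\<in>UNIV. \<Sum>j\<in>UNIV. x $ j * (\<beta> j i (w x) (fd w x (e i x) + hess w x x (e i x)) + \<beta> j i (fd w x (e i x)) (fd w x x))
     + e i x $ j * \<beta> j i (w x) (fd w x x))
  = (\<Sum>i\<in>UNIV. \<Sum>j\<in>UNIV. x $ j * (\<beta> j i (fd w x x) (fd w x (e i x)) - \<beta> j i (fd w x (e i x)) (fd w x x)))
   + (\<Sum>i\<in>UNIV. \<Sum>j\<in>UNIV. x $ j * \<beta> j i (w x) (fd w x (fd (e i) x x)) - e i x $ j * \<beta> j i (w x) (fd w x x))"
  unfolding sum_subtractf[symmetric] sum.distrib[symmetric]
  by (intro sum.cong refl) (simp add: \<beta>_add_right hess_sym[OF w open_\<Omega> x, of x] algebra_simps)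

lemma dvg_F2_raw:
  assumes "\<And>v. fd w x v \<in> W" "w x \<in> W"
  shows "dvg (F2 w) x = p x * (2 * (\<Sum>i\<in>UNIV. \<Sum>j\<in>UNIV. x $ j * \<beta> j i (fd w x x) (fd w x (e i x)))
    + ((\<Sum>i\<in>UNIV. \<Sum>j\<in>UNIV. x $ j * \<beta> j i (w x) (fd w x (fd (e i) x x)) - e i x $ j * \<beta> j i (w x) (fd w x x))
       - (\<Sum>i\<in>UNIV. s w i x * dvg (e i) x)))"
proof -
  have ad: "a w differentiable (at x)" using a_deriv by (rule differentiableI)
  have sd: "s w i differentiable (at x)" for i using s_deriv by (rule differentiableI)
  have xr: "x \<in> ball 0 r" using \<Omega>D[OF x] by auto
  \<comment> \<open>Antisymmetry of \<open>\<beta>\<close> in its indices. Together with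
    \<open>gauss2\<close> it disposes of the derivative of \<open>p\<close> in the second part of
    \<open>F2\<close>.\<close>
  have z: "(\<Sum>i\<in>UNIV. x $ i * s w i x) = 0"
  proof -
    have "(\<Sum>i\<in>UNIV. \<Sum>j\<in>UNIV. x $ i * (x $ j * \<beta> j i (w x) (fd w x x))) = 0"
      by (rule sum_antisym_zero) (subst \<beta>_anti[OF assms(2,1)], simp add: algebra_simps)
    then show ?thesis by (simp add: s_def sum_distrib_left)
  qed
  have sp: "(\<lambda>y. (p y * s w i y) *\<^sub>R e i y) differentiable (at x)" for i
    by (intro derivative_intros differentiable_scaleR fd_p_mult(2)[OF x sd] e_differentiable[OF x])
  have ap: "(\<lambda>y. (p y * a w y) *\<^sub>R y) differentiable (at x)"
    by (intro differentiable_scaleR fd_p_mult(2)[OF x ad]) simp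
  have d1: "dvg (\<lambda>y. (p y * s w i y) *\<^sub>R e i y) x
     = p x * (fd (s w i) x (e i x) + s w i x * dvg (e i) x) - p x * real CARD('n) / (norm x)^2 * (x $ i * s w i x)" for i
    using dvg_scaleR[OF fd_p_mult(2)[OF x sd] e_differentiable[OF x], of i i]
    by (simp add: fd_p_mult(1)[OF x sd] gauss2[OF xr] algebra_simps)
  define V where "V i y = (- 1) *\<^sub>R ((p y * s w i y) *\<^sub>R e i y)" for i y
  have Vd: "V i differentiable (at x)" for i
    unfolding V_def by (intro differentiable_scaleR sp differentiable_const)
  have dV: "dvg (V i) x = - dvg (\<lambda>y. (p y * s w i y) *\<^sub>R e i y) x" for i
    unfolding V_def using dvg_scaleR[of "\<lambda>_. - 1", OF _ sp] by simp
  have "dvg (F2 w) x = dvg (\<lambda>y. (p y * a w y) *\<^sub>R y + (\<Sum>i\<in>UNIV. V i y)) x"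
    unfolding F2_def V_def by (simp add: sum_negf)
  also have "\<dots> = dvg (\<lambda>y. (p y * a w y) *\<^sub>R y) x + (\<Sum>i\<in>UNIV. dvg (V i) x)"
    by (subst dvg_add[OF ap]) (auto intro!: differentiable_sum Vd simp: dvg_sum[OF Vd])
  also have "\<dots> = p x * fd (a w) x x - (\<Sum>i\<in>UNIV. dvg (\<lambda>y. (p y * s w i y) *\<^sub>R e i y) x)"
    unfolding dvg_radial[OF x ad] dV by (simp add: sum_negf)
  also have "(\<Sum>i\<in>UNIV. dvg (\<lambda>y. (p y * s w i y) *\<^sub>R e i y) x)
     = p x * (\<Sum>i\<in>UNIV. fd (s w i) x (e i x) + s w i x * dvg (e i) x)"
    unfolding d1 sum_subtractf sum_distrib_left[symmetric] z by simp
  also have "p x * fd (a w) x x - p x * (\<Sum>i\<in>UNIV. fd (s w i) x (e i x) + s w i x * dvg (e i) x)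
    = p x * ((fd (a w) x x - (\<Sum>i\<in>UNIV. fd (s w i) x (e i x))) - (\<Sum>i\<in>UNIV. s w i x * dvg (e i) x))"
    by (simp add: sum.distrib algebra_simps)
  also have "fd (a w) x x - (\<Sum>i\<in>UNIV. fd (s w i) x (e i x)) =
    (\<Sum>i\<in>UNIV. \<Sum>j\<in>UNIV. x $ j * (\<beta> j i (fd w x x) (fd w x (e i x)) - \<beta> j i (fd w x (e i x)) (fd w x x)))
   + (\<Sum>i\<in>UNIV. \<Sum>j\<in>UNIV. x $ j * \<beta> j i (w x) (fd w x (fd (e i) x x)) - e i x $ j * \<beta> j i (w x) (fd w x x))"
    unfolding fd_eq[OF a_deriv] fd_eq[OF s_deriv] by (rule F2_alg)
  also have "(\<Sum>i\<in>UNIV. \<Sum>j\<in>UNIV. x $ j * (\<beta> j i (fd w x x) (fd w x (e i x)) - \<beta> j i (fd w x (e i x)) (fd w x x)))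
    = 2 * (\<Sum>i\<in>UNIV. \<Sum>j\<in>UNIV. x $ j * \<beta> j i (fd w x x) (fd w x (e i x)))"
    unfolding sum_distrib_left
    by (intro sum.cong refl) (subst (2) \<beta>_skew[OF assms(1) assms(1)], simp)
  finally show ?thesis by (simp add: algebra_simps)
qed

lemma dvg_F3_raw:
  assumes "\<And>v. fd w x v \<in> W" "w x \<in> W" "\<And>u v. hess w x u v \<in> W"
  shows "dvg (F3 w) x = p x * norm x ^ 3 * ((\<Sum>i\<in>UNIV. \<Sum>j\<in>UNIV. \<beta> j i (fd w x (e j x)) (fd w x (e i x)))
    + (\<Sum>i\<in>UNIV. \<Sum>j\<in>UNIV. (3 - real CARD('n)) / (norm x)^2 * (x $ j * \<beta> j i (w x) (fd w x (e i x)))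
        + \<beta> j i (w x) (fd w x (fd (e i) x (e j x))) + \<beta> j i (w x) (fd w x (e i x)) * dvg (e j) x))"
proof -
  have n: "norm x \<noteq> 0" "x \<noteq> 0" using \<Omega>D[OF x] by auto
  have xr: "x \<in> ball 0 r" using \<Omega>D[OF x] by auto
  define k where "k j y = (\<Sum>i\<in>UNIV. \<beta> j i (w y) (fd w y (e i y)))" for j y
  have kd: "(k j has_derivative (\<lambda>v. \<Sum>i\<in>UNIV. \<beta> j i (w x) (fd w x (fd (e i) x v) + hess w x (e i x) v)
      + \<beta> j i (fd w x v) (fd w x (e i x)))) (at x)" for j
    unfolding k_def by (intro has_derivative_sum bounded_bilinear.FDERIV[OF \<beta>_bilinear] fd_works[OF w_diff] g_deriv)
  have n3: "((\<lambda>y. norm y ^ 3) has_derivative (\<lambda>v. 3 * norm x ^ 3 * (x \<bullet> v) / (norm x)^2)) (at x)"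
    by (rule has_derivative_eq_rhs[OF has_derivative_power[OF norm_has_derivative[OF n(2)]]])
      (use n in \<open>simp add: fun_eq_iff power2_eq_square power3_eq_cube field_simps\<close>)
  have hd: "((\<lambda>y. norm y ^ 3 * k j y) has_derivative (\<lambda>v. norm x ^ 3 * fd (k j) x v
     + 3 * norm x ^ 3 * (x \<bullet> v) / (norm x)^2 * k j x)) (at x)" for j
    by (rule has_derivative_mult[OF n3]) (simp add: fd_eq[OF kd] kd)
  define V where "V j y = (p y * (norm y ^ 3 * k j y)) *\<^sub>R e j y" for j y
  have Vd: "V j differentiable (at x)" for j
    unfolding V_def by (intro differentiable_scaleR fd_p_mult(2)[OF x] differentiableI[OF hd] e_differentiable[OF x])
  have dV: "dvg (V j) x = p x * norm x ^ 3 * (fd (k j) x (e j x) + (3 - real CARD('n)) / (norm x)^2 * (x $ j * k j x)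
      + k j x * dvg (e j) x)" for j
    unfolding V_def dvg_scaleR[OF fd_p_mult(2)[OF x differentiableI[OF hd]] e_differentiable[OF x]]
      fd_p_mult(1)[OF x differentiableI[OF hd]] fd_eq[OF hd] gauss2[OF xr]
    by (simp add: algebra_simps add_divide_distrib diff_divide_distrib)
  have "dvg (F3 w) x = (\<Sum>j\<in>UNIV. dvg (V j) x)"
    using dvg_sum[of UNIV V] Vd by (simp add: F3_def[abs_def] V_def[abs_def] k_def mult.commute mult.left_commute mult.assoc)
  also have "\<dots> = p x * norm x ^ 3 * (\<Sum>j\<in>UNIV. fd (k j) x (e j x) + (3 - real CARD('n)) / (norm x)^2 * (x $ j * k j x)
      + k j x * dvg (e j) x)"
    unfolding dV by (simp add: sum_distrib_left)
  also have "(\<Sum>j\<in>UNIV. fd (k j) x (e j x) + (3 - real CARD('n)) / (norm x)^2 * (x $ j * k j x) + k j x * dvg (e j) x)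
    = (\<Sum>j\<in>UNIV. \<Sum>i\<in>UNIV. \<beta> j i (w x) (hess w x (e i x) (e j x)))
    + ((\<Sum>j\<in>UNIV. \<Sum>i\<in>UNIV. \<beta> j i (fd w x (e j x)) (fd w x (e i x)))
    + (\<Sum>j\<in>UNIV. \<Sum>i\<in>UNIV. (3 - real CARD('n)) / (norm x)^2 * (x $ j * \<beta> j i (w x) (fd w x (e i x)))
        + \<beta> j i (w x) (fd w x (fd (e i) x (e j x))) + \<beta> j i (w x) (fd w x (e i x)) * dvg (e j) x))"
    unfolding fd_eq[OF kd] unfolding k_def sum_distrib_left sum_distrib_right sum.distrib[symmetric]
    by (intro sum.cong refl) (simp add: \<beta>_add_right)
  \<comment> \<open>Symmetric second derivatives meet the antisymmetric indices of
    \<open>\<beta>\<close>.\<close>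
  also have "(\<Sum>j\<in>UNIV. \<Sum>i\<in>UNIV. \<beta> j i (w x) (hess w x (e i x) (e j x))) = 0"
    by (rule sum_antisym_zero) (subst \<beta>_anti[OF assms(2,3)], simp add: hess_sym[OF w open_\<Omega> x])
  finally have * : "dvg (F3 w) x = p x * norm x ^ 3 * (0 + ((\<Sum>j\<in>UNIV. \<Sum>i\<in>UNIV. \<beta> j i (fd w x (e j x)) (fd w x (e i x)))
    + (\<Sum>j\<in>UNIV. \<Sum>i\<in>UNIV. (3 - real CARD('n)) / (norm x)^2 * (x $ j * \<beta> j i (w x) (fd w x (e i x)))
        + \<beta> j i (w x) (fd w x (fd (e i) x (e j x))) + \<beta> j i (w x) (fd w x (e i x)) * dvg (e j) x)))" .
  have swap: "(\<Sum>j\<in>UNIV. \<Sum>i\<in>UNIV. f j i) = (\<Sum>i\<in>UNIV. \<Sum>j\<in>UNIV. f j i)" for f :: "'n \<Rightarrow> 'n \<Rightarrow> real"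
    by (rule sum.swap)
  show ?thesis unfolding * by (subst (1 2) swap) simp
qed

end

end

text \<open>Pairings of \<open>f\<close> with vectors orthogonal to \<open>W\<close> vanish near
  \<open>x\<close>, hence so do their derivatives, and \<open>W\<close> is its own double orthogonal
  complement.\<close>

lemma fd_in_subspace:
  fixes f :: "'a::euclidean_space \<Rightarrow> 'b::euclidean_space"
  assumes W: "subspace W" and S: "open S" "x \<in> S" and f: "\<And>y. y \<in> S \<Longrightarrow> f y \<in> W"
    and d: "f differentiable (at x)"
  shows "fd f x v \<in> W"
proof -
  have "z \<bullet> fd f x v = 0" if z: "z \<in> orthogonal_comp W" for z
  proof -
    have "fd (\<lambda>y. z \<bullet> f y) x = fd (\<lambda>_. 0) x"
      by (rule fd_cong[OF S]) (use z f in \<open>auto simp: orthogonal_comp_def orthogonal_def inner_commute\<close>)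
    then show ?thesis
      using fd_eq[OF bounded_linear.has_derivative[OF bounded_linear_inner_right[of z] fd_works[OF d]]]
      by (simp add: fun_eq_iff)
  qed
  then have "fd f x v \<in> orthogonal_comp (orthogonal_comp W)"
    by (auto simp: orthogonal_comp_def orthogonal_def inner_commute)
  then show ?thesis using orthogonal_comp_self[OF W] by simp
qed

lemma abs_double_sum_le:
  fixes f :: "'n::finite \<Rightarrow> 'n \<Rightarrow> real"
  assumes "\<And>i j. \<bar>f i j\<bar> \<le> B"
  shows "\<bar>\<Sum>i\<in>UNIV. \<Sum>j\<in>UNIV. f i j\<bar> \<le> (real CARD('n))^2 * B"
proof -
  have "\<bar>\<Sum>i\<in>UNIV. \<Sum>j\<in>UNIV. f i j\<bar> \<le> (\<Sum>i\<in>(UNIV::'n set). \<Sum>j\<in>(UNIV::'n set). B)"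
    by (intro order_trans[OF sum_abs] sum_mono assms)
  then show ?thesis by (simp add: power2_eq_square mult.assoc)
qed

context radial_frame begin

lemma fd_bound:
  fixes w :: "real^'n \<Rightarrow> 'v::euclidean_space"
  assumes "w differentiable (at x)" "x \<in> ball 0 r"
  shows "norm (fd w x v) \<le> K0 * norm v * (\<Sum>i\<in>UNIV. norm (fd w x (e i x)))"
proof -
  obtain c where c: "v = (\<Sum>i\<in>UNIV. c i *\<^sub>R e i x)" "\<And>i. \<bar>c i\<bar> \<le> K0 * norm v"
    using e_span[OF assms(2)] by blast
  interpret bounded_linear "fd w x" by (rule fd_bounded_linear[OF assms(1)])
  have "fd w x v = (\<Sum>i\<in>UNIV. c i *\<^sub>R fd w x (e i x))"
    by (subst c(1)) (simp add: sum scaleR)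
  also have "norm \<dots> \<le> (\<Sum>i\<in>UNIV. K0 * norm v * norm (fd w x (e i x)))"
    by (rule sum_norm_le) (use c(2) in \<open>auto intro: mult_right_mono\<close>)
  finally show ?thesis by (simp add: sum_distrib_left)
qed

lemma norm_e: assumes "x \<in> ball 0 r" shows "norm (e i x) \<le> 1 + K0"
proof -
  have "norm (e i x) \<le> norm (axis i (1::real)::real^'n) + norm (e i x - axis i 1)"
    using norm_triangle_ineq[of "axis i 1" "e i x - axis i 1"] by simp
  also have "\<dots> \<le> 1 + K0 * norm x" using e_flat[OF assms, of i] by simp
  also have "K0 * norm x \<le> K0 * 1" using assms r K0 by (intro mult_left_mono) auto
  finally show ?thesis by simp
qed

lemma c_nonneg: "0 \<le> c2" "0 \<le> c3" "0 \<le> \<kappa>"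
  using K0 by (auto simp: c2_def c3_def \<kappa>_def)

end

section \<open>The pointwise inequality\<close>

context carleman begin

context
  fixes w :: "real^'n \<Rightarrow> 'v" and x :: "real^'n"
  assumes w: "C_on 2 \<Omega> w" and x: "x \<in> \<Omega>" and wW: "\<And>y. y \<in> \<Omega> \<Longrightarrow> w y \<in> W"
begin

lemma fd_W: "y \<in> \<Omega> \<Longrightarrow> fd w y v \<in> W"
  by (rule fd_in_subspace[OF W open_\<Omega> _ wW]) (use C_on_mono[OF w, of 1] in auto)

lemma hess_W: "hess w x u v \<in> W"
  unfolding hess_def
  by (rule fd_in_subspace[OF W open_\<Omega> x fd_W]) (use w x in \<open>auto simp: numeral_2_eq_2\<close>)

text \<open>On the left stand the quantity to be estimated and three divergences, which integrate to
  zero; on the right stands the conjugated operator. What is left over are errors from the frame not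
  being the coordinate frame, estimated in \<open>R2\<close> and \<open>R3\<close>.\<close>

lemma pointwise_carleman:
  assumes \<tau>: "\<tau> \<ge> 1"
  shows "p x * (\<tau> * norm x * (norm (w x))^2) + (dvg (F1 \<tau> w) x + dvg (F2 w) x + (1 / \<tau>) * dvg (F3 w) x)
     \<le> 3 * (p x * ((norm x)^2 * (norm ((\<Sum>i\<in>UNIV. A i (fd w x (e i x)))
          + (\<tau> * (1 - \<kappa> * norm x) / (norm x)^2) *\<^sub>R (\<Sum>i\<in>UNIV. x $ i *\<^sub>R A i (w x))))^2))"
proof -
  note xr = \<Omega>D[OF x]
  note wd = w_diff[OF w x]
  define \<rho> where "\<rho> = norm x"
  have \<rho>: "0 < \<rho>" "\<rho> \<le> 1" "\<rho> \<noteq> 0" "\<rho> < r" using xr by (auto simp: \<rho>_def)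
  define q where "q = (\<Sum>i\<in>UNIV. norm (fd w x (e i x)))"
  define m where "m = 1 - \<kappa> * norm x"
  define n where "n = real CARD('n)"
  have n1: "n \<ge> 1" unfolding n_def using zero_less_card_finite[where 'a='n] by linarith
  define N where "N = norm (w x)"
  define X where "X = fd w x x"
  define xn where "xn = norm X"
  have q0: "q \<ge> 0" unfolding q_def by (simp add: sum_nonneg)
  have gq: "norm (fd w x (e i x)) \<le> q" for i
    unfolding q_def by (rule member_le_sum) auto
  have fq: "norm (fd w x v) \<le> K0 * norm v * q" for v
    using fd_bound[OF wd xr(1)] by (simp add: q_def)
  note wW' = wW[OF x] and fW = fd_W[OF x]
  interpret fw: bounded_linear "fd w x" by (rule fd_bounded_linear[OF wd])
  have X: "X = (\<Sum>i\<in>UNIV. x $ i *\<^sub>R fd w x (e i x))"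
    unfolding X_def by (subst gauss1[OF xr(1), symmetric]) (simp add: fw.sum fw.scaleR)
  define f where "f = (\<Sum>i\<in>UNIV. A i (fd w x (e i x))) + (\<tau> * m / (norm x)^2) *\<^sub>R (\<Sum>i\<in>UNIV. x $ i *\<^sub>R A i (w x))"
  define T where "T = (\<Sum>i\<in>UNIV. \<Sum>j\<in>UNIV. x $ j * \<beta> j i X (fd w x (e i x)))"
  define B where "B = (\<Sum>i\<in>UNIV. \<Sum>j\<in>UNIV. \<beta> j i (fd w x (e j x)) (fd w x (e i x)))"
  define Q where "Q = (\<Sum>i\<in>UNIV. (norm (fd w x (e i x)))^2)"
  note dl = dirac_lower[OF wW' fW xr(2) X f_def]
  have "\<kappa> * norm x \<le> \<kappa> * r" using xr c_nonneg by (intro mult_left_mono) auto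
  then have m: "0 \<le> m" "m \<le> 1" using small c_nonneg \<rho> unfolding m_def by (auto simp: algebra_simps)
  have H1: "xn^2 + 2 * T + 2 * \<tau> * m * (X \<bullet> w x) \<le> \<rho>^2 * (norm f)^2"
    using dl(1) by (simp add: xn_def T_def \<rho>_def mult.assoc)
  have H2: "Q + B \<le> 2 * (norm f)^2 + 2 * \<tau>^2 * N^2 / \<rho>^2"
  proof -
    have "Q + B \<le> 2 * (norm f)^2 + 2 * (\<tau> * m)^2 * N^2 / \<rho>^2"
      using dl(2) by (simp add: Q_def B_def \<rho>_def N_def)
    moreover have "(\<tau> * m)^2 \<le> \<tau>^2" using m \<tau> by (intro power_mono) (auto simp: mult_left_le)
    then have "2 * (\<tau> * m)^2 * N^2 / \<rho>^2 \<le> 2 * \<tau>^2 * N^2 / \<rho>^2"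
      by (intro divide_right_mono mult_right_mono) auto
    ultimately show ?thesis by linarith
  qed
  have qQ: "q^2 \<le> n * Q"
    unfolding q_def Q_def n_def using sum_squared_le_sum_of_squares[of "\<lambda>i. norm (fd w x (e i x))" "UNIV::'n set"]
    by (simp add: mult.commute)
  have dve: "\<bar>dvg (e i) x\<bar> \<le> n * K0" for i
    unfolding n_def by (rule dvg_bound) (rule e_deriv[OF xr(1)])
  have xj: "\<bar>x $ j\<bar> \<le> \<rho>" for j unfolding \<rho>_def by (rule component_le_norm_cart)
  have N0: "N \<ge> 0" "xn \<ge> 0" by (simp_all add: N_def xn_def)
  have K00: "K0 \<ge> 0" using K0 by simp
  define r2 where "r2 = (\<Sum>i\<in>UNIV. \<Sum>j\<in>UNIV. x $ j * \<beta> j i (w x) (fd w x (fd (e i) x x)) - e i x $ j * \<beta> j i (w x) X)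
       - (\<Sum>i\<in>UNIV. s w i x * dvg (e i) x)"
  have dF2: "dvg (F2 w) x = p x * (2 * T + r2)"
    using dvg_F2_raw[OF w x fW wW'] by (simp add: T_def r2_def X_def)
  have R2: "\<bar>r2\<bar> \<le> c2 * (\<rho>^2 * (N * q) + \<rho> * (N * xn))"
  proof -
    have 1: "\<bar>\<Sum>i\<in>UNIV. \<Sum>j\<in>UNIV. x $ j * \<beta> j i (w x) (fd w x (fd (e i) x x))\<bar> \<le> n^2 * (\<rho> * (2 * (N * (K0 * (K0 * \<rho>) * q))))"
      unfolding n_def
    proof (rule abs_double_sum_le)
      fix i j
      have "\<bar>\<beta> j i (w x) (fd w x (fd (e i) x x))\<bar> \<le> 2 * (N * norm (fd w x (fd (e i) x x)))"
        unfolding N_def by (rule \<beta>_bound[OF wW' fW])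
      also have "\<dots> \<le> 2 * (N * (K0 * (K0 * \<rho>) * q))"
        using fq[of "fd (e i) x x"] e_deriv[OF xr(1), of i x] N0 q0 K00
        by (intro mult_left_mono order_trans[OF fq] mult_right_mono) (auto simp: \<rho>_def)
      finally show "\<bar>x $ j * \<beta> j i (w x) (fd w x (fd (e i) x x))\<bar> \<le> \<rho> * (2 * (N * (K0 * (K0 * \<rho>) * q)))"
        unfolding abs_mult using xj[of j] \<rho> by (intro mult_mono) auto
    qed
    have 2: "\<bar>\<Sum>i\<in>UNIV. \<Sum>j\<in>UNIV. e i x $ j * \<beta> j i (w x) X\<bar> \<le> n^2 * (K0 * \<rho> * (2 * (N * xn)))"
      unfolding n_def
    proof (rule abs_double_sum_le)
      fix i j
      \<comment> \<open>The diagonal of \<open>\<beta>\<close> vanishes, so only the deviation of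
        the frame from the coordinate frame counts; this gains the factor
        \<open>\<rho>\<close>.\<close>
      have "e i x $ j * \<beta> j i (w x) X = (e i x - axis i 1) $ j * \<beta> j i (w x) X"
        using \<beta>_diag[OF wW' fW, of i x] by (auto simp: axis_def X_def algebra_simps)
      moreover have "\<bar>(e i x - axis i 1) $ j\<bar> \<le> K0 * \<rho>"
        using component_le_norm_cart[of "e i x - axis i 1" j] e_flat[OF xr(1), of i] by (simp add: \<rho>_def)
      moreover have "\<bar>\<beta> j i (w x) X\<bar> \<le> 2 * (N * xn)"
        unfolding N_def xn_def X_def by (rule \<beta>_bound[OF wW' fW])
      ultimately show "\<bar>e i x $ j * \<beta> j i (w x) X\<bar> \<le> K0 * \<rho> * (2 * (N * xn))"
        unfolding abs_mult using K00 \<rho> by (auto intro: mult_mono)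
    qed
    have 3: "\<bar>\<Sum>i\<in>UNIV. s w i x * dvg (e i) x\<bar> \<le> n * (n * (\<rho> * (2 * (N * xn))) * (n * K0))"
    proof -
      have "\<bar>s w i x * dvg (e i) x\<bar> \<le> n * (\<rho> * (2 * (N * xn))) * (n * K0)" for i
      proof -
        have "\<bar>s w i x\<bar> \<le> (\<Sum>j\<in>(UNIV::'n set). \<rho> * (2 * (N * xn)))"
          unfolding s_def
        proof (rule order_trans[OF sum_abs], rule sum_mono)
          fix j
          have "\<bar>\<beta> j i (w x) (fd w x x)\<bar> \<le> 2 * (N * xn)"
            unfolding N_def xn_def X_def by (rule \<beta>_bound[OF wW' fW])
          then show "\<bar>x $ j * \<beta> j i (w x) (fd w x x)\<bar> \<le> \<rho> * (2 * (N * xn))"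
            unfolding abs_mult using xj[of j] \<rho> by (intro mult_mono) auto
        qed
        then have "\<bar>s w i x\<bar> \<le> n * (\<rho> * (2 * (N * xn)))" by (simp add: n_def)
        then show ?thesis unfolding abs_mult using dve[of i] n1 \<rho> N0
          by (intro mult_mono) auto
      qed
      then have "\<bar>\<Sum>i\<in>UNIV. s w i x * dvg (e i) x\<bar> \<le> (\<Sum>i\<in>(UNIV::'n set). n * (\<rho> * (2 * (N * xn))) * (n * K0))"
        by (intro order_trans[OF sum_abs] sum_mono)
      then show ?thesis by (simp add: n_def)
    qed
    have "\<bar>r2\<bar> \<le> n^2 * (\<rho> * (2 * (N * (K0 * (K0 * \<rho>) * q)))) + n^2 * (K0 * \<rho> * (2 * (N * xn)))
       + n * (n * (\<rho> * (2 * (N * xn))) * (n * K0))"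
      using 1 2 3 unfolding r2_def sum_subtractf by linarith
    also have "\<dots> = 2*n^2*K0^2 * (\<rho>^2 * (N * q)) + (2*n^2*K0 + 2*n^3*K0) * (\<rho> * (N * xn))"
      by (simp add: algebra_simps power2_eq_square power3_eq_cube)
    also have "\<dots> \<le> c2 * (\<rho>^2 * (N * q)) + c2 * (\<rho> * (N * xn))"
      unfolding c2_def n_def[symmetric] using n1 K00 N0 q0 \<rho>
      by (intro add_mono mult_right_mono) auto
    finally show ?thesis by (simp add: algebra_simps)
  qed
  define r3 where "r3 = (\<Sum>i\<in>UNIV. \<Sum>j\<in>UNIV. (3 - real CARD('n)) / (norm x)^2 * (x $ j * \<beta> j i (w x) (fd w x (e i x)))
        + \<beta> j i (w x) (fd w x (fd (e i) x (e j x))) + \<beta> j i (w x) (fd w x (e i x)) * dvg (e j) x)"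
  have dF3: "dvg (F3 w) x = p x * \<rho> ^ 3 * (B + r3)"
    using dvg_F3_raw[OF w x fW wW' hess_W] by (simp add: B_def r3_def \<rho>_def)
  have R3: "\<bar>r3\<bar> \<le> c3 * (N * q) / \<rho>"
  proof -
    have "\<bar>r3\<bar> \<le> n^2 * (2 * (n + 3) * (N * q) / \<rho> + 2 * (K0 * (K0 * (1 + K0))) * (N * q) / \<rho> + 2 * (n * K0) * (N * q) / \<rho>)"
      unfolding r3_def n_def
    proof (rule abs_double_sum_le)
      fix i j
      have b: "\<bar>\<beta> j i (w x) (fd w x (e i x))\<bar> \<le> 2 * (N * q)"
        using \<beta>_bound[OF wW' fW, of j i "e i x"] mult_left_mono[OF gq[of i] N0(1)] by (simp add: N_def)
      have bj: "\<bar>x $ j * \<beta> j i (w x) (fd w x (e i x))\<bar> \<le> \<rho> * (2 * (N * q))"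
        unfolding abs_mult using xj[of j] \<rho> b by (intro mult_mono) auto
      have "\<bar>(3 - n) / \<rho>^2 * (x $ j * \<beta> j i (w x) (fd w x (e i x)))\<bar> \<le> (n + 3) / \<rho>^2 * (\<rho> * (2 * (N * q)))"
        unfolding abs_mult[of "(3 - n) / \<rho>^2"] using bj n1 by (intro mult_mono) (auto simp: divide_right_mono)
      also have "\<dots> = 2 * (n + 3) * (N * q) / \<rho>" using \<rho> by (simp add: power2_eq_square)
      finally have 1: "\<bar>(3 - n) / \<rho>^2 * (x $ j * \<beta> j i (w x) (fd w x (e i x)))\<bar> \<le> 2 * (n + 3) * (N * q) / \<rho>" .
      have le: "c * (N * q) \<le> c * (N * q) / \<rho>" if "c \<ge> 0" for c
        using that N0 q0 \<rho> by (auto simp: le_divide_eq mult_left_le)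
      have "\<bar>\<beta> j i (w x) (fd w x (fd (e i) x (e j x)))\<bar> \<le> 2 * (N * norm (fd w x (fd (e i) x (e j x))))"
        unfolding N_def by (rule \<beta>_bound[OF wW' fW])
      moreover have "norm (fd w x (fd (e i) x (e j x))) \<le> K0 * (K0 * (1 + K0)) * q"
        using norm_e[OF xr(1), of j] e_deriv[OF xr(1), of i "e j x"] K00 q0
        by (intro order_trans[OF fq] mult_right_mono mult_left_mono) (auto intro: order_trans mult_left_mono)
      ultimately have "\<bar>\<beta> j i (w x) (fd w x (fd (e i) x (e j x)))\<bar> \<le> 2 * (N * (K0 * (K0 * (1 + K0)) * q))"
        by (meson N0(1) mult_left_mono order_trans zero_le_numeral)
      also have "\<dots> = 2 * (K0 * (K0 * (1 + K0))) * (N * q)" by simp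
      also have "\<dots> \<le> 2 * (K0 * (K0 * (1 + K0))) * (N * q) / \<rho>" using K00 by (intro le) auto
      finally have 2: "\<bar>\<beta> j i (w x) (fd w x (fd (e i) x (e j x)))\<bar> \<le> 2 * (K0 * (K0 * (1 + K0))) * (N * q) / \<rho>" .
      have "\<bar>\<beta> j i (w x) (fd w x (e i x)) * dvg (e j) x\<bar> \<le> 2 * (N * q) * (n * K0)"
        unfolding abs_mult using b dve[of j] by (intro mult_mono) auto
      also have "\<dots> = 2 * (n * K0) * (N * q)" by simp
      also have "\<dots> \<le> 2 * (n * K0) * (N * q) / \<rho>" using K00 n1 by (intro le) auto
      finally have 3: "\<bar>\<beta> j i (w x) (fd w x (e i x)) * dvg (e j) x\<bar> \<le> 2 * (n * K0) * (N * q) / \<rho>" .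
      show "\<bar>(3 - real CARD('n)) / (norm x)^2 * (x $ j * \<beta> j i (w x) (fd w x (e i x)))
        + \<beta> j i (w x) (fd w x (fd (e i) x (e j x))) + \<beta> j i (w x) (fd w x (e i x)) * dvg (e j) x\<bar>
        \<le> 2 * (real CARD('n) + 3) * (N * q) / \<rho> + 2 * (K0 * (K0 * (1 + K0))) * (N * q) / \<rho> + 2 * (real CARD('n) * K0) * (N * q) / \<rho>"
        using 1 2 3 unfolding n_def[symmetric] \<rho>_def[symmetric] by linarith
    qed
    also have "\<dots> = c3 * (N * q) / \<rho>"
      unfolding c3_def n_def[symmetric] using \<rho>
      by (simp add: field_simps power2_eq_square power3_eq_cube)
    finally show ?thesis .
  qed
  have alg: "\<tau> * \<rho> * N^2 + (2 * \<tau> * m * (X \<bullet> w x) - \<tau> * \<kappa> * \<rho> * N^2) + (2 * T + r2)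
     + \<rho>^3 * (B + r3) / \<tau> \<le> 3 * (\<rho>^2 * (norm f)^2)"
    using carleman_algebra[OF \<rho>(1,2) \<tau> n1 c_nonneg(1,2) N0(1) q0 N0(2) _ qQ H1 H2 R2 R3]
    by (simp add: \<kappa>_def n_def)
  have "p x * (\<tau> * norm x * (norm (w x))^2) + (dvg (F1 \<tau> w) x + dvg (F2 w) x + (1 / \<tau>) * dvg (F3 w) x)
    = p x * (\<tau> * \<rho> * N^2 + (2 * \<tau> * m * (X \<bullet> w x) - \<tau> * \<kappa> * \<rho> * N^2) + (2 * T + r2) + \<rho>^3 * (B + r3) / \<tau>)"
    unfolding dF2 dF3 dvg_F1[OF w x] by (simp add: \<rho>_def N_def m_def X_def algebra_simps add_divide_distrib)
  also have "\<dots> \<le> p x * (3 * (\<rho>^2 * (norm f)^2))"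
    using alg p_pos[OF x] by (intro mult_left_mono) auto
  finally show ?thesis by (simp add: f_def \<rho>_def m_def)
qed

end

end

section \<open>The integrated Carleman estimate\<close>

context carleman begin

lemma P_cong_zero:
  assumes "x \<in> \<Omega> - K" "compact K" "\<And>y. y \<in> \<Omega> - K \<Longrightarrow> u y = 0"
  shows "P u x = 0"
proof -
  have "fd u x = fd (\<lambda>_. 0) x"
    by (rule fd_cong[where S="\<Omega> - K"]) (use assms open_\<Omega> in \<open>auto intro: open_Diff compact_imp_closed\<close>)
  then show ?thesis by (simp add: P_def linear_0[OF A_linear])
qed

lemma C_on_P:
  assumes "C_on 2 \<Omega> u" shows "C_on 1 \<Omega> (P u)"
proof -
  have u: "C_on (Suc 1) \<Omega> u" using assms by (simp only: Suc_1)
  show ?thesis unfolding P_def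
    by (intro C_on_sum C_on_linear_compose[OF A_bounded_linear] C_on_fd_apply[OF u] e_C1' open_\<Omega>)
qed

text \<open>For \<open>w\<close> equal to \<open>\<psi>\<close> times \<open>u\<close>, the
  derivative of the weight adds a radial symbol to the operator, so
  \<open>pointwise_carleman\<close> applies. The support of \<open>w\<close> is compact in the
  punctured ball, and the three divergences integrate to zero.\<close>

lemma carleman_estimate:
  assumes u: "C_on 2 \<Omega> u" and uW: "\<And>y. y \<in> \<Omega> \<Longrightarrow> u y \<in> W"
    and K: "compact K" "K \<subseteq> \<Omega>" and z: "\<And>y. y \<in> \<Omega> - K \<Longrightarrow> u y = 0" and \<tau>: "\<tau> \<ge> 1"
  shows "\<tau> * (LINT x:\<Omega>|lborel. p x * norm x * (\<psi> \<tau> x)^2 * (norm (u x))^2)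
    \<le> 3 * (LINT x:\<Omega>|lborel. p x * (norm x)^2 * (\<psi> \<tau> x)^2 * (norm (P u x))^2)"
proof -
  define w where "w x = \<psi> \<tau> x *\<^sub>R u x" for x
  have w: "C_on 2 \<Omega> w" unfolding w_def by (intro C_on_scaleR C_on_\<psi> u open_\<Omega>)
  have wW: "w y \<in> W" if "y \<in> \<Omega>" for y unfolding w_def using uW[OF that] W by (intro subspace_scale)
  have wz: "w y = 0" if "y \<in> \<Omega> - K" for y unfolding w_def using z[OF that] by simp
  have fw: "fd w x v = \<psi> \<tau> x *\<^sub>R fd u x v - (\<tau> * (1 - \<kappa> * norm x) / (norm x)^2 * (x \<bullet> v)) *\<^sub>R w x"
    if x: "x \<in> \<Omega>" for x v
  proof -
    have "u differentiable (at x)" using C_on_mono[OF u, of 1] x by simp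
    note fd_eq[OF has_derivative_scaleR[OF \<psi>_deriv[OF x, of \<tau>] fd_works[OF this]], THEN fun_cong, of v]
    then have "fd w x v = \<psi> \<tau> x *\<^sub>R fd u x v + (- \<tau> * (1 - \<kappa> * norm x) / (norm x)^2 * (x \<bullet> v) * \<psi> \<tau> x) *\<^sub>R u x"
      unfolding w_def[abs_def] .
    then show ?thesis by (simp add: w_def)
  qed
  \<comment> \<open>By \<open>gauss2\<close> the frame derivatives of the weight are those of
    Euclidean space, so the conjugation adds exactly the radial symbol.\<close>
  have f: "(\<Sum>i\<in>UNIV. A i (fd w x (e i x)))
          + (\<tau> * (1 - \<kappa> * norm x) / (norm x)^2) *\<^sub>R (\<Sum>i\<in>UNIV. x $ i *\<^sub>R A i (w x)) = \<psi> \<tau> x *\<^sub>R P u x"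
    if x: "x \<in> \<Omega>" for x
    using \<Omega>D[OF x] unfolding fw[OF x] P_def
    by (simp add: gauss2 linear_diff[OF A_linear] linear_cmul[OF A_linear] sum_subtractf scaleR_sum_right)
  define D where "D x = dvg (F1 \<tau> w) x + dvg (F2 w) x + (1 / \<tau>) * dvg (F3 w) x" for x
  define L where "L x = p x * norm x * (\<psi> \<tau> x)^2 * (norm (u x))^2" for x
  define R where "R x = p x * (norm x)^2 * (\<psi> \<tau> x)^2 * (norm (P u x))^2" for x
  have pw: "\<tau> * L x + D x \<le> 3 * R x" if x: "x \<in> \<Omega>" for x
  proof -
    have "norm (w x) = \<psi> \<tau> x * norm (u x)" using \<psi>_pos[of \<tau> x] by (simp add: w_def)
    then show ?thesis
      using pointwise_carleman[OF w x wW \<tau>] unfolding f[OF x] D_def L_def R_def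
      by (simp add: power_mult_distrib mult_ac)
  qed
  have F: "set_integrable lborel \<Omega> (dvg F)" "(LINT x:\<Omega>|lborel. dvg F x) = 0"
    if "F \<in> {F1 \<tau> w, F2 w, F3 w}" for F
  proof -
    have "C_on 1 \<Omega> F" using that C_on_fields[OF w] by auto
    moreover have "F x = 0" if "x \<in> \<Omega> - K" for x
    proof -
      have \<beta>0: "\<beta> j i 0 y = 0" for j i y by (rule bounded_bilinear.zero_left[OF \<beta>_bilinear])
      show ?thesis using \<open>F \<in> _\<close> wz[OF that] by (auto simp: F1_def F2_def F3_def a_def s_def \<beta>0)
    qed
    ultimately show "set_integrable lborel \<Omega> (dvg F)" "(LINT x:\<Omega>|lborel. dvg F x) = 0"
      using integral_dvg_zero[OF open_\<Omega> K] by blast+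
  qed
  have Dint: "set_integrable lborel \<Omega> D"
    unfolding D_def using F(1) by (intro set_integral_add set_integrable_mult_right) auto
  have D0: "(LINT x:\<Omega>|lborel. D x) = 0"
    unfolding D_def using F
    by (simp add: set_integral_add set_integrable_mult_right)
  have "continuous_on \<Omega> (P u)" using C_on_P[OF u] C_on_continuous by blast
  moreover have "continuous_on \<Omega> u" using u C_on_continuous by blast
  moreover have "continuous_on \<Omega> p" "continuous_on \<Omega> (\<psi> \<tau>)"
    using C_on_p C_on_\<psi> C_on_continuous by blast+
  ultimately have "continuous_on \<Omega> L" "continuous_on \<Omega> R"
    unfolding L_def R_def by (auto intro!: continuous_intros)
  moreover have "L x = 0" "R x = 0" if "x \<in> \<Omega> - K" for x
    using z[OF that] P_cong_zero[OF that K(1) z] by (auto simp: L_def R_def)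
  ultimately have LR: "set_integrable lborel \<Omega> L" "set_integrable lborel \<Omega> R"
    using integrable_compact_support[OF open_\<Omega> K] by blast+
  have "(LINT x:\<Omega>|lborel. \<tau> * L x + D x) \<le> (LINT x:\<Omega>|lborel. 3 * R x)"
    by (rule set_integral_mono) (use pw LR Dint in \<open>auto intro: set_integral_add set_integrable_mult_right\<close>)
  then have "\<tau> * (LINT x:\<Omega>|lborel. L x) \<le> 3 * (LINT x:\<Omega>|lborel. R x)"
    using LR Dint D0 by (simp add: set_integral_add set_integrable_mult_right)
  then show ?thesis unfolding L_def R_def .
qed

end

section \<open>Transport along rays and localization\<close>

context radial_weight begin

lemma weight_bounds:
  assumes "x \<in> ball 0 r" shows "1/2 \<le> 1 - \<kappa> * norm x" "1 - \<kappa> * norm x \<le> 1"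
proof -
  have "\<kappa> * norm x \<le> \<kappa> * r" using assms c_nonneg by (intro mult_left_mono) auto
  then show "1/2 \<le> 1 - \<kappa> * norm x" "1 - \<kappa> * norm x \<le> 1" using small c_nonneg by (auto simp: algebra_simps)
qed

text \<open>The divergence of \<open>F\<close> differentiates the weighted square of
  \<open>v\<close> radially. The weight contributes \<open>-2\<tau>(1 - \<kappa>|x|)\<close> with
  the bracket at least 1/2, and \<open>d * v x\<close> has a favourable sign; completing a square
  with the source leaves the multiple \<open>\<tau>^2\<close> of the weighted square.\<close>

lemma transport_estimate:
  fixes v :: "real^'n \<Rightarrow> real"
  assumes v: "C_on 1 \<Omega> v" and K: "compact K" "K \<subseteq> \<Omega>" and z: "\<And>y. y \<in> \<Omega> - K \<Longrightarrow> v y = 0"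
    and \<tau>: "\<tau> \<ge> 1" and d: "d \<ge> 0"
  shows "\<tau>^2 * (LINT x:\<Omega>|lborel. p x * (\<psi> \<tau> x)^2 * (v x)^2)
    \<le> 4 * (LINT x:\<Omega>|lborel. p x * (\<psi> \<tau> x)^2 * (fd v x x + d * v x)^2)"
proof -
  define L where "L x = p x * (\<psi> \<tau> x)^2 * (v x)^2" for x
  define R where "R x = p x * (\<psi> \<tau> x)^2 * (fd v x x + d * v x)^2" for x
  define F where "F x = (p x * ((\<psi> \<tau> x)^2 * (v x)^2)) *\<^sub>R x" for x
  have v1: "C_on (Suc 0) \<Omega> v" using v by simp
  have F1: "C_on 1 \<Omega> F" unfolding F_def
    by (intro C_on_scaleR C_on_mult C_on_p C_on_power C_on_\<psi> v open_\<Omega> C_on_linear bounded_linear_ident)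
  have Fz: "F x = 0" if "x \<in> \<Omega> - K" for x using z[OF that] by (simp add: F_def)
  note Fi = integral_dvg_zero[OF open_\<Omega> K F1 Fz]
  have pw: "\<tau>^2 * L x + (2 * \<tau>) * dvg F x \<le> 4 * R x" if x: "x \<in> \<Omega>" for x
  proof -
    have xr: "x \<in> ball 0 r" "norm x > 0" using \<Omega>D[OF x] by auto
    define m where "m = 1 - \<kappa> * norm x"
    have m: "1/2 \<le> m" unfolding m_def by (rule weight_bounds[OF xr(1)])
    define S where "S = (\<psi> \<tau> x)^2"
    have S: "S > 0" unfolding S_def using \<psi>_pos[of \<tau> x] by simp
    have vd: "(v has_derivative fd v x) (at x)" by (rule C_on_has_derivative[OF v1 x])
    have h: "((\<lambda>y. (\<psi> \<tau> y)^2 * (v y)^2) has_derivative (\<lambda>u. (\<psi> \<tau> x)^2 * (2 * fd v x u * v x)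
       + (2 * (- \<tau> * (1 - \<kappa> * norm x) / (norm x)^2 * (x \<bullet> u) * \<psi> \<tau> x) * \<psi> \<tau> x) * (v x)^2)) (at x)"
      using has_derivative_mult[OF has_derivative_power[OF \<psi>_deriv[OF x], of \<tau> 2] has_derivative_power[OF vd, of 2]]
      by simp
    have "dvg F x = p x * fd (\<lambda>y. (\<psi> \<tau> y)^2 * (v y)^2) x x"
      unfolding F_def by (rule dvg_radial[OF x differentiableI[OF h]])
    also have "\<dots> = p x * S * (2 * fd v x x * v x - 2 * \<tau> * m * (v x)^2)"
    proof -
      have "- \<tau> * (1 - \<kappa> * norm x) / (norm x)^2 * (x \<bullet> x) * \<psi> \<tau> x = - \<tau> * m * \<psi> \<tau> x"
        using xr(2) by (simp add: m_def power2_norm_eq_inner[symmetric])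
      then show ?thesis unfolding fd_eq[OF h] by (simp add: S_def power2_eq_square algebra_simps)
    qed
    finally have D: "dvg F x = p x * S * (2 * fd v x x * v x - 2 * \<tau> * m * (v x)^2)" .
    have "\<tau>^2 * (v x)^2 + (2 * \<tau>) * (2 * fd v x x * v x - 2 * \<tau> * m * (v x)^2) \<le> 4 * (fd v x x + d * v x)^2"
    proof -
      define h where "h = fd v x x + d * v x"
      have "0 \<le> (2 * h - \<tau> * v x)^2" by simp
      then have 1: "4 * \<tau> * (h * v x) \<le> 4 * h^2 + \<tau>^2 * (v x)^2"
        by (simp add: power2_eq_square algebra_simps)
      have 2: "2 * \<tau>^2 * (v x)^2 \<le> 4 * m * \<tau>^2 * (v x)^2"
        using m by (intro mult_right_mono) auto
      have 3: "0 \<le> 4 * \<tau> * d * (v x)^2" using \<tau> d by auto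
      have "\<tau>^2 * (v x)^2 + (2 * \<tau>) * (2 * fd v x x * v x - 2 * \<tau> * m * (v x)^2)
        = \<tau>^2 * (v x)^2 + 4 * \<tau> * (h * v x) - 4 * \<tau> * d * (v x)^2 - 4 * m * \<tau>^2 * (v x)^2"
        by (simp add: h_def algebra_simps power2_eq_square)
      then show ?thesis using 1 2 3 unfolding h_def by linarith
    qed
    then have "p x * S * (\<tau>^2 * (v x)^2 + (2 * \<tau>) * (2 * fd v x x * v x - 2 * \<tau> * m * (v x)^2))
       \<le> p x * S * (4 * (fd v x x + d * v x)^2)"
      using p_pos[OF x] S by (intro mult_left_mono) auto
    then show ?thesis unfolding L_def R_def D S_def[symmetric] by (simp add: algebra_simps)
  qed
  have "continuous_on \<Omega> (\<lambda>x. fd v x x)"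
    using C_on_fd_apply[OF v1 open_\<Omega>, of "\<lambda>x. x"] by (simp add: continuous_on_id)
  moreover have "continuous_on \<Omega> v" using v C_on_continuous by blast
  moreover have "continuous_on \<Omega> p" "continuous_on \<Omega> (\<psi> \<tau>)"
    using C_on_p C_on_\<psi> C_on_continuous by blast+
  ultimately have "continuous_on \<Omega> L" "continuous_on \<Omega> R"
    unfolding L_def R_def by (auto intro!: continuous_intros)
  moreover have "L x = 0" "R x = 0" if x: "x \<in> \<Omega> - K" for x
  proof -
    have "fd v x = fd (\<lambda>_. 0) x"
      by (rule fd_cong[where S="\<Omega> - K"]) (use x z K open_\<Omega> in \<open>auto intro: open_Diff compact_imp_closed\<close>)
    then show "L x = 0" "R x = 0" using z[OF x] by (simp_all add: L_def R_def)
  qed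
  ultimately have LR: "set_integrable lborel \<Omega> L" "set_integrable lborel \<Omega> R"
    using integrable_compact_support[OF open_\<Omega> K] by blast+
  have "(LINT x:\<Omega>|lborel. \<tau>\<^sup>2 * L x + (2 * \<tau>) * dvg F x) \<le> (LINT x:\<Omega>|lborel. 4 * R x)"
    by (rule set_integral_mono) (use pw LR Fi in \<open>auto intro: set_integral_add set_integrable_mult_right\<close>)
  then have "\<tau>^2 * (LINT x:\<Omega>|lborel. L x) \<le> 4 * (LINT x:\<Omega>|lborel. R x)"
    using LR Fi by (simp add: set_integral_add set_integrable_mult_right)
  then show ?thesis unfolding L_def R_def .
qed

text \<open>Radial cutoff functions: \<open>\<gamma> x\<close> is the factor in \<open>d\<zeta> = \<gamma> x \<cdot> dx\<close>.\<close>

definition cutoff :: "(real^'n \<Rightarrow> real) \<Rightarrow> (real^'n \<Rightarrow> real) \<Rightarrow> bool" where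
  "cutoff \<zeta> \<gamma> \<longleftrightarrow> C_on 2 \<Omega> \<zeta> \<and> continuous_on \<Omega> \<gamma> \<and>
     (\<forall>x\<in>\<Omega>. (\<zeta> has_derivative (\<lambda>v. \<gamma> x * (x \<bullet> v))) (at x)) \<and>
     (\<exists>K. compact K \<and> K \<subseteq> \<Omega> \<and> (\<forall>x\<in>\<Omega>-K. \<zeta> x = 0 \<and> \<gamma> x = 0))"

text \<open>The common weight of both estimates. The elliptic one has the power \<open>|x|\<close>
  on its left and \<open>|x|^2\<close> on its right; the transport one has no power, but a source of
  size \<open>|x|\<close>. As \<open>|x| < 1\<close>, both reduce to \<open>|x|^2\<close>.\<close>

definition I :: "real \<Rightarrow> (real^'n \<Rightarrow> real) \<Rightarrow> real" where
  "I \<tau> f = (LINT x:\<Omega>|lborel. p x * (norm x)^2 * (\<psi> \<tau> x)^2 * f x)"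

lemma I_integrable:
  assumes "cutoff \<zeta> \<gamma>" "continuous_on \<Omega> f" "\<And>x. x \<in> \<Omega> \<Longrightarrow> \<zeta> x = 0 \<Longrightarrow> \<gamma> x = 0 \<Longrightarrow> f x = 0"
  shows "set_integrable lborel \<Omega> (\<lambda>x. p x * norm x ^ j * (\<psi> \<tau> x)^2 * f x)"
proof -
  obtain K where K: "compact K" "K \<subseteq> \<Omega>" "\<And>x. x \<in> \<Omega>-K \<Longrightarrow> \<zeta> x = 0 \<and> \<gamma> x = 0"
    using assms(1) unfolding cutoff_def by blast
  have "continuous_on \<Omega> p" "continuous_on \<Omega> (\<psi> \<tau>)"
    using C_on_p C_on_\<psi> C_on_continuous by blast+
  then have "continuous_on \<Omega> (\<lambda>x. p x * norm x ^ j * (\<psi> \<tau> x)^2 * f x)"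
    by (intro continuous_intros assms(2))
  then show ?thesis
    by (rule integrable_compact_support[OF open_\<Omega> K(1,2)]) (use K(3) assms(3) in auto)
qed

text \<open>Up to sign, \<open>\<gamma> x * norm x\<close> is the length of the gradient of
  \<open>\<zeta>\<close>; so this dominates the square of the cutoff together with that of the
  commutator it causes.\<close>

abbreviation cut2 :: "(real^'n \<Rightarrow> real) \<Rightarrow> (real^'n \<Rightarrow> real) \<Rightarrow> real^'n \<Rightarrow> real" where
  "cut2 \<zeta> \<gamma> x \<equiv> (\<zeta> x)^2 + (\<gamma> x)^2 * (norm x)^2"

lemma cutoff_continuous: "cutoff \<zeta> \<gamma> \<Longrightarrow> continuous_on \<Omega> \<zeta>" "cutoff \<zeta> \<gamma> \<Longrightarrow> continuous_on \<Omega> \<gamma>"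
  unfolding cutoff_def using C_on_continuous by blast+

lemma cutoff_lower:
  assumes cut: "cutoff \<zeta> \<gamma>" and n: "continuous_on \<Omega> n" and j: "j \<le> 2"
  shows "I \<tau> (\<lambda>x. (\<zeta> x)^2 * (n x)^2) \<le> (LINT x:\<Omega>|lborel. p x * norm x ^ j * (\<psi> \<tau> x)^2 * (\<zeta> x * n x)^2)"
  unfolding I_def
proof (rule set_integral_mono[OF I_integrable[OF cut] I_integrable[OF cut]])
  fix x assume x: "x \<in> \<Omega>"
  have "(norm x)^2 * (p x * (\<psi> \<tau> x)^2 * (\<zeta> x * n x)^2) \<le> norm x ^ j * (p x * (\<psi> \<tau> x)^2 * (\<zeta> x * n x)^2)"
    using \<Omega>D[OF x] p_pos[OF x] j by (intro mult_right_mono power_decreasing) auto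
  then show "p x * (norm x)^2 * (\<psi> \<tau> x)^2 * ((\<zeta> x)^2 * (n x)^2) \<le> p x * norm x ^ j * (\<psi> \<tau> x)^2 * (\<zeta> x * n x)^2"
    by (simp add: power_mult_distrib mult_ac)
qed (auto intro!: continuous_intros cutoff_continuous[OF cut] n)

lemma cutoff_upper:
  assumes cut: "cutoff \<zeta> \<gamma>" and c: "continuous_on \<Omega> R" "continuous_on \<Omega> Z"
    and le: "\<And>x. x \<in> \<Omega> \<Longrightarrow> 0 \<le> R x" "\<And>x. x \<in> \<Omega> \<Longrightarrow> norm x ^ j * R x \<le> M * ((norm x)^2 * (cut2 \<zeta> \<gamma> x * Z x))"
  shows "(LINT x:\<Omega>|lborel. p x * norm x ^ j * (\<psi> \<tau> x)^2 * R x) \<le> M * I \<tau> (\<lambda>x. cut2 \<zeta> \<gamma> x * Z x)"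
proof -
  have i: "set_integrable lborel \<Omega> (\<lambda>x. p x * norm x ^ j * (\<psi> \<tau> x)^2 * R x)"
  proof (rule I_integrable[OF cut c(1)])
    fix x assume x: "x \<in> \<Omega>" "\<zeta> x = 0" "\<gamma> x = 0"
    then have "norm x ^ j * R x \<le> 0" "norm x ^ j > 0" using le(2)[OF x(1)] \<Omega>D[OF x(1)] by auto
    then show "R x = 0" using le(1)[OF x(1)] by (simp add: mult_le_0_iff)
  qed
  have k: "set_integrable lborel \<Omega> (\<lambda>x. p x * (norm x)^2 * (\<psi> \<tau> x)^2 * (cut2 \<zeta> \<gamma> x * Z x))"
    by (rule I_integrable[OF cut]) (auto intro!: continuous_intros cutoff_continuous[OF cut] c)
  have "(LINT x:\<Omega>|lborel. p x * norm x ^ j * (\<psi> \<tau> x)^2 * R x)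
    \<le> (LINT x:\<Omega>|lborel. M * (p x * (norm x)^2 * (\<psi> \<tau> x)^2 * (cut2 \<zeta> \<gamma> x * Z x)))"
  proof (rule set_integral_mono[OF i set_integrable_mult_right[OF k]])
    fix x assume x: "x \<in> \<Omega>"
    have "p x * (\<psi> \<tau> x)^2 * (norm x ^ j * R x) \<le> p x * (\<psi> \<tau> x)^2 * (M * ((norm x)^2 * (cut2 \<zeta> \<gamma> x * Z x)))"
      using le(2)[OF x] p_pos[OF x] by (intro mult_left_mono) auto
    then show "p x * norm x ^ j * (\<psi> \<tau> x)^2 * R x \<le> M * (p x * (norm x)^2 * (\<psi> \<tau> x)^2 * (cut2 \<zeta> \<gamma> x * Z x))"
      by (simp only: mult_ac)
  qed
  then show ?thesis by (simp add: I_def)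
qed

text \<open>The estimate is applied to \<open>\<zeta>\<close> times \<open>v\<close>. The commutator
  is \<open>\<gamma>|x|^2 v\<close>, so it carries the same factor \<open>|x|\<close> as the source
  beside the length of the gradient.\<close>

lemma transport_cutoff:
  fixes v Z :: "real^'n \<Rightarrow> real"
  assumes v: "C_on 1 \<Omega> v" and cut: "cutoff \<zeta> \<gamma>" and \<tau>: "\<tau> \<ge> 1" and d: "d \<ge> 0"
    and Z: "continuous_on \<Omega> Z" "\<And>x. x \<in> \<Omega> \<Longrightarrow> (v x)^2 \<le> Z x" and C: "C \<ge> 0"
    and le: "\<And>x. x \<in> \<Omega> \<Longrightarrow> (fd v x x + d * v x)^2 \<le> C * (norm x)^2 * Z x"
  shows "\<tau> * I \<tau> (\<lambda>x. (\<zeta> x)^2 * (v x)^2) \<le> (8 * C + 8) * I \<tau> (\<lambda>x. cut2 \<zeta> \<gamma> x * Z x)"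
proof -
  obtain K where K: "compact K" "K \<subseteq> \<Omega>" "\<And>x. x \<in> \<Omega>-K \<Longrightarrow> \<zeta> x = 0 \<and> \<gamma> x = 0"
    using cut unfolding cutoff_def by blast
  have \<zeta>: "C_on 2 \<Omega> \<zeta>" "\<And>x. x \<in> \<Omega> \<Longrightarrow> (\<zeta> has_derivative (\<lambda>v. \<gamma> x * (x \<bullet> v))) (at x)"
    using cut unfolding cutoff_def by auto
  define w where "w x = \<zeta> x * v x" for x
  have "C_on 1 \<Omega> \<zeta>" by (rule C_on_mono[OF \<zeta>(1)]) simp
  then have w: "C_on 1 \<Omega> w" unfolding w_def by (intro C_on_mult v open_\<Omega>)
  have wz: "w y = 0" if "y \<in> \<Omega> - K" for y using K(3)[OF that] by (simp add: w_def)
  note cc = cutoff_continuous[OF cut]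
  have vc: "continuous_on \<Omega> v" using v C_on_continuous by blast
  have v1: "C_on (Suc 0) \<Omega> v" using v by simp
  have fdw: "fd w x x = \<zeta> x * fd v x x + \<gamma> x * (norm x)^2 * v x" if x: "x \<in> \<Omega>" for x
    using fd_eq[OF has_derivative_mult[OF \<zeta>(2)[OF x] C_on_has_derivative[OF v1 x]]]
    by (simp add: w_def[abs_def] power2_norm_eq_inner)
  have fdc: "continuous_on \<Omega> (\<lambda>x. fd w x x)"
  proof -
    have "C_on (Suc 0) \<Omega> w" using w by simp
    then show ?thesis
    using C_on_fd_apply[of 0 \<Omega> w "\<lambda>x. x"] by (simp add: continuous_on_id open_\<Omega>)
  qed
  have wc: "continuous_on \<Omega> w" using w C_on_continuous by blast
  define R where "R x = (fd w x x + d * w x)^2" for x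
  have Rc: "continuous_on \<Omega> R" unfolding R_def by (intro continuous_intros fdc wc)
  have Rle: "R x \<le> (2 * C + 2) * (norm x)^2 * (cut2 \<zeta> \<gamma> x * Z x)" if x: "x \<in> \<Omega>" for x
  proof -
    define h where "h = fd v x x + d * v x"
    have Z0: "Z x \<ge> 0" using Z(2)[OF x] zero_le_power2[of "v x"] by linarith
    have "R x = (\<zeta> x * h + \<gamma> x * (norm x)^2 * v x)^2"
      by (simp add: R_def fdw[OF x] h_def w_def algebra_simps)
    also have "\<dots> \<le> 2 * (\<zeta> x * h)^2 + 2 * (\<gamma> x * (norm x)^2 * v x)^2"
      using sum_squares_bound[of "\<zeta> x * h" "\<gamma> x * (norm x)^2 * v x"] by (simp add: power2_sum)
    also have "\<dots> = 2 * ((\<zeta> x)^2 * h^2) + 2 * ((\<gamma> x)^2 * (norm x)^2 * (norm x)^2 * (v x)^2)"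
      by (simp add: power_mult_distrib power2_eq_square)
    also have "\<dots> \<le> 2 * ((\<zeta> x)^2 * (C * (norm x)^2 * Z x)) + 2 * ((\<gamma> x)^2 * (norm x)^2 * (norm x)^2 * Z x)"
      using le[OF x] Z(2)[OF x] unfolding h_def by (intro add_mono mult_left_mono) auto
    also have "\<dots> = (norm x)^2 * (2 * C * ((\<zeta> x)^2 * Z x) + 2 * ((\<gamma> x)^2 * (norm x)^2 * Z x))"
      by (simp add: algebra_simps)
    also have "\<dots> \<le> (norm x)^2 * ((2 * C + 2) * ((\<zeta> x)^2 * Z x) + (2 * C + 2) * ((\<gamma> x)^2 * (norm x)^2 * Z x))"
      using Z0 C by (intro mult_left_mono add_mono mult_right_mono) auto
    finally show ?thesis by (simp add: algebra_simps)
  qed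
  have te: "\<tau>^2 * (LINT x:\<Omega>|lborel. p x * (\<psi> \<tau> x)^2 * (w x)^2) \<le> 4 * (LINT x:\<Omega>|lborel. p x * (\<psi> \<tau> x)^2 * R x)"
    unfolding R_def by (rule transport_estimate[OF w K(1,2) wz \<tau> d])
  have "\<tau> * I \<tau> (\<lambda>x. (\<zeta> x)^2 * (v x)^2) \<le> \<tau>^2 * I \<tau> (\<lambda>x. (\<zeta> x)^2 * (v x)^2)"
  proof (rule mult_right_mono)
    show "\<tau> \<le> \<tau>^2" using \<tau> by (simp add: power2_eq_square)
    show "0 \<le> I \<tau> (\<lambda>x. (\<zeta> x)^2 * (v x)^2)"
      unfolding I_def set_lebesgue_integral_def
      by (rule Bochner_Integration.integral_nonneg) (auto simp: indicator_def intro!: mult_nonneg_nonneg less_imp_le[OF p_pos])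
  qed
  also have "\<dots> \<le> \<tau>^2 * (LINT x:\<Omega>|lborel. p x * (\<psi> \<tau> x)^2 * (w x)^2)"
    using cutoff_lower[OF cut vc, of 0 \<tau>] by (intro mult_left_mono) (auto simp: w_def)
  also note te
  also have "4 * (LINT x:\<Omega>|lborel. p x * (\<psi> \<tau> x)^2 * R x) \<le> 4 * ((2 * C + 2) * I \<tau> (\<lambda>x. cut2 \<zeta> \<gamma> x * Z x))"
    using cutoff_upper[OF cut Rc Z(1), of 0 "2 * C + 2" \<tau>] Rle by (simp add: R_def mult.assoc)
  also have "\<dots> = (8 * C + 8) * I \<tau> (\<lambda>x. cut2 \<zeta> \<gamma> x * Z x)" by (simp add: distrib_right)
  finally show ?thesis .
qed

end

context carleman begin

text \<open>The commutator of \<open>P\<close> with the cutoff is \<open>\<gamma>\<close> times the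
  radial symbol of \<open>u\<close>, of norm \<open>|\<gamma>||x||u|\<close> by
  \<open>radial_inner_radial\<close>.\<close>

lemma elliptic_cutoff:
  assumes u: "C_on 2 \<Omega> u" and uW: "\<And>y. y \<in> \<Omega> \<Longrightarrow> u y \<in> W" and cut: "cutoff \<zeta> \<gamma>" and \<tau>: "\<tau> \<ge> 1"
    and Z: "continuous_on \<Omega> Z" "\<And>x. x \<in> \<Omega> \<Longrightarrow> (norm (u x))^2 \<le> Z x" and C: "C \<ge> 0"
    and le: "\<And>x. x \<in> \<Omega> \<Longrightarrow> (norm (P u x))^2 \<le> C * Z x"
  shows "\<tau> * I \<tau> (\<lambda>x. (\<zeta> x)^2 * (norm (u x))^2) \<le> (6 * C + 6) * I \<tau> (\<lambda>x. cut2 \<zeta> \<gamma> x * Z x)"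
proof -
  obtain K where K: "compact K" "K \<subseteq> \<Omega>" "\<And>x. x \<in> \<Omega>-K \<Longrightarrow> \<zeta> x = 0 \<and> \<gamma> x = 0"
    using cut unfolding cutoff_def by blast
  have \<zeta>: "C_on 2 \<Omega> \<zeta>" "\<And>x. x \<in> \<Omega> \<Longrightarrow> (\<zeta> has_derivative (\<lambda>v. \<gamma> x * (x \<bullet> v))) (at x)"
    using cut unfolding cutoff_def by auto
  define w where "w x = \<zeta> x *\<^sub>R u x" for x
  have w: "C_on 2 \<Omega> w" unfolding w_def by (intro C_on_scaleR u \<zeta> open_\<Omega>)
  have wW: "w y \<in> W" if "y \<in> \<Omega>" for y unfolding w_def using uW[OF that] W by (intro subspace_scale)
  have wz: "w y = 0" if "y \<in> \<Omega> - K" for y using K(3)[OF that] by (simp add: w_def)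
  note cc = cutoff_continuous[OF cut]
  have uc: "continuous_on \<Omega> u" using u C_on_continuous by blast
  have Pw: "P w x = \<zeta> x *\<^sub>R P u x + \<gamma> x *\<^sub>R (\<Sum>i\<in>UNIV. x $ i *\<^sub>R A i (u x))" if x: "x \<in> \<Omega>" for x
  proof -
    have "u differentiable (at x)" using C_on_mono[OF u, of 1] x by simp
    from fd_eq[OF has_derivative_scaleR[OF \<zeta>(2)[OF x] fd_works[OF this]]]
    have "fd w x v = \<zeta> x *\<^sub>R fd u x v + (\<gamma> x * (x \<bullet> v)) *\<^sub>R u x" for v
      by (simp add: w_def[abs_def])
    then show ?thesis using \<Omega>D[OF x]
      by (simp add: P_def gauss2 linear_add[OF A_linear] linear_cmul[OF A_linear] sum.distrib scaleR_sum_right)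
  qed
  define R where "R x = (norm (P w x))^2" for x
  have Rle: "R x \<le> (2 * C + 2) * (cut2 \<zeta> \<gamma> x * Z x)" if x: "x \<in> \<Omega>" for x
  proof -
    have Z0: "Z x \<ge> 0" using Z(2)[OF x] zero_le_power2[of "norm (u x)"] by linarith
    define b where "b = (\<Sum>i\<in>UNIV. x $ i *\<^sub>R A i (u x))"
    have b: "(norm b)^2 = (norm x)^2 * (norm (u x))^2"
      unfolding b_def power2_norm_eq_inner[of "\<Sum>i\<in>UNIV. _ i"] radial_inner_radial[OF uW[OF x] uW[OF x]]
      by (simp add: power2_norm_eq_inner)
    have "R x \<le> 2 * (norm (\<zeta> x *\<^sub>R P u x))^2 + 2 * (norm (\<gamma> x *\<^sub>R b))^2"
    proof -
      define c d where "c = \<zeta> x *\<^sub>R P u x" and "d = \<gamma> x *\<^sub>R b"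
      have "0 \<le> (norm (c - d))^2" by simp
      then have "(norm (c + d))^2 \<le> 2 * (norm c)^2 + 2 * (norm d)^2"
        unfolding power2_norm_eq_inner by (simp add: inner_diff_left inner_diff_right inner_add_left inner_add_right inner_commute)
      then show ?thesis unfolding R_def Pw[OF x] b_def[symmetric] c_def d_def .
    qed
    also have "\<dots> = 2 * ((\<zeta> x)^2 * (norm (P u x))^2) + 2 * ((\<gamma> x)^2 * (norm x)^2 * (norm (u x))^2)"
      by (simp add: power_mult_distrib b)
    also have "\<dots> \<le> 2 * ((\<zeta> x)^2 * (C * Z x)) + 2 * ((\<gamma> x)^2 * (norm x)^2 * Z x)"
      using le[OF x] Z(2)[OF x] by (intro add_mono mult_left_mono) auto
    also have "\<dots> = 2 * C * ((\<zeta> x)^2 * Z x) + 2 * ((\<gamma> x)^2 * (norm x)^2 * Z x)" by simp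
    also have "\<dots> \<le> (2 * C + 2) * ((\<zeta> x)^2 * Z x) + (2 * C + 2) * ((\<gamma> x)^2 * (norm x)^2 * Z x)"
      using Z0 C by (intro add_mono mult_right_mono) auto
    finally show ?thesis by (simp add: algebra_simps)
  qed
  have Rc: "continuous_on \<Omega> R" unfolding R_def
    using C_on_P[OF w] C_on_continuous by (intro continuous_intros) blast
  have ce: "\<tau> * (LINT x:\<Omega>|lborel. p x * norm x * (\<psi> \<tau> x)^2 * (norm (w x))^2)
      \<le> 3 * (LINT x:\<Omega>|lborel. p x * (norm x)^2 * (\<psi> \<tau> x)^2 * R x)"
    unfolding R_def by (rule carleman_estimate[OF w wW K(1,2) wz \<tau>])
  have "\<tau> * I \<tau> (\<lambda>x. (\<zeta> x)^2 * (norm (u x))^2) \<le> \<tau> * (LINT x:\<Omega>|lborel. p x * norm x * (\<psi> \<tau> x)^2 * (norm (w x))^2)"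
    using cutoff_lower[OF cut continuous_on_norm[OF uc], of 1 \<tau>] \<tau> by (intro mult_left_mono) (auto simp: w_def power_mult_distrib)
  also note ce
  also have "3 * (LINT x:\<Omega>|lborel. p x * (norm x)^2 * (\<psi> \<tau> x)^2 * R x) \<le> 3 * ((2 * C + 2) * I \<tau> (\<lambda>x. cut2 \<zeta> \<gamma> x * Z x))"
    by (intro mult_left_mono cutoff_upper[OF cut Rc Z(1)])
      (use mult_left_mono[OF Rle, of _ "(norm _)^2"] in \<open>auto simp: R_def mult.left_commute\<close>)
  also have "\<dots> = (6 * C + 6) * I \<tau> (\<lambda>x. cut2 \<zeta> \<gamma> x * Z x)" by (simp add: distrib_right)
  finally show ?thesis .
qed

end

section \<open>Cutoff functions and unique continuation\<close>

lemma pos_power_deriv: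
  assumes n: "n \<ge> 2"
  shows "((\<lambda>t::real. max 0 t ^ n) has_real_derivative real n * max 0 t ^ (n - 1)) (at t)"
proof -
  consider "t > 0" | "t < 0" | "t = 0" by linarith
  then show ?thesis
  proof cases
    case 1
    have "((\<lambda>t::real. t ^ n) has_real_derivative real n * t ^ (n - 1)) (at t)"
      by (auto intro!: derivative_eq_intros)
    then have "((\<lambda>t::real. max 0 t ^ n) has_real_derivative real n * t ^ (n - 1)) (at t)"
      by (rule has_field_derivative_transform_within_open[where S="{0<..}"]) (use 1 in auto)
    then show ?thesis using 1 by (simp add: max_def)
  next
    case 2
    have "((\<lambda>t::real. 0) has_real_derivative 0) (at t)" by simp
    then have "((\<lambda>t::real. max 0 t ^ n) has_real_derivative 0) (at t)"
      by (rule has_field_derivative_transform_within_open[where S="{..<0}"]) (use 2 n in auto)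
    then show ?thesis using 2 n by (simp add: power_0_left)
  next
    case 3
    have "((\<lambda>h::real. max 0 h ^ n / h) \<longlongrightarrow> 0) (at 0)"
    proof (rule Lim_null_comparison)
      show "\<forall>\<^sub>F h in at 0. norm (max 0 h ^ n / h) \<le> \<bar>h\<bar> ^ (n - 1)"
      proof (rule always_eventually, rule allI)
        fix h :: real
        have "\<bar>h\<bar> ^ n = \<bar>h\<bar> ^ (n - 1) * \<bar>h\<bar>" using n by (metis Suc_1 Suc_le_D diff_Suc_1 power_Suc2)
        moreover have "\<bar>max 0 h ^ n\<bar> \<le> \<bar>h\<bar> ^ n" by (simp add: power_mono max_def power_abs)
        ultimately show "norm (max 0 h ^ n / h) \<le> \<bar>h\<bar> ^ (n - 1)"
          by (cases "h = 0") (auto simp: divide_le_eq)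
      qed
      show "((\<lambda>h::real. \<bar>h\<bar> ^ (n - 1)) \<longlongrightarrow> 0) (at 0)"
        using n by (auto intro!: tendsto_eq_intros simp: power_0_left)
    qed
    then show ?thesis using 3 n by (simp add: DERIV_def power_0_left)
  qed
qed

text \<open>The cube is the first power of the positive part of class C^2, the class that
  \<open>cutoff\<close> demands.\<close>

lemma C_on_cube: "C_on 2 UNIV (\<lambda>t::real. max 0 t ^ 3)"
proof -
  have h: "((\<lambda>t::real. max 0 t ^ n) has_derivative (\<lambda>v. real n * max 0 t ^ (n - 1) * v)) (at t)"
    if "n \<ge> 2" for n t
    using pos_power_deriv[OF that, of t] by (simp add: has_field_derivative_def)
  have 1: "C_on 1 UNIV (\<lambda>t::real. max 0 t ^ 2)"
    unfolding One_nat_def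
    by (rule C_on_SucI[OF h]) (auto intro!: continuous_intros)
  have "C_on (Suc 1) UNIV (\<lambda>t::real. max 0 t ^ 3)"
  proof (rule C_on_SucI[OF h])
    show "C_on 1 UNIV (\<lambda>t::real. real 3 * max 0 t ^ (3 - 1) * v)" for v
      using C_on_mult[OF C_on_mult[OF C_on_const[of 1 UNIV "3::real"] 1] C_on_const[of 1 UNIV v]]
      by simp
  qed auto
  then show ?thesis by (simp only: Suc_1)
qed

context radial_weight begin

text \<open>Both profiles are functions of \<open>|x|^2\<close>, so their gradients are multiples of
  \<open>x\<close>. \<open>outer\<close> vanishes for \<open>|x| \<ge> r/2\<close>,
  \<open>inner\<close> for \<open>|x| \<le> \<epsilon>\<close>.\<close>

definition outer :: "real^'n \<Rightarrow> real" where "outer x = max 0 (1 - (norm x)^2 / (r/2)^2)"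
definition inner :: "real \<Rightarrow> real^'n \<Rightarrow> real" where "inner \<epsilon> x = max 0 (1 - \<epsilon>^2 / (norm x)^2)"

definition \<zeta>\<^sub>0 :: "real \<Rightarrow> real^'n \<Rightarrow> real" where "\<zeta>\<^sub>0 \<epsilon> x = outer x ^ 3 * inner \<epsilon> x ^ 3"

definition \<gamma>\<^sub>0 :: "real \<Rightarrow> real^'n \<Rightarrow> real" where
  "\<gamma>\<^sub>0 \<epsilon> x = - (2 / (r/2)^2) * (3 * outer x ^ 2) * inner \<epsilon> x ^ 3 + outer x ^ 3 * (3 * inner \<epsilon> x ^ 2) * (2 * \<epsilon>^2 / norm x ^ 4)"

lemma cutoff_\<zeta>\<^sub>0:
  assumes \<epsilon>: "\<epsilon> > 0"
  shows "cutoff (\<zeta>\<^sub>0 \<epsilon>) (\<gamma>\<^sub>0 \<epsilon>)"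
  unfolding cutoff_def
proof (intro conjI ballI)
  have s2: "C_on 2 \<Omega> (\<lambda>x. 1 - \<epsilon>^2 * inverse ((norm x)^2))"
    by (intro C_on_diff C_on_mult C_on_inverse C_on_power C_on_norm C_on_const open_\<Omega> zero_notin_\<Omega>) (use \<Omega>D in auto)
  have s1: "C_on 2 \<Omega> (\<lambda>x. 1 - (norm x)^2 * inverse ((r/2)^2))"
    by (intro C_on_diff C_on_mult C_on_power C_on_norm C_on_const open_\<Omega> zero_notin_\<Omega>)
  show "C_on 2 \<Omega> (\<zeta>\<^sub>0 \<epsilon>)"
    unfolding \<zeta>\<^sub>0_def outer_def inner_def divide_inverse
    by (intro C_on_mult C_on_compose[OF s1[unfolded divide_inverse] C_on_cube] C_on_compose[OF s2 C_on_cube] open_\<Omega>) auto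
  show "continuous_on \<Omega> (\<gamma>\<^sub>0 \<epsilon>)"
    unfolding \<gamma>\<^sub>0_def outer_def inner_def by (intro continuous_intros) (use \<Omega>D in auto)
next
  fix x assume x: "x \<in> \<Omega>"
  have x0: "x \<noteq> 0" "norm x \<noteq> 0" using \<Omega>D[OF x] by auto
  note nd = norm_has_derivative[OF x0(1)]
  have s1: "((\<lambda>x. 1 - (norm x)^2 / (r/2)^2) has_derivative (\<lambda>v. - (2 / (r/2)^2) * (x \<bullet> v))) (at x)"
    by (rule has_derivative_eq_rhs, (rule derivative_intros nd)+) (use x0 r in \<open>auto simp: fun_eq_iff field_simps\<close>)
  have s2: "((\<lambda>x. 1 - \<epsilon>^2 / (norm x)^2) has_derivative (\<lambda>v. (2 * \<epsilon>^2 / norm x ^ 4) * (x \<bullet> v))) (at x)"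
    unfolding divide_inverse
    by (rule has_derivative_eq_rhs, (rule derivative_intros nd[unfolded divide_inverse] | simp add: x0)+)
      (use x0 in \<open>auto simp: fun_eq_iff field_simps power2_eq_square power4_eq_xxxx\<close>)
  have h: "((\<lambda>t::real. max 0 t ^ 3) has_derivative (\<lambda>v. (3 * max 0 t ^ 2) * v)) (at t)" for t
    using pos_power_deriv[of 3 t] by (simp add: has_field_derivative_def)
  have "(\<zeta>\<^sub>0 \<epsilon> has_derivative (\<lambda>v. outer x ^ 3 * (3 * inner \<epsilon> x ^ 2 * (2 * \<epsilon>^2 / norm x ^ 4 * (x \<bullet> v)))
      + 3 * outer x ^ 2 * (- (2 / (r/2)^2) * (x \<bullet> v)) * inner \<epsilon> x ^ 3)) (at x)"
    using has_derivative_mult[OF diff_chain_at[OF s1 h] diff_chain_at[OF s2 h]]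
    by (simp only: o_def \<zeta>\<^sub>0_def[abs_def] outer_def inner_def)
  then show "(\<zeta>\<^sub>0 \<epsilon> has_derivative (\<lambda>v. \<gamma>\<^sub>0 \<epsilon> x * (x \<bullet> v))) (at x)"
    by (rule has_derivative_eq_rhs) (simp add: fun_eq_iff \<gamma>\<^sub>0_def algebra_simps)
next
  show "\<exists>K. compact K \<and> K \<subseteq> \<Omega> \<and> (\<forall>x\<in>\<Omega> - K. \<zeta>\<^sub>0 \<epsilon> x = 0 \<and> \<gamma>\<^sub>0 \<epsilon> x = 0)"
  proof (intro exI conjI ballI)
    show "compact (cball 0 (r/2) - ball 0 \<epsilon> :: (real^'n) set)" by (intro compact_diff) auto
    show "(cball 0 (r/2) - ball 0 \<epsilon> :: (real^'n) set) \<subseteq> \<Omega>" using r \<epsilon> by (auto simp: \<Omega>_def)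
  next
    fix x assume x: "x \<in> \<Omega> - (cball 0 (r/2) - ball 0 \<epsilon>)"
    have x0: "norm x > 0" using x \<Omega>D by auto
    have "outer x = 0 \<or> inner \<epsilon> x = 0"
    proof (cases "norm x < \<epsilon>")
      case True
      then have "(norm x)^2 \<le> \<epsilon>^2" by (intro power_mono) auto
      then show ?thesis using x0 by (simp add: inner_def le_divide_eq)
    next
      case False
      then have "r / 2 \<le> norm x" using x by auto
      then have "(r/2)^2 \<le> (norm x)^2" using r by (intro power_mono) auto
      then show ?thesis using r by (simp add: outer_def le_divide_eq)
    qed
    then show "\<zeta>\<^sub>0 \<epsilon> x = 0" "\<gamma>\<^sub>0 \<epsilon> x = 0" unfolding \<zeta>\<^sub>0_def \<gamma>\<^sub>0_def by auto
  qed
qed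

lemma \<psi>_nat: "x \<in> \<Omega> \<Longrightarrow> \<psi> (real T) x = exp (real T * \<kappa> * norm x) / norm x ^ T"
  using \<Omega>D(3)[of x] by (simp add: \<psi>_def right_diff_distrib exp_diff exp_of_nat_mult mult.assoc)

text \<open>The slope \<open>-1 / |x|\<close> of the logarithmic part outweighs
  \<open>\<kappa>\<close>, because \<open>\<kappa>|x| < 1\<close> on the ball.\<close>

lemma \<psi>_mono:
  assumes "x \<in> \<Omega>" "y \<in> \<Omega>" "norm x \<le> norm y" "\<tau> \<ge> 0" shows "\<psi> \<tau> y \<le> \<psi> \<tau> x"
proof -
  have p: "norm x > 0" "norm y > 0" using \<Omega>D assms by auto
  have "\<kappa> * norm y \<le> 1" using weight_bounds(1)[OF \<Omega>D(1)[OF assms(2)]] by linarith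
  then have "\<kappa> * (norm y - norm x) * norm y \<le> norm y - norm x"
    using assms(3) mult_right_mono[of "\<kappa> * norm y" 1 "norm y - norm x"] by (simp add: mult_ac)
  then have "\<kappa> * (norm y - norm x) \<le> 1 - norm x / norm y" using p by (simp add: field_simps)
  also have "\<dots> \<le> - ln (norm x / norm y)" using ln_le_minus_one[of "norm x / norm y"] p by simp
  also have "\<dots> = ln (norm y) - ln (norm x)" using p by (simp add: ln_div)
  finally have "\<kappa> * norm y - ln (norm y) \<le> \<kappa> * norm x - ln (norm x)" by (simp add: algebra_simps)
  then show ?thesis unfolding \<psi>_def using assms(4) by (auto intro: mult_left_mono)
qed

text \<open>Let \<open>a\<close> be the squared weight at radius \<open>r / 4\<close>. Near
  \<open>x0\<close> the squared weight is at least \<open>a\<close>, so the left integral is at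
  least a multiple of \<open>\<tau> a\<close>. On the right, the commutator of the outer cutoff is
  absorbed inside radius \<open>r / 4\<close> and is of size \<open>a\<close> beyond; that of the
  inner cutoff is made at most \<open>a\<close> by choosing its radius after \<open>\<tau>\<close>,
  which flatness of \<open>Z\<close> permits. Division by \<open>a\<close> bounds
  \<open>\<tau>\<close>, a contradiction. Natural values \<open>T\<close> of \<open>\<tau>\<close>
  let the weight be written with powers of \<open>|x|\<close>.\<close>

theorem unique_continuation:
  fixes Z :: "real^'n \<Rightarrow> real"
  assumes Zc: "continuous_on \<Omega> Z" and Z0: "\<And>x. x \<in> \<Omega> \<Longrightarrow> 0 \<le> Z x"
    and flat: "\<And>M::nat. \<exists>C. \<forall>x\<in>\<Omega>. Z x \<le> C * norm x ^ M" and C0: "C0 \<ge> 0"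
    and est: "\<And>\<tau> \<zeta> \<gamma>. \<tau> \<ge> 1 \<Longrightarrow> cutoff \<zeta> \<gamma> \<Longrightarrow>
      \<tau> * I \<tau> (\<lambda>x. (\<zeta> x)^2 * Z x) \<le> C0 * I \<tau> (\<lambda>x. cut2 \<zeta> \<gamma> x * Z x)"
    and x0: "x0 \<in> \<Omega>" "norm x0 < r / 4"
  shows "Z x0 = 0"
proof (rule ccontr)
  assume ne: "Z x0 \<noteq> 0"
  define q where "q x = p x * (norm x)^2 * Z x" for x
  have qn: "q x \<ge> 0" if "x \<in> \<Omega>" for x unfolding q_def using p_pos[OF that] Z0[OF that] by simp
  have q0: "q x0 > 0" using ne Z0[OF x0(1)] p_pos[OF x0(1)] \<Omega>D(2)[OF x0(1)] by (simp add: q_def)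
  have flat': "\<exists>C\<ge>0. \<forall>x\<in>\<Omega>. Z x \<le> C * norm x ^ M" for M
  proof -
    obtain C where C: "\<forall>x\<in>\<Omega>. Z x \<le> C * norm x ^ M" using flat by blast
    have "Z x \<le> max C 0 * norm x ^ M" if "x \<in> \<Omega>" for x
      using C that mult_right_mono[of C "max C 0" "norm x ^ M"] by fastforce
    then show ?thesis by (intro exI[of _ "max C 0"]) auto
  qed
  obtain B where B: "B \<ge> 0" "\<And>x. x \<in> \<Omega> \<Longrightarrow> q x \<le> B"
  proof -
    \<comment> \<open>Flatness of order \<open>CARD('n)\<close> compensates the singular factor
      \<open>p\<close>.\<close>
    obtain C where C: "C \<ge> 0" "\<And>x. x \<in> \<Omega> \<Longrightarrow> Z x \<le> C * norm x ^ CARD('n)" using flat' by blast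
    have "q x \<le> C" if x: "x \<in> \<Omega>" for x
    proof -
      have n: "norm x > 0" "(norm x)^2 \<le> 1" using \<Omega>D[OF x] by (auto simp: power_le_one)
      have "q x \<le> p x * (norm x)^2 * (C * norm x ^ CARD('n))"
        unfolding q_def using C(2)[OF x] p_pos[OF x] by (intro mult_left_mono) auto
      also have "\<dots> = (norm x)^2 * C" using n by (simp add: p_def)
      also have "\<dots> \<le> C" using mult_right_mono[OF n(2) C(1)] by simp
      finally show ?thesis .
    qed
    then show ?thesis using that C(1) by blast
  qed
  define O' where "O' = \<Omega> \<inter> ball 0 (r/4) \<inter> - cball 0 (norm x0 / 2)"
  have "open O'" unfolding O'_def using open_\<Omega> by (intro open_Int) auto
  moreover have "continuous_on O' q" unfolding q_def O'_def
    by (intro continuous_intros continuous_on_subset[OF C_on_continuous[OF C_on_p]] continuous_on_subset[OF Zc]) auto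
  ultimately have "open (O' \<inter> q -` {q x0 / 2<..})" by (intro continuous_open_preimage) auto
  moreover have "x0 \<in> O' \<inter> q -` {q x0 / 2<..}" using x0 q0 \<Omega>D(3)[OF x0(1)] by (auto simp: O'_def)
  ultimately obtain \<delta> where \<delta>: "\<delta> > 0" "cball x0 \<delta> \<subseteq> O' \<inter> q -` {q x0 / 2<..}" using open_contains_cball by metis
  define N where "N = cball x0 \<delta>"
  have N: "x \<in> \<Omega>" "norm x < r / 4" "norm x > norm x0 / 2" "q x \<ge> q x0 / 2" if "x \<in> N" for x
    using that \<delta>(2) by (auto simp: N_def O'_def)
  define r4 where "r4 = (r/2) ^ 4"
  have r4: "r4 > 0" using r by (simp add: r4_def)
  \<comment> \<open>The summand 1 pays for the commutator of the inner cutoff, which contributes at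
    most \<open>a\<close>.\<close>
  define D where "D = C0 * (1 + 72 / r4) * B + 1"
  \<comment> \<open>Both profiles are at least 3/4 on \<open>N\<close>, and
    \<open>\<zeta>\<^sub>0\<close> contains their cubes and is squared. The factor 1/2 in
    \<open>k\<close> is the share of \<open>T\<close> left after absorption.\<close>
  define c where "c = (3/4::real) ^ 6"
  have c: "c > 0" by (simp add: c_def)
  define k where "k = 1/2 * ((c * c) * (q x0 / 2))"
  obtain y :: "real^'n" where y: "norm y = r / 4" using vector_choose_size[of "r/4"] r by auto
  have y\<Omega>: "y \<in> \<Omega>" using y r by (auto simp: \<Omega>_def)
  have main: "real T * k * measure lborel N \<le> D * measure lborel (cball (0::real^'n) r)"
    if T: "T \<ge> 1" "real T \<ge> 2 * (C0 * (1 + 128 / r4))" for T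
  proof -
    define a where "a = (\<psi> (real T) y)^2"
    have a: "a > 0" unfolding a_def using \<psi>_pos[of "real T" y] by simp
    \<comment> \<open>The exponent cancels \<open>p\<close> by \<open>CARD('n)\<close>, the squared
      weight by \<open>2 * T\<close>, and by 6 the negative power left by the gradient of
      \<open>inner\<close>.\<close>
    obtain C where C: "C \<ge> 0" "\<And>x. x \<in> \<Omega> \<Longrightarrow> Z x \<le> C * norm x ^ (CARD('n) + 2 * T + 6)" using flat' by blast
    define b where "b x = (\<psi> (real T) x)^2 * q x" for x
    have bn: "b x \<ge> 0" if "x \<in> \<Omega>" for x unfolding b_def using qn[OF that] by simp
    have bflat: "b x \<le> (exp (real T))^2 * C * norm x ^ 6" if x: "x \<in> \<Omega>" for x
    proof -
      have n: "norm x > 0" "(norm x)^2 \<le> 1" using \<Omega>D[OF x] by (auto simp: power_le_one)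
      have "\<kappa> * norm x \<le> 1" using weight_bounds(1)[OF \<Omega>D(1)[OF x]] by linarith
      then have "exp (real T * \<kappa> * norm x) \<le> exp (real T)" using mult_left_mono[of "\<kappa> * norm x" 1 "real T"] by (simp add: mult.assoc)
      then have "(\<psi> (real T) x)^2 \<le> (exp (real T) / norm x ^ T)^2"
        unfolding \<psi>_nat[OF x] using n by (intro power_mono divide_right_mono) auto
      moreover have "q x \<le> p x * 1 * (C * norm x ^ (CARD('n) + 2 * T + 6))"
        unfolding q_def using n C(2)[OF x] p_pos[OF x] Z0[OF x] by (intro mult_mono) auto
      ultimately have "b x \<le> (exp (real T) / norm x ^ T)^2 * (p x * 1 * (C * norm x ^ (CARD('n) + 2 * T + 6)))"
        unfolding b_def using qn[OF x] by (intro mult_mono) auto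
      also have "\<dots> = (exp (real T))^2 * C * norm x ^ 6" using n by (simp add: p_def power_divide power_add power_even_eq flip: power_mult)
      finally show ?thesis .
    qed
    define M where "M = C0 * (72 * ((exp (real T))^2 * C))"
    have M: "M \<ge> 0" using C0 C by (simp add: M_def)
    \<comment> \<open>\<open>norm x0 / 4\<close> keeps \<open>inner\<close> above 3/4 on
      \<open>N\<close>, and \<open>a / (M + 1)\<close> brings \<open>M * \<epsilon> ^ 4\<close>
      below \<open>a\<close>. The choice depends on \<open>T\<close> through \<open>a\<close> and
      \<open>M\<close>.\<close>
    define \<epsilon> where "\<epsilon> = min 1 (min (norm x0 / 4) (a / (M + 1)))"
    have \<epsilon>: "\<epsilon> > 0" "\<epsilon> \<le> 1" "\<epsilon> \<le> norm x0 / 4" using a M \<Omega>D(3)[OF x0(1)] unfolding \<epsilon>_def by (simp_all only: min_less_iff_conj min_le_iff_disj) auto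
    have M\<epsilon>: "M * \<epsilon> ^ 4 \<le> a"
    proof -
      have "\<epsilon> ^ 4 \<le> a / (M + 1)" using power_decreasing[of 1 4 \<epsilon>] \<epsilon> by (simp add: \<epsilon>_def)
      then have "M * \<epsilon> ^ 4 \<le> M * (a / (M + 1))" using M by (rule mult_left_mono)
      also have "\<dots> \<le> a" using M a by (simp add: field_simps)
      finally show ?thesis .
    qed
    define s t where "s x = outer x" and "t x = inner \<epsilon> x" for x
    have st: "0 \<le> s x" "s x \<le> 1" "0 \<le> t x" "t x \<le> 1" for x by (auto simp: s_def t_def outer_def inner_def)
    define F where "F x = s x ^ 6 * t x ^ 6 * b x" for x
    define g where "g x = (\<zeta>\<^sub>0 \<epsilon> x)^2 + (\<gamma>\<^sub>0 \<epsilon> x)^2 * (norm x)^2" for x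
    have F: "p x * (norm x)^2 * (\<psi> (real T) x)^2 * ((\<zeta>\<^sub>0 \<epsilon> x)^2 * Z x) = F x"
      and G: "p x * (norm x)^2 * (\<psi> (real T) x)^2 * (((\<zeta>\<^sub>0 \<epsilon> x)^2 + (\<gamma>\<^sub>0 \<epsilon> x)^2 * (norm x)^2) * Z x) = g x * b x" for x
      by (simp_all add: F_def b_def q_def g_def \<zeta>\<^sub>0_def s_def t_def power_mult_distrib flip: power_mult)
    have Gle: "g x * b x \<le> (s x ^ 6 + 72 / r4 * s x ^ 4) * t x ^ 6 * b x + 72 * ((exp (real T))^2 * C) * \<epsilon> ^ 4"
      and Fn: "F x \<ge> 0" if x: "x \<in> \<Omega>" for x
    proof -
      have n: "norm x > 0" "(norm x)^2 \<le> 1" using \<Omega>D[OF x] by (auto simp: power_le_one)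
      define u v where "u = - (2 / (r/2)^2) * (3 * s x ^ 2) * t x ^ 3" and "v = s x ^ 3 * (3 * t x ^ 2) * (2 * \<epsilon>^2 / norm x ^ 4)"
      have "(\<gamma>\<^sub>0 \<epsilon> x)^2 \<le> 2 * u^2 + 2 * v^2"
        using sum_squares_bound[of u v] unfolding \<gamma>\<^sub>0_def s_def[symmetric] t_def[symmetric] u_def[symmetric] v_def[symmetric] by (simp add: power2_sum)
      then have 1: "g x \<le> s x ^ 6 * t x ^ 6 + (2 * u^2 + 2 * v^2) * (norm x)^2"
        unfolding g_def \<zeta>\<^sub>0_def s_def[symmetric] t_def[symmetric] by (simp add: power_mult_distrib mult_right_mono flip: power_mult)
      have U: "2 * u^2 = 72 / r4 * s x ^ 4 * t x ^ 6"
        unfolding u_def r4_def by (simp add: power_mult_distrib power_divide flip: power_mult)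
      have n': "2 * u^2 * (norm x)^2 \<le> 2 * u^2 * 1" by (intro mult_left_mono n) simp
      have "v = (s x ^ 3 * t x ^ 2) * (6 * \<epsilon>^2 / norm x ^ 4)" by (simp add: v_def)
      also have "\<dots> \<le> 1 * (6 * \<epsilon>^2 / norm x ^ 4)" using st[of x] by (intro mult_right_mono mult_le_one power_le_one) auto
      finally have "v^2 \<le> (6 * \<epsilon>^2 / norm x ^ 4)^2" using st[of x] by (intro power_mono) (auto simp: v_def)
      also have "\<dots> = 36 * \<epsilon> ^ 4 / norm x ^ 8" by (simp add: power_mult_distrib power_divide flip: power_mult)
      finally have V: "2 * v^2 * (norm x)^2 \<le> 2 * (36 * \<epsilon> ^ 4 / norm x ^ 8) * (norm x)^2" by (intro mult_right_mono mult_left_mono) auto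
      have "g x \<le> (s x ^ 6 + 72 / r4 * s x ^ 4) * t x ^ 6 + 2 * (36 * \<epsilon> ^ 4 / norm x ^ 8) * (norm x)^2"
        using 1 V n' unfolding distrib_right U mult_1_right by linarith
      then have "g x * b x \<le> ((s x ^ 6 + 72 / r4 * s x ^ 4) * t x ^ 6 + 2 * (36 * \<epsilon> ^ 4 / norm x ^ 8) * (norm x)^2) * b x"
        using bn[OF x] by (rule mult_right_mono)
      also have "\<dots> = (s x ^ 6 + 72 / r4 * s x ^ 4) * t x ^ 6 * b x + 72 * \<epsilon> ^ 4 / norm x ^ 6 * b x"
        using n by (simp add: distrib_right power_numeral_reduce)
      also have "72 * \<epsilon> ^ 4 / norm x ^ 6 * b x \<le> 72 * \<epsilon> ^ 4 / norm x ^ 6 * ((exp (real T))^2 * C * norm x ^ 6)"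
        using bflat[OF x] \<epsilon> by (intro mult_left_mono) auto
      finally show "g x * b x \<le> (s x ^ 6 + 72 / r4 * s x ^ 4) * t x ^ 6 * b x + 72 * ((exp (real T))^2 * C) * \<epsilon> ^ 4"
        using n by (simp add: mult_ac)
      show "F x \<ge> 0" unfolding F_def using st[of x] bn[OF x] by simp
    qed
    have pw: "real T * k * a * indicator N x - D * a * indicator (cball 0 r) x
        \<le> real T * (indicator \<Omega> x *\<^sub>R F x) - C0 * (indicator \<Omega> x *\<^sub>R (g x * b x))" for x
    proof (cases "x \<in> \<Omega>")
      case False
      then have "x \<notin> N" using N(1) by blast
      then show ?thesis using False a B C0 r4 by (simp add: D_def indicator_def)
    next
      case x: True
      have xc: "x \<in> cball 0 r" using \<Omega>D(1)[OF x] by auto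
      have G': "C0 * (g x * b x) \<le> C0 * ((s x ^ 6 + 72 / r4 * s x ^ 4) * t x ^ 6 * b x) + a"
        using mult_left_mono[OF Gle[OF x] C0] M\<epsilon> by (simp add: M_def distrib_left mult_ac)
      have "real T * k * a * indicator N x - D * a \<le> real T * F x - C0 * (g x * b x)"
      proof (cases "norm x \<le> r / 4")
        case inn: True
        have "(norm x)^2 \<le> (r/4)^2" using inn by (intro power_mono) auto
        then have "(norm x)^2 / (r/2)^2 \<le> 1 / 4" using r by (simp add: field_simps power2_eq_square)
        then have s34: "s x \<ge> 3 / 4" unfolding s_def outer_def by linarith
        have "(3/4)^2 \<le> (s x)^2" using s34 by (intro power_mono) auto
        then have "s x ^ 4 * 1 \<le> s x ^ 4 * (16 / 9 * (s x)^2)" using st[of x] by (intro mult_left_mono) (auto simp: power2_eq_square)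
        \<comment> \<open>Two powers of \<open>s x\<close> cost the factor 16/9, and 72 * 16/9 = 128
          is the constant in the lower bound for \<open>T\<close>.\<close>
        then have "72 / r4 * s x ^ 4 \<le> 72 / r4 * (16 / 9 * s x ^ 6)" using r4 by (intro mult_left_mono) (auto simp: power_numeral_reduce)
        then have "(s x ^ 6 + 72 / r4 * s x ^ 4) * (t x ^ 6 * b x) \<le> ((1 + 128 / r4) * s x ^ 6) * (t x ^ 6 * b x)"
          using st[of x] bn[OF x] by (intro mult_right_mono) (auto simp: algebra_simps)
        from mult_left_mono[OF this C0] have "C0 * (g x * b x) \<le> C0 * (1 + 128 / r4) * F x + a"
          using G' by (simp add: F_def mult_ac)
        also have "\<dots> \<le> real T / 2 * F x + a" using T(2) Fn[OF x] by (intro add_right_mono mult_right_mono) linarith+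
        finally have 1: "C0 * (g x * b x) \<le> real T / 2 * F x + a" .
        have "k * a * indicator N x \<le> 1/2 * F x"
        proof (cases "x \<in> N")
          case xN: True
          have "(2 * \<epsilon>)^2 \<le> (norm x)^2" using N(3)[OF xN] \<epsilon> by (intro power_mono) auto
          then have "\<epsilon>^2 / (norm x)^2 \<le> 1 / 4" using \<Omega>D(3)[OF x] by (simp add: field_simps)
          then have t34: "t x \<ge> 3 / 4" unfolding t_def inner_def by linarith
          have "\<psi> (real T) y \<le> \<psi> (real T) x" by (rule \<psi>_mono[OF x y\<Omega>]) (use inn y in auto)
          then have "a \<le> (\<psi> (real T) x)^2" unfolding a_def using \<psi>_pos less_imp_le by (intro power_mono) auto
          then have 2: "a * (q x0 / 2) \<le> b x" unfolding b_def using N(4)[OF xN] q0 a by (intro mult_mono) auto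
          have "c * c \<le> s x ^ 6 * t x ^ 6" unfolding c_def using s34 t34 by (intro mult_mono power_mono) auto
          from mult_mono[OF this 2] have "(c * c) * (a * (q x0 / 2)) \<le> F x"
            unfolding F_def using q0 a st[of x] by simp
          then show ?thesis using xN by (simp add: k_def mult_ac)
        qed (use Fn[OF x] in simp)
        from mult_left_mono[OF this, of "real T"] 1 have "real T * k * a * indicator N x - a \<le> real T * F x - C0 * (g x * b x)"
          by (simp add: mult.assoc)
        moreover have "a \<le> D * a" using B C0 r4 a by (simp add: D_def)
        ultimately show ?thesis by linarith
      next
        case out: False
        have "\<psi> (real T) x \<le> \<psi> (real T) y" by (rule \<psi>_mono[OF y\<Omega> x]) (use out y in auto)
        then have "(\<psi> (real T) x)^2 \<le> a" unfolding a_def using \<psi>_pos less_imp_le by (intro power_mono) auto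
        then have 1: "b x \<le> a * B" unfolding b_def using B(2)[OF x] qn[OF x] a by (intro mult_mono) auto
        have "(s x ^ 6 + 72 / r4 * s x ^ 4) * t x ^ 6 \<le> (1 + 72 / r4 * 1) * 1"
          using st[of x] r4 by (intro mult_mono add_mono power_le_one) auto
        from mult_mono[OF this 1] have "(s x ^ 6 + 72 / r4 * s x ^ 4) * t x ^ 6 * b x \<le> (1 + 72 / r4 * 1) * 1 * (a * B)"
          using bn[OF x] r4 by simp
        from mult_left_mono[OF this C0] G' have "C0 * (g x * b x) \<le> D * a" by (simp add: D_def algebra_simps)
        moreover have "x \<notin> N" using N(2) out by force
        moreover have "0 \<le> real T * F x" using Fn[OF x] by simp
        ultimately show ?thesis by simp
      qed
      then show ?thesis using x xc by (simp add: indicator_def)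
    qed
    note cut = cutoff_\<zeta>\<^sub>0[OF \<epsilon>(1)]
    have "continuous_on \<Omega> (\<lambda>x. (\<zeta>\<^sub>0 \<epsilon> x)^2 * Z x)" "continuous_on \<Omega> (\<lambda>x. ((\<zeta>\<^sub>0 \<epsilon> x)^2 + (\<gamma>\<^sub>0 \<epsilon> x)^2 * (norm x)^2) * Z x)"
      by (intro continuous_intros cutoff_continuous[OF cut] Zc)+
    from I_integrable[OF cut this(1), of 2 "real T"] I_integrable[OF cut this(2), of 2 "real T"]
    have Fi: "integrable lborel (\<lambda>x. indicator \<Omega> x *\<^sub>R F x)" and Gi: "integrable lborel (\<lambda>x. indicator \<Omega> x *\<^sub>R (g x * b x))"
      unfolding F G set_integrable_def by simp_all
    have ii: "integrable lborel (indicator (cball z d) :: real^'n \<Rightarrow> real)" for d and z :: "real^'n"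
      by (intro integrable_real_indicator) (use emeasure_lborel_cball_finite[of z d] in \<open>simp_all add: infinity_ennreal_def\<close>)
    note ci = integrable_mult_right[OF ii]
    have "integral\<^sup>L lborel (\<lambda>x. real T * k * a * indicator N x - D * a * indicator (cball 0 r) x)
       \<le> integral\<^sup>L lborel (\<lambda>x. real T * (indicator \<Omega> x *\<^sub>R F x) - C0 * (indicator \<Omega> x *\<^sub>R (g x * b x)))"
      by (intro Bochner_Integration.integral_mono Bochner_Integration.integrable_diff ci[folded N_def] ci integrable_mult_right Fi Gi pw)
        (simp_all add: N_def ii ci)
    also have "\<dots> = real T * I (real T) (\<lambda>x. (\<zeta>\<^sub>0 \<epsilon> x)^2 * Z x) - C0 * I (real T) (\<lambda>x. ((\<zeta>\<^sub>0 \<epsilon> x)^2 + (\<gamma>\<^sub>0 \<epsilon> x)^2 * (norm x)^2) * Z x)"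
      unfolding I_def F G set_lebesgue_integral_def using Fi Gi by (subst Bochner_Integration.integral_diff) auto
    also have "\<dots> \<le> 0" using est[OF _ cut, of "real T"] T(1) by simp
    also have "integral\<^sup>L lborel (\<lambda>x. real T * k * a * indicator N x - D * a * indicator (cball 0 r) x)
       = real T * k * a * measure lborel N - D * a * measure lborel (cball (0::real^'n) r)"
      by (subst Bochner_Integration.integral_diff) (simp_all add: N_def ii ci)
    finally have "a * (real T * k * measure lborel N) \<le> a * (D * measure lborel (cball (0::real^'n) r))" by (simp add: mult_ac)
    then show ?thesis using a by simp
  qed
  have pos: "k * measure lborel N > 0" using q0 content_cball_pos[OF \<delta>(1), of x0] c by (simp add: k_def N_def)
  obtain T :: nat where "real T > max 1 (max (2 * (C0 * (1 + 128 / r4))) (D * measure lborel (cball (0::real^'n) r) / (k * measure lborel N)))"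
    using reals_Archimedean2 by blast
  then show False using main[of T] pos by (simp add: field_simps)
qed

end

section \<open>Radial differential equations\<close>

lemma linear_family_bound:
  fixes L :: "'a::topological_space \<Rightarrow> 'b::euclidean_space \<Rightarrow> 'c::real_normed_vector"
  assumes K: "compact K" and lin: "\<And>x. x \<in> K \<Longrightarrow> linear (L x)" and c: "\<And>v. continuous_on K (\<lambda>x. L x v)"
  obtains B where "B \<ge> 0" "\<And>x v. x \<in> K \<Longrightarrow> norm (L x v) \<le> B * norm v"
proof -
  have "\<exists>B. \<forall>x\<in>K. norm (L x b) \<le> B" for b
    using compact_imp_bounded[OF compact_continuous_image[OF c K], of b] unfolding bounded_iff by blast
  then obtain M where M: "\<And>x b. x \<in> K \<Longrightarrow> norm (L x b) \<le> M b" by metis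
  show ?thesis
  proof (rule that)
    show "(\<Sum>b\<in>Basis. max 0 (M b)) \<ge> 0" by (intro sum_nonneg) simp
    fix x v assume x: "x \<in> K"
    have "L x v = (\<Sum>b\<in>Basis. (v \<bullet> b) *\<^sub>R L x b)" by (rule linear_basis_sum[OF lin[OF x]])
    also have "norm \<dots> \<le> (\<Sum>b\<in>Basis. max 0 (M b) * norm v)"
    proof (rule order_trans[OF norm_sum], rule sum_mono)
      fix b :: 'b assume "b \<in> Basis"
      then have "\<bar>v \<bullet> b\<bar> * norm (L x b) \<le> norm v * max 0 (M b)"
        using M[OF x, of b] by (intro mult_mono Basis_le_norm) auto
      then show "norm ((v \<bullet> b) *\<^sub>R L x b) \<le> max 0 (M b) * norm v" by (simp add: mult.commute)
    qed
    finally show "norm (L x v) \<le> (\<Sum>b\<in>Basis. max 0 (M b)) * norm v" by (simp add: sum_distrib_right)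
  qed
qed

lemma continuous_on_section: "continuous_on (S \<times> T) (\<lambda>(x, t). f x t) \<Longrightarrow> x \<in> S \<Longrightarrow> continuous_on T (f x)"
  by (rule continuous_on_compose2[of "S \<times> T" "\<lambda>(x, t). f x t" T "\<lambda>t. (x, t)", unfolded split_conv])
    (auto intro!: continuous_on_Pair continuous_on_const continuous_on_id)

lemma C1_integral:
  fixes f :: "'a::euclidean_space \<Rightarrow> real \<Rightarrow> 'b::euclidean_space"
  assumes U: "open U" "convex U" "x \<in> U"
    and d: "\<And>y t. y \<in> U \<Longrightarrow> t \<in> {0..1} \<Longrightarrow> ((\<lambda>y. f y t) has_derivative f' y t) (at y)"
    and c: "\<And>h. continuous_on (U \<times> {0..1}) (\<lambda>(y, t). f' y t h)"
    and i: "continuous_on (U \<times> {0..1}) (\<lambda>(y, t). f y t)"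
  shows "((\<lambda>y. integral {0..1} (f y)) has_derivative (\<lambda>h. integral {0..1} (\<lambda>t. f' x t h))) (at x)"
proof -
  have ap: "blinfun_apply (Blinfun (f' y t)) = f' y t" if "y \<in> U" "t \<in> {0..1}" for y t
    using d[OF that] by (intro bounded_linear_Blinfun_apply has_derivative_bounded_linear)
  have cb: "continuous_on (U \<times> cbox 0 1) (\<lambda>(y, t). Blinfun (f' y t))"
  proof (rule continuous_on_blinfun_componentwise)
    show "continuous_on (U \<times> cbox 0 1) (\<lambda>z. blinfun_apply (case z of (y, t) \<Rightarrow> Blinfun (f' y t)) b)" for b
      by (rule continuous_on_eq[OF c[of b, folded cbox_interval]]) (auto simp: ap)
  qed
  have *: "((\<lambda>y. integral (cbox 0 1) (f y)) has_derivative integral (cbox 0 1) (\<lambda>t. Blinfun (f' x t))) (at x within U)"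
    by (rule leibniz_rule[OF _ _ cb U(3,2)])
      (use d ap continuous_on_section[OF i] in \<open>auto intro: has_derivative_at_withinI integrable_continuous_real\<close>)
  have "blinfun_apply (integral (cbox 0 1) (\<lambda>t. Blinfun (f' x t))) h = integral {0..1} (\<lambda>t. f' x t h)" for h
    by (rule trans[OF blinfun_apply_integral[OF integrable_continuous[OF continuous_on_section[OF cb U(3)]]]],
      unfold cbox_interval, rule integral_cong) (use ap U in auto)
  then have "blinfun_apply (integral (cbox 0 1) (\<lambda>t. Blinfun (f' x t))) = (\<lambda>h. integral {0..1} (\<lambda>t. f' x t h))"
    by (rule ext)
  then show ?thesis using * unfolding at_within_open[OF U(3,1)] cbox_interval by simp
qed

section \<open>Picard iteration on all rays at once\<close>

lemma norm_scaleR_le: "t \<in> {0..1} \<Longrightarrow> norm (t *\<^sub>R x) \<le> norm x"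
  by (simp add: mult_left_le_one_le)

text \<open>Iterates for \<open>fd Z x x = A (Z x) x\<close>. On the ray through \<open>x\<close>
  this is the ordinary equation with right-hand side \<open>A (Z (t *\<^sub>R x)) x\<close> and
  initial value \<open>z0\<close>; the solution at \<open>x\<close> is the value at time 1, and
  \<open>x\<close> is kept as a parameter.\<close>

primrec picard :: "('b::euclidean_space \<Rightarrow> 'a::euclidean_space \<Rightarrow> 'b) \<Rightarrow> 'b \<Rightarrow> nat \<Rightarrow> 'a \<Rightarrow> 'b" where
  "picard A z0 0 x = z0"
| "picard A z0 (Suc k) x = z0 + integral {0..1} (\<lambda>t. A (picard A z0 k (t *\<^sub>R x)) x)"

definition radial_sol :: "('b::euclidean_space \<Rightarrow> 'a::euclidean_space \<Rightarrow> 'b) \<Rightarrow> 'b \<Rightarrow> 'a \<Rightarrow> 'b" where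
  "radial_sol A z0 x = lim (\<lambda>k. picard A z0 k x)"

text \<open>The system satisfied by the pair of a radial solution and its directional derivative.\<close>

definition aug :: "('b::euclidean_space \<Rightarrow> 'a::euclidean_space \<Rightarrow> 'b) \<Rightarrow> 'b \<times> 'b \<Rightarrow> 'a \<times> 'a \<Rightarrow> 'b \<times> 'b" where
  "aug A w y = (A (fst w) (fst y), A (fst w) (snd y) + fd (\<lambda>z. A z (fst y)) (fst w) (snd w))"

locale radial_ode =
  fixes A :: "'b::euclidean_space \<Rightarrow> 'a::euclidean_space \<Rightarrow> 'b" and \<Omega> :: "'b set" and z0 :: 'b
  assumes \<Omega>: "open \<Omega>" "z0 \<in> \<Omega>"
    and A_lin: "\<And>z. z \<in> \<Omega> \<Longrightarrow> linear (A z)"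
    and A_C1: "\<And>x. C_on 1 \<Omega> (\<lambda>z. A z x)"
begin

lemmas A_basis = linear_basis_sum[OF A_lin]

lemma A_continuous:
  assumes "continuous_on S f" "continuous_on S g" "\<And>y. y \<in> S \<Longrightarrow> f y \<in> \<Omega>"
  shows "continuous_on S (\<lambda>y. A (f y) (g y))"
proof -
  have "continuous_on S (\<lambda>y. A (f y) b)" for b
    by (rule continuous_on_compose2[OF C_on_continuous[OF A_C1] assms(1)]) (use assms(3) in auto)
  then have "continuous_on S (\<lambda>y. \<Sum>b\<in>Basis. (g y \<bullet> b) *\<^sub>R A (f y) b)"
    by (intro continuous_intros assms)
  then show ?thesis by (rule continuous_on_eq) (use A_basis assms(3) in auto)
qed

lemma A_diff: "z \<in> \<Omega> \<Longrightarrow> (\<lambda>z. A z x) differentiable (at z)"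
  using A_C1[of x] by simp

lemma fdA_linear:
  assumes z: "z \<in> \<Omega>" shows "linear (\<lambda>x. fd (\<lambda>z. A z x) z \<xi>)"
proof (rule linearI)
  fix x y
  have "fd (\<lambda>z. A z (x + y)) z = fd (\<lambda>z. A z x + A z y) z"
    by (rule fd_cong[OF \<Omega>(1) z]) (rule linear_add[OF A_lin])
  also have "\<dots> = (\<lambda>v. fd (\<lambda>z. A z x) z v + fd (\<lambda>z. A z y) z v)"
    by (rule fd_eq[OF has_derivative_add[OF fd_works fd_works]]) (rule A_diff[OF z])+
  finally show "fd (\<lambda>z. A z (x + y)) z \<xi> = fd (\<lambda>z. A z x) z \<xi> + fd (\<lambda>z. A z y) z \<xi>" by simp
next
  fix c x
  have "fd (\<lambda>z. A z (c *\<^sub>R x)) z = fd (\<lambda>z. c *\<^sub>R A z x) z"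
    by (rule fd_cong[OF \<Omega>(1) z]) (rule linear_cmul[OF A_lin])
  also have "\<dots> = (\<lambda>v. c *\<^sub>R fd (\<lambda>z. A z x) z v)"
    by (rule fd_eq[OF has_derivative_scaleR_right[OF fd_works]]) (rule A_diff[OF z])
  finally show "fd (\<lambda>z. A z (c *\<^sub>R x)) z \<xi> = c *\<^sub>R fd (\<lambda>z. A z x) z \<xi>" by simp
qed

lemma fdA_continuous:
  assumes "continuous_on S f" "continuous_on S g" "continuous_on S \<xi>" "\<And>y. y \<in> S \<Longrightarrow> f y \<in> \<Omega>"
  shows "continuous_on S (\<lambda>y. fd (\<lambda>z. A z (g y)) (f y) (\<xi> y))"
proof -
  have "continuous_on S (\<lambda>y. fd (\<lambda>z. A z b) (f y) c)" for b c
    by (rule continuous_on_compose2[OF C_on_deriv_continuous[OF A_C1[unfolded One_nat_def]] assms(1)])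
      (use assms(4) in auto)
  then have "continuous_on S (\<lambda>y. \<Sum>b\<in>Basis. (g y \<bullet> b) *\<^sub>R (\<Sum>c\<in>Basis. (\<xi> y \<bullet> c) *\<^sub>R fd (\<lambda>z. A z b) (f y) c))"
    by (intro continuous_intros assms)
  then show ?thesis
    by (rule continuous_on_eq)
      (simp only: linear_basis_sum[OF fdA_linear[OF assms(4)], where x="g _"] fd_basis_sum[OF A_diff[OF assms(4)], where u="\<xi> _"])
qed

lemma A_has_derivative:
  assumes f: "(f has_derivative f') (at y)" and g: "(g has_derivative g') (at y)" and y: "f y \<in> \<Omega>"
  shows "((\<lambda>y. A (f y) (g y)) has_derivative (\<lambda>h. A (f y) (g' h) + fd (\<lambda>z. A z (g y)) (f y) (f' h))) (at y)"
proof -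
  have "((\<lambda>y. A (f y) b) has_derivative (\<lambda>h. fd (\<lambda>z. A z b) (f y) (f' h))) (at y)" for b
    using diff_chain_at[OF f fd_works[OF A_diff[OF y]]] by (simp add: o_def)
  then have "((\<lambda>y. \<Sum>b\<in>Basis. (g y \<bullet> b) *\<^sub>R A (f y) b) has_derivative
    (\<lambda>h. \<Sum>b\<in>Basis. (g y \<bullet> b) *\<^sub>R fd (\<lambda>z. A z b) (f y) (f' h) + (g' h \<bullet> b) *\<^sub>R A (f y) b)) (at y)"
    by (intro has_derivative_sum has_derivative_scaleR has_derivative_inner_left g)
  then have *: "((\<lambda>y. \<Sum>b\<in>Basis. (g y \<bullet> b) *\<^sub>R A (f y) b) has_derivative
    (\<lambda>h. A (f y) (g' h) + fd (\<lambda>z. A z (g y)) (f y) (f' h))) (at y)"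
    unfolding sum.distrib A_basis[OF y, symmetric] linear_basis_sum[OF fdA_linear[OF y], symmetric]
    by (simp add: add.commute)
  have "\<forall>\<^sub>F x in at y. f x \<in> \<Omega>"
    using has_derivative_continuous[OF f] \<Omega>(1) y unfolding continuous_within by (rule topological_tendstoD)
  then show ?thesis
    by (intro has_derivative_transform_eventually[OF *])
      (auto elim!: eventually_mono simp: A_basis[symmetric] y)
qed

text \<open>Linearity in \<open>x\<close> reduces both bounds to unit vectors, where compactness
  applies.\<close>

lemma A_lipschitz:
  assumes K: "compact K" "convex K" "K \<subseteq> \<Omega>"
  obtains B where "B \<ge> 0" "\<And>z x. z \<in> K \<Longrightarrow> norm (A z x) \<le> B * norm x"
    "\<And>z w x. z \<in> K \<Longrightarrow> w \<in> K \<Longrightarrow> norm (A z x - A w x) \<le> B * norm (z - w) * norm x"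
proof -
  obtain B where B: "B \<ge> 0" "\<And>z x. z \<in> K \<Longrightarrow> norm (A z x) \<le> B * norm x"
    by (rule linear_family_bound[OF K(1), of A])
      (use A_lin K continuous_on_subset[OF C_on_continuous[OF A_C1] K(3)] in auto)
  obtain L where L: "L \<ge> 0"
    "\<And>p \<xi>. p \<in> K \<times> cball 0 1 \<Longrightarrow> norm (fd (\<lambda>z. A z (snd p)) (fst p) \<xi>) \<le> L * norm \<xi>"
  proof (rule linear_family_bound[of "K \<times> cball (0::'a) 1" "\<lambda>p. fd (\<lambda>z. A z (snd p)) (fst p)"])
    show "compact (K \<times> cball (0::'a) 1)" by (intro compact_Times K compact_cball)
    show "continuous_on (K \<times> cball 0 1) (\<lambda>p. fd (\<lambda>z. A z (snd p)) (fst p) v)" for v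
      by (intro fdA_continuous continuous_intros) (use K in auto)
    show "linear (fd (\<lambda>z. A z (snd p)) (fst p))" if "p \<in> K \<times> cball 0 1" for p
      by (intro has_derivative_linear[OF fd_works] A_diff) (use that K in auto)
  qed blast
  show ?thesis
  proof (rule that[of "B + L"])
    fix z w x assume z: "z \<in> K" "w \<in> K"
    show "norm (A z x) \<le> (B + L) * norm x" using B(2)[OF z(1)] L(1) by (simp add: add_increasing2 distrib_right)
    have "norm (A z (sgn x) - A w (sgn x)) \<le> L * norm (z - w)"
      by (rule differentiable_bound[where f'="\<lambda>z. fd (\<lambda>z. A z (sgn x)) z", OF K(2) _ _ z])
        (use K in \<open>auto intro!: has_derivative_at_withinI[OF fd_works] A_diff onorm_le L(2)[of "(_, sgn x)", simplified] simp: norm_sgn\<close>)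
    moreover have "A z x - A w x = norm x *\<^sub>R (A z (sgn x) - A w (sgn x))"
      using linear_cmul[OF A_lin, of z "norm x" "sgn x"] linear_cmul[OF A_lin, of w "norm x" "sgn x"] subsetD[OF K(3)] z
      by (cases "x = 0") (auto simp: sgn_div_norm scaleR_diff_right)
    ultimately have "norm (A z x - A w x) \<le> norm x * (L * norm (z - w))" by (simp add: mult_left_mono)
    also have "\<dots> \<le> (B + L) * norm (z - w) * norm x" using B(1) by (simp add: algebra_simps)
    finally show "norm (A z x - A w x) \<le> (B + L) * norm (z - w) * norm x" .
  qed (use B L in simp)
qed

lemma integrand_continuous:
  assumes f: "continuous_on S f" "\<And>x. x \<in> S \<Longrightarrow> f x \<in> \<Omega>" and S: "\<And>x t. x \<in> S \<Longrightarrow> t \<in> {0..1} \<Longrightarrow> t *\<^sub>R x \<in> S"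
  shows "continuous_on (S \<times> {0..1}) (\<lambda>(x, t). A (f (t *\<^sub>R x)) x)"
  unfolding split_beta
  by (intro A_continuous continuous_on_compose2[OF f(1)] continuous_intros) (use f(2) S in auto)

lemma picard_converges:
  obtains \<rho> K where "\<rho> > 0" "compact K" "K \<subseteq> \<Omega>" "\<And>k. continuous_on (cball 0 \<rho>) (picard A z0 k)"
    "\<And>k x. x \<in> cball 0 \<rho> \<Longrightarrow> picard A z0 k x \<in> K"
    "uniform_limit (cball 0 \<rho>) (picard A z0) (radial_sol A z0) sequentially"
proof -
  obtain \<delta> where \<delta>: "\<delta> > 0" "cball z0 \<delta> \<subseteq> \<Omega>" using \<Omega> open_contains_cball by metis
  define K where "K = cball z0 \<delta>"
  have K: "compact K" "convex K" "K \<subseteq> \<Omega>" using \<delta> by (auto simp: K_def)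
  obtain B where B: "B \<ge> 0" "\<And>z x. z \<in> K \<Longrightarrow> norm (A z x) \<le> B * norm x"
    "\<And>z w x. z \<in> K \<Longrightarrow> w \<in> K \<Longrightarrow> norm (A z x - A w x) \<le> B * norm (z - w) * norm x"
    using A_lipschitz[OF K] by blast
  \<comment> \<open>\<open>B * \<rho> \<le> \<delta>\<close> keeps the iterates in \<open>K\<close>,
    and \<open>B * \<rho> \<le> 1 / 2\<close> makes the iteration contract.\<close>
  define \<rho> where "\<rho> = min \<delta> (1 / 2) / (B + 1)"
  have "\<rho> * (B + 1) = min \<delta> (1 / 2)" using B by (simp add: \<rho>_def)
  moreover have \<rho>: "\<rho> > 0" using B \<delta> by (simp add: \<rho>_def)
  ultimately have B\<rho>: "B * \<rho> \<le> \<delta>" "B * \<rho> \<le> 1 / 2" by (auto simp: algebra_simps)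
  have sc: "t *\<^sub>R x \<in> cball 0 \<rho>" if "x \<in> cball 0 \<rho>" "t \<in> {0..1}" for t and x :: 'a
    using that norm_scaleR_le[OF that(2), of x] by simp
  have i: "continuous_on (cball 0 \<rho> \<times> {0..1}) (\<lambda>(x, t). A (f (t *\<^sub>R x)) x)"
    if "continuous_on (cball 0 \<rho>) f" "\<And>x. x \<in> cball 0 \<rho> \<Longrightarrow> f x \<in> K" for f
    by (rule integrand_continuous) (use that sc K in auto)
  have main: "continuous_on (cball 0 \<rho>) (picard A z0 k) \<and> (\<forall>x\<in>cball 0 \<rho>. picard A z0 k x \<in> K)" for k
  proof (induction k)
    case (Suc k)
    note c = i[OF Suc.IH[THEN conjunct1] Suc.IH[THEN conjunct2, rule_format]]
    have "picard A z0 (Suc k) x \<in> K" if x: "x \<in> cball 0 \<rho>" for x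
    proof -
      have "norm (integral {0..1} (\<lambda>t. A (picard A z0 k (t *\<^sub>R x)) x)) \<le> B * norm x * (1 - 0)"
        by (rule integral_bound) (use continuous_on_section[OF c x] B(2) Suc.IH sc[OF x] in auto)
      also have "\<dots> \<le> B * \<rho>" using x B by (auto intro: mult_left_mono)
      finally show ?thesis using B\<rho> by (simp add: K_def dist_norm)
    qed
    then show ?case
      using integral_continuous_on_param[OF c[folded cbox_interval]] by (auto intro!: continuous_intros simp: cbox_interval)
  qed (use \<delta> in \<open>auto simp: K_def\<close>)
  note mc = main[THEN conjunct1] and mK = main[THEN conjunct2, rule_format]
  have ci: "continuous_on {0..1} (\<lambda>t. A (picard A z0 k (t *\<^sub>R x)) x)" if "x \<in> cball 0 \<rho>" for k x
    by (rule continuous_on_section[OF i[OF mc mK] that])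
  have step: "norm (picard A z0 (Suc k) x - picard A z0 k x) \<le> \<delta> * (1/2) ^ k" if "x \<in> cball 0 \<rho>" for k x
    using that
  proof (induction k arbitrary: x)
    case 0
    then show ?case using mK[of x "Suc 0"] by (auto simp: K_def dist_norm norm_minus_commute simp del: picard.simps(2))
  next
    case (Suc k)
    let ?d = "\<lambda>t. A (picard A z0 (Suc k) (t *\<^sub>R x)) x - A (picard A z0 k (t *\<^sub>R x)) x"
    have "picard A z0 (Suc (Suc k)) x - picard A z0 (Suc k) x = integral {0..1} ?d"
      by (subst (1 2) picard.simps(2))
        (simp add: integral_diff[OF integrable_continuous_real integrable_continuous_real, OF ci ci, OF Suc.prems Suc.prems] del: picard.simps(2))
    also have "norm \<dots> \<le> B * (\<delta> * (1/2) ^ k) * \<rho> * (1 - 0)"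
    proof (rule integral_bound)
      show "continuous_on {0..1} ?d" by (intro continuous_on_diff ci Suc.prems)
      fix t :: real assume t: "t \<in> {0..1}"
      note sx = sc[OF Suc.prems t]
      show "norm (?d t) \<le> B * (\<delta> * (1/2) ^ k) * \<rho>"
        by (rule order_trans[OF B(3)[OF mK[OF sx] mK[OF sx]]])
          (use Suc.IH[OF sx] Suc.prems B(1) \<delta>(1) in \<open>intro mult_mono, auto\<close>)
    qed simp
    also have "\<dots> = (B * \<rho>) * (\<delta> * (1/2) ^ k)" by simp
    also have "\<dots> \<le> (1/2) * (\<delta> * (1/2) ^ k)" using B\<rho> \<delta> by (intro mult_right_mono) auto
    finally show ?case by simp
  qed
  define Z where "Z x = z0 + suminf (\<lambda>i. picard A z0 (Suc i) x - picard A z0 i x)" for x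
  have "uniform_limit (cball 0 \<rho>) (\<lambda>n x. \<Sum>i<n. picard A z0 (Suc i) x - picard A z0 i x)
      (\<lambda>x. suminf (\<lambda>i. picard A z0 (Suc i) x - picard A z0 i x)) sequentially"
    by (rule Weierstrass_m_test[OF step]) (auto intro: summable_mult summable_geometric)
  moreover have "(\<Sum>i<n. picard A z0 (Suc i) x - picard A z0 i x) = picard A z0 n x - z0" for n x
    by (subst sum_lessThan_telescope) simp
  ultimately
  have ulZ: "uniform_limit (cball 0 \<rho>) (picard A z0) Z sequentially"
    using uniform_limit_add[OF uniform_limit_const, of _ _ _ _ "\<lambda>_. z0"]
    unfolding Z_def by fastforce
  have "radial_sol A z0 x = Z x" if "x \<in> cball 0 \<rho>" for x
    unfolding radial_sol_def by (rule limI[OF tendsto_uniform_limitI[OF ulZ that]])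
  then have "uniform_limit (cball 0 \<rho>) (picard A z0) (radial_sol A z0) sequentially"
    using ulZ by (subst uniform_limit_cong'[where g="picard A z0" and i=Z]) auto
  then show ?thesis using that[OF \<rho> K(1,3) mc mK] by blast
qed

lemma aug_C_on:
  assumes "\<And>x. C_on (Suc k) \<Omega> (\<lambda>z. A z x)"
  shows "C_on k (\<Omega> \<times> (UNIV :: 'b set)) (\<lambda>w. aug A w y)"
proof -
  have op: "open (\<Omega> \<times> (UNIV :: 'b set))" by (intro open_Times \<Omega> open_UNIV)
  have f: "C_on k (\<Omega> \<times> (UNIV :: 'b set)) (fst :: 'b \<times> 'b \<Rightarrow> 'b)" "C_on k (\<Omega> \<times> (UNIV :: 'b set)) (snd :: 'b \<times> 'b \<Rightarrow> 'b)"
    by (intro C_on_linear bounded_linear_fst bounded_linear_snd)+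
  have a: "C_on k (\<Omega> \<times> (UNIV :: 'b set)) (\<lambda>w. A (fst w) x)" for x
    by (rule C_on_compose[where g="\<lambda>z. A z x", OF f(1) C_on_SucD[OF assms] op \<Omega>(1)]) auto
  have d: "C_on k (\<Omega> \<times> (UNIV :: 'b set)) (\<lambda>w. fd (\<lambda>z. A z x) (fst w) c)" for x c
    by (rule C_on_compose[where g="\<lambda>z. fd (\<lambda>z. A z x) z c", OF f(1) C_on_fd[OF assms] op \<Omega>(1)]) auto
  have "C_on k (\<Omega> \<times> (UNIV :: 'b set)) (\<lambda>w. \<Sum>c\<in>Basis. (snd w \<bullet> c) *\<^sub>R fd (\<lambda>z. A z (fst y)) (fst w) c)"
    by (intro C_on_sum C_on_scaleR d op C_on_linear_compose[OF bounded_linear_inner_left f(2)])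
  then have "C_on k (\<Omega> \<times> (UNIV :: 'b set)) (\<lambda>w. fd (\<lambda>z. A z (fst y)) (fst w) (snd w))"
    by (rule C_on_cong[OF _ op]) (auto intro!: fd_basis_sum[symmetric] A_diff)
  then show ?thesis unfolding aug_def by (intro C_on_Pair C_on_add a op)
qed

lemma aug_radial_ode:
  assumes "\<And>x. C_on 2 \<Omega> (\<lambda>z. A z x)"
  shows "radial_ode (aug A) (\<Omega> \<times> UNIV) (z0, 0)"
proof (rule radial_ode.intro)
  show "open (\<Omega> \<times> (UNIV :: 'b set))" by (intro open_Times \<Omega> open_UNIV)
  show "(z0, 0 :: 'b) \<in> \<Omega> \<times> UNIV" using \<Omega> by simp
  fix w :: "'b \<times> 'b" assume "w \<in> \<Omega> \<times> UNIV"
  then have z: "fst w \<in> \<Omega>" by auto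
  show "linear (aug A w)"
    using linear_add[OF A_lin[OF z]] linear_cmul[OF A_lin[OF z]]
      linear_add[OF fdA_linear[OF z, of "snd w"]] linear_cmul[OF fdA_linear[OF z, of "snd w"]]
    by (intro linearI) (auto simp: aug_def algebra_simps)
next
  fix y :: "'a \<times> 'a" show "C_on 1 (\<Omega> \<times> (UNIV :: 'b set)) (\<lambda>w. aug A w y)"
    by (rule aug_C_on) (use assms in \<open>simp only: Suc_1\<close>)
qed

text \<open>The iterates of the augmented system are the iterates \<open>p k\<close> paired with
  their directional derivatives. So the uniform convergence known for the augmented system is that
  of the derivatives, and the limit is differentiable. Its derivative is read off from the augmented
  solution, which transfers regularity with a gain of one order.\<close>

theorem radial_sol_regular:
  assumes A2: "\<And>x. C_on 2 \<Omega> (\<lambda>z. A z x)" and \<epsilon>: "\<epsilon> > 0"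
  obtains \<rho> where "\<rho> > 0" "\<rho> \<le> \<epsilon>" "continuous_on (ball 0 (2 * \<rho>)) (radial_sol (aug A) (z0, 0))"
    "\<And>x. x \<in> ball 0 \<rho> \<Longrightarrow> radial_sol A z0 x \<in> \<Omega>"
    "\<And>x. x \<in> ball 0 \<rho> \<Longrightarrow> fd (radial_sol A z0) x x = A (radial_sol A z0 x) x"
    "\<And>k. C_on k (ball 0 (2 * \<rho>)) (radial_sol (aug A) (z0, 0)) \<Longrightarrow> C_on (Suc k) (ball 0 \<rho>) (radial_sol A z0)"
proof -
  interpret B: radial_ode "aug A" "\<Omega> \<times> UNIV" "(z0, 0)" by (rule aug_radial_ode[OF A2])
  define p where "p = picard A z0"
  define P where "P = picard (aug A) (z0, 0)"
  define Z where "Z = radial_sol A z0"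
  define Y where "Y = radial_sol (aug A) (z0, 0)"
  obtain \<rho>1 K where \<rho>1: "\<rho>1 > 0" and K: "compact K" "K \<subseteq> \<Omega>" and "\<And>k. continuous_on (cball 0 \<rho>1) (p k)"
    and pK: "\<And>k x. x \<in> cball 0 \<rho>1 \<Longrightarrow> p k x \<in> K" and ul1: "uniform_limit (cball 0 \<rho>1) p Z sequentially"
    by (rule picard_converges[folded Z_def p_def]) (rule that)
  obtain \<rho>2 L where \<rho>2: "\<rho>2 > 0" and "compact L" "L \<subseteq> \<Omega> \<times> UNIV" and Pc: "\<And>k. continuous_on (cball 0 \<rho>2) (P k)"
    and "\<And>k x. x \<in> cball 0 \<rho>2 \<Longrightarrow> P k x \<in> L" and ul2: "uniform_limit (cball 0 \<rho>2) P Y sequentially"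
    by (rule B.picard_converges[folded Y_def P_def]) (rule that)
  define \<rho> where "\<rho> = min \<epsilon> (min \<rho>1 (\<rho>2 / 2))"
  have \<rho>: "\<rho> > 0" "\<rho> \<le> \<epsilon>" "\<rho> \<le> \<rho>1" "2 * \<rho> \<le> \<rho>2" using \<rho>1 \<rho>2 \<epsilon> by (auto simp: \<rho>_def)
  have pair_in: "(x, \<rho> *\<^sub>R b) \<in> ball 0 (2 * \<rho>)" "(x, \<rho> *\<^sub>R b) \<in> cball 0 \<rho>2" if "x \<in> ball 0 \<rho>" "b \<in> Basis" for x b :: 'a
    using that(1) norm_Basis[OF that(2)] \<rho> norm_Pair_le[of x "\<rho> *\<^sub>R b"] by simp_all
  have sc: "t *\<^sub>R x \<in> ball 0 \<rho>" if "x \<in> ball 0 \<rho>" "t \<in> {0..1}" for t and x :: 'a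
    using that norm_scaleR_le[OF that(2), of x] by simp
  have p\<Omega>: "p k x \<in> \<Omega>" if "x \<in> ball 0 \<rho>" for k x
    using pK[of x k] K \<rho> that by auto
  have Zlim: "(\<lambda>n. p n x) \<longlonglongrightarrow> Z x" if "x \<in> ball 0 \<rho>" for x
    by (rule tendsto_uniform_limitI[OF ul1]) (use that \<rho> in auto)
  have Z\<Omega>: "Z x \<in> \<Omega>" if "x \<in> ball 0 \<rho>" for x
    using Lim_in_closed_set[OF compact_imp_closed[OF K(1)] _ _ Zlim[OF that]] pK[of x] that \<rho> K(2) by auto
  define f' where "f' k y t h = A (p k (t *\<^sub>R y)) h + fd (\<lambda>z. A z y) (p k (t *\<^sub>R y)) (t *\<^sub>R fd (p k) (t *\<^sub>R y) h)" for k y t h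
  have ps: "p (Suc k) = (\<lambda>y. z0 + integral {0..1} (\<lambda>t. A (p k (t *\<^sub>R y)) y))" for k
    by (auto simp: p_def)
  have *: "continuous_on (ball 0 \<rho> \<times> {0..1}) (\<lambda>(y, t). f' k y t h)"
    "x \<in> ball 0 \<rho> \<Longrightarrow> (p (Suc k) has_derivative (\<lambda>h. integral {0..1} (\<lambda>t. f' k x t h))) (at x)"
    if pk: "C_on (Suc 0) (ball 0 \<rho>) (p k)" for k h x
  proof -
    note d = C_on_has_derivative[OF pk]
    show fc: "continuous_on (ball 0 \<rho> \<times> {0..1}) (\<lambda>(y, t). f' k y t h)" for h
      unfolding f'_def split_beta
      by (intro continuous_on_add A_continuous fdA_continuous continuous_on_scaleR continuous_on_fst continuous_on_snd
        continuous_on_id continuous_on_const continuous_on_compose2[OF C_on_continuous[OF pk]]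
        continuous_on_compose2[OF C_on_deriv_continuous[OF pk]])
        (use p\<Omega> sc in auto)
    have "((\<lambda>y. A (p k (t *\<^sub>R y)) y) has_derivative f' k y t) (at y)" if y: "y \<in> ball 0 \<rho>" and t: "t \<in> {0..1}" for y t
    proof -
      have l: "((\<lambda>y. t *\<^sub>R y) has_derivative (\<lambda>h. t *\<^sub>R h)) (at y)" by (auto intro!: derivative_eq_intros)
      have "fd (p k) (t *\<^sub>R y) (t *\<^sub>R h) = t *\<^sub>R fd (p k) (t *\<^sub>R y) h" for h
        by (rule linear_cmul[OF has_derivative_linear[OF d[OF sc[OF y t]]]])
      then show ?thesis
        using A_has_derivative[OF diff_chain_at[OF l d[OF sc[OF y t]]] has_derivative_ident] p\<Omega>[OF sc[OF y t]]
        by (simp add: o_def f'_def[abs_def])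
    qed
    from has_derivative_add[OF has_derivative_const C1_integral[OF open_ball convex_ball _ this fc
      integrand_continuous[OF C_on_continuous[OF pk] p\<Omega> sc]]]
    show "x \<in> ball 0 \<rho> \<Longrightarrow> (p (Suc k) has_derivative (\<lambda>h. integral {0..1} (\<lambda>t. f' k x t h))) (at x)"
      unfolding ps by simp
  qed
  have good: "C_on (Suc 0) (ball 0 \<rho>) (p k) \<and> (\<forall>x\<in>ball 0 \<rho>. \<forall>h. P k (x, h) = (p k x, fd (p k) x h))" for k
  proof (induction k)
    case 0
    have "p 0 = (\<lambda>_. z0)" by (auto simp: p_def)
    then show ?case by (simp add: P_def)
  next
    case (Suc k)
    note c = Suc.IH[THEN conjunct1] and e = Suc.IH[THEN conjunct2, rule_format]
    have "P (Suc k) (x, h) = (p (Suc k) x, fd (p (Suc k)) x h)" if x: "x \<in> ball 0 \<rho>" for x h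
    proof -
      define F where "F t = (A (p k (t *\<^sub>R x)) x, f' k x t h)" for t
      have "aug A (P k (t *\<^sub>R x, t *\<^sub>R h)) (x, h) = F t" if t: "t \<in> {0..1}" for t
        unfolding e[OF sc[OF x t]] linear_cmul[OF has_derivative_linear[OF C_on_has_derivative[OF c sc[OF x t]]]]
        by (simp add: aug_def F_def f'_def)
      then have "P (Suc k) (x, h) = (z0, 0) + integral {0..1} F"
        unfolding P_def by simp (rule integral_cong, simp)
      moreover have Fi: "F integrable_on {0..1}" unfolding F_def
        by (intro integrable_continuous_real continuous_on_Pair continuous_on_section[OF *(1)[OF c] x]
          continuous_on_section[OF integrand_continuous[OF C_on_continuous[OF c] p\<Omega> sc] x])
      ultimately show ?thesis
        using integral_linear[OF Fi bounded_linear_fst] integral_linear[OF Fi bounded_linear_snd]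
        unfolding fd_eq[OF *(2)[OF c x]] by (simp add: prod_eq_iff o_def F_def ps)
    qed
    moreover have "C_on (Suc 0) (ball 0 \<rho>) (p (Suc k))"
      by (rule C_on_SucI[OF *(2)[OF c]])
        (use integral_continuous_on_param[OF *(1)[OF c, folded cbox_interval]] in \<open>simp_all add: cbox_interval\<close>)
    ultimately show ?case by blast
  qed
  note pc = good[THEN conjunct1] and Pe = good[THEN conjunct2, rule_format]
  note pd = C_on_has_derivative[OF pc]
  \<comment> \<open>The augmented solution is known only for small directions; basis vectors are
    scaled by \<open>\<rho>\<close> to fit and scaled back by linearity.\<close>
  define g' where "g' x v = (\<Sum>b\<in>Basis. ((v \<bullet> b) / \<rho>) *\<^sub>R snd (Y (x, \<rho> *\<^sub>R b)))" for x v
  have fdp: "fd (p n) x v = (\<Sum>b\<in>Basis. ((v \<bullet> b) / \<rho>) *\<^sub>R snd (P n (x, \<rho> *\<^sub>R b)))" if x: "x \<in> ball 0 \<rho>" for n x v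
    unfolding Pe[OF x] snd_conv linear_cmul[OF has_derivative_linear[OF pd[OF x]]]
    by (subst linear_basis_sum[OF has_derivative_linear[OF pd[OF x]]]) (use \<rho> in simp)
  have fdlim: "(\<lambda>n. fd (p n) x v) \<longlonglongrightarrow> g' x v" if "x \<in> ball 0 \<rho>" for x v
    unfolding fdp[OF that] g'_def by (intro tendsto_intros tendsto_uniform_limitI[OF ul2] pair_in that)
  have "\<exists>g. \<forall>x\<in>ball 0 \<rho>. (\<lambda>n. p n x) \<longlonglongrightarrow> g x \<and> (g has_derivative g' x) (at x within ball 0 \<rho>)"
  proof (rule has_derivative_sequence)
    show "convex (ball (0::'a) \<rho>)" "0 \<in> ball 0 \<rho>" using \<rho> by auto
    then show "(\<lambda>n. p n 0) \<longlonglongrightarrow> Z 0" by (intro Zlim)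
    show "(p n has_derivative fd (p n) x) (at x within ball 0 \<rho>)" if "x \<in> ball 0 \<rho>" for n x
      by (rule has_derivative_at_withinI[OF pd[OF that]])
    fix e :: real assume e: "e > 0"
    define e' where "e' = e * \<rho> / DIM('a)"
    have "\<forall>\<^sub>F n in sequentially. \<forall>w\<in>cball 0 \<rho>2. dist (P n w) (Y w) < e'"
      using ul2 e \<rho> unfolding uniform_limit_iff e'_def by simp
    then show "\<forall>\<^sub>F n in sequentially. \<forall>x\<in>ball (0::'a) \<rho>. \<forall>h. norm (fd (p n) x h - g' x h) \<le> e * norm h"
    proof (rule eventually_mono, intro ballI allI)
      fix n and x h :: 'a assume u: "\<forall>w\<in>cball 0 \<rho>2. dist (P n w) (Y w) < e'" and x: "x \<in> ball 0 \<rho>"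
      have "fd (p n) x h - g' x h = (\<Sum>b\<in>Basis. ((h \<bullet> b) / \<rho>) *\<^sub>R (snd (P n (x, \<rho> *\<^sub>R b)) - snd (Y (x, \<rho> *\<^sub>R b))))"
        unfolding fdp[OF x] g'_def by (simp add: sum_subtractf scaleR_diff_right)
      also have "norm \<dots> \<le> (\<Sum>b\<in>(Basis::'a set). norm h / \<rho> * e')"
      proof (rule sum_norm_le)
        fix b :: 'a assume b: "b \<in> Basis"
        have "dist (snd (P n (x, \<rho> *\<^sub>R b))) (snd (Y (x, \<rho> *\<^sub>R b))) \<le> e'"
          using u pair_in(2)[OF x b] by (meson dist_snd_le less_imp_le order_trans)
        then show "norm (((h \<bullet> b) / \<rho>) *\<^sub>R (snd (P n (x, \<rho> *\<^sub>R b)) - snd (Y (x, \<rho> *\<^sub>R b)))) \<le> norm h / \<rho> * e'"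
          using \<rho> Basis_le_norm[OF b, of h] unfolding norm_scaleR dist_norm
          by (intro mult_mono) (auto simp: divide_right_mono)
      qed
      also have "\<dots> = e * norm h" using \<rho> by (simp add: e'_def)
      finally show "norm (fd (p n) x h - g' x h) \<le> e * norm h" .
    qed
  qed
  then obtain g where g: "\<And>x. x \<in> ball 0 \<rho> \<Longrightarrow> (\<lambda>n. p n x) \<longlonglongrightarrow> g x"
    "\<And>x. x \<in> ball 0 \<rho> \<Longrightarrow> (g has_derivative g' x) (at x within ball 0 \<rho>)" by blast
  have Zd: "(Z has_derivative g' x) (at x)" if x: "x \<in> ball 0 \<rho>" for x
  proof (rule has_derivative_transform_within_open[OF _ open_ball x])
    show "(g has_derivative g' x) (at x)" using g(2)[OF x] unfolding at_within_open[OF x open_ball] .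
    show "g y = Z y" if "y \<in> ball 0 \<rho>" for y using LIMSEQ_unique[OF g(1) Zlim] that by blast
  qed
  show ?thesis
  proof (rule that[OF \<rho>(1,2)], unfold Z_def[symmetric] Y_def[symmetric])
    have "continuous_on (cball 0 \<rho>2) Y" by (rule uniform_limit_theorem[OF _ ul2]) (use Pc in auto)
    then show "continuous_on (ball 0 (2 * \<rho>)) Y" by (rule continuous_on_subset) (use \<rho> in auto)
    show "C_on (Suc k) (ball 0 \<rho>) Z" if Y: "C_on k (ball 0 (2 * \<rho>)) Y" for k
    proof (rule C_on_SucI[OF Zd])
      show "C_on k (ball 0 \<rho>) (\<lambda>x. g' x v)" for v unfolding g'_def
        by (intro C_on_sum C_on_scaleR C_on_const C_on_snd open_ball
          C_on_compose[OF C_on_Pair[OF C_on_linear[OF bounded_linear_ident] C_on_const] Y] pair_in) auto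
    qed auto
    fix x :: 'a assume x: "x \<in> ball 0 \<rho>"
    show "Z x \<in> \<Omega>" by (rule Z\<Omega>[OF x])
    \<comment> \<open>The integrand of the derivative of \<open>p (Suc k)\<close> in direction
      \<open>x\<close> is the derivative in \<open>t\<close> of
      \<open>A (p k (t *\<^sub>R x)) (t *\<^sub>R x)\<close>, which vanishes at
      \<open>t = 0\<close>.\<close>
    have fr: "fd (p (Suc k)) x x = A (p k x) x" for k
    proof -
      have "((\<lambda>t. A (p k (t *\<^sub>R x)) (t *\<^sub>R x)) has_vector_derivative f' k x t x) (at t within {0..1})" if t: "t \<in> {0..1}" for t
      proof -
        note s = sc[OF x t]
        have l: "((\<lambda>t. t *\<^sub>R x) has_derivative (\<lambda>h. h *\<^sub>R x)) (at t)" by (auto intro!: derivative_eq_intros)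
        show ?thesis
          using has_derivative_at_withinI[OF A_has_derivative[OF diff_chain_at[OF l pd[OF s]] l]] p\<Omega>[OF s]
            linear_cmul[OF has_derivative_linear[OF pd[OF s]]] linear_cmul[OF A_lin[OF p\<Omega>[OF s]]]
            linear_cmul[OF fdA_linear[OF p\<Omega>[OF s]]] linear_cmul[OF has_derivative_linear[OF fd_works[OF A_diff[OF p\<Omega>[OF s]]]]]
          by (simp add: has_vector_derivative_def o_def f'_def scaleR_add_right mult.commute)
      qed
      from fundamental_theorem_of_calculus[OF _ this] show ?thesis
        using linear_0[OF A_lin[OF \<Omega>(2)]] linear_0[OF A_lin[OF p\<Omega>[of 0 k]]] \<rho>
        unfolding fd_eq[OF *(2)[OF pc x]] by (simp add: integral_unique)
    qed
    have "isCont (\<lambda>z. A z x) (Z x)" by (rule differentiable_imp_continuous_within[OF A_diff[OF Z\<Omega>[OF x]]])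
    then have "(\<lambda>n. A (p n x) x) \<longlonglongrightarrow> A (Z x) x" by (rule isCont_tendsto_compose[OF _ Zlim[OF x]])
    then show "fd Z x x = A (Z x) x"
      using LIMSEQ_Suc[OF fdlim[OF x, of x]] unfolding fr fd_eq[OF Zd[OF x]] by (metis LIMSEQ_unique)
  qed
qed

text \<open>Two rounds of the bootstrap: \<open>A\<close> of class C^3 makes \<open>aug A\<close> of
  class C^2, so the augmented solution is C^1 and the solution itself C^2.\<close>

theorem radial_ode_solution:
  assumes A3: "\<And>x. C_on 3 \<Omega> (\<lambda>z. A z x)"
  obtains \<rho> Z where "\<rho> > 0" "C_on 2 (ball 0 \<rho>) Z" "Z 0 = z0"
    "\<And>x. x \<in> ball 0 \<rho> \<Longrightarrow> Z x \<in> \<Omega>" "\<And>x. x \<in> ball 0 \<rho> \<Longrightarrow> fd Z x x = A (Z x) x"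
proof -
  have A2: "C_on 2 \<Omega> (\<lambda>z. A z x)" for x by (rule C_on_mono[OF A3]) simp
  interpret B: radial_ode "aug A" "\<Omega> \<times> UNIV" "(z0, 0)" by (rule aug_radial_ode[OF A2])
  have "C_on 2 (\<Omega> \<times> (UNIV :: 'b set)) (\<lambda>w. aug A w y)" for y
    by (rule aug_C_on) (use A3 in \<open>simp add: numeral_3_eq_3 numeral_2_eq_2 del: C_on.simps\<close>)
  from B.radial_sol_regular[OF this zero_less_one]
  obtain \<rho>2 where 2: "\<rho>2 > 0" "C_on (Suc 0) (ball 0 \<rho>2) (radial_sol (aug A) (z0, 0))" by (metis C_on.simps(1))
  obtain \<rho> where 1: "\<rho> > 0" "\<rho> \<le> \<rho>2 / 2"
    "\<And>x. x \<in> ball 0 \<rho> \<Longrightarrow> radial_sol A z0 x \<in> \<Omega>"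
    "\<And>x. x \<in> ball 0 \<rho> \<Longrightarrow> fd (radial_sol A z0) x x = A (radial_sol A z0 x) x"
    "\<And>k. C_on k (ball 0 (2 * \<rho>)) (radial_sol (aug A) (z0, 0)) \<Longrightarrow> C_on (Suc k) (ball 0 \<rho>) (radial_sol A z0)"
    using radial_sol_regular[OF A2, of "\<rho>2 / 2"] 2(1) by (metis half_gt_zero)
  have "picard A z0 k 0 = z0" for k
    by (induction k) (simp_all add: linear_0[OF A_lin[OF \<Omega>(2)]])
  then have "radial_sol A z0 0 = z0" by (simp add: radial_sol_def)
  moreover have "C_on 2 (ball 0 \<rho>) (radial_sol A z0)"
    unfolding numeral_2_eq_2 by (intro 1(5) C_on_subset[OF 2(2)]) (use 1(2) in auto)
  ultimately show ?thesis using that[OF 1(1) _ _ 1(3,4)] by blast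
qed

end



section \<open>Tensor calculus in a chart\<close>

text \<open>Exchanging \<open>k\<close> with entry \<open>a\<close> of the list is an involution. It
  moves a Christoffel contraction from a tensor index to the vector in that slot.\<close>

lemma bij_update_reindex:
  fixes f :: "'i::finite list \<Rightarrow> 'i \<Rightarrow> real"
  assumes "a < m"
  shows "(\<Sum>I | length I = m. \<Sum>k\<in>UNIV. f I k) = (\<Sum>I | length I = m. \<Sum>k\<in>UNIV. f (I[a := k]) (I ! a))"
proof -
  have "(\<Sum>(I, k) \<in> {I. length I = m} \<times> UNIV. f I k) = (\<Sum>(I, k) \<in> {I. length I = m} \<times> UNIV. f (I[a := k]) (I ! a))"
    by (rule sum.reindex_bij_witness[where i="\<lambda>(I, k). (I[a := k], I ! a)" and j="\<lambda>(I, k). (I[a := k], I ! a)"])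
      (use assms in auto)
  then show ?thesis by (simp only: sum.cartesian_product)
qed

lemma finite_lists_of_length [simp]: "finite {I :: 'i::finite list. length I = m}"
  using finite_lists_length_eq[of "UNIV :: 'i set" m] by simp

lemma tensor_apply_Nil: "tensor_apply T [] = T []"
  by (simp add: tensor_apply_def)

lemma sum_lists_Suc:
  "(\<Sum>I | length I = Suc m. f I) = (\<Sum>i\<in>(UNIV::'i::finite set). \<Sum>I | length I = m. f (i # I))"
proof -
  have "(\<Sum>I | length I = Suc m. f I) = (\<Sum>(i, I) \<in> UNIV \<times> {I. length I = m}. f (i # I))"
    by (rule sum.reindex_bij_witness[where i="\<lambda>(i, I). i # I" and j="\<lambda>I. (hd I, tl I)"])
      (auto simp: length_Suc_conv)
  then show ?thesis by (simp add: sum.cartesian_product)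
qed

lemma tensor_apply_Cons:
  "tensor_apply T (v # vs) = (\<Sum>i\<in>UNIV. v $ i * tensor_apply (\<lambda>I. T (i # I)) vs)"
proof -
  have "(\<Prod>a<Suc (length vs). (v # vs) ! a $ ((i # I) ! a)) = v $ i * (\<Prod>a<length vs. vs ! a $ (I ! a))" for i I
    unfolding prod.lessThan_Suc_shift by simp
  then show ?thesis
    unfolding tensor_apply_def
    by (simp add: sum_lists_Suc sum_distrib_left algebra_simps)
qed

lemma tensor_apply_update:
  assumes "a < length vs"
  shows "tensor_apply T (vs[a := w]) =
    (\<Sum>I | length I = length vs. T I * (w $ (I ! a) * (\<Prod>b\<in>{..<length vs} - {a}. vs ! b $ (I ! b))))"
proof -
  have "(\<Prod>b<length vs. vs[a := w] ! b $ (I ! b)) = w $ (I ! a) * (\<Prod>b\<in>{..<length vs} - {a}. vs ! b $ (I ! b))" for I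
  proof -
    have "(\<Prod>b<length vs. vs[a := w] ! b $ (I ! b)) = vs[a := w] ! a $ (I ! a) * (\<Prod>b\<in>{..<length vs} - {a}. vs[a := w] ! b $ (I ! b))"
      by (rule prod.remove) (use assms in auto)
    also have "(\<Prod>b\<in>{..<length vs} - {a}. vs[a := w] ! b $ (I ! b)) = (\<Prod>b\<in>{..<length vs} - {a}. vs ! b $ (I ! b))"
      by (rule prod.cong) auto
    finally show ?thesis using assms by simp
  qed
  then show ?thesis unfolding tensor_apply_def by simp
qed

lemma tensor_apply_update_add:
  assumes "a < length vs"
  shows "tensor_apply T (vs[a := u + w]) = tensor_apply T (vs[a := u]) + tensor_apply T (vs[a := w])"
  unfolding tensor_apply_update[OF assms] by (simp add: sum.distrib[symmetric] algebra_simps)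

text \<open>The covariant derivative along \<open>u\<close> of the constant coordinate field
  \<open>v\<close>, as a bilinear map.\<close>

definition Gam :: "(real^'n \<Rightarrow> real^'n^'n::finite) \<Rightarrow> real^'n \<Rightarrow> real^'n \<Rightarrow> real^'n \<Rightarrow> real^'n" where
  "Gam G y u v = (\<chi> k. \<Sum>i\<in>UNIV. \<Sum>j\<in>UNIV. christoffel G k i j y * (u $ i * v $ j))"

lemma fd_axis_sum:
  fixes f :: "real^'n::finite \<Rightarrow> 'b::real_normed_vector"
  assumes "f differentiable (at x)"
  shows "fd f x v = (\<Sum>i\<in>UNIV. v $ i *\<^sub>R fd f x (axis i 1))"
proof -
  interpret bounded_linear "fd f x" by (rule fd_bounded_linear[OF assms])
  have "fd f x v = fd f x (\<Sum>i\<in>UNIV. v $ i *\<^sub>R axis i 1)" by (simp add: vec_axis_sum)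
  then show ?thesis by (simp only: sum scaleR)
qed

text \<open>The invariant form of the index formula: by \<open>bij_update_reindex\<close> the
  correction in slot \<open>a\<close> becomes the insertion of
  \<open>Gam G y u (vs ! a)\<close>.\<close>

lemma tensor_apply_cov_deriv:
  assumes d: "\<And>I. length I = length vs \<Longrightarrow> (\<lambda>y. T y I) differentiable (at y)"
  shows "tensor_apply (cov_deriv G T y) (u # vs) =
    (\<Sum>I | length I = length vs. fd (\<lambda>y. T y I) y u * (\<Prod>a<length vs. vs ! a $ (I ! a)))
    - (\<Sum>a<length vs. tensor_apply (T y) (vs[a := Gam G y u (vs ! a)]))"
proof -
  define m where "m = length vs"
  define Q where "Q I = (\<Prod>a<m. vs ! a $ (I ! a))" for I
  define C where "C I = (\<Sum>a<m. \<Sum>k\<in>UNIV. (\<Sum>i\<in>UNIV. u $ i * christoffel G k i (I ! a) y) * T y (I[a := k]))" for I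
  have 1: "tensor_apply (cov_deriv G T y) (u # vs) = (\<Sum>I | length I = m. (fd (\<lambda>y. T y I) y u - C I) * Q I)"
  proof -
    have "tensor_apply (cov_deriv G T y) (u # vs) = (\<Sum>I | length I = m. (\<Sum>i\<in>UNIV. u $ i * cov_deriv G T y (i # I)) * Q I)"
      unfolding tensor_apply_Cons unfolding tensor_apply_def m_def[symmetric] Q_def[symmetric]
      by (simp add: sum_distrib_left sum_distrib_right mult.assoc) (rule sum.swap)
    also have "\<dots> = (\<Sum>I | length I = m. (fd (\<lambda>y. T y I) y u - C I) * Q I)"
    proof (rule sum.cong[OF refl])
      fix I :: "'a list" assume "I \<in> {I. length I = m}"
      then have I: "length I = m" "length I = length vs" by (auto simp: m_def)
      have "(\<Sum>i\<in>UNIV. u $ i * cov_deriv G T y (i # I)) = (\<Sum>i\<in>UNIV. u $ i * partial i (\<lambda>y. T y I) y)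
         - (\<Sum>i\<in>UNIV. \<Sum>a<m. \<Sum>k\<in>UNIV. u $ i * christoffel G k i (I ! a) y * T y (I[a := k]))"
        using I by (simp add: algebra_simps sum_subtractf sum_distrib_left)
      also have "(\<Sum>i\<in>UNIV. u $ i * partial i (\<lambda>y. T y I) y) = fd (\<lambda>y. T y I) y u"
        unfolding fd_axis_sum[OF d[OF I(2)], of u] by (simp add: partial_def)
      also have "(\<Sum>i\<in>UNIV. \<Sum>a<m. \<Sum>k\<in>UNIV. u $ i * christoffel G k i (I ! a) y * T y (I[a := k])) = C I"
        unfolding C_def sum_distrib_right
        by (subst sum.swap, rule sum.cong[OF refl], rule sum.swap)
      finally show "(\<Sum>i\<in>UNIV. u $ i * cov_deriv G T y (i # I)) * Q I = (fd (\<lambda>y. T y I) y u - C I) * Q I" by simp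
    qed
    finally show ?thesis .
  qed
  have 2: "(\<Sum>I | length I = m. (\<Sum>k\<in>UNIV. (\<Sum>i\<in>UNIV. u $ i * christoffel G k i (I ! a) y) * T y (I[a := k])) * Q I)
    = tensor_apply (T y) (vs[a := Gam G y u (vs ! a)])" if a: "a < m" for a
  proof -
    define Q' where "Q' I = (\<Prod>b\<in>{..<m} - {a}. vs ! b $ (I ! b))" for I
    have Q: "Q I = vs ! a $ (I ! a) * Q' I" for I
      unfolding Q_def Q'_def by (rule prod.remove) (use a in auto)
    have Qu: "Q' (I[a := k]) = Q' I" if "length I = m" for I k
      unfolding Q'_def by (rule prod.cong) auto
    have "(\<Sum>I | length I = m. (\<Sum>k\<in>UNIV. (\<Sum>i\<in>UNIV. u $ i * christoffel G k i (I ! a) y) * T y (I[a := k])) * Q I)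
      = (\<Sum>I | length I = m. \<Sum>k\<in>UNIV. (\<Sum>i\<in>UNIV. u $ i * christoffel G k i (I ! a) y) * T y (I[a := k]) * (vs ! a $ (I ! a) * Q' I))"
      unfolding Q by (simp add: sum_distrib_right)
    also have "\<dots> = (\<Sum>I | length I = m. \<Sum>k\<in>UNIV. (\<Sum>i\<in>UNIV. u $ i * christoffel G (I ! a) i k y) * T y I * (vs ! a $ k * Q' I))"
      by (subst bij_update_reindex[OF a]) (use a in \<open>auto intro!: sum.cong simp: Qu\<close>)
    also have "\<dots> = (\<Sum>I | length I = m. T y I * ((Gam G y u (vs ! a)) $ (I ! a) * Q' I))"
    proof (rule sum.cong[OF refl])
      fix I
      have "(Gam G y u (vs ! a)) $ (I ! a) = (\<Sum>k\<in>UNIV. (\<Sum>i\<in>UNIV. u $ i * christoffel G (I ! a) i k y) * vs ! a $ k)"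
        unfolding Gam_def by (simp add: sum_distrib_right) (subst sum.swap, simp add: algebra_simps)
      then show "(\<Sum>k\<in>UNIV. (\<Sum>i\<in>UNIV. u $ i * christoffel G (I ! a) i k y) * T y I * (vs ! a $ k * Q' I))
         = T y I * ((Gam G y u (vs ! a)) $ (I ! a) * Q' I)"
        by (simp add: sum_distrib_left sum_distrib_right mult_ac)
    qed
    also have "\<dots> = tensor_apply (T y) (vs[a := Gam G y u (vs ! a)])"
      using tensor_apply_update[of a vs "T y"] a unfolding m_def Q'_def by simp
    finally show ?thesis .
  qed
  have "(\<Sum>I | length I = m. C I * Q I) = (\<Sum>a<m. tensor_apply (T y) (vs[a := Gam G y u (vs ! a)]))"
  proof -
    have "(\<Sum>I | length I = m. C I * Q I) = (\<Sum>a<m. \<Sum>I | length I = m. (\<Sum>k\<in>UNIV. (\<Sum>i\<in>UNIV. u $ i * christoffel G k i (I ! a) y) * T y (I[a := k])) * Q I)"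
      unfolding C_def sum_distrib_right by (rule sum.swap)
    also have "\<dots> = (\<Sum>a<m. tensor_apply (T y) (vs[a := Gam G y u (vs ! a)]))"
      by (rule sum.cong[OF refl]) (rule 2, simp)
    finally show ?thesis .
  qed
  then show ?thesis unfolding 1 by (simp add: left_diff_distrib sum_subtractf m_def[symmetric] Q_def[symmetric])
qed

text \<open>The Leibniz rule for vector fields along a map:
  \<open>V' a h + Gam G (F x) (F' h) (V a x)\<close> is the covariant derivative of
  \<open>V a\<close> along \<open>F\<close>. The derivatives of frame components come from
  it.\<close>

lemma tensor_apply_along:
  fixes F :: "'a::real_normed_vector \<Rightarrow> real^'n::finite"
  assumes F: "(F has_derivative F') (at x)"
    and V: "\<And>a. a < m \<Longrightarrow> (V a has_derivative V' a) (at x)"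
    and d: "\<And>I. length I = m \<Longrightarrow> (\<lambda>y. T y I) differentiable (at (F x))"
  shows "((\<lambda>x. tensor_apply (T (F x)) (map (\<lambda>a. V a x) [0..<m])) has_derivative
     (\<lambda>h. tensor_apply (cov_deriv G T (F x)) (F' h # map (\<lambda>a. V a x) [0..<m])
       + (\<Sum>a<m. tensor_apply (T (F x)) ((map (\<lambda>a. V a x) [0..<m])[a := V' a h + Gam G (F x) (F' h) (V a x)])))) (at x)"
proof -
  define vs where "vs = map (\<lambda>a. V a x) [0..<m]"
  have vs: "length vs = m" "\<And>a. a < m \<Longrightarrow> vs ! a = V a x" by (auto simp: vs_def)
  have T: "((\<lambda>x. T (F x) I) has_derivative (\<lambda>h. fd (\<lambda>y. T y I) (F x) (F' h))) (at x)" if "length I = m" for I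
    using diff_chain_at[OF F fd_works[OF d[OF that]]] by (simp add: o_def)
  have P: "((\<lambda>x. \<Prod>a<m. V a x $ (I ! a)) has_derivative
     (\<lambda>h. \<Sum>a<m. V' a h $ (I ! a) * (\<Prod>b\<in>{..<m} - {a}. V b x $ (I ! b)))) (at x)" for I
    by (rule has_derivative_prod) (use V in \<open>auto intro: bounded_linear.has_derivative[OF bounded_linear_vec_nth]\<close>)
  have "((\<lambda>x. \<Sum>I | length I = m. T (F x) I * (\<Prod>a<m. V a x $ (I ! a))) has_derivative
     (\<lambda>h. \<Sum>I | length I = m. T (F x) I * (\<Sum>a<m. V' a h $ (I ! a) * (\<Prod>b\<in>{..<m} - {a}. V b x $ (I ! b)))
        + fd (\<lambda>y. T y I) (F x) (F' h) * (\<Prod>a<m. V a x $ (I ! a)))) (at x)"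
    by (intro has_derivative_sum has_derivative_mult T P) simp
  moreover have "(\<lambda>x. tensor_apply (T (F x)) (map (\<lambda>a. V a x) [0..<m])) = (\<lambda>x. \<Sum>I | length I = m. T (F x) I * (\<Prod>a<m. V a x $ (I ! a)))"
    unfolding tensor_apply_def by (intro ext) simp
  moreover have "(\<Sum>I | length I = m. T (F x) I * (\<Sum>a<m. V' a h $ (I ! a) * (\<Prod>b\<in>{..<m} - {a}. V b x $ (I ! b)))
        + fd (\<lambda>y. T y I) (F x) (F' h) * (\<Prod>a<m. V a x $ (I ! a)))
     = tensor_apply (cov_deriv G T (F x)) (F' h # vs) + (\<Sum>a<m. tensor_apply (T (F x)) (vs[a := V' a h + Gam G (F x) (F' h) (V a x)]))" for h
  proof -
    have 1: "tensor_apply (cov_deriv G T (F x)) (F' h # vs) =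
      (\<Sum>I | length I = m. fd (\<lambda>y. T y I) (F x) (F' h) * (\<Prod>a<m. V a x $ (I ! a)))
      - (\<Sum>a<m. tensor_apply (T (F x)) (vs[a := Gam G (F x) (F' h) (V a x)]))"
      using tensor_apply_cov_deriv[of vs T "F x" G "F' h"] d vs by simp
    have 2: "tensor_apply (T (F x)) (vs[a := V' a h + Gam G (F x) (F' h) (V a x)])
       = tensor_apply (T (F x)) (vs[a := V' a h]) + tensor_apply (T (F x)) (vs[a := Gam G (F x) (F' h) (V a x)])" if "a < m" for a
      by (rule tensor_apply_update_add) (use that vs in simp)
    have 3: "(\<Sum>a<m. tensor_apply (T (F x)) (vs[a := V' a h]))
      = (\<Sum>I | length I = m. T (F x) I * (\<Sum>a<m. V' a h $ (I ! a) * (\<Prod>b\<in>{..<m} - {a}. V b x $ (I ! b))))"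
    proof -
      have "(\<Sum>a<m. tensor_apply (T (F x)) (vs[a := V' a h]))
        = (\<Sum>a<m. \<Sum>I | length I = m. T (F x) I * (V' a h $ (I ! a) * (\<Prod>b\<in>{..<m} - {a}. V b x $ (I ! b))))"
      proof (rule sum.cong[OF refl])
        fix a assume a: "a \<in> {..<m}"
        then show "tensor_apply (T (F x)) (vs[a := V' a h])
          = (\<Sum>I | length I = m. T (F x) I * (V' a h $ (I ! a) * (\<Prod>b\<in>{..<m} - {a}. V b x $ (I ! b))))"
          using tensor_apply_update[of a vs "T (F x)" "V' a h"] vs by simp
      qed
      also have "\<dots> = (\<Sum>I | length I = m. T (F x) I * (\<Sum>a<m. V' a h $ (I ! a) * (\<Prod>b\<in>{..<m} - {a}. V b x $ (I ! b))))"
        unfolding sum_distrib_left by (rule sum.swap)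
      finally show ?thesis .
    qed
    show ?thesis unfolding 1 sum.distrib 3[symmetric] by (simp add: 2 sum.distrib)
  qed
  ultimately show ?thesis unfolding vs_def[symmetric] by simp
qed

section \<open>Curvature\<close>

definition gdot :: "(real^'n \<Rightarrow> real^'n^'n::finite) \<Rightarrow> real^'n \<Rightarrow> real^'n \<Rightarrow> real^'n \<Rightarrow> real" where
  "gdot G y u v = (\<Sum>i\<in>UNIV. \<Sum>j\<in>UNIV. G y $ i $ j * (u $ i * v $ j))"

text \<open>The curvature endomorphism \<open>R(u, v) w\<close>, computed with constant coordinate
  fields, whose brackets vanish; \<open>Rop_axis\<close> identifies it with
  \<open>curvature_op\<close>.\<close>

definition Rop :: "(real^'n \<Rightarrow> real^'n^'n::finite) \<Rightarrow> real^'n \<Rightarrow> real^'n \<Rightarrow> real^'n \<Rightarrow> real^'n \<Rightarrow> real^'n" where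
  "Rop G y u v w = fd (\<lambda>z. Gam G z v w) y u - fd (\<lambda>z. Gam G z u w) y v
     + Gam G y u (Gam G y v w) - Gam G y v (Gam G y u w)"

text \<open>Cramer's rule writes the entries of the inverse as quotients of determinants.\<close>

lemma C_on_matrix_inv:
  fixes M :: "'a::euclidean_space \<Rightarrow> real^'n^'n::finite"
  assumes S: "open S" and M: "\<And>a b. C_on k S (\<lambda>x. M x $ a $ b)" and inv: "\<And>x. x \<in> S \<Longrightarrow> invertible (M x)"
  shows "C_on k S (\<lambda>x. matrix_inv (M x) $ i $ j)"
proof -
  define D where "D x = det (\<chi> a b. if b = i then axis j 1 $ a else M x $ a $ b)" for x
  have nz: "det (M x) \<noteq> 0" if "x \<in> S" for x using inv[OF that] by (simp add: invertible_det_nz)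
  have det: "C_on k S (\<lambda>x. det (M x :: real^'n^'n))" if "\<And>a b. C_on k S (\<lambda>x. M x $ a $ b)" for M
    unfolding det_def by (intro C_on_sum C_on_mult C_on_const C_on_prod that S)
  have "C_on k S (\<lambda>x. D x * inverse (det (M x)))"
  proof (intro C_on_mult C_on_inverse S)
    show "C_on k S D" unfolding D_def
    proof (rule det)
      show "C_on k S (\<lambda>x. (\<chi> a b. if b = i then axis j 1 $ a else M x $ a $ b) $ a $ b)" for a b
        by (cases "b = i") (simp_all add: M)
    qed
  qed (use nz in \<open>auto intro: det M\<close>)
  then show ?thesis
  proof (rule C_on_cong[OF _ S])
    fix x assume x: "x \<in> S"
    have "M x ** matrix_inv (M x) = mat 1"
      using matrix_inv_mult_sum(1)[OF inv[OF x]]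
      by (simp add: vec_eq_iff matrix_matrix_mult_def mat_def)
    then have "M x *v (matrix_inv (M x) *v axis j 1) = axis j 1"
      by (simp add: matrix_vector_mul_assoc)
    then have "matrix_inv (M x) *v axis j 1 = (\<chi> k. det (\<chi> a b. if b = k then axis j 1 $ a else M x $ a $ b) / det (M x))"
      using cramer[OF nz[OF x]] by blast
    then have "(matrix_inv (M x) *v axis j 1) $ i = D x / det (M x)" by (simp add: D_def)
    then show "D x * inverse (det (M x)) = matrix_inv (M x) $ i $ j"
      by (simp add: matrix_vector_mult_basis column_def divide_inverse)
  qed
qed

section \<open>Connection and curvature of a metric on an open set\<close>

locale metric_patch =
  fixes G :: "real^'n \<Rightarrow> real^'n^'n::finite" and S :: "(real^'n) set"
  assumes S: "open S"
    and G_smooth: "\<And>i j. smooth_on S (\<lambda>x. G x $ i $ j)"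
    and G_sym: "x \<in> S \<Longrightarrow> G x $ i $ j = G x $ j $ i"
    and G_pos: "x \<in> S \<Longrightarrow> v \<noteq> 0 \<Longrightarrow> gdot G x v v > 0"
begin

lemma G_C_on: "C_on k S (\<lambda>x. G x $ i $ j)"
  using G_smooth by (rule smooth_on_C_on)

lemma G_invertible: assumes "x \<in> S" shows "invertible (G x)" "det (G x) \<noteq> 0"
proof -
  have "v = 0" if "G x *v v = 0" for v
  proof (rule ccontr)
    assume "v \<noteq> 0"
    moreover have "gdot G x v v = (\<Sum>i\<in>UNIV. v $ i * (G x *v v) $ i)"
      by (simp add: gdot_def matrix_vector_mult_def sum_distrib_left mult_ac)
    ultimately show False using G_pos[OF assms, of v] that by simp
  qed
  then have "\<exists>B. B ** G x = mat 1" by (simp add: matrix_left_invertible_ker)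
  then show i: "invertible (G x)" by (simp add: invertible_left_inverse)
  then show "det (G x) \<noteq> 0" by (simp add: invertible_det_nz)
qed

lemma ginv_C_on: "C_on k S (ginv G i j)"
  unfolding ginv_def by (rule C_on_matrix_inv[OF S G_C_on G_invertible(1)])

lemma partial_C_on: "(\<And>k. C_on k S f) \<Longrightarrow> C_on k S (partial i f)"
  unfolding partial_def using C_on_fd[of k S f] by blast

lemma christoffel_C_on: "C_on k S (christoffel G l i j)"
proof -
  have "C_on k S (\<lambda>x. (\<Sum>l'\<in>UNIV. ginv G l l' x * (partial i (\<lambda>y. G y $ j $ l') x + partial j (\<lambda>y. G y $ i $ l') x
          - partial l' (\<lambda>y. G y $ i $ j) x)) * (1/2))"
    by (intro C_on_mult C_on_sum C_on_add C_on_diff partial_C_on ginv_C_on G_C_on C_on_const S)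
  then show ?thesis unfolding christoffel_def[abs_def] by simp
qed

lemma cov_deriv_C_on:
  assumes "\<And>I k. C_on k S (\<lambda>x. T x I)"
  shows "C_on k S (\<lambda>x. cov_deriv G T x I)"
proof (cases I)
  case (Cons i J)
  have "C_on k S (\<lambda>x. partial i (\<lambda>y. T y J) x
     - (\<Sum>a<length J. \<Sum>k\<in>UNIV. christoffel G k i (J ! a) x * T x (J[a := k])))"
    by (intro C_on_diff C_on_sum C_on_mult partial_C_on christoffel_C_on assms S)
  then show ?thesis using Cons by simp
qed simp

lemma cov_deriv_pow_C_on:
  assumes "\<And>I k. C_on k S (\<lambda>x. T x I)"
  shows "C_on k S (\<lambda>x. (cov_deriv G ^^ m) T x I)"
  by (induction m arbitrary: k I) (auto intro!: assms cov_deriv_C_on)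

lemma riemann_C_on: "C_on k S (\<lambda>x. riemann G x I)"
  unfolding riemann_def curvature_op_def
  by (intro C_on_sum C_on_mult C_on_add C_on_diff partial_C_on christoffel_C_on G_C_on S)

lemma Gam_C_on: "C_on k S (\<lambda>y. Gam G y u v)"
  unfolding Gam_def by (rule C_on_vec) (auto intro!: C_on_sum C_on_mult christoffel_C_on S)

lemma Gam_diff: "y \<in> S \<Longrightarrow> (\<lambda>y. Gam G y u v) differentiable (at y)"
  using Gam_C_on[of 1 u v] by simp

lemma Gam_bilinear: "bounded_bilinear (Gam G y)"
proof -
  have "bilinear (Gam G y)"
    unfolding bilinear_def Gam_def
    by (auto intro!: linearI simp: vec_eq_iff sum.distrib algebra_simps sum_distrib_left)
  then show ?thesis by (simp add: bilinear_conv_bounded_bilinear)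
qed

sublocale Gam: bounded_bilinear "Gam G y" for y
  by (rule Gam_bilinear)

lemma Gam_sym: "y \<in> S \<Longrightarrow> Gam G y u v = Gam G y v u"
proof -
  assume y: "y \<in> S"
  have "christoffel G k i j y = christoffel G k j i y" for k i j
    by (rule christoffel_symmetric[OF _ S y]) (rule G_sym)
  then show ?thesis unfolding Gam_def vec_eq_iff vec_lambda_beta
    by (subst sum.swap) (simp add: mult.commute)
qed

lemma gdot_bilinear: "bounded_bilinear (gdot G y)"
proof -
  have "bilinear (gdot G y)"
    unfolding bilinear_def gdot_def
    by (auto intro!: linearI simp: sum.distrib algebra_simps sum_distrib_left)
  then show ?thesis by (simp add: bilinear_conv_bounded_bilinear)
qed

sublocale gdot: bounded_bilinear "gdot G y" for y
  by (rule gdot_bilinear)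

lemma gdot_sym: "y \<in> S \<Longrightarrow> gdot G y u v = gdot G y v u"
  unfolding gdot_def by (subst sum.swap) (simp add: G_sym mult.commute)

lemma gdot_C_on: "C_on k S (\<lambda>y. gdot G y u v)"
  unfolding gdot_def by (intro C_on_sum C_on_mult C_on_const G_C_on S)

lemmas Gam_simps = Gam.add_left Gam.add_right
  Gam.diff_left Gam.diff_right
  Gam.minus_left Gam.minus_right
lemmas gdot_simps = gdot.add_left gdot.add_right
  gdot.diff_left gdot.diff_right
  gdot.minus_left gdot.minus_right

lemma metric_compatible:
  assumes y: "y \<in> S"
  shows "fd (\<lambda>z. gdot G z u v) y w = gdot G y (Gam G y w u) v + gdot G y u (Gam G y w v)"
proof -
  define T where "T = (\<lambda>y I. G y $ (I ! 0) $ (I ! (1::nat)))"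
  have TA: "tensor_apply (T z) [a, b] = gdot G z a b" for z a b
    by (simp add: tensor_apply_Cons tensor_apply_Nil T_def gdot_def sum_distrib_left mult_ac)
  have dT: "(\<lambda>y. T y I) differentiable (at y)" for I
    using G_C_on[of 1] y by (simp add: T_def)
  have "cov_deriv G T y [k, i, j] = 0" for k i j
    unfolding T_def by (rule christoffel_metric[where S=S and G=G and x=y, OF _ S y G_invertible(1)[OF y]]) (rule G_sym)
  then have "0 = tensor_apply (cov_deriv G T y) [w, u, v]"
    by (simp add: tensor_apply_Cons tensor_apply_Nil)
  also have "\<dots> = (\<Sum>I | length I = 2. fd (\<lambda>y. T y I) y w * (\<Prod>a<2. [u, v] ! a $ (I ! a)))
     - (tensor_apply (T y) [Gam G y w u, v] + tensor_apply (T y) [u, Gam G y w v])"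
    using tensor_apply_cov_deriv[of "[u, v]" T y G w] dT by (simp add: numeral_2_eq_2 lessThan_Suc)
  also have "(\<Sum>I | length I = 2. fd (\<lambda>y. T y I) y w * (\<Prod>a<2. [u, v] ! a $ (I ! a))) = fd (\<lambda>z. gdot G z u v) y w"
  proof -
    have A: "((\<lambda>z. \<Sum>I | length I = 2. T z I * (\<Prod>a<2. [u, v] ! a $ (I ! a))) has_derivative
      (\<lambda>w. \<Sum>I | length I = 2. fd (\<lambda>y. T y I) y w * (\<Prod>a<2. [u, v] ! a $ (I ! a)))) (at y)"
      by (intro has_derivative_sum has_derivative_mult_left fd_works dT)
    have B: "(\<lambda>z. \<Sum>I | length I = 2. T z I * (\<Prod>a<2. [u, v] ! a $ (I ! a))) = (\<lambda>z. gdot G z u v)"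
      unfolding TA[symmetric] by (simp add: tensor_apply_def numeral_2_eq_2)
    show ?thesis unfolding fd_eq[OF A[unfolded B]] ..
  qed
  finally show ?thesis unfolding TA by linarith
qed

end

lemma param_bilinear_has_derivative:
  fixes B :: "real^'n::finite \<Rightarrow> real^'n \<Rightarrow> real^'n \<Rightarrow> 'c::real_normed_vector"
  assumes bil: "\<And>y. bounded_bilinear (B y)"
    and d: "\<And>u v. (\<lambda>y. B y u v) differentiable (at (F x))"
    and F: "(F has_derivative F') (at x)" and V: "(V has_derivative V') (at x)" and W: "(W has_derivative W') (at x)"
  shows "((\<lambda>x. B (F x) (V x) (W x)) has_derivative
    (\<lambda>h. fd (\<lambda>y. B y (V x) (W x)) (F x) (F' h) + (B (F x) (V' h) (W x) + B (F x) (V x) (W' h)))) (at x)"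
proof -
  have e: "B y u v = (\<Sum>i\<in>UNIV. \<Sum>j\<in>UNIV. (u $ i * v $ j) *\<^sub>R B y (axis i 1) (axis j 1))" for y u v
  proof -
    interpret bounded_bilinear "B y" by (rule bil)
    have "B y u v = B y (\<Sum>i\<in>UNIV. u $ i *\<^sub>R axis i 1) (\<Sum>j\<in>UNIV. v $ j *\<^sub>R axis j 1)" by (simp add: vec_axis_sum)
    also have "\<dots> = (\<Sum>i\<in>UNIV. \<Sum>j\<in>UNIV. (u $ i * v $ j) *\<^sub>R B y (axis i 1) (axis j 1))"
      unfolding sum_left sum_right scaleR_left scaleR_right scaleR_sum_right scaleR_scaleR
      by (rule trans[OF sum.swap]) (simp only: mult.commute)
    finally show ?thesis .
  qed
  have c: "((\<lambda>x. V x $ i) has_derivative (\<lambda>h. V' h $ i)) (at x)" "((\<lambda>x. W x $ i) has_derivative (\<lambda>h. W' h $ i)) (at x)" for i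
    using V W by (auto intro: bounded_linear.has_derivative[OF bounded_linear_vec_nth])
  have b: "((\<lambda>x. B (F x) u v) has_derivative (\<lambda>h. fd (\<lambda>y. B y u v) (F x) (F' h))) (at x)" for u v
    using diff_chain_at[OF F fd_works[OF d]] by (simp add: o_def)
  have fdB: "fd (\<lambda>y. B y u v) (F x) h = (\<Sum>i\<in>UNIV. \<Sum>j\<in>UNIV. (u $ i * v $ j) *\<^sub>R fd (\<lambda>y. B y (axis i 1) (axis j 1)) (F x) h)" for u v h
  proof -
    have "((\<lambda>y. \<Sum>i\<in>UNIV. \<Sum>j\<in>UNIV. (u $ i * v $ j) *\<^sub>R B y (axis i 1) (axis j 1)) has_derivative
      (\<lambda>h. \<Sum>i\<in>UNIV. \<Sum>j\<in>UNIV. (u $ i * v $ j) *\<^sub>R fd (\<lambda>y. B y (axis i 1) (axis j 1)) (F x) h)) (at (F x))"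
      by (intro has_derivative_sum has_derivative_scaleR_right fd_works d)
    then show ?thesis unfolding e[of _ u v, symmetric] by (simp add: fd_eq)
  qed
  have "((\<lambda>x. \<Sum>i\<in>UNIV. \<Sum>j\<in>UNIV. (V x $ i * W x $ j) *\<^sub>R B (F x) (axis i 1) (axis j 1)) has_derivative
     (\<lambda>h. \<Sum>i\<in>UNIV. \<Sum>j\<in>UNIV. (V x $ i * W x $ j) *\<^sub>R fd (\<lambda>y. B y (axis i 1) (axis j 1)) (F x) (F' h)
       + (V x $ i * W' h $ j + V' h $ i * W x $ j) *\<^sub>R B (F x) (axis i 1) (axis j 1))) (at x)"
    by (intro has_derivative_sum has_derivative_scaleR has_derivative_mult c b)
  moreover have "(\<Sum>i\<in>UNIV. \<Sum>j\<in>UNIV. (V x $ i * W x $ j) *\<^sub>R fd (\<lambda>y. B y (axis i 1) (axis j 1)) (F x) (F' h)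
       + (V x $ i * W' h $ j + V' h $ i * W x $ j) *\<^sub>R B (F x) (axis i 1) (axis j 1))
    = fd (\<lambda>y. B y (V x) (W x)) (F x) (F' h) + (B (F x) (V' h) (W x) + B (F x) (V x) (W' h))" for h
    unfolding fdB[of "V x" "W x"] e[of "F x" "V' h"] e[of "F x" "V x" "W' h"]
    by (simp add: sum.distrib scaleR_add_left)
  ultimately show ?thesis unfolding e[of "F _" "V _" "W _", symmetric] by simp
qed

context metric_patch begin

lemma gdot_diff: "y \<in> S \<Longrightarrow> (\<lambda>y. gdot G y u v) differentiable (at y)"
  using gdot_C_on[of 1 u v] by simp

lemma gdot_along:
  assumes "F x \<in> S" "(F has_derivative F') (at x)" "(V has_derivative V') (at x)" "(W has_derivative W') (at x)"
  shows "((\<lambda>x. gdot G (F x) (V x) (W x)) has_derivative (\<lambda>h. gdot G (F x) (V' h + Gam G (F x) (F' h) (V x)) (W x)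
     + gdot G (F x) (V x) (W' h + Gam G (F x) (F' h) (W x)))) (at x)"
  by (rule has_derivative_eq_rhs[OF param_bilinear_has_derivative[OF gdot_bilinear gdot_diff assms(2-4)]])
    (use assms(1) in \<open>auto simp: metric_compatible gdot_simps\<close>)

abbreviation DG :: "real^'n \<Rightarrow> real^'n \<Rightarrow> real^'n \<Rightarrow> real^'n \<Rightarrow> real^'n" where
  "DG y e a b \<equiv> fd (\<lambda>z. Gam G z a b) y e"

lemma Gam_along:
  assumes "F x \<in> S" "(F has_derivative F') (at x)" "(V has_derivative V') (at x)" "(W has_derivative W') (at x)"
  shows "((\<lambda>x. Gam G (F x) (V x) (W x)) has_derivative (\<lambda>h. DG (F x) (F' h) (V x) (W x)
     + (Gam G (F x) (V' h) (W x) + Gam G (F x) (V x) (W' h)))) (at x)"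
  by (rule param_bilinear_has_derivative[OF Gam_bilinear Gam_diff assms(2-4)]) (use assms(1) in auto)

context
  fixes y assumes y: "y \<in> S"
begin

lemma DG_bilinear: "bounded_bilinear (\<lambda>a b. DG y e a b)"
proof -
  have 1: "DG y e (a + a') b = DG y e a b + DG y e a' b" "DG y e b (a + a') = DG y e b a + DG y e b a'" for a a' b
    unfolding Gam.add_left Gam.add_right
    by (simp_all add: fd_eq[OF has_derivative_add[OF fd_works fd_works]] Gam_diff[OF y])
  have 2: "DG y e (c *\<^sub>R a) b = c *\<^sub>R DG y e a b" "DG y e b (c *\<^sub>R a) = c *\<^sub>R DG y e b a" for a b c
    unfolding Gam.scaleR_left Gam.scaleR_right
    by (simp_all add: fd_eq[OF has_derivative_scaleR_right[OF fd_works]] Gam_diff[OF y])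
  have "bilinear (\<lambda>a b. DG y e a b)" unfolding bilinear_def
    by (intro conjI allI linearI 1 2)
  then show ?thesis by (simp add: bilinear_conv_bounded_bilinear)
qed

lemma DG_linear: "bounded_linear (\<lambda>e. DG y e a b)"
  by (rule fd_bounded_linear[OF Gam_diff[OF y]])

lemma DG_sym: "DG y e a b = DG y e b a"
  using fd_cong[of S y "\<lambda>z. Gam G z a b" "\<lambda>z. Gam G z b a", OF S y Gam_sym] by simp

lemmas DG_simps = bounded_bilinear.add_left[OF DG_bilinear] bounded_bilinear.add_right[OF DG_bilinear]
  bounded_bilinear.diff_left[OF DG_bilinear] bounded_bilinear.diff_right[OF DG_bilinear]
  bounded_bilinear.minus_left[OF DG_bilinear] bounded_bilinear.minus_right[OF DG_bilinear]
  linear_add[OF bounded_linear.linear[OF DG_linear]] linear_diff[OF bounded_linear.linear[OF DG_linear]]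
  linear_neg[OF bounded_linear.linear[OF DG_linear]]

lemma Rop_add:
  "Rop G y (u + u') v w = Rop G y u v w + Rop G y u' v w"
  "Rop G y u (v + v') w = Rop G y u v w + Rop G y u v' w"
  "Rop G y u v (w + w') = Rop G y u v w + Rop G y u v w'"
  unfolding Rop_def DG_simps by (simp_all add: Gam_simps)

lemma Rop_scaleR:
  "Rop G y (c *\<^sub>R u) v w = c *\<^sub>R Rop G y u v w"
  "Rop G y u (c *\<^sub>R v) w = c *\<^sub>R Rop G y u v w"
  "Rop G y u v (c *\<^sub>R w) = c *\<^sub>R Rop G y u v w"
  unfolding Rop_def Gam.scaleR_left Gam.scaleR_right
    fd_eq[OF has_derivative_scaleR_right[OF fd_works[OF Gam_diff[OF y]]]]
    linear_cmul[OF bounded_linear.linear[OF DG_linear]]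
  by (simp_all add: scaleR_add_right scaleR_diff_right)

lemma Rop_linear: "linear (\<lambda>u. Rop G y u v w)" "linear (\<lambda>v. Rop G y u v w)" "linear (\<lambda>w. Rop G y u v w)"
  by (intro linearI Rop_add Rop_scaleR)+

lemma Rop_anti: "Rop G y u v w = - Rop G y v u w"
  by (simp add: Rop_def)

lemma Rop_cyclic: "Rop G y u v w + Rop G y v w u + Rop G y w u v = 0"
  unfolding Rop_def
  by (simp add: DG_sym[of u w v] DG_sym[of v u w] DG_sym[of w v u] Gam_sym[OF y, of w v] Gam_sym[OF y, of u w] Gam_sym[OF y, of v u])

lemma Rop_axis: "Rop G y (axis i 1) (axis j 1) (axis k 1) $ l = curvature_op G l i j k y"
proof -
  have Ga: "Gam G z (axis i 1) (axis j 1) $ l = christoffel G l i j z" for z i j l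
    by (simp add: Gam_def axis_def if_distrib[of "(*) _"] sum.delta cong: if_cong)
  have "fd (\<lambda>z. Gam G z (axis i 1) (axis j 1)) y e $ l = fd (christoffel G l i j) y e" for i j e l
    using fd_eq[OF bounded_linear.has_derivative[OF bounded_linear_vec_nth[of l] fd_works[OF Gam_diff[OF y, of "axis i 1" "axis j 1"]]]]
    unfolding Ga by (simp add: fun_eq_iff)
  moreover have "Gam G y (axis i 1) w $ l = (\<Sum>m\<in>UNIV. christoffel G l i m y * w $ m)" for i w l
    by (simp add: Gam_def axis_def if_distrib[of "(*) _"] if_distribR cong: if_cong) 
      (subst sum.swap, simp add: if_distrib[of "\<lambda>x. x * _"] if_distrib[of "(*) _"] cong: if_cong)
  ultimately show ?thesis
    unfolding Rop_def curvature_op_def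
    by (simp add: partial_def Ga sum_subtractf mult.commute)
qed

lemma Rop_expand:
  "Rop G y u v w = (\<Sum>i\<in>UNIV. u $ i *\<^sub>R (\<Sum>j\<in>UNIV. v $ j *\<^sub>R (\<Sum>k\<in>UNIV. w $ k *\<^sub>R Rop G y (axis i 1) (axis j 1) (axis k 1))))"
proof -
  have 1: "Rop G y u v w = (\<Sum>i\<in>UNIV. u $ i *\<^sub>R Rop G y (axis i 1) v w)" for u v w
    by (subst vec_axis_sum[of u, symmetric]) (simp only: linear_sum[OF Rop_linear(1)] linear_cmul[OF Rop_linear(1)])
  have 2: "Rop G y u v w = (\<Sum>i\<in>UNIV. v $ i *\<^sub>R Rop G y u (axis i 1) w)" for u v w
    by (subst vec_axis_sum[of v, symmetric]) (simp only: linear_sum[OF Rop_linear(2)] linear_cmul[OF Rop_linear(2)])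
  have 3: "Rop G y u v w = (\<Sum>i\<in>UNIV. w $ i *\<^sub>R Rop G y u v (axis i 1))" for u v w
    by (subst vec_axis_sum[of w, symmetric]) (simp only: linear_sum[OF Rop_linear(3)] linear_cmul[OF Rop_linear(3)])
  show ?thesis
    by (subst 1, rule sum.cong[OF refl], subst 2, rule arg_cong[where f="\<lambda>x. _ *\<^sub>R x"], rule sum.cong[OF refl], subst 3, rule refl)
qed

lemma tensor_apply_riemann: "tensor_apply (riemann G y) [u, v, w, z] = gdot G y (Rop G y u v w) z"
proof -
  have "gdot G y (Rop G y u v w) z
    = (\<Sum>i\<in>UNIV. u $ i * (\<Sum>j\<in>UNIV. v $ j * (\<Sum>k\<in>UNIV. w $ k * gdot G y (Rop G y (axis i 1) (axis j 1) (axis k 1)) z)))"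
    by (subst Rop_expand)
      (simp only: gdot.sum_left gdot.scaleR_left real_scaleR_def)
  moreover have "gdot G y (Rop G y (axis i 1) (axis j 1) (axis k 1)) z = (\<Sum>l\<in>UNIV. z $ l * riemann G y [i, j, k, l])" for i j k
    unfolding gdot_def Rop_axis riemann_def
    by (subst sum.swap) (simp add: sum_distrib_left mult_ac numeral_3_eq_3 numeral_2_eq_2)
  ultimately show ?thesis by (simp add: tensor_apply_Cons tensor_apply_Nil)
qed

text \<open>For constant \<open>w\<close> and \<open>z\<close> the second derivatives of
  \<open>gdot G y w z\<close> commute. Metric compatibility computes them; the products of first
  derivatives are symmetric in \<open>u\<close> and \<open>v\<close>, and the remaining difference
  is the claim.\<close>

lemma Rop_skew: "gdot G y (Rop G y u v w) z = - gdot G y (Rop G y u v z) w"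
proof -
  have g2: "C_on 2 S (\<lambda>y. gdot G y w z)" by (rule gdot_C_on)
  have *: "fd (\<lambda>y. fd (\<lambda>z'. gdot G z' w z) y v) y u
     = gdot G y (DG y u v w + Gam G y u (Gam G y v w)) z + gdot G y (Gam G y v w) (Gam G y u z)
       + (gdot G y (Gam G y u w) (Gam G y v z) + gdot G y w (DG y u v z + Gam G y u (Gam G y v z)))" for u v
  proof -
    have c: "((\<lambda>y. c) has_derivative (\<lambda>_. 0)) (at y)" for c :: "real^'n" by simp
    have "fd (\<lambda>y. fd (\<lambda>z'. gdot G z' w z) y v) y = fd (\<lambda>y. gdot G y (Gam G y v w) z + gdot G y w (Gam G y v z)) y"
      by (rule fd_cong[OF S y]) (rule metric_compatible)
    also have "\<dots> = (\<lambda>u. (gdot G y (DG y u v w + Gam G y u (Gam G y v w)) z + gdot G y (Gam G y v w) (0 + Gam G y u z))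
       + (gdot G y (0 + Gam G y u w) (Gam G y v z) + gdot G y w (DG y u v z + Gam G y u (Gam G y v z))))"
      by (rule fd_eq)
        (intro has_derivative_add gdot_along[OF y has_derivative_ident] c fd_works Gam_diff[OF y])
    finally show ?thesis by simp
  qed
  have "fd (\<lambda>y. fd (\<lambda>z'. gdot G z' w z) y v) y u = fd (\<lambda>y. fd (\<lambda>z'. gdot G z' w z) y u) y v"
    by (rule second_derivative_symmetric[OF g2 S y])
  then show ?thesis unfolding * Rop_def gdot_sym[OF y, of "_ - _" w] gdot_sym[OF y, of "_ + _" w]
    by (simp add: gdot_simps gdot_sym[OF y, of w])
qed

text \<open>A linear combination of four cyclic identities, reduced by the two
  antisymmetries.\<close>

lemma Rop_pair: "gdot G y (Rop G y u v w) z = gdot G y (Rop G y w z u) v"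
proof -
  define R where "R a b c d = gdot G y (Rop G y a b c) d" for a b c d
  have a1: "R a b c d = - R b a c d" for a b c d
    unfolding R_def by (subst Rop_anti) (simp add: gdot_simps)
  have a2: "R a b c d = - R a b d c" for a b c d unfolding R_def by (rule Rop_skew)
  have a3: "R a b c d + R b c a d + R c a b d = 0" for a b c d
    unfolding R_def using Rop_cyclic[of a b c] by (metis gdot_simps(1) gdot.zero_left)
  have "R u v w z = R w z u v"
    using a3[of u v w z] a3[of v w z u] a3[of w z u v] a3[of z u v w]
      a1[of u v w z] a2[of u v w z] a1[of v w u z] a2[of v w u z] a1[of w u v z] a2[of w u v z]
      a1[of v w z u] a2[of v w z u] a1[of w z v u] a2[of w z v u] a1[of z v w u] a2[of z v w u]
      a1[of w z u v] a2[of w z u v] a1[of z u w v] a2[of z u w v] a1[of u w z v] a2[of u w z v]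
      a1[of z u v w] a2[of z u v w] a1[of u v z w] a2[of u v z w] a1[of v z u w] a2[of v z u w]
    by linarith
  then show ?thesis by (simp add: R_def)
qed

end

lemma fd_Rop:
  assumes y: "y \<in> S"
  shows "((\<lambda>y. Rop G y a b c) has_derivative (\<lambda>e. hess (\<lambda>z. Gam G z b c) y a e - hess (\<lambda>z. Gam G z a c) y b e
    + (DG y e a (Gam G y b c) + Gam G y a (DG y e b c)) - (DG y e b (Gam G y a c) + Gam G y b (DG y e a c)))) (at y)"
proof -
  have c: "((\<lambda>y. c) has_derivative (\<lambda>_. 0)) (at y)" for c :: "real^'n" by simp
  have h: "((\<lambda>y. DG y a b c) has_derivative (\<lambda>e. hess (\<lambda>z. Gam G z b c) y a e)) (at y)" for a b c
    unfolding hess_def using C_on_fd[OF Gam_C_on[of "Suc (Suc 0)" b c], of a] y by (intro fd_works) auto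
  have g: "((\<lambda>y. Gam G y a (Gam G y b c)) has_derivative (\<lambda>e. DG y e a (Gam G y b c)
     + (Gam G y 0 (Gam G y b c) + Gam G y a (DG y e b c)))) (at y)" for a b c
    by (intro Gam_along[OF y has_derivative_ident] c fd_works Gam_diff[OF y])
  have z: "Gam G y 0 w = 0" for w by (rule Gam.zero_left)
  show ?thesis unfolding Rop_def
    by (rule has_derivative_eq_rhs, (rule has_derivative_add has_derivative_diff h g)+) (simp add: fun_eq_iff z)
qed

lemma tensor_apply_cov_riemann:
  assumes y: "y \<in> S"
  shows "tensor_apply (cov_deriv G (riemann G) y) [e, a, b, c, d] = gdot G y (fd (\<lambda>y. Rop G y a b c) y e
    + Gam G y e (Rop G y a b c) - Rop G y (Gam G y e a) b c - Rop G y a (Gam G y e b) c - Rop G y a b (Gam G y e c)) d"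
proof -
  have dT: "(\<lambda>y. riemann G y I) differentiable (at y)" for I
    using riemann_C_on[of 1 I] y by simp
  define V where "V i = (\<lambda>_::real^'n. [a, b, c, d] ! i)" for i
  have up: "[0..<4] = [0, 1, 2, 3::nat]" by (simp add: upt_rec)
  have m: "map (\<lambda>i. V i z) [0..<4] = [a, b, c, d]" for z
    unfolding up V_def by simp
  have "((\<lambda>x. tensor_apply (riemann G x) (map (\<lambda>a. V a x) [0..<4])) has_derivative
     (\<lambda>h. tensor_apply (cov_deriv G (riemann G) y) (h # map (\<lambda>a. V a y) [0..<4])
       + (\<Sum>k<4. tensor_apply (riemann G y) ((map (\<lambda>a. V a y) [0..<4])[k := 0 + Gam G y h (V k y)])))) (at y)"
    using tensor_apply_along[of "\<lambda>x. x" "\<lambda>h. h" y 4 V "\<lambda>_ _. 0" "riemann G" G] dT by (simp add: V_def)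
  then have 1: "fd (\<lambda>x. tensor_apply (riemann G x) [a, b, c, d]) y e = tensor_apply (cov_deriv G (riemann G) y) [e, a, b, c, d]
     + (\<Sum>k<4. tensor_apply (riemann G y) ([a, b, c, d][k := Gam G y e ([a, b, c, d] ! k)]))"
    unfolding m by (simp add: fd_eq V_def)
  have "fd (\<lambda>x. tensor_apply (riemann G x) [a, b, c, d]) y e = fd (\<lambda>x. gdot G x (Rop G x a b c) d) y e"
    using fd_cong[OF S y tensor_apply_riemann] by simp
  also have "\<dots> = gdot G y (fd (\<lambda>y. Rop G y a b c) y e + Gam G y e (Rop G y a b c)) d + gdot G y (Rop G y a b c) (0 + Gam G y e d)"
    by (subst fd_eq[OF gdot_along[OF y has_derivative_ident fd_works has_derivative_const]])
      (use fd_Rop[OF y] in \<open>auto intro: differentiableI\<close>)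
  finally show ?thesis using 1
    by (simp add: eval_nat_numeral lessThan_Suc tensor_apply_riemann[OF y] gdot_simps)
qed

text \<open>Verified in arbitrary coordinates: in the cyclic sum the second derivatives of
  \<open>Gam\<close> cancel by their symmetry, and the remaining terms pair off by the symmetry of
  \<open>Gam\<close>.\<close>

lemma second_bianchi:
  assumes y: "y \<in> S"
  shows "tensor_apply (cov_deriv G (riemann G) y) [e, a, b, c, d] + tensor_apply (cov_deriv G (riemann G) y) [a, b, e, c, d]
     + tensor_apply (cov_deriv G (riemann G) y) [b, e, a, c, d] = 0"
proof -
  define N where "N e a b = fd (\<lambda>y. Rop G y a b c) y e
    + Gam G y e (Rop G y a b c) - Rop G y (Gam G y e a) b c - Rop G y a (Gam G y e b) c - Rop G y a b (Gam G y e c)" for e a b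
  have hs: "hess (\<lambda>z. Gam G z p c) y q s = hess (\<lambda>z. Gam G z p c) y s q" for p q s
    by (rule hess_sym[OF Gam_C_on S y])
  have "N e a b + N a b e + N b e a = 0"
    unfolding N_def fd_eq[OF fd_Rop[OF y]]
    unfolding Rop_def hs[of b e a] hs[of a e b] hs[of e b a]
      Gam_sym[OF y, of e a] Gam_sym[OF y, of e b] Gam_sym[OF y, of b a]
    by (simp add: Gam_simps DG_simps[OF y])
  then have "gdot G y (N e a b + N a b e + N b e a) d = 0"
    by (simp add: gdot.zero_left)
  then show ?thesis unfolding tensor_apply_cov_riemann[OF y] N_def[symmetric] by (simp add: gdot_simps)
qed

section \<open>Hessian of a function and traces\<close>

context
  fixes h :: "real^'n \<Rightarrow> real" assumes h: "smooth_on S h"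
begin

lemma h_C_on: "C_on k S h" using h by (rule smooth_on_C_on)

lemma scalar_C_on: "C_on k S (\<lambda>x. scalar_field h x I)"
  unfolding scalar_field_def by (rule h_C_on)

lemma grad_apply: "y \<in> S \<Longrightarrow> tensor_apply (cov_deriv G (scalar_field h) y) [u] = fd h y u"
  using tensor_apply_cov_deriv[of "[]" "scalar_field h" y G u] h_C_on[of 1]
  by (simp add: scalar_field_def)

lemma h_diff: "y \<in> S \<Longrightarrow> h differentiable (at y)"
  using h_C_on[of 1] by simp

lemma hess_apply:
  assumes y: "y \<in> S"
  shows "tensor_apply (cov_deriv G (cov_deriv G (scalar_field h)) y) [u, v] = hess h y v u - fd h y (Gam G y u v)"
proof -
  have d: "(\<lambda>y. cov_deriv G (scalar_field h) y I) differentiable (at y)" for I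
    using cov_deriv_C_on[OF scalar_C_on, where k=1 and I=I] y by simp
  define V where "V = (\<lambda>(i::nat) (_::real^'n). v)"
  have "((\<lambda>x. tensor_apply (cov_deriv G (scalar_field h) x) (map (\<lambda>a. V a x) [0..<1])) has_derivative
     (\<lambda>u. tensor_apply (cov_deriv G (cov_deriv G (scalar_field h)) y) (u # map (\<lambda>a. V a y) [0..<1])
       + (\<Sum>k<1. tensor_apply (cov_deriv G (scalar_field h) y) ((map (\<lambda>a. V a y) [0..<1])[k := 0 + Gam G y u (V k y)])))) (at y)"
    using tensor_apply_along[of "\<lambda>x. x" "\<lambda>h. h" y 1 V "\<lambda>_ _. 0" "cov_deriv G (scalar_field h)" G] d by (simp add: V_def)
  then have "fd (\<lambda>x. tensor_apply (cov_deriv G (scalar_field h) x) [v]) y u = tensor_apply (cov_deriv G (cov_deriv G (scalar_field h)) y) [u, v]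
       + fd h y (Gam G y u v)"
    by (simp add: fd_eq V_def grad_apply[OF y])
  moreover have "fd (\<lambda>x. tensor_apply (cov_deriv G (scalar_field h) x) [v]) y u = hess h y v u"
    unfolding hess_def using fd_cong[OF S y grad_apply] by simp
  ultimately show ?thesis by simp
qed

lemma hess_apply_sym:
  assumes y: "y \<in> S"
  shows "tensor_apply (cov_deriv G (cov_deriv G (scalar_field h)) y) [u, v] = tensor_apply (cov_deriv G (cov_deriv G (scalar_field h)) y) [v, u]"
  unfolding hess_apply[OF y] hess_sym[OF h_C_on S y, of v u] Gam_sym[OF y, of u v] ..

text \<open>The Ricci identity for the one-form \<open>dh\<close>: third coordinate derivatives
  commute, and the rest assembles into \<open>Rop\<close>. The sign is that of the action on a
  covector.\<close>

lemma third_commutator: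
  assumes y: "y \<in> S"
  shows "tensor_apply (cov_deriv G (cov_deriv G (cov_deriv G (scalar_field h))) y) [a, b, c]
    - tensor_apply (cov_deriv G (cov_deriv G (cov_deriv G (scalar_field h))) y) [b, a, c] = - fd h y (Rop G y a b c)"
proof -
  define H where "H = cov_deriv G (cov_deriv G (scalar_field h))"
  have d: "(\<lambda>y. H y I) differentiable (at y)" for I
    unfolding H_def using cov_deriv_C_on[OF cov_deriv_C_on[OF scalar_C_on], where k=1 and I=I] y by simp
  have c0: "((\<lambda>y. c) has_derivative (\<lambda>_. 0)) (at y)" for c :: "real^'n" by simp
  have fh: "C_on 2 S (\<lambda>y. fd h y u)" for u by (rule C_on_fd[OF h_C_on])
  have *: "tensor_apply (cov_deriv G H y) [a, b, c] = hess (\<lambda>y. fd h y c) y b a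
     - (fd h y (DG y a b c) + hess h y (Gam G y b c) a) - tensor_apply (H y) [Gam G y a b, c] - tensor_apply (H y) [b, Gam G y a c]" for a b c
  proof -
    define V where "V i = (\<lambda>_::real^'n. [b, c] ! i)" for i
    have up: "[0..<2] = [0, 1::nat]" by (simp add: upt_rec)
    have m: "map (\<lambda>i. V i z) [0..<2] = [b, c]" for z unfolding up V_def by simp
    have "((\<lambda>x. tensor_apply (H x) (map (\<lambda>a. V a x) [0..<2])) has_derivative
     (\<lambda>u. tensor_apply (cov_deriv G H y) (u # map (\<lambda>a. V a y) [0..<2])
       + (\<Sum>k<2. tensor_apply (H y) ((map (\<lambda>a. V a y) [0..<2])[k := 0 + Gam G y u (V k y)])))) (at y)"
      using tensor_apply_along[of "\<lambda>x. x" "\<lambda>h. h" y 2 V "\<lambda>_ _. 0" H G] d by (simp add: V_def)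
    then have 1: "fd (\<lambda>x. tensor_apply (H x) [b, c]) y a = tensor_apply (cov_deriv G H y) [a, b, c]
       + (tensor_apply (H y) [Gam G y a b, c] + tensor_apply (H y) [b, Gam G y a c])"
      unfolding m by (simp add: fd_eq V_def numeral_2_eq_2 lessThan_Suc)
    have "fd (\<lambda>x. tensor_apply (H x) [b, c]) y = fd (\<lambda>x. hess h x c b - fd h x (Gam G x b c)) y"
      unfolding H_def by (rule fd_cong[OF S y]) (rule hess_apply)
    also have "\<dots> = (\<lambda>a. hess (\<lambda>y. fd h y c) y b a - (fd h y (DG y a b c) + hess h y (Gam G y b c) a))"
    proof (rule fd_eq[OF has_derivative_diff])
      show "((\<lambda>x. hess h x c b) has_derivative hess (\<lambda>y. fd h y c) y b) (at y)"
        unfolding hess_def using C_on_fd[OF C_on_fd[OF h_C_on[of "Suc (Suc (Suc 0))"], of c], of b] y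
        by (intro fd_works) simp
      show "((\<lambda>x. fd h x (Gam G x b c)) has_derivative (\<lambda>a. fd h y (DG y a b c) + hess h y (Gam G y b c) a)) (at y)"
        by (rule fd_apply_has_derivative[OF h_C_on S y Gam_diff[OF y]])
    qed
    finally show ?thesis using 1 by simp
  qed
  have s: "hess (\<lambda>y. fd h y c) y b a = hess (\<lambda>y. fd h y c) y a b" by (rule hess_sym[OF fh S y])
  have lin: "fd h y (u + v) = fd h y u + fd h y v" "fd h y (u - v) = fd h y u - fd h y v" for u v
    using bounded_linear.linear[OF fd_bounded_linear[OF h_diff[OF y]]] by (auto simp: linear_add linear_diff)
  show ?thesis unfolding H_def[symmetric] * unfolding H_def hess_apply[OF y] s Rop_def lin
      hess_sym[OF h_C_on S y, of "Gam G y a c" b] hess_sym[OF h_C_on S y, of "Gam G y b c" a] Gam_sym[OF y, of b a]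
    by simp
qed

end

text \<open>Orthonormality of the rows reads \<open>E G E^T = 1\<close>. A one-sided inverse of a
  square matrix is two-sided, so \<open>E^T E\<close> is the inverse of \<open>G\<close>.\<close>

lemma frame_inverse:
  fixes E :: "real^'n^'n"
  assumes y: "y \<in> S" and on: "\<And>a b. gdot G y (E $ a) (E $ b) = (if a = b then 1 else 0)"
  shows "(\<Sum>e\<in>UNIV. E $ e $ i * E $ e $ j) = ginv G i j y"
proof -
  have "E ** (G y ** transpose E) = mat 1"
    using on by (simp add: vec_eq_iff matrix_matrix_mult_def transpose_def mat_def gdot_def sum_distrib_left mult_ac)
  then have "(G y ** transpose E) ** E = mat 1" by (rule matrix_left_right_inverse[THEN iffD1])
  then have 1: "G y ** (transpose E ** E) = mat 1" by (simp add: matrix_mul_assoc)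
  have 2: "matrix_inv (G y) ** G y = mat 1"
    using matrix_inv_mult_sum(2)[OF G_invertible(1)[OF y]]
    by (simp add: vec_eq_iff matrix_matrix_mult_def mat_def)
  have "transpose E ** E = (matrix_inv (G y) ** G y) ** (transpose E ** E)" by (simp add: 2)
  also have "\<dots> = matrix_inv (G y) ** (G y ** (transpose E ** E))" by (rule matrix_mul_assoc[symmetric])
  also have "\<dots> = matrix_inv (G y)" by (simp add: 1)
  finally have "(transpose E ** E) $ i $ j = matrix_inv (G y) $ i $ j" by simp
  then show ?thesis by (simp add: ginv_def matrix_matrix_mult_def transpose_def)
qed

text \<open>A trace may be taken in any orthonormal frame: \<open>frame_inverse\<close> turns the
  sum over the frame into the inverse metric, which lowers to the coordinate trace.\<close>

lemma ricci_frame: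
  fixes E :: "real^'n^'n"
  assumes y: "y \<in> S" and on: "\<And>a b. gdot G y (E $ a) (E $ b) = (if a = b then 1 else 0)"
  shows "(\<Sum>e\<in>UNIV. gdot G y (Rop G y (E $ e) v w) (E $ e)) = (\<Sum>j\<in>UNIV. \<Sum>k\<in>UNIV. ricci G j k y * (v $ j * w $ k))"
proof -
  define L where "L u = Rop G y u v w" for u
  have lin: "linear L" unfolding L_def by (rule Rop_linear(1)[OF y])
  have "(\<Sum>e\<in>UNIV. gdot G y (L (E $ e)) (E $ e)) = (\<Sum>e\<in>UNIV. \<Sum>i\<in>UNIV. E $ e $ i * gdot G y (L (axis i 1)) (E $ e))"
  proof (rule sum.cong[OF refl])
    fix e
    have "L (E $ e) = (\<Sum>i\<in>UNIV. E $ e $ i *\<^sub>R L (axis i 1))"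
      by (subst vec_axis_sum[of "E $ e", symmetric]) (simp only: linear_sum[OF lin] linear_cmul[OF lin])
    then show "gdot G y (L (E $ e)) (E $ e) = (\<Sum>i\<in>UNIV. E $ e $ i * gdot G y (L (axis i 1)) (E $ e))"
      by (simp only: gdot.sum_left gdot.scaleR_left real_scaleR_def)
  qed
  also have "\<dots> = (\<Sum>i\<in>UNIV. \<Sum>m\<in>UNIV. L (axis i 1) $ m * (\<Sum>l\<in>UNIV. G y $ m $ l * (\<Sum>e\<in>UNIV. E $ e $ l * E $ e $ i)))"
    unfolding gdot_def sum_distrib_left
    by (rule trans[OF sum.swap], rule sum.cong[OF refl], rule trans[OF sum.swap], rule sum.cong[OF refl],
        rule trans[OF sum.swap], intro sum.cong refl) (simp add: mult_ac)
  also have "\<dots> = (\<Sum>i\<in>UNIV. \<Sum>m\<in>UNIV. L (axis i 1) $ m * (if m = i then 1 else 0))"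
    unfolding frame_inverse[OF y on] ginv_def matrix_inv_mult_sum(1)[OF G_invertible(1)[OF y]] ..
  also have "\<dots> = (\<Sum>i\<in>UNIV. L (axis i 1) $ i)" by (simp add: if_distrib[of "(*) _"] cong: if_cong)
  also have "\<dots> = (\<Sum>i\<in>UNIV. \<Sum>j\<in>UNIV. \<Sum>k\<in>UNIV. v $ j * (w $ k * curvature_op G i i j k y))"
  proof (rule sum.cong[OF refl])
    fix i
    have v: "L (axis i 1) = (\<Sum>j\<in>UNIV. v $ j *\<^sub>R (\<Sum>k\<in>UNIV. w $ k *\<^sub>R Rop G y (axis i 1) (axis j 1) (axis k 1)))"
      unfolding L_def
      by (subst vec_axis_sum[of v, symmetric], simp only: linear_sum[OF Rop_linear(2)[OF y]] linear_cmul[OF Rop_linear(2)[OF y]],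
          subst vec_axis_sum[of w, symmetric], simp only: linear_sum[OF Rop_linear(3)[OF y]] linear_cmul[OF Rop_linear(3)[OF y]])
    show "L (axis i 1) $ i = (\<Sum>j\<in>UNIV. \<Sum>k\<in>UNIV. v $ j * (w $ k * curvature_op G i i j k y))"
      unfolding v by (simp add: Rop_axis[OF y] sum_distrib_left)
  qed
  also have "\<dots> = (\<Sum>j\<in>UNIV. \<Sum>k\<in>UNIV. ricci G j k y * (v $ j * w $ k))"
    unfolding ricci_def sum_distrib_right
    by (rule trans[OF sum.swap], rule sum.cong[OF refl], rule trans[OF sum.swap], intro sum.cong refl) simp
  finally show ?thesis by (simp add: L_def)
qed

lemma laplacian_frame:
  fixes E :: "real^'n^'n"
  assumes y: "y \<in> S" and on: "\<And>a b. gdot G y (E $ a) (E $ b) = (if a = b then 1 else 0)"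
  shows "(\<Sum>e\<in>UNIV. tensor_apply (cov_deriv G (cov_deriv G (scalar_field h)) y) [E $ e, E $ e]) = laplacian G h y"
proof -
  have "(\<Sum>e\<in>UNIV. tensor_apply (cov_deriv G (cov_deriv G (scalar_field h)) y) [E $ e, E $ e])
    = (\<Sum>i\<in>UNIV. \<Sum>j\<in>UNIV. (\<Sum>e\<in>UNIV. E $ e $ i * E $ e $ j) * cov_deriv G (cov_deriv G (scalar_field h)) y [i, j])"
    unfolding tensor_apply_Cons tensor_apply_Nil sum_distrib_left sum_distrib_right
    by (rule trans[OF sum.swap], rule sum.cong[OF refl], rule trans[OF sum.swap], intro sum.cong refl) (simp add: mult_ac)
  then show ?thesis unfolding frame_inverse[OF y on] laplacian_def by simp
qed

end

section \<open>Radially parallel frames\<close>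

lemma radial_mvt:
  fixes f :: "'a::euclidean_space \<Rightarrow> real"
  assumes d: "\<And>x. x \<in> ball 0 \<rho> \<Longrightarrow> f differentiable (at x)" and x: "x \<in> ball 0 \<rho>"
  obtains t where "0 < t" "t < 1" "t *\<^sub>R x \<in> ball 0 \<rho>" "f x - f 0 = fd f (t *\<^sub>R x) x"
proof -
  have sx: "t *\<^sub>R x \<in> ball 0 \<rho>" if "0 \<le> t" "t \<le> 1" for t
    using x norm_scaleR_le[of t x] that by simp
  have "((\<lambda>t. f (t *\<^sub>R x)) has_real_derivative fd f (t *\<^sub>R x) x) (at t)" if t: "0 \<le> t" "t \<le> 1" for t
    using has_real_derivative_along[of f "fd f (t *\<^sub>R x)" 0 t x] fd_works[OF d[OF sx[OF t]]] by simp
  from MVT2[of 0 1 "\<lambda>t. f (t *\<^sub>R x)" "\<lambda>t. fd f (t *\<^sub>R x) x", OF _ this] obtain t where "0 < t" "t < 1" "f (1 *\<^sub>R x) - f (0 *\<^sub>R x) = fd f (t *\<^sub>R x) x" by auto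
  then show ?thesis using sx[of t] by (intro that[of t]) auto
qed

lemma radial_constant:
  fixes f :: "'a::euclidean_space \<Rightarrow> real"
  assumes d: "\<And>x. x \<in> ball 0 \<rho> \<Longrightarrow> f differentiable (at x)" and z: "\<And>x. x \<in> ball 0 \<rho> \<Longrightarrow> fd f x x = 0"
    and x: "x \<in> ball 0 \<rho>"
  shows "f x = f 0"
proof -
  obtain t where t: "0 < t" "t *\<^sub>R x \<in> ball 0 \<rho>" "f x - f 0 = fd f (t *\<^sub>R x) x" using radial_mvt[OF d x] .
  then show ?thesis using z[OF t(2)] fd_scaleR[OF d[OF t(2)], of t x] by simp
qed

context metric_patch begin

lemma C_on_G_along:
  assumes "C_on k T F" "open T" "\<And>x. x \<in> T \<Longrightarrow> F x \<in> S" "\<And>k. C_on k S f"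
  shows "C_on k T (\<lambda>x. f (F x))"
  by (rule C_on_compose[OF assms(1) assms(4) assms(2) S assms(3)])

lemma C_on_gdot_along:
  fixes F :: "'a::euclidean_space \<Rightarrow> real^'n"
  assumes "C_on k T F" "C_on k T V" "C_on k T W" "open T" "\<And>x. x \<in> T \<Longrightarrow> F x \<in> S"
  shows "C_on k T (\<lambda>x. gdot G (F x) (V x) (W x))"
  unfolding gdot_def
  by (intro C_on_sum C_on_mult C_on_nth assms C_on_G_along[OF assms(1,4,5), of "\<lambda>y. G y $ _ $ _"] G_C_on)

lemma C_on_Gam_along:
  fixes F :: "'a::euclidean_space \<Rightarrow> real^'n"
  assumes "C_on k T F" "C_on k T V" "C_on k T W" "open T" "\<And>x. x \<in> T \<Longrightarrow> F x \<in> S"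
  shows "C_on k T (\<lambda>x. Gam G (F x) (V x) (W x))"
  unfolding Gam_def
  by (rule C_on_vec) (auto intro!: C_on_sum C_on_mult C_on_nth assms C_on_G_along[OF assms(1,4,5)] christoffel_C_on)

lemma C_on_tensor_along:
  fixes F :: "'a::euclidean_space \<Rightarrow> real^'n"
  assumes "C_on k T F" "\<And>a. a < m \<Longrightarrow> C_on k T (V a)" "open T" "\<And>x. x \<in> T \<Longrightarrow> F x \<in> S" "\<And>I k. C_on k S (\<lambda>y. Q y I)"
  shows "C_on k T (\<lambda>x. tensor_apply (Q (F x)) (map (\<lambda>a. V a x) [0..<m]))"
proof -
  have "C_on k T (\<lambda>x. \<Sum>I | length I = m. Q (F x) I * (\<Prod>a<m. V a x $ (I ! a)))"
    by (intro C_on_sum C_on_mult C_on_prod C_on_nth assms C_on_G_along[OF assms(1,3,4)]) auto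
  then show ?thesis by (simp add: tensor_apply_def)
qed

lemma frame_expand:
  fixes E :: "real^'n^'n"
  assumes y: "y \<in> S" and on: "\<And>a b. gdot G y (E $ a) (E $ b) = (if a = b then 1 else 0)"
  shows "(\<Sum>a\<in>UNIV. gdot G y u (E $ a) *\<^sub>R E $ a) = u"
proof -
  have "(\<Sum>a\<in>UNIV. gdot G y u (E $ a) *\<^sub>R E $ a) $ k = u $ k" for k
  proof -
    have "(\<Sum>a\<in>UNIV. gdot G y u (E $ a) *\<^sub>R E $ a) $ k = (\<Sum>a\<in>UNIV. \<Sum>i\<in>UNIV. \<Sum>j\<in>UNIV. G y $ i $ j * (u $ i * E $ a $ j) * E $ a $ k)"
      by (simp add: gdot_def sum_distrib_right)
    also have "\<dots> = (\<Sum>i\<in>UNIV. u $ i * (\<Sum>j\<in>UNIV. G y $ i $ j * (\<Sum>a\<in>UNIV. E $ a $ j * E $ a $ k)))"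
      unfolding sum_distrib_left
      by (rule trans[OF sum.swap], rule sum.cong[OF refl], rule trans[OF sum.swap], intro sum.cong refl) (simp add: mult_ac)
    also have "\<dots> = (\<Sum>i\<in>UNIV. u $ i * (if i = k then 1 else 0))"
      unfolding frame_inverse[OF y on] ginv_def matrix_inv_mult_sum(1)[OF G_invertible(1)[OF y]] ..
    finally show ?thesis by (simp add: if_distrib[of "(*) _"] cong: if_cong)
  qed
  then show ?thesis by (simp add: vec_eq_iff)
qed

end

section \<open>Normal coordinates with a parallel frame\<close>

text \<open>\<open>F\<close> is the exponential map read through the frame at the origin, and
  \<open>E x $ a\<close> is a frame vector at \<open>F x\<close>. \<open>F_radial\<close> says that
  the velocity of a ray has constant coefficients in the frame, \<open>E_radial\<close> that the
  frame is parallel along the ray; together they contain the geodesic equation.\<close>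

locale normal_frame = metric_patch G S
  for G :: "real^'n \<Rightarrow> real^'n^'n::finite" and S :: "(real^'n) set" +
  fixes F :: "real^'n \<Rightarrow> real^'n" and E :: "real^'n \<Rightarrow> real^'n^'n" and \<rho> :: real
  assumes \<rho>: "\<rho> > 0"
    and F_C2: "C_on 2 (ball 0 \<rho>) F" and E_C2: "C_on 2 (ball 0 \<rho>) E"
    and F_in: "x \<in> ball 0 \<rho> \<Longrightarrow> F x \<in> S"
    and F_radial: "x \<in> ball 0 \<rho> \<Longrightarrow> fd F x x = (\<Sum>a\<in>UNIV. x $ a *\<^sub>R E x $ a)"
    and E_radial: "x \<in> ball 0 \<rho> \<Longrightarrow> fd E x x $ b = - Gam G (F x) (\<Sum>a\<in>UNIV. x $ a *\<^sub>R E x $ a) (E x $ b)"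
    and E_orthonormal_0: "gdot G (F 0) (E 0 $ a) (E 0 $ b) = (if a = b then 1 else 0)"
    and F_nondegenerate: "x \<in> ball 0 \<rho> \<Longrightarrow> fd F x v = 0 \<Longrightarrow> v = 0"
begin

text \<open>The covariant derivative along \<open>F\<close>, in direction \<open>v\<close>, of the
  frame vector with index \<open>b\<close>.\<close>

definition CD :: "real^'n \<Rightarrow> real^'n \<Rightarrow> 'n \<Rightarrow> real^'n" where
  "CD x v b = fd E x v $ b + Gam G (F x) (fd F x v) (E x $ b)"

text \<open>The orthonormal coframe dual to \<open>E\<close>, pulled back by
  \<open>F\<close>.\<close>

definition \<theta> :: "real^'n \<Rightarrow> real^'n \<Rightarrow> real^'n" where
  "\<theta> x v = (\<chi> a. gdot G (F x) (fd F x v) (E x $ a))"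

text \<open>The connection form: entry \<open>c\<close>, \<open>b\<close> is the coefficient of
  \<open>E x $ c\<close> in the covariant derivative of \<open>E x $ b\<close>.\<close>

definition \<omega> :: "real^'n \<Rightarrow> real^'n \<Rightarrow> real^'n^'n" where
  "\<omega> x v = (\<chi> c b. gdot G (F x) (CD x v b) (E x $ c))"

text \<open>The frame dual to \<open>\<theta>\<close>, that is, the pullback of \<open>E\<close> by
  \<open>F\<close>; its vectors are the columns of the inverse matrix.\<close>

definition e :: "'n \<Rightarrow> real^'n \<Rightarrow> real^'n" where
  "e a x = (\<chi> i. matrix_inv (matrix (\<theta> x)) $ i $ a)"

lemma F_C1: "C_on 1 (ball 0 \<rho>) F" and E_C1: "C_on 1 (ball 0 \<rho>) E"
  using C_on_mono[OF F_C2, of 1] C_on_mono[OF E_C2, of 1] by auto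

lemma fdF_C1: "C_on 1 (ball 0 \<rho>) (\<lambda>x. fd F x v)" and fdE_C1: "C_on 1 (ball 0 \<rho>) (\<lambda>x. fd E x v)"
  using C_on_fd[of 1 "ball 0 \<rho>" F v] C_on_fd[of 1 "ball 0 \<rho>" E v] F_C2 E_C2 by (simp_all only: Suc_1)

lemma CD_C1: "C_on 1 (ball 0 \<rho>) (\<lambda>x. CD x v b)"
  unfolding CD_def by (intro C_on_add C_on_nth C_on_Gam_along fdE_C1 fdF_C1 F_C1 E_C1 open_ball F_in)

lemma \<theta>_C1: "C_on 1 (ball 0 \<rho>) (\<lambda>x. \<theta> x v)"
  unfolding \<theta>_def by (intro C_on_vec open_ball, unfold vec_lambda_beta, intro C_on_gdot_along C_on_nth fdF_C1 F_C1 E_C1 open_ball F_in)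

lemma \<omega>_C1: "C_on 1 (ball 0 \<rho>) (\<lambda>x. \<omega> x v)"
  unfolding \<omega>_def by (intro C_on_vec open_ball, unfold vec_lambda_beta, intro C_on_gdot_along C_on_nth CD_C1 F_C1 E_C1 open_ball F_in)

context
  fixes x :: "real^'n" assumes x: "x \<in> ball 0 \<rho>"
begin

lemma F_deriv: "(F has_derivative fd F x) (at x)" and E_deriv: "(E has_derivative fd E x) (at x)"
  using F_C1 E_C1 x by (auto intro: fd_works)

lemma Eb_deriv: "((\<lambda>y. E y $ b) has_derivative (\<lambda>v. fd E x v $ b)) (at x)"
  by (rule bounded_linear.has_derivative[OF bounded_linear_vec_nth E_deriv])

lemma F_linear: "linear (fd F x)" and E_linear: "linear (fd E x)"
  using F_deriv E_deriv by (auto dest: has_derivative_bounded_linear bounded_linear.linear)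

lemma CD_radial: "CD x x b = 0"
  by (simp add: CD_def E_radial[OF x] F_radial[OF x])

end

lemma E_orthonormal:
  assumes x: "x \<in> ball 0 \<rho>"
  shows "gdot G (F x) (E x $ a) (E x $ b) = (if a = b then 1 else 0)"
proof -
  have d: "((\<lambda>x. gdot G (F x) (E x $ a) (E x $ b)) has_derivative
     (\<lambda>v. gdot G (F x) (CD x v a) (E x $ b) + gdot G (F x) (E x $ a) (CD x v b))) (at x)" if x: "x \<in> ball 0 \<rho>" for x
    unfolding CD_def by (rule gdot_along[OF F_in[OF x] F_deriv[OF x] Eb_deriv[OF x] Eb_deriv[OF x]])
  have "gdot G (F x) (E x $ a) (E x $ b) = gdot G (F 0) (E 0 $ a) (E 0 $ b)"
  proof (rule radial_constant[OF _ _ x])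
    show "(\<lambda>x. gdot G (F x) (E x $ a) (E x $ b)) differentiable (at y)" if "y \<in> ball 0 \<rho>" for y
      using d[OF that] by (rule differentiableI)
    show "fd (\<lambda>x. gdot G (F x) (E x $ a) (E x $ b)) y y = 0" if "y \<in> ball 0 \<rho>" for y
      unfolding fd_eq[OF d[OF that]] CD_radial[OF that]
      by (simp add: gdot.zero_left gdot.zero_right)
  qed
  then show ?thesis by (simp add: E_orthonormal_0)
qed

lemmas gdot_sum = gdot.sum_left gdot.sum_right
  gdot.scaleR_left gdot.scaleR_right

context
  fixes x :: "real^'n" assumes x: "x \<in> ball 0 \<rho>"
begin

lemma expand: "(\<Sum>a\<in>UNIV. gdot G (F x) u (E x $ a) *\<^sub>R E x $ a) = u"
  by (rule frame_expand[OF F_in[OF x] E_orthonormal[OF x]])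

lemma gdot_E: "gdot G (F x) (\<Sum>a\<in>UNIV. c a *\<^sub>R E x $ a) (E x $ b) = c b"
  by (simp add: gdot_sum E_orthonormal[OF x] if_distrib[of "(*) _"] cong: if_cong)

lemma F_\<theta>: "fd F x v = (\<Sum>a\<in>UNIV. \<theta> x v $ a *\<^sub>R E x $ a)"
  by (simp add: \<theta>_def expand)

lemma CD_\<omega>: "CD x v b = (\<Sum>c\<in>UNIV. \<omega> x v $ c $ b *\<^sub>R E x $ c)"
  by (simp add: \<omega>_def expand)

lemma \<theta>_linear: "linear (\<theta> x)"
  by (rule linearI) (auto simp: \<theta>_def vec_eq_iff linear_add[OF F_linear[OF x]] linear_cmul[OF F_linear[OF x]] gdot_simps gdot_sum)

lemma CD_linear: "linear (\<lambda>v. CD x v b)"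
  by (rule linearI) (auto simp: CD_def linear_add[OF F_linear[OF x]] linear_cmul[OF F_linear[OF x]]
     linear_add[OF E_linear[OF x]] linear_cmul[OF E_linear[OF x]] Gam_simps
     Gam.scaleR_left scaleR_add_right)

lemma \<omega>_linear: "linear (\<omega> x)"
  by (rule linearI) (auto simp: \<omega>_def vec_eq_iff linear_add[OF CD_linear] linear_cmul[OF CD_linear] gdot_simps gdot_sum)

lemma \<omega>_skew: "\<omega> x v $ a $ b = - \<omega> x v $ b $ a"
proof -
  have "((\<lambda>x. gdot G (F x) (E x $ b) (E x $ a)) has_derivative
     (\<lambda>v. gdot G (F x) (CD x v b) (E x $ a) + gdot G (F x) (E x $ b) (CD x v a))) (at x)"
    unfolding CD_def by (rule gdot_along[OF F_in[OF x] F_deriv[OF x] Eb_deriv[OF x] Eb_deriv[OF x]])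
  then have "fd (\<lambda>x. gdot G (F x) (E x $ b) (E x $ a)) x v = gdot G (F x) (CD x v b) (E x $ a) + gdot G (F x) (E x $ b) (CD x v a)"
    by (simp add: fd_eq)
  moreover have "fd (\<lambda>x. gdot G (F x) (E x $ b) (E x $ a)) x = fd (\<lambda>_. if b = a then 1 else 0) x"
    by (rule fd_cong[OF open_ball x]) (rule E_orthonormal)
  ultimately show ?thesis by (simp add: \<omega>_def gdot_sym[OF F_in[OF x], of "E x $ b"])
qed

lemma \<theta>_radial: "\<theta> x x = x"
  by (simp add: \<theta>_def vec_eq_iff F_radial[OF x] gdot_E)

lemma \<omega>_radial: "\<omega> x x = 0"
  by (simp add: \<omega>_def vec_eq_iff CD_radial[OF x] gdot.zero_left)

lemma \<theta>_invertible: "invertible (matrix (\<theta> x))"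
proof -
  have "v = 0" if "matrix (\<theta> x) *v v = 0" for v
  proof -
    have "\<theta> x v = 0" using that by (simp add: matrix_works \<theta>_linear)
    then have "fd F x v = 0" by (simp add: F_\<theta>)
    then show ?thesis by (rule F_nondegenerate[OF x])
  qed
  then have "\<exists>B. B ** matrix (\<theta> x) = mat 1" by (simp add: matrix_left_invertible_ker)
  then show ?thesis by (simp add: invertible_left_inverse)
qed

lemma \<theta>_e: "\<theta> x (e a x) = axis a 1"
proof -
  have "\<theta> x (e a x) = matrix (\<theta> x) *v e a x" by (simp add: matrix_works \<theta>_linear)
  also have "\<dots> = axis a 1"
    using matrix_inv_mult_sum(1)[OF \<theta>_invertible] by (simp add: e_def vec_eq_iff matrix_vector_mult_def axis_def)
  finally show ?thesis .
qed

lemma F_e: "fd F x (e a x) = E x $ a"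
  unfolding F_\<theta>[of "e a x"] \<theta>_e
  by (simp add: axis_def if_distrib[of "\<lambda>c. c *\<^sub>R _"] cong: if_cong)

lemma \<theta>_inj: "\<theta> x u = \<theta> x v \<Longrightarrow> u = v"
  using F_\<theta>[of u] F_\<theta>[of v] F_nondegenerate[OF x, of "u - v"] linear_diff[OF F_linear[OF x], of u v] by simp

lemma e_\<theta>: "(\<Sum>a\<in>UNIV. \<theta> x v $ a *\<^sub>R e a x) = v"
proof (rule \<theta>_inj)
  show "\<theta> x (\<Sum>a\<in>UNIV. \<theta> x v $ a *\<^sub>R e a x) = \<theta> x v"
    by (simp add: linear_sum[OF \<theta>_linear] linear_cmul[OF \<theta>_linear] \<theta>_e vec_axis_sum)
qed

lemma e_radial: "(\<Sum>a\<in>UNIV. x $ a *\<^sub>R e a x) = x"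
  using e_\<theta>[of x] by (simp add: \<theta>_radial)

lemma hessF_deriv: "((\<lambda>y. fd F y v) has_derivative hess F x v) (at x)" 
  and hessE_deriv: "((\<lambda>y. fd E y v) has_derivative hess E x v) (at x)"
  unfolding hess_def using fdF_C1[of v] fdE_C1[of v] x by (auto intro: fd_works)

lemma hessEb_deriv: "((\<lambda>y. fd E y v $ b) has_derivative (\<lambda>u. hess E x v u $ b)) (at x)"
  by (rule bounded_linear.has_derivative[OF bounded_linear_vec_nth hessE_deriv])

lemma radial_deriv_F: "fd F x v + hess F x x v = (\<Sum>a\<in>UNIV. v $ a *\<^sub>R E x $ a + x $ a *\<^sub>R fd E x v $ a)"
proof -
  have "((\<lambda>y. \<Sum>a\<in>UNIV. y $ a *\<^sub>R E y $ a) has_derivative (\<lambda>v. \<Sum>a\<in>UNIV. x $ a *\<^sub>R fd E x v $ a + v $ a *\<^sub>R E x $ a)) (at x)"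
    by (intro has_derivative_sum has_derivative_scaleR Eb_deriv[OF x] bounded_linear_imp_has_derivative bounded_linear_vec_nth)
  then have "fd (\<lambda>y. \<Sum>a\<in>UNIV. y $ a *\<^sub>R E y $ a) x v = (\<Sum>a\<in>UNIV. x $ a *\<^sub>R fd E x v $ a + v $ a *\<^sub>R E x $ a)"
    by (simp add: fd_eq)
  moreover have "fd (\<lambda>y. fd F y y) x v = fd F x v + hess F x x v"
    using fd_eq[OF fd_apply_has_derivative[OF F_C2 open_ball x differentiable_ident]] by simp
  moreover have "fd (\<lambda>y. fd F y y) x = fd (\<lambda>y. \<Sum>a\<in>UNIV. y $ a *\<^sub>R E y $ a) x"
    by (rule fd_cong[OF open_ball x]) (rule F_radial)
  ultimately show ?thesis by (simp add: add.commute)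
qed

text \<open>The first structure equation contracted with the radial field, on which
  \<open>\<theta>\<close> is the identity and \<open>\<omega>\<close> vanishes; the left side is the
  radial Lie derivative of \<open>\<theta>\<close>. It results from differentiating
  \<open>F_radial\<close> in direction \<open>v\<close> and exchanging second derivatives of
  \<open>F\<close>.\<close>

lemma \<theta>_transport: "fd (\<lambda>y. \<theta> y v) x x + \<theta> x v = v + \<omega> x v *v x"
proof -
  have "((\<lambda>y. gdot G (F y) (fd F y v) (E y $ a)) has_derivative (\<lambda>u. gdot G (F x) (hess F x v u + Gam G (F x) (fd F x u) (fd F x v)) (E x $ a)
    + gdot G (F x) (fd F x v) (CD x u a))) (at x)" for a
    unfolding CD_def by (rule gdot_along[OF F_in[OF x] F_deriv[OF x] hessF_deriv Eb_deriv[OF x]])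
  from fd_eq[OF this] have 1: "fd (\<lambda>y. gdot G (F y) (fd F y v) (E y $ a)) x x = gdot G (F x) (hess F x v x + Gam G (F x) (fd F x x) (fd F x v)) (E x $ a)" for a
    by (simp add: CD_radial[OF x] gdot.zero_right)
  have 2: "fd (\<lambda>y. \<theta> y v) x u $ a = fd (\<lambda>y. gdot G (F y) (fd F y v) (E y $ a)) x u" for u a
  proof -
    have "(\<lambda>y. \<theta> y v) differentiable (at x)" using \<theta>_C1[of v] x by simp
    from fd_eq[OF bounded_linear.has_derivative[OF bounded_linear_vec_nth[of a] fd_works[OF this]]]
    show ?thesis by (simp add: \<theta>_def fun_eq_iff)
  qed
  have 3: "hess F x v x + Gam G (F x) (fd F x x) (fd F x v) = (\<Sum>a\<in>UNIV. v $ a *\<^sub>R E x $ a) + (\<Sum>b\<in>UNIV. x $ b *\<^sub>R CD x v b) - fd F x v"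
  proof -
    have "hess F x v x = (\<Sum>a\<in>UNIV. v $ a *\<^sub>R E x $ a + x $ a *\<^sub>R fd E x v $ a) - fd F x v"
      using radial_deriv_F[of v] hess_sym[OF F_C2 open_ball x, of v x] by (simp add: algebra_simps)
    moreover have "Gam G (F x) (fd F x x) (fd F x v) = (\<Sum>b\<in>UNIV. x $ b *\<^sub>R Gam G (F x) (fd F x v) (E x $ b))"
      by (subst Gam_sym[OF F_in[OF x]])
        (simp only: F_radial[OF x] Gam.sum_right Gam.scaleR_right)
    ultimately show ?thesis by (simp add: CD_def sum.distrib scaleR_add_right)
  qed
  have 4: "gdot G (F x) (\<Sum>b\<in>UNIV. x $ b *\<^sub>R CD x v b) (E x $ a) = (\<omega> x v *v x) $ a" for a
    by (simp add: gdot_sum \<omega>_def matrix_vector_mult_def mult.commute)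
  have "fd (\<lambda>y. \<theta> y v) x x $ a = v $ a + (\<omega> x v *v x) $ a - \<theta> x v $ a" for a
    unfolding 2 1 3 by (simp add: gdot_simps 4 gdot_E \<theta>_def)
  then show ?thesis by (simp add: vec_eq_iff)
qed

text \<open>The second structure equation contracted with the radial field: the radial Lie
  derivative of the connection form is a curvature component.\<close>

lemma \<omega>_transport:
  "fd (\<lambda>y. \<omega> y v) x x $ c $ b + \<omega> x v $ c $ b
    = gdot G (F x) (Rop G (F x) (\<Sum>a\<in>UNIV. x $ a *\<^sub>R E x $ a) (fd F x v) (E x $ b)) (E x $ c)"
proof -
  define U where "U = fd F x x"
  define w where "w = fd F x v"
  have CDd: "((\<lambda>y. CD y v b) has_derivative (\<lambda>u. hess E x v u $ b + (DG (F x) (fd F x u) w (E x $ b)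
     + (Gam G (F x) (hess F x v u) (E x $ b) + Gam G (F x) w (fd E x u $ b))))) (at x)"
    unfolding CD_def w_def by (intro has_derivative_add hessEb_deriv Gam_along[OF F_in[OF x] F_deriv[OF x] hessF_deriv Eb_deriv[OF x]])
  have "((\<lambda>y. gdot G (F y) (CD y v b) (E y $ c)) has_derivative (\<lambda>u. gdot G (F x) ((hess E x v u $ b + (DG (F x) (fd F x u) w (E x $ b)
     + (Gam G (F x) (hess F x v u) (E x $ b) + Gam G (F x) w (fd E x u $ b)))) + Gam G (F x) (fd F x u) (CD x v b)) (E x $ c)
    + gdot G (F x) (CD x v b) (CD x u c))) (at x)"
    unfolding CD_def[of x _ c] by (rule gdot_along[OF F_in[OF x] F_deriv[OF x] CDd Eb_deriv[OF x]])
  from fd_eq[OF this] have 1: "fd (\<lambda>y. gdot G (F y) (CD y v b) (E y $ c)) x x = gdot G (F x) ((hess E x v x $ b + (DG (F x) U w (E x $ b)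
     + (Gam G (F x) (hess F x v x) (E x $ b) + Gam G (F x) w (fd E x x $ b)))) + Gam G (F x) U (CD x v b)) (E x $ c)"
    by (simp add: CD_radial[OF x] gdot.zero_right U_def)
  have 2: "fd (\<lambda>y. \<omega> y v) x u $ c $ b = fd (\<lambda>y. gdot G (F y) (CD y v b) (E y $ c)) x u" for u
  proof -
    have "(\<lambda>y. \<omega> y v) differentiable (at x)" using \<omega>_C1[of v] x by simp
    from fd_eq[OF bounded_linear.has_derivative[OF bounded_linear_vec_nth[of b] bounded_linear.has_derivative[OF bounded_linear_vec_nth[of c] fd_works[OF this]]]]
    show ?thesis by (simp add: \<omega>_def fun_eq_iff)
  qed
  \<comment> \<open>The equation of parallel transport, differentiated in direction
    \<open>v\<close>.\<close>
  have 3: "fd E x v $ b + hess E x x v $ b = - (DG (F x) w U (E x $ b) + (Gam G (F x) (w + hess F x x v) (E x $ b) + Gam G (F x) U (fd E x v $ b)))"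
  proof -
    have Ud: "((\<lambda>y. fd F y y) has_derivative (\<lambda>v. fd F x v + hess F x x v)) (at x)"
      using fd_apply_has_derivative[OF F_C2 open_ball x differentiable_ident] by simp
    have "((\<lambda>y. - Gam G (F y) (fd F y y) (E y $ b)) has_derivative (\<lambda>v. - (DG (F x) (fd F x v) U (E x $ b)
      + (Gam G (F x) (fd F x v + hess F x x v) (E x $ b) + Gam G (F x) U (fd E x v $ b))))) (at x)"
      unfolding U_def by (intro has_derivative_minus Gam_along[OF F_in[OF x] F_deriv[OF x] Ud Eb_deriv[OF x]])
    then have a: "fd (\<lambda>y. - Gam G (F y) (fd F y y) (E y $ b)) x v = - (DG (F x) w U (E x $ b)
      + (Gam G (F x) (w + hess F x x v) (E x $ b) + Gam G (F x) U (fd E x v $ b)))" by (simp add: fd_eq w_def)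
    have "((\<lambda>y. fd E y y $ b) has_derivative (\<lambda>v. (fd E x v + hess E x x v) $ b)) (at x)"
      by (rule bounded_linear.has_derivative[OF bounded_linear_vec_nth])
        (use fd_apply_has_derivative[OF E_C2 open_ball x differentiable_ident] in simp)
    then have "fd (\<lambda>y. fd E y y $ b) x v = (fd E x v + hess E x x v) $ b" by (simp add: fd_eq)
    moreover have "fd (\<lambda>y. fd E y y $ b) x = fd (\<lambda>y. - Gam G (F y) (fd F y y) (E y $ b)) x"
      by (rule fd_cong[OF open_ball x]) (simp add: E_radial F_radial)
    ultimately show ?thesis using a by simp
  qed
  have 4: "hess E x v x $ b + (DG (F x) U w (E x $ b)
     + (Gam G (F x) (hess F x v x) (E x $ b) + Gam G (F x) w (fd E x x $ b))) + Gam G (F x) U (CD x v b)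
    = Rop G (F x) U w (E x $ b) - CD x v b"
  proof -
    have "hess E x v x $ b = - (DG (F x) w U (E x $ b) + (Gam G (F x) (w + hess F x x v) (E x $ b) + Gam G (F x) U (fd E x v $ b))) - fd E x v $ b"
      using 3 hess_sym[OF E_C2 open_ball x, of v x] by (simp add: algebra_simps)
    moreover have "fd E x x $ b = - Gam G (F x) U (E x $ b)" by (simp add: E_radial[OF x] U_def F_radial[OF x])
    ultimately show ?thesis
      by (simp add: Rop_def CD_def w_def Gam_simps hess_sym[OF F_C2 open_ball x, of v x])
  qed
  show ?thesis unfolding 2 1 4 unfolding U_def w_def F_radial[OF x] by (simp add: gdot_simps \<omega>_def)
qed

end

text \<open>The difference of the two sides is constant on rays and vanishes at the origin: pairing
  \<open>\<theta>_transport\<close> with the radial vector removes the term in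
  \<open>\<omega>\<close>, which is skew.\<close>

lemma gauss: assumes x: "x \<in> ball 0 \<rho>" shows "x \<bullet> \<theta> x v = x \<bullet> v"
proof -
  have d: "((\<lambda>y. y \<bullet> \<theta> y v - y \<bullet> v) has_derivative (\<lambda>u. (x \<bullet> fd (\<lambda>y. \<theta> y v) x u + u \<bullet> \<theta> x v) - u \<bullet> v)) (at x)"
    if "x \<in> ball 0 \<rho>" for x
  proof -
    have t: "((\<lambda>y. \<theta> y v) has_derivative fd (\<lambda>y. \<theta> y v) x) (at x)"
      using \<theta>_C1[of v] that by (intro fd_works) simp
    show ?thesis
      by (intro has_derivative_diff has_derivative_inner[OF has_derivative_ident t] bounded_linear_imp_has_derivative bounded_linear_inner_left)
  qed
  have "x \<bullet> \<theta> x v - x \<bullet> v = 0 \<bullet> \<theta> 0 v - 0 \<bullet> v"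
  proof (rule radial_constant[OF _ _ x])
    show "(\<lambda>x. x \<bullet> \<theta> x v - x \<bullet> v) differentiable (at y)" if "y \<in> ball 0 \<rho>" for y
      using d[OF that] by (rule differentiableI)
    fix y :: "real^'n" assume y: "y \<in> ball 0 \<rho>"
    have "y \<bullet> (\<omega> y v *v y) = 0"
    proof -
      have "y \<bullet> (\<omega> y v *v y) = (\<Sum>i\<in>UNIV. \<Sum>j\<in>UNIV. y $ i * (\<omega> y v $ i $ j * y $ j))"
        by (simp add: inner_vec_def matrix_vector_mult_def sum_distrib_left)
      also have "\<dots> = 0" by (rule sum_antisym_zero) (subst \<omega>_skew[OF y], simp)
      finally show ?thesis .
    qed
    moreover have "y \<bullet> (fd (\<lambda>y. \<theta> y v) y y + \<theta> y v) = y \<bullet> (v + \<omega> y v *v y)"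
      by (simp only: \<theta>_transport[OF y])
    ultimately show "fd (\<lambda>x. x \<bullet> \<theta> x v - x \<bullet> v) y y = 0"
      unfolding fd_eq[OF d[OF y]] by (simp add: inner_add_right)
  qed
  then show ?thesis by simp
qed

lemma e_inner: assumes x: "x \<in> ball 0 \<rho>" shows "x \<bullet> e a x = x $ a"
  using gauss[OF x, of "e a x"] by (simp add: \<theta>_e[OF x] inner_axis)

lemma e_C1: "C_on 1 (ball 0 \<rho>) (e a)"
proof -
  have "C_on 1 (ball 0 \<rho>) (\<lambda>x. matrix_inv (matrix (\<theta> x)) $ i $ a)" for i
  proof (rule C_on_matrix_inv[OF open_ball _ \<theta>_invertible])
    show "C_on 1 (ball 0 \<rho>) (\<lambda>x. matrix (\<theta> x) $ a $ b)" for a b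
      unfolding matrix_def using C_on_nth[OF \<theta>_C1 open_ball] by simp
  qed
  then show ?thesis unfolding e_def by (intro C_on_vec open_ball) simp
qed

lemma \<theta>_0: "\<theta> 0 v = v"
proof -
  have z: "(0 :: real^'n) \<in> ball 0 \<rho>" using \<rho> by simp
  have "(\<lambda>y. \<theta> y v) differentiable (at 0)" using \<theta>_C1[of v] z by simp
  then have "fd (\<lambda>y. \<theta> y v) 0 0 = 0"
    using linear_0 bounded_linear.linear fd_bounded_linear by blast
  then show ?thesis using \<theta>_transport[OF z, of v] by simp
qed

lemma e_0: "e a 0 = axis a 1"
proof -
  have z: "(0 :: real^'n) \<in> ball 0 \<rho>" using \<rho> by simp
  show ?thesis using \<theta>_e[OF z, of a] by (simp add: \<theta>_0)
qed

subsection \<open>Tensors in the frame\<close>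

text \<open>Frame components as functions of the normal coordinates. Being scalar functions on a
  ball, those of two manifolds can be subtracted.\<close>

definition comp :: "(real^'n \<Rightarrow> 'n list \<Rightarrow> real) \<Rightarrow> 'n list \<Rightarrow> real^'n \<Rightarrow> real" where
  "comp T as x = tensor_apply (T (F x)) (map (\<lambda>a. E x $ a) as)"

lemma comp_map: "comp T as x = tensor_apply (T (F x)) (map (\<lambda>k. E x $ (as ! k)) [0..<length as])"
proof -
  have "map (\<lambda>a. E x $ a) as = map (\<lambda>k. E x $ (as ! k)) [0..<length as]"
    by (rule nth_equalityI) auto
  then show ?thesis by (simp add: comp_def)
qed

lemma comp_C2:
  assumes "\<And>I k. C_on k S (\<lambda>y. T y I)" shows "C_on 2 (ball 0 \<rho>) (comp T as)"
  unfolding comp_map[abs_def]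
  by (rule C_on_tensor_along[OF F_C2 _ open_ball F_in assms]) (auto intro!: C_on_nth E_C2)

lemma tensor_apply_sum_scale:
  assumes "a < length vs"
  shows "tensor_apply T (vs[a := \<Sum>c\<in>C. f c *\<^sub>R w c]) = (\<Sum>c\<in>C. f c * tensor_apply T (vs[a := w c]))"
  unfolding tensor_apply_update[OF assms]
  by (simp add: sum_distrib_left sum_distrib_right mult_ac) (rule trans[OF sum.swap], simp)

lemma comp_deriv:
  assumes x: "x \<in> ball 0 \<rho>" and T: "\<And>I k. C_on k S (\<lambda>y. T y I)"
  shows "(comp T as has_derivative (\<lambda>v. (\<Sum>a\<in>UNIV. \<theta> x v $ a * comp (cov_deriv G T) (a # as) x)
     + (\<Sum>k<length as. \<Sum>c\<in>UNIV. \<omega> x v $ c $ (as ! k) * comp T (as[k := c]) x))) (at x)"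
proof -
  define vs where "vs = map (\<lambda>k. E x $ (as ! k)) [0..<length as]"
  have vs': "vs = map (\<lambda>a. E x $ a) as" unfolding vs_def by (rule nth_equalityI) auto
  have dT: "(\<lambda>y. T y I) differentiable (at (F x))" for I
    using T[of 1 I] F_in[OF x] by simp
  have "(comp T as has_derivative (\<lambda>v. tensor_apply (cov_deriv G T (F x)) (fd F x v # vs)
       + (\<Sum>k<length as. tensor_apply (T (F x)) (vs[k := fd E x v $ (as ! k) + Gam G (F x) (fd F x v) (E x $ (as ! k))])))) (at x)"
    unfolding comp_map[abs_def] vs_def
    by (rule tensor_apply_along[OF F_deriv[OF x] Eb_deriv[OF x] dT])
  moreover have "tensor_apply (cov_deriv G T (F x)) (fd F x v # vs) = (\<Sum>a\<in>UNIV. \<theta> x v $ a * comp (cov_deriv G T) (a # as) x)" for v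
  proof -
    have "tensor_apply (cov_deriv G T (F x)) (fd F x v # vs) = tensor_apply (cov_deriv G T (F x)) ((0 # vs)[0 := \<Sum>a\<in>UNIV. \<theta> x v $ a *\<^sub>R E x $ a])"
      using F_\<theta>[OF x, of v] by simp
    also have "\<dots> = (\<Sum>a\<in>UNIV. \<theta> x v $ a * comp (cov_deriv G T) (a # as) x)"
      by (subst tensor_apply_sum_scale) (auto simp: comp_def vs')
    finally show ?thesis .
  qed
  moreover have "tensor_apply (T (F x)) (vs[k := fd E x v $ (as ! k) + Gam G (F x) (fd F x v) (E x $ (as ! k))])
     = (\<Sum>c\<in>UNIV. \<omega> x v $ c $ (as ! k) * comp T (as[k := c]) x)" if "k < length as" for k v
    unfolding CD_def[symmetric] CD_\<omega>[OF x]
    by (subst tensor_apply_sum_scale) (use that in \<open>auto simp: comp_def vs' map_update\<close>)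
  ultimately show ?thesis by simp
qed

lemma comp_e:
  assumes x: "x \<in> ball 0 \<rho>" and T: "\<And>I k. C_on k S (\<lambda>y. T y I)"
  shows "fd (comp T as) x (e b x) = comp (cov_deriv G T) (b # as) x
     + (\<Sum>k<length as. \<Sum>c\<in>UNIV. \<omega> x (e b x) $ c $ (as ! k) * comp T (as[k := c]) x)"
  unfolding fd_eq[OF comp_deriv[OF x T]] \<theta>_e[OF x]
  by (simp add: axis_def if_distrib[of "\<lambda>c. c * _"] cong: if_cong)

text \<open>The frame is parallel along rays, so no connection term appears: radial derivatives of
  components are components of the next covariant derivative. This is how jets at the origin control
  components near it.\<close>

lemma comp_radial:
  assumes x: "x \<in> ball 0 \<rho>" and T: "\<And>I k. C_on k S (\<lambda>y. T y I)"
  shows "fd (comp T as) x x = (\<Sum>a\<in>UNIV. x $ a * comp (cov_deriv G T) (a # as) x)"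
  unfolding fd_eq[OF comp_deriv[OF x T]] \<theta>_radial[OF x] \<omega>_radial[OF x] by simp

end

lemma fd_nth: "f differentiable (at x) \<Longrightarrow> fd (\<lambda>y. f y $ i) x v = fd f x v $ i"
  using fd_eq[OF bounded_linear.has_derivative[OF bounded_linear_vec_nth[of i] fd_works[of f x]]] by simp

lemma C_on_real_deriv:
  fixes f :: "real \<Rightarrow> real"
  assumes "C_on (Suc k) UNIV f" shows "C_on k UNIV (deriv f)"
proof -
  have "deriv f x = fd f x 1" for x
  proof -
    have "(f has_field_derivative deriv f x) (at x)"
      using assms by (simp add: DERIV_deriv_iff_real_differentiable)
    from fd_eq[OF this[unfolded has_field_derivative_def]] show ?thesis by simp
  qed
  then show ?thesis using C_on_fd[OF assms, of 1] by (simp add: fun_eq_iff[of "deriv f"] C_on_cong[OF _ open_UNIV])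
qed

section \<open>The field equations in the frame\<close>

locale einstein_frame = normal_frame G S F E \<rho>
  for G :: "real^'n \<Rightarrow> real^'n^'n::finite" and S F E \<rho> +
  fixes h :: "real^'n \<Rightarrow> real" and V :: "real \<Rightarrow> real" and \<Lambda> :: real
  assumes h: "smooth_on S h" and V: "C_on 3 UNIV V"
    and ricci_eq: "y \<in> S \<Longrightarrow> ricci G i j y = partial i h y * partial j h y + G y $ i $ j * V (h y) + \<Lambda> * G y $ i $ j"
    and laplacian_eq: "y \<in> S \<Longrightarrow> laplacian G h y = deriv V (h y)"
begin

abbreviation T1 where "T1 \<equiv> cov_deriv G (scalar_field h)"
abbreviation T2 where "T2 \<equiv> cov_deriv G T1"

definition R :: "'n \<Rightarrow> 'n \<Rightarrow> 'n \<Rightarrow> 'n \<Rightarrow> real^'n \<Rightarrow> real" where "R a b c d = comp (riemann G) [a, b, c, d]"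
definition \<phi> :: "real^'n \<Rightarrow> real" where "\<phi> = comp (scalar_field h) []"
definition \<alpha> :: "'n \<Rightarrow> real^'n \<Rightarrow> real" where "\<alpha> a = comp T1 [a]"
definition H :: "'n \<Rightarrow> 'n \<Rightarrow> real^'n \<Rightarrow> real" where "H a b = comp T2 [a, b]"
definition w :: "'n \<Rightarrow> 'n \<Rightarrow> 'n \<Rightarrow> real^'n \<Rightarrow> real" where "w k p a x = \<omega> x (e k x) $ p $ a"

text \<open>The connection terms by which a frame derivative of \<open>R\<close> exceeds the
  component of its covariant derivative; they are algebraic in the unknowns. \<open>WH\<close> is
  the analogue for the Hessian.\<close>

definition WR :: "'n \<Rightarrow> 'n \<Rightarrow> 'n \<Rightarrow> 'n \<Rightarrow> 'n \<Rightarrow> real^'n \<Rightarrow> real" where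
  "WR k a b c d x = (\<Sum>p\<in>UNIV. w k p a x * R p b c d x) + (\<Sum>p\<in>UNIV. w k p b x * R a p c d x)
     + (\<Sum>p\<in>UNIV. w k p c x * R a b p d x) + (\<Sum>p\<in>UNIV. w k p d x * R a b c p x)"

definition WH :: "'n \<Rightarrow> 'n \<Rightarrow> 'n \<Rightarrow> real^'n \<Rightarrow> real" where
  "WH k a b x = (\<Sum>p\<in>UNIV. w k p a x * H p b x) + (\<Sum>p\<in>UNIV. w k p b x * H a p x)"

lemma T1_C: "C_on k S (\<lambda>x. T1 x I)" and T2_C: "C_on k S (\<lambda>x. T2 x I)"
  by (intro cov_deriv_C_on scalar_C_on h)+

lemma R_C2: "C_on 2 (ball 0 \<rho>) (R a b c d)" and \<phi>_C2: "C_on 2 (ball 0 \<rho>) \<phi>"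
  and \<alpha>_C2: "C_on 2 (ball 0 \<rho>) (\<alpha> a)" and H_C2: "C_on 2 (ball 0 \<rho>) (H a b)"
  unfolding R_def \<phi>_def \<alpha>_def H_def by (intro comp_C2 riemann_C_on T1_C T2_C scalar_C_on h)+


context
  fixes x :: "real^'n" assumes x: "x \<in> ball 0 \<rho>"
begin

lemma \<phi>_eq: "\<phi> x = h (F x)"
  by (simp add: \<phi>_def comp_def tensor_apply_Nil scalar_field_def)

lemma \<alpha>_eq: "\<alpha> a x = fd h (F x) (E x $ a)"
  by (simp add: \<alpha>_def comp_def grad_apply[OF h F_in[OF x]])

lemma R_eq: "R a b c d x = gdot G (F x) (Rop G (F x) (E x $ a) (E x $ b) (E x $ c)) (E x $ d)"
  by (simp add: R_def comp_def tensor_apply_riemann[OF F_in[OF x]])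

lemma R_sym: "R a b c d x = - R b a c d x" "R a b c d x = - R a b d c x" "R a b c d x = R c d a b x"
  unfolding R_eq by (subst Rop_anti[OF F_in[OF x]], simp only: gdot_simps) (rule Rop_skew[OF F_in[OF x]] Rop_pair[OF F_in[OF x]])+

lemma H_sym: "H a b x = H b a x"
  by (simp add: H_def comp_def hess_apply_sym[OF h F_in[OF x], of "E x $ a"])

lemma w_skew: "w k p a x = - w k a p x"
  unfolding w_def by (rule \<omega>_skew[OF x])

lemma \<phi>_e: "fd \<phi> x (e k x) = \<alpha> k x" and \<phi>_radial: "fd \<phi> x x = (\<Sum>a\<in>UNIV. x $ a * \<alpha> a x)"
  unfolding \<phi>_def \<alpha>_def by (subst comp_e comp_radial; use x scalar_C_on[OF h] in simp)+

lemma \<alpha>_e: "fd (\<alpha> a) x (e k x) = H k a x + (\<Sum>p\<in>UNIV. w k p a x * \<alpha> p x)"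
  and \<alpha>_radial: "fd (\<alpha> b) x x = (\<Sum>a\<in>UNIV. x $ a * H a b x)"
  unfolding \<alpha>_def H_def w_def by (subst comp_e comp_radial; use x T1_C in simp)+

lemma H_e: "fd (H a b) x (e k x) = comp (cov_deriv G T2) [k, a, b] x + WH k a b x"
  unfolding H_def WH_def w_def by (subst comp_e; use x T2_C in \<open>simp add: lessThan_Suc eval_nat_numeral\<close>)

lemma R_e: "fd (R a b c d) x (e k x) = comp (cov_deriv G (riemann G)) [k, a, b, c, d] x + WR k a b c d x"
  unfolding R_def WR_def w_def by (subst comp_e; use x riemann_C_on in \<open>simp add: lessThan_Suc eval_nat_numeral\<close>)

lemma \<omega>_radial_R:
  "fd (\<lambda>y. \<omega> y v $ c $ b) x x + \<omega> x v $ c $ b = (\<Sum>a\<in>UNIV. x $ a * (\<Sum>d\<in>UNIV. \<theta> x v $ d * R a d b c x))"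
proof -
  have d: "(\<lambda>y. \<omega> y v) differentiable (at x)" using \<omega>_C1[of v] x by simp
  have "fd (\<lambda>y. \<omega> y v $ c $ b) x x = fd (\<lambda>y. \<omega> y v) x x $ c $ b"
    using fd_nth[of "\<lambda>y. \<omega> y v $ c" x b x] fd_nth[OF d, of c x]
      differentiableI[OF bounded_linear.has_derivative[OF bounded_linear_vec_nth[of c] fd_works[OF d]]] by simp
  then show ?thesis using \<omega>_transport[OF x, of v c b] sum.swap[of "\<lambda>d a. \<theta> x v $ d * (x $ a * R a d b c x)" UNIV UNIV] unfolding R_eq F_\<theta>[OF x, of v]
  by (simp add: linear_sum[OF Rop_linear(1)] linear_cmul[OF Rop_linear(1)] linear_sum[OF Rop_linear(2)] linear_cmul[OF Rop_linear(2)]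
    F_in[OF x] gdot_sum sum_distrib_left mult.left_commute)
qed

lemma \<theta>_radial_\<omega>: "fd (\<lambda>y. \<theta> y v $ a) x x + \<theta> x v $ a = v $ a + (\<Sum>b\<in>UNIV. x $ b * \<omega> x v $ a $ b)"
proof -
  have d: "(\<lambda>y. \<theta> y v) differentiable (at x)" using \<theta>_C1[of v] x by simp
  show ?thesis unfolding fd_nth[OF d] using arg_cong[OF \<theta>_transport[OF x, of v], of "\<lambda>u. u $ a"]
    by (simp add: matrix_vector_mult_def mult.commute)
qed

text \<open>The Ricci equation in the frame: the Ricci tensor contracts the first index of
  \<open>R\<close> with the last.\<close>

lemma trace_R: "(\<Sum>a\<in>UNIV. R a c d a x) = \<alpha> c x * \<alpha> d x + (if c = d then 1 else 0) * (V (\<phi> x) + \<Lambda>)"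
proof -
  have "(\<Sum>a\<in>UNIV. R a c d a x) = (\<Sum>j\<in>UNIV. \<Sum>k\<in>UNIV. ricci G j k (F x) * (E x $ c $ j * E x $ d $ k))"
    unfolding R_eq by (rule ricci_frame[OF F_in[OF x] E_orthonormal[OF x]])
  also have "\<dots> = (\<Sum>j\<in>UNIV. \<Sum>k\<in>UNIV. (E x $ c $ j * fd h (F x) (axis j 1)) * (E x $ d $ k * fd h (F x) (axis k 1)))
     + (V (h (F x)) + \<Lambda>) * gdot G (F x) (E x $ c) (E x $ d)"
    unfolding gdot_def sum_distrib_left sum.distrib[symmetric]
    by (intro sum.cong refl) (simp add: ricci_eq[OF F_in[OF x]] partial_def algebra_simps)
  also have "(\<Sum>j\<in>UNIV. \<Sum>k\<in>UNIV. (E x $ c $ j * fd h (F x) (axis j 1)) * (E x $ d $ k * fd h (F x) (axis k 1))) = \<alpha> c x * \<alpha> d x"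
    unfolding \<alpha>_eq fd_axis_sum[OF h_diff[OF h F_in[OF x]], of "E x $ _"] by (simp add: sum_product)
  finally show ?thesis by (simp add: E_orthonormal[OF x] \<phi>_eq)
qed

lemma trace_H: "(\<Sum>a\<in>UNIV. H a a x) = deriv V (\<phi> x)"
  unfolding H_def comp_def \<phi>_eq using laplacian_frame[OF F_in[OF x] E_orthonormal[OF x]] laplacian_eq[OF F_in[OF x]] by simp


end

context
  fixes x :: "real^'n" assumes x: "x \<in> ball 0 \<rho>"
begin

abbreviation DR where "DR k a b c d \<equiv> comp (cov_deriv G (riemann G)) [k, a, b, c, d] x"
abbreviation DH where "DH k a b \<equiv> comp (cov_deriv G T2) [k, a, b] x"

lemma differentiable_comps: "R a b c d differentiable (at x)" "H a b differentiable (at x)" "\<alpha> a differentiable (at x)" "\<phi> differentiable (at x)"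
  using R_C2 H_C2 \<alpha>_C2 \<phi>_C2 x by (auto simp: numeral_2_eq_2)

text \<open>The frame derivatives of \<open>R\<close> inherit its symmetries, and so do the
  connection terms \<open>WR\<close>; \<open>R_e\<close> passes them on to the covariant
  derivative.\<close>

lemma DR_sym: "DR k a b c d = - DR k b a c d" "DR k a b c d = - DR k a b d c" "DR k a b c d = DR k c d a b"
proof -
  have m: "fd (\<lambda>x. - f x) x = (\<lambda>v. - fd f x v)" if "f differentiable (at x)" for f :: "real^'n \<Rightarrow> real"
    by (rule fd_eq[OF has_derivative_minus[OF fd_works[OF that]]])
  have "fd (R a b c d) x = fd (\<lambda>x. - R b a c d x) x" by (rule fd_cong[OF open_ball x]) (rule R_sym)
  moreover have "WR k a b c d x = - WR k b a c d x"
    unfolding WR_def by (simp add: R_sym(1)[OF x, of b] R_sym(1)[OF x, of _ a] sum_negf)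
  ultimately show "DR k a b c d = - DR k b a c d"
    using R_e[OF x, of a b c d k] R_e[OF x, of b a c d k] m[OF differentiable_comps(1)] by simp
  have "fd (R a b c d) x = fd (\<lambda>x. - R a b d c x) x" by (rule fd_cong[OF open_ball x]) (rule R_sym)
  moreover have "WR k a b c d x = - WR k a b d c x"
    unfolding WR_def by (simp add: R_sym(2)[OF x, of _ _ d] R_sym(2)[OF x, of _ _ _ c] sum_negf)
  ultimately show "DR k a b c d = - DR k a b d c"
    using R_e[OF x, of a b c d k] R_e[OF x, of a b d c k] m[OF differentiable_comps(1)] by simp
  have "fd (R a b c d) x = fd (R c d a b) x" by (rule fd_cong[OF open_ball x]) (rule R_sym)
  moreover have "WR k a b c d x = WR k c d a b x"
    unfolding WR_def by (simp add: R_sym(3)[OF x, of a] R_sym(3)[OF x, of _ b])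
  ultimately show "DR k a b c d = DR k c d a b"
    using R_e[OF x, of a b c d k] R_e[OF x, of c d a b k] by simp
qed

lemma DH_sym: "DH k a b = DH k b a"
proof -
  have "fd (H a b) x = fd (H b a) x" by (rule fd_cong[OF open_ball x]) (rule H_sym)
  moreover have "WH k a b x = WH k b a x"
    unfolding WH_def by (simp add: H_sym[OF x, of b] H_sym[OF x, of _ a])
  ultimately show ?thesis using H_e[OF x, of a b k] H_e[OF x, of b a k] by simp
qed

lemma DR_bianchi: "DR k a b c d + DR a b k c d + DR b k a c d = 0"
  unfolding comp_def using second_bianchi[OF F_in[OF x], of "E x $ k"] by simp

lemma DH_commutator: "DH a b c - DH b a c = - (\<Sum>d\<in>UNIV. R a b c d x * \<alpha> d x)"
proof -
  have "fd h (F x) (Rop G (F x) (E x $ a) (E x $ b) (E x $ c)) = (\<Sum>d\<in>UNIV. R a b c d x * \<alpha> d x)"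
    unfolding R_eq[OF x] \<alpha>_eq[OF x]
    by (subst expand[OF x, symmetric])
      (simp add: linear_sum linear_cmul bounded_linear.linear[OF fd_bounded_linear[OF h_diff[OF h F_in[OF x]]]])
  then show ?thesis unfolding comp_def using third_commutator[OF h F_in[OF x], of "E x $ a" "E x $ b" "E x $ c"] by simp
qed

lemma fd_V: "C_on 1 UNIV f \<Longrightarrow> fd (\<lambda>x. f (\<phi> x)) x v = deriv f (\<phi> x) * fd \<phi> x v"
proof -
  assume "C_on 1 UNIV f"
  then have "(f has_derivative (\<lambda>r. deriv f (\<phi> x) * r)) (at (\<phi> x))"
    using DERIV_deriv_iff_real_differentiable[of f "\<phi> x"] by (simp add: has_field_derivative_def)
  from fd_eq[OF diff_chain_at[OF fd_works[OF differentiable_comps(4)] this, unfolded o_def]] show ?thesis by simp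
qed

text \<open>The derivative of \<open>trace_H\<close>. The connection terms cancel, since
  \<open>w\<close> is skew and \<open>H\<close> symmetric.\<close>

lemma DH_trace: "(\<Sum>a\<in>UNIV. DH k a a) = deriv (deriv V) (\<phi> x) * \<alpha> k x"
proof -
  have "fd (\<lambda>x. \<Sum>a\<in>UNIV. H a a x) x = fd (\<lambda>x. deriv V (\<phi> x)) x"
    by (rule fd_cong[OF open_ball x]) (rule trace_H)
  moreover have "fd (\<lambda>x. \<Sum>a\<in>UNIV. H a a x) x = (\<lambda>v. \<Sum>a\<in>UNIV. fd (H a a) x v)"
    by (rule fd_eq) (intro has_derivative_sum fd_works differentiable_comps)
  moreover have "C_on 1 UNIV (deriv V)"
    by (rule C_on_mono[OF C_on_real_deriv[of 2]]) (use V in \<open>auto simp: eval_nat_numeral\<close>)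
  moreover have "(\<Sum>a\<in>UNIV. WH k a a x) = 0"
  proof -
    have "(\<Sum>a\<in>UNIV. WH k a a x) = (\<Sum>a\<in>UNIV. \<Sum>p\<in>UNIV. 2 * (w k p a x * H p a x))"
      unfolding WH_def sum.distrib[symmetric] by (intro sum.cong refl) (simp add: H_sym[OF x])
    also have "\<dots> = 0" by (rule sum_antisym_zero) (subst w_skew[OF x], subst H_sym[OF x], simp)
    finally show ?thesis .
  qed
  ultimately have "(\<Sum>a\<in>UNIV. fd (H a a) x (e k x)) = deriv (deriv V) (\<phi> x) * \<alpha> k x" "(\<Sum>a\<in>UNIV. WH k a a x) = 0"
    using fd_V[of "deriv V" "e k x"] by (simp_all add: \<phi>_e[OF x] fun_eq_iff)
  then show ?thesis by (simp only: H_e[OF x] sum.distrib)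
qed

text \<open>The derivative of \<open>trace_R\<close>. Connection terms in the traced pair cancel by
  skewness of \<open>w\<close>; those in \<open>c\<close> and \<open>d\<close> are the ones that
  turn derivatives of \<open>\<alpha>\<close> into \<open>H\<close>.\<close>

lemma DR_trace: "(\<Sum>a\<in>UNIV. DR k a c d a) = H k c x * \<alpha> d x + \<alpha> c x * H k d x + (if c = d then 1 else 0) * (deriv V (\<phi> x) * \<alpha> k x)"
proof -
  let ?\<delta> = "if c = d then 1 else 0 :: real"
  have "fd (\<lambda>x. \<Sum>a\<in>UNIV. R a c d a x) x = fd (\<lambda>x. \<alpha> c x * \<alpha> d x + ?\<delta> * (V (\<phi> x) + \<Lambda>)) x"
    by (rule fd_cong[OF open_ball x]) (rule trace_R)
  moreover have "fd (\<lambda>x. \<Sum>a\<in>UNIV. R a c d a x) x = (\<lambda>v. \<Sum>a\<in>UNIV. fd (R a c d a) x v)"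
    by (rule fd_eq) (intro has_derivative_sum fd_works differentiable_comps)
  moreover have "fd (\<lambda>x. \<alpha> c x * \<alpha> d x + ?\<delta> * (V (\<phi> x) + \<Lambda>)) x
     = (\<lambda>v. (\<alpha> c x * fd (\<alpha> d) x v + fd (\<alpha> c) x v * \<alpha> d x) + ?\<delta> * (fd (\<lambda>x. V (\<phi> x)) x v + 0))"
  proof (rule fd_eq, intro has_derivative_add has_derivative_mult has_derivative_mult_right fd_works differentiable_comps has_derivative_const)
    have "V differentiable (at (\<phi> x))" using V by (simp add: eval_nat_numeral)
    from differentiable_chain_at[OF differentiable_comps(4) this] show "(\<lambda>x. V (\<phi> x)) differentiable (at x)" by (simp add: o_def)
  qed
  moreover have "fd (\<lambda>x. V (\<phi> x)) x v = deriv V (\<phi> x) * fd \<phi> x v" for v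
    by (rule fd_V[OF C_on_mono[OF V]]) simp
  ultimately have 1: "(\<Sum>a\<in>UNIV. fd (R a c d a) x (e k x)) = (\<alpha> c x * fd (\<alpha> d) x (e k x) + fd (\<alpha> c) x (e k x) * \<alpha> d x) + ?\<delta> * (deriv V (\<phi> x) * \<alpha> k x)"
    by (simp add: fun_eq_iff \<phi>_e[OF x])
  have 2: "(\<Sum>a\<in>UNIV. WR k a c d a x) = (\<Sum>p\<in>UNIV. w k p c x * (\<alpha> p x * \<alpha> d x)) + (\<Sum>p\<in>UNIV. w k p d x * (\<alpha> c x * \<alpha> p x))"
  proof -
    have "(\<Sum>a\<in>UNIV. WR k a c d a x) = (\<Sum>a\<in>UNIV. \<Sum>p\<in>UNIV. w k p a x * (R p c d a x + R a c d p x))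
       + ((\<Sum>p\<in>UNIV. w k p c x * (\<Sum>a\<in>UNIV. R a p d a x)) + (\<Sum>p\<in>UNIV. w k p d x * (\<Sum>a\<in>UNIV. R a c p a x)))"
      unfolding WR_def sum.distrib sum_distrib_left distrib_left sum.swap[of "\<lambda>p a. w k p c x * _ p a"] sum.swap[of "\<lambda>p a. w k p d x * _ p a"]
      by simp
    also have "(\<Sum>a\<in>UNIV. \<Sum>p\<in>UNIV. w k p a x * (R p c d a x + R a c d p x)) = 0"
      by (rule sum_antisym_zero) (subst w_skew[OF x], simp)
    also have "(\<Sum>p\<in>UNIV. w k p c x * (\<Sum>a\<in>UNIV. R a p d a x)) + (\<Sum>p\<in>UNIV. w k p d x * (\<Sum>a\<in>UNIV. R a c p a x))
      = (\<Sum>p\<in>UNIV. w k p c x * (\<alpha> p x * \<alpha> d x)) + (\<Sum>p\<in>UNIV. w k p d x * (\<alpha> c x * \<alpha> p x)) + (w k d c x + w k c d x) * (V (\<phi> x) + \<Lambda>)"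
      unfolding trace_R[OF x] distrib_left sum.distrib
      by (simp add: if_distrib[of "(*) _"] if_distrib[of "\<lambda>t. t * _"] cong: if_cong) (simp add: algebra_simps)
    finally show ?thesis using w_skew[OF x, of k d c] by simp
  qed
  from 1 have "(\<Sum>a\<in>UNIV. DR k a c d a) + (\<Sum>a\<in>UNIV. WR k a c d a x) = (\<alpha> c x * fd (\<alpha> d) x (e k x) + fd (\<alpha> c) x (e k x) * \<alpha> d x) + ?\<delta> * (deriv V (\<phi> x) * \<alpha> k x)"
    by (simp only: R_e[OF x] sum.distrib)
  then show ?thesis unfolding 2 \<alpha>_e[OF x] by (simp add: distrib_left distrib_right sum_distrib_left sum_distrib_right mult_ac)
qed

lemma R_curl: "fd (R a b c d) x (e k x) + fd (R b k c d) x (e a x) + fd (R k a c d) x (e b x)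
    = WR k a b c d x + WR a b k c d x + WR b k a c d x"
  unfolding R_e[OF x] using DR_bianchi[of k a b c d] by simp

text \<open>The contracted second Bianchi identity: the divergence of the curvature is the curl of
  the Ricci tensor, which \<open>DR_trace\<close> expresses without derivatives of the curvature. So
  the right side is algebraic in the unknowns.\<close>

lemma R_div: "(\<Sum>a\<in>UNIV. fd (R a b c d) x (e a x)) = (\<Sum>a\<in>UNIV. WR a a b c d x)
    - (H c d x * \<alpha> b x + \<alpha> d x * H c b x + (if d = b then 1 else 0) * (deriv V (\<phi> x) * \<alpha> c x))
    + (H d c x * \<alpha> b x + \<alpha> c x * H d b x + (if c = b then 1 else 0) * (deriv V (\<phi> x) * \<alpha> d x))"
proof -
  have "DR a a b c d = DR d a c b a - DR c a d b a" for a
    using DR_bianchi[of a c d a b] DR_sym(3)[of a a b c d] DR_sym(1)[of c d a a b] DR_sym(2)[of c a d a b] DR_sym(2)[of d a c a b]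
    by linarith
  then show ?thesis unfolding R_e[OF x] sum.distrib by (simp add: sum_subtractf DR_trace)
qed

lemma H_curl: "fd (H b c) x (e a x) - fd (H a c) x (e b x) = WH a b c x - WH b a c x - (\<Sum>d\<in>UNIV. R a b c d x * \<alpha> d x)"
  unfolding H_e[OF x] using DH_commutator[of a b c] by simp

text \<open>Commuting derivatives turns the divergence of the Hessian into the gradient of its trace
  \<open>deriv V (\<phi> x)\<close> and a curvature term. The second derivative of \<open>V\<close>
  enters here.\<close>

lemma H_div: "(\<Sum>a\<in>UNIV. fd (H a c) x (e a x)) = (\<Sum>a\<in>UNIV. WH a a c x) + deriv (deriv V) (\<phi> x) * \<alpha> c x
    - (\<Sum>a\<in>UNIV. \<Sum>d\<in>UNIV. R a c a d x * \<alpha> d x)"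
proof -
  have "DH a a c = DH c a a - (\<Sum>d\<in>UNIV. R a c a d x * \<alpha> d x)" for a
    using DH_commutator[of a c a] DH_sym[of a a c] by simp
  then show ?thesis unfolding H_e[OF x] sum.distrib by (simp add: sum_subtractf DH_trace)
qed

end

end

section \<open>Existence of normal frames and of an admissible radius\<close>

text \<open>Geodesics and parallel transport form one radial system for the pair
  \<open>(F, E)\<close>, so \<open>radial_ode_solution\<close> gives both in class C^2. The radius
  is then reduced until the derivative of \<open>F\<close> is injective.\<close>

lemma (in metric_patch) normal_frame_exists:
  fixes E0 :: "real^'n^'n"
  assumes y0: "y0 \<in> S" and on: "\<And>a b. gdot G y0 (E0 $ a) (E0 $ b) = (if a = b then 1 else 0)"
  obtains F E \<rho> where "normal_frame G S F E \<rho>" "F 0 = y0" "E 0 = E0"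
proof -
  define A where "A z x = (\<Sum>a\<in>UNIV. x $ a *\<^sub>R snd z $ a, \<chi> b. - Gam G (fst z) (\<Sum>a\<in>UNIV. x $ a *\<^sub>R snd z $ a) (snd z $ b))"
    for z :: "(real^'n) \<times> (real^'n^'n)" and x :: "real^'n"
  have o: "open (S \<times> (UNIV :: (real^'n^'n) set))" using S by (intro open_Times) auto
  have A_C: "C_on k (S \<times> UNIV) (\<lambda>z. A z x)" for k x
    unfolding A_def
    by (intro C_on_Pair C_on_vec o, unfold vec_lambda_beta, intro C_on_sum C_on_scaleR C_on_nth C_on_const C_on_linear[OF bounded_linear_snd] o,
      intro C_on_minus C_on_Gam_along C_on_sum C_on_scaleR C_on_nth C_on_const C_on_linear[OF bounded_linear_snd] C_on_linear[OF bounded_linear_fst] o) auto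
  interpret radial_ode A "S \<times> UNIV" "(y0, E0)"
  proof (rule radial_ode.intro)
    show "linear (A z)" for z
    proof (rule linearI)
      have s: "(\<Sum>a\<in>UNIV. (x + y) $ a *\<^sub>R snd z $ a) = (\<Sum>a\<in>UNIV. x $ a *\<^sub>R snd z $ a) + (\<Sum>a\<in>UNIV. y $ a *\<^sub>R snd z $ a)"
        "(\<Sum>a\<in>UNIV. (c *\<^sub>R x) $ a *\<^sub>R snd z $ a) = c *\<^sub>R (\<Sum>a\<in>UNIV. x $ a *\<^sub>R snd z $ a)" for x y c
        by (simp_all add: scaleR_add_left sum.distrib scaleR_sum_right)
      show "A z (x + y) = A z x + A z y" for x y unfolding A_def s by (simp add: Gam_simps vec_eq_iff)
      show "A z (c *\<^sub>R x) = c *\<^sub>R A z x" for c x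
        unfolding A_def s by (simp add: Gam.scaleR_left vec_eq_iff)
    qed
  qed (use o y0 A_C in \<open>auto simp del: C_on.simps One_nat_def\<close>)
  obtain \<rho> Z where Z: "\<rho> > 0" "C_on 2 (ball 0 \<rho>) Z" "Z 0 = (y0, E0)"
    "\<And>x. x \<in> ball 0 \<rho> \<Longrightarrow> Z x \<in> S \<times> UNIV" "\<And>x. x \<in> ball 0 \<rho> \<Longrightarrow> fd Z x x = A (Z x) x"
    using radial_ode_solution[OF A_C] by blast
  define F where "F x = fst (Z x)" for x
  define E where "E x = snd (Z x)" for x
  have dZ: "(Z has_derivative fd Z x) (at x)" if "x \<in> ball 0 \<rho>" for x
    by (rule C_on_has_derivative[of 1, OF _ that]) (use Z(2) in \<open>simp only: Suc_1\<close>)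
  have fdF: "fd F x v = fst (fd Z x v)" and fdE: "fd E x v = snd (fd Z x v)" if "x \<in> ball 0 \<rho>" for x v
    unfolding F_def[abs_def] E_def[abs_def]
    using fd_eq[OF bounded_linear.has_derivative[OF bounded_linear_fst dZ[OF that]]]
      fd_eq[OF bounded_linear.has_derivative[OF bounded_linear_snd dZ[OF that]]] by auto
  have F2: "C_on 2 (ball 0 \<rho>) F" and E2: "C_on 2 (ball 0 \<rho>) E"
    unfolding F_def E_def by (rule C_on_linear_compose[OF bounded_linear_fst Z(2) open_ball], rule C_on_linear_compose[OF bounded_linear_snd Z(2) open_ball])
  have Fr: "fd F x x = (\<Sum>a\<in>UNIV. x $ a *\<^sub>R E x $ a)"
    and Er: "fd E x x $ b = - Gam G (F x) (\<Sum>a\<in>UNIV. x $ a *\<^sub>R E x $ a) (E x $ b)" if "x \<in> ball 0 \<rho>" for x b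
    using fdF[OF that] fdE[OF that] Z(5)[OF that] by (auto simp: A_def F_def E_def)
  have cF: "continuous_on (ball 0 \<rho>) (\<lambda>x. fd F x v)" for v
    by (rule C_on_deriv_continuous[of 1]) (use F2 in \<open>simp only: Suc_1\<close>)
  have lin: "linear (fd F x)" if "x \<in> ball 0 \<rho>" for x
    by (rule has_derivative_linear[OF C_on_has_derivative[of 1, OF _ that]]) (use F2 in \<open>simp only: Suc_1\<close>)
  \<comment> \<open>The radial equation says nothing about other directions at the origin; the
    derivative there is a limit of derivatives along the ray through \<open>v\<close>.\<close>
  have F0: "fd F 0 v = (\<Sum>a\<in>UNIV. v $ a *\<^sub>R E0 $ a)" for v
  proof -
    define s where "s n = inverse (real (Suc n)) * (\<rho> / (2 * (norm v + 1)))" for n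
    have s: "s n > 0" "s n *\<^sub>R v \<in> ball 0 \<rho>" for n
    proof -
      show "s n > 0" using Z(1) by (simp add: s_def divide_simps add_nonneg_pos)
      have "s n \<le> \<rho> / (2 * (norm v + 1))" unfolding s_def
        by (rule mult_left_le_one_le) (use Z(1) in \<open>auto intro!: divide_nonneg_nonneg simp: inverse_le_1_iff\<close>)
      then have "s n * norm v \<le> \<rho> / (2 * (norm v + 1)) * norm v" by (rule mult_right_mono) simp
      also have "\<dots> < \<rho>"
      proof -
        have "norm v / (2 * (norm v + 1)) < 1"
          by (subst pos_divide_less_eq) (use norm_ge_zero[of v] in \<open>auto simp: algebra_simps intro: add_nonneg_pos simp del: norm_ge_zero\<close>)
        from mult_strict_left_mono[OF this Z(1)] show ?thesis by simp
      qed
      finally show "s n *\<^sub>R v \<in> ball 0 \<rho>" using \<open>s n > 0\<close> by simp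
    qed
    have lim: "(\<lambda>n. s n *\<^sub>R v) \<longlonglongrightarrow> 0"
      unfolding s_def using tendsto_scaleR[OF tendsto_mult_right[OF LIMSEQ_inverse_real_of_nat, of "\<rho> / (2 * (norm v + 1))"] tendsto_const[of v]] by simp
    have eq: "fd F (s n *\<^sub>R v) v = (\<Sum>a\<in>UNIV. v $ a *\<^sub>R E (s n *\<^sub>R v) $ a)" for n
    proof -
      have "s n *\<^sub>R fd F (s n *\<^sub>R v) v = s n *\<^sub>R (\<Sum>a\<in>UNIV. v $ a *\<^sub>R E (s n *\<^sub>R v) $ a)"
        using Fr[OF s(2)[of n]] by (simp add: linear_cmul[OF lin[OF s(2)]] scaleR_sum_right)
      then show ?thesis using s(1)[of n] by simp
    qed
    have z: "0 \<in> ball 0 \<rho>" using Z(1) by simp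
    have "(\<lambda>n. fd F (s n *\<^sub>R v) v) \<longlonglongrightarrow> fd F 0 v"
      by (rule continuous_on_tendsto_compose[OF cF lim z]) (use s in auto)
    moreover have "(\<lambda>n. \<Sum>a\<in>UNIV. v $ a *\<^sub>R E (s n *\<^sub>R v) $ a) \<longlonglongrightarrow> (\<Sum>a\<in>UNIV. v $ a *\<^sub>R E 0 $ a)"
      by (intro tendsto_intros continuous_on_tendsto_compose[OF C_on_continuous[OF E2] lim z]) (use s in auto)
    ultimately show ?thesis unfolding eq using LIMSEQ_unique by (fastforce simp: E_def Z(3))
  qed
  \<comment> \<open>By \<open>F0\<close> the determinant is nonzero at the origin, because
    \<open>E0\<close> is orthonormal; continuity keeps it nonzero nearby.\<close>
  define D where "D x = det (matrix (fd F x))" for x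
  have "continuous_on (ball 0 \<rho>) D"
    unfolding D_def det_def matrix_def using cF by (auto intro!: continuous_intros)
  moreover have "D 0 \<noteq> 0"
  proof -
    have z: "0 \<in> ball 0 \<rho>" using Z(1) by simp
    have "v = 0" if "matrix (fd F 0) *v v = 0" for v
    proof -
      have "(\<Sum>a\<in>UNIV. v $ a *\<^sub>R E0 $ a) = 0" using that by (simp add: matrix_works lin[OF z] F0[symmetric])
      then have "gdot G y0 (\<Sum>a\<in>UNIV. v $ a *\<^sub>R E0 $ a) (E0 $ b) = 0" for b
        by (simp add: gdot.zero_left)
      then have "v $ b = 0" for b
        by (simp add: gdot.sum_left gdot.scaleR_left on
            if_distrib[of "(*) _"] cong: if_cong)
      then show ?thesis by (simp add: vec_eq_iff)
    qed
    then have "\<exists>B. B ** matrix (fd F 0) = mat 1" by (simp add: matrix_left_invertible_ker)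
    then show ?thesis unfolding D_def by (simp add: invertible_left_inverse[symmetric] invertible_det_nz)
  qed
  ultimately obtain \<delta> where \<delta>': "\<delta> > 0" "\<And>x. x \<in> ball 0 \<rho> \<Longrightarrow> dist x 0 < \<delta> \<Longrightarrow> dist (D x) (D 0) < \<bar>D 0\<bar>"
    using Z(1) unfolding continuous_on_iff by (metis centre_in_ball zero_less_abs_iff)
  have \<delta>: "D x \<noteq> 0" if "x \<in> ball 0 \<rho>" "norm x < \<delta>" for x
    using \<delta>'(2)[OF that(1)] that(2) by (auto simp: dist_real_def)
  define \<rho>' where "\<rho>' = min \<rho> \<delta>"
  have sub: "ball 0 \<rho>' \<subseteq> ball (0::real^'n) \<rho>" by (auto simp: \<rho>'_def)
  have "normal_frame G S F E \<rho>'"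
  proof
    show "v = 0" if x: "x \<in> ball 0 \<rho>'" and v: "fd F x v = 0" for x v
    proof -
      have x': "x \<in> ball 0 \<rho>" using x sub by blast
      have "invertible (matrix (fd F x))" using \<delta>[OF x'] x by (simp add: invertible_det_nz D_def \<rho>'_def)
      then have "\<exists>B. B ** matrix (fd F x) = mat 1" by (simp add: invertible_left_inverse)
      moreover have "matrix (fd F x) *v v = 0" using v by (simp add: matrix_works lin[OF x'])
      ultimately show ?thesis by (simp add: matrix_left_invertible_ker)
    qed
  qed (use Z \<delta>'(1) sub Fr Er F2 E2 on in \<open>auto simp: \<rho>'_def F_def E_def mem_Times_iff intro: C_on_subset simp del: C_on.simps\<close>)
  then show ?thesis by (rule that) (simp_all add: F_def E_def Z(3))
qed

context normal_frame begin

lemma shrink: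
  assumes "0 < \<rho>'" "\<rho>' \<le> \<rho>" shows "normal_frame G S F E \<rho>'"
proof
  show "v = 0" if "x \<in> ball 0 \<rho>'" "fd F x v = 0" for x v
    using F_nondegenerate[of x v] that assms by auto
qed (use assms F_C2 E_C2 F_in F_radial E_radial E_orthonormal_0 in \<open>auto intro: C_on_subset simp del: C_on.simps\<close>)

lemma radial_weight_exists:
  obtains r K0 where "0 < r" "r < \<rho>" "radial_weight e r K0"
proof -
  let ?K = "cball (0::real^'n) (\<rho> / 2)"
  have sub: "?K \<subseteq> ball 0 \<rho>" using \<rho> by auto
  have de: "(e i has_derivative fd (e i) x) (at x)" if "x \<in> ball 0 \<rho>" for i x
    using C_on_has_derivative[OF e_C1[of i, unfolded One_nat_def] that] .
  have "\<exists>B\<ge>0. \<forall>x v. x \<in> ?K \<longrightarrow> norm (fd (e i) x v) \<le> B * norm v" for i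
  proof (rule linear_family_bound)
    show "compact ?K" by simp
    show "linear (fd (e i) x)" if "x \<in> ?K" for x using de sub that has_derivative_linear by blast
    show "continuous_on ?K (\<lambda>x. fd (e i) x v)" for v
      by (rule continuous_on_subset[OF C_on_deriv_continuous[of 0 _ "e i"] sub]) (use e_C1 in simp)
  qed blast
  then obtain B where B: "\<And>i. B i \<ge> 0" "\<And>i x v. x \<in> ?K \<Longrightarrow> norm (fd (e i) x v) \<le> B i * norm v" by metis
  obtain T where T: "T \<ge> 0" "\<And>x v. x \<in> ?K \<Longrightarrow> norm (\<theta> x v) \<le> T * norm v"
  proof (rule linear_family_bound[of ?K \<theta>])
    show "linear (\<theta> x)" if "x \<in> ?K" for x using \<theta>_linear sub that by blast
    show "continuous_on ?K (\<lambda>x. \<theta> x v)" for v by (rule continuous_on_subset[OF C_on_continuous[OF \<theta>_C1] sub])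
  qed auto
  define K0 where "K0 = 1 + T + (\<Sum>i\<in>UNIV. B i)"
  have BK: "B i \<le> K0" "T \<le> K0" "1 \<le> K0" for i
    using member_le_sum[of i UNIV B] B(1) T(1) sum_nonneg[of UNIV B] by (auto simp: K0_def)
  have fr: "radial_frame e r K0" if r: "0 < r" "r \<le> 1" "r \<le> \<rho> / 2" for r
  proof
    have s: "ball 0 r \<subseteq> ?K" using r by auto
    show "C_on 1 (ball 0 r) (e i)" for i by (rule C_on_subset[OF e_C1]) (use s sub in blast)
    fix x :: "real^'n" assume x: "x \<in> ball 0 r"
    then have x': "x \<in> ?K" "x \<in> ball 0 \<rho>" using s sub by blast+
    show "(\<Sum>i\<in>UNIV. x $ i *\<^sub>R e i x) = x" by (rule e_radial[OF x'(2)])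
    show "x \<bullet> e i x = x $ i" for i by (rule e_inner[OF x'(2)])
    show d: "norm (fd (e i) x v) \<le> K0 * norm v" for i v
      using B(2)[OF x'(1), of i v] mult_right_mono[OF BK(1)[of i], of "norm v"] by simp
    show "norm (e i x - axis i 1) \<le> K0 * norm x" for i
    proof -
      have "norm (e i x - e i 0) \<le> B i * norm (x - 0)"
      proof (rule differentiable_bound[of "ball 0 r"])
        show "(e i has_derivative fd (e i) y) (at y within ball 0 r)" if "y \<in> ball 0 r" for y
          using de that s sub by (meson has_derivative_at_withinI subsetD)
        show "onorm (fd (e i) y) \<le> B i" if "y \<in> ball 0 r" for y
          by (rule onorm_bound) (use B that s in auto)
      qed (use x r in auto)
      then show ?thesis using mult_right_mono[OF BK(1)[of i], of "norm x"] by (simp add: e_0)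
    qed
    show "\<exists>c. v = (\<Sum>i\<in>UNIV. c i *\<^sub>R e i x) \<and> (\<forall>i. \<bar>c i\<bar> \<le> K0 * norm v)" for v
    proof (intro exI conjI allI)
      show "v = (\<Sum>i\<in>UNIV. \<theta> x v $ i *\<^sub>R e i x)" by (rule e_\<theta>[OF x'(2), symmetric])
      show "\<bar>\<theta> x v $ i\<bar> \<le> K0 * norm v" for i
        using component_le_norm_cart[of "\<theta> x v" i] T(2)[OF x'(1), of v] mult_right_mono[OF BK(2), of "norm v"] by simp
    qed
  qed (use r BK in auto)
  define r0 where "r0 = min 1 (\<rho> / 2)"
  interpret r0: radial_frame e r0 K0 by (rule fr) (use \<rho> in \<open>auto simp: r0_def\<close>)
  have k: "r0.\<kappa> > 0" unfolding r0.\<kappa>_def by (intro add_pos_nonneg) auto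
  \<comment> \<open>\<open>\<kappa>\<close> depends only on \<open>K0\<close> and the dimension, so
    the radius may be reduced after it is known.\<close>
  define r where "r = min r0 (1 / (2 * r0.\<kappa>))"
  have r: "0 < r" "r \<le> 1" "r \<le> \<rho> / 2" using \<rho> k by (auto simp: r_def r0_def)
  have "2 * r * r0.\<kappa> \<le> 2 * (1 / (2 * r0.\<kappa>)) * r0.\<kappa>"
    using k by (intro mult_right_mono mult_left_mono) (auto simp: r_def)
  then have "2 * r * r0.\<kappa> \<le> 1" using k by simp
  then have "radial_weight e r K0" by (intro radial_weight.intro fr r radial_weight_axioms.intro)
  then show ?thesis using that r \<rho> by auto
qed

end

section \<open>Comparison of functions\<close>

text \<open>Boundedness of both functions is included so that the relation is stable under products.
  The modulus \<open>m\<close> is a power of \<open>|x|\<close> in the study of flatness and the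
  root of \<open>Z\<close> in the differential inequalities.\<close>

definition close :: "'a set \<Rightarrow> ('a \<Rightarrow> real) \<Rightarrow> ('a \<Rightarrow> real) \<Rightarrow> ('a \<Rightarrow> real) \<Rightarrow> bool" where
  "close T m f f' \<longleftrightarrow> (\<exists>C. \<forall>x\<in>T. 0 \<le> m x \<and> \<bar>f x - f' x\<bar> \<le> C * m x \<and> \<bar>f x\<bar> \<le> C \<and> \<bar>f' x\<bar> \<le> C)"

lemma closeE:
  assumes "close T m f f'"
  obtains C where "C \<ge> 0" "\<And>x. x \<in> T \<Longrightarrow> 0 \<le> m x" "\<And>x. x \<in> T \<Longrightarrow> \<bar>f x - f' x\<bar> \<le> C * m x"
    "\<And>x. x \<in> T \<Longrightarrow> \<bar>f x\<bar> \<le> C" "\<And>x. x \<in> T \<Longrightarrow> \<bar>f' x\<bar> \<le> C"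
proof -
  obtain C where C: "\<And>x. x \<in> T \<Longrightarrow> 0 \<le> m x \<and> \<bar>f x - f' x\<bar> \<le> C * m x \<and> \<bar>f x\<bar> \<le> C \<and> \<bar>f' x\<bar> \<le> C"
    using assms unfolding close_def by blast
  have "\<bar>f x - f' x\<bar> \<le> \<bar>C\<bar> * m x" "\<bar>f x\<bar> \<le> \<bar>C\<bar>" "\<bar>f' x\<bar> \<le> \<bar>C\<bar>" "0 \<le> m x" if "x \<in> T" for x
    using C[OF that] mult_right_mono[of C "\<bar>C\<bar>" "m x"] by linarith+
  then show ?thesis by (intro that[of "\<bar>C\<bar>"]) auto
qed

lemma close_sym: "close T m f f' \<Longrightarrow> close T m f' f"
  unfolding close_def by (simp add: abs_minus_commute conj_commute)

lemma close_const: "(\<And>x. x \<in> T \<Longrightarrow> 0 \<le> m x) \<Longrightarrow> close T m (\<lambda>x. c) (\<lambda>x. c)"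
  unfolding close_def by (rule exI[of _ "\<bar>c\<bar>"]) auto

lemma close_add:
  assumes "close T m f f'" "close T m g g'" shows "close T m (\<lambda>x. f x + g x) (\<lambda>x. f' x + g' x)"
proof -
  obtain C where C: "\<And>x. x \<in> T \<Longrightarrow> 0 \<le> m x" "\<And>x. x \<in> T \<Longrightarrow> \<bar>f x - f' x\<bar> \<le> C * m x"
    "\<And>x. x \<in> T \<Longrightarrow> \<bar>f x\<bar> \<le> C" "\<And>x. x \<in> T \<Longrightarrow> \<bar>f' x\<bar> \<le> C" using closeE[OF assms(1)] by metis
  obtain D where D: "\<And>x. x \<in> T \<Longrightarrow> \<bar>g x - g' x\<bar> \<le> D * m x"
    "\<And>x. x \<in> T \<Longrightarrow> \<bar>g x\<bar> \<le> D" "\<And>x. x \<in> T \<Longrightarrow> \<bar>g' x\<bar> \<le> D" using closeE[OF assms(2)] by metis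
  show ?thesis unfolding close_def
    by (rule exI[of _ "C + D"], intro ballI conjI C(1), assumption)
      (use C D in \<open>force simp: distrib_right dest!: bspec\<close>)+
qed

lemma close_minus: "close T m f f' \<Longrightarrow> close T m (\<lambda>x. - f x) (\<lambda>x. - f' x)"
  unfolding close_def by (simp add: abs_minus_commute)

lemma close_diff: "close T m f f' \<Longrightarrow> close T m g g' \<Longrightarrow> close T m (\<lambda>x. f x - g x) (\<lambda>x. f' x - g' x)"
  using close_add[of T m f f' "\<lambda>x. - g x" "\<lambda>x. - g' x", OF _ close_minus] by simp

lemma close_mult:
  assumes "close T m f f'" "close T m g g'" shows "close T m (\<lambda>x. f x * g x) (\<lambda>x. f' x * g' x)"
proof -
  obtain C where C: "C \<ge> 0" "\<And>x. x \<in> T \<Longrightarrow> 0 \<le> m x" "\<And>x. x \<in> T \<Longrightarrow> \<bar>f x - f' x\<bar> \<le> C * m x"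
    "\<And>x. x \<in> T \<Longrightarrow> \<bar>f x\<bar> \<le> C" "\<And>x. x \<in> T \<Longrightarrow> \<bar>f' x\<bar> \<le> C" using closeE[OF assms(1)] by metis
  obtain D where D: "D \<ge> 0" "\<And>x. x \<in> T \<Longrightarrow> \<bar>g x - g' x\<bar> \<le> D * m x"
    "\<And>x. x \<in> T \<Longrightarrow> \<bar>g x\<bar> \<le> D" "\<And>x. x \<in> T \<Longrightarrow> \<bar>g' x\<bar> \<le> D" using closeE[OF assms(2)] by metis
  show ?thesis unfolding close_def
  proof (rule exI[of _ "2 * C * D"], intro ballI conjI C(2))
    fix x assume x: "x \<in> T"
    have "\<bar>f x * g x - f' x * g' x\<bar> = \<bar>f x * (g x - g' x) + (f x - f' x) * g' x\<bar>" by (simp add: algebra_simps)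
    also have "\<dots> \<le> \<bar>f x\<bar> * \<bar>g x - g' x\<bar> + \<bar>f x - f' x\<bar> * \<bar>g' x\<bar>" by (metis abs_mult abs_triangle_ineq)
    also have "\<dots> \<le> C * (D * m x) + C * m x * D"
      using C D x by (intro add_mono mult_mono) (auto intro: mult_nonneg_nonneg)
    finally show "\<bar>f x * g x - f' x * g' x\<bar> \<le> 2 * C * D * m x" by (simp add: algebra_simps)
    have "\<bar>f x\<bar> * \<bar>g x\<bar> \<le> C * D" "\<bar>f' x\<bar> * \<bar>g' x\<bar> \<le> C * D" "0 \<le> C * D"
      using C D x by (auto intro!: mult_mono)
    then show "\<bar>f x * g x\<bar> \<le> 2 * C * D" "\<bar>f' x * g' x\<bar> \<le> 2 * C * D" unfolding abs_mult by linarith+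
  qed
qed

lemma close_sum:
  assumes "finite I" "\<And>x. x \<in> T \<Longrightarrow> 0 \<le> m x" "\<And>i. i \<in> I \<Longrightarrow> close T m (f i) (f' i)"
  shows "close T m (\<lambda>x. \<Sum>i\<in>I. f i x) (\<lambda>x. \<Sum>i\<in>I. f' i x)"
  using assms(1,3) by (induction I rule: finite_induct) (auto intro: close_const[OF assms(2)] close_add)

text \<open>The bounds in \<open>close\<close> confine both functions to a compact interval, on
  which a C^1 function is Lipschitz.\<close>

lemma close_lipschitz:
  fixes g :: "real \<Rightarrow> real"
  assumes "close T m f f'" "C_on 1 UNIV g"
  shows "close T m (\<lambda>x. g (f x)) (\<lambda>x. g (f' x))"
proof -
  obtain C where C: "C \<ge> 0" "\<And>x. x \<in> T \<Longrightarrow> 0 \<le> m x" "\<And>x. x \<in> T \<Longrightarrow> \<bar>f x - f' x\<bar> \<le> C * m x"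
    "\<And>x. x \<in> T \<Longrightarrow> \<bar>f x\<bar> \<le> C" "\<And>x. x \<in> T \<Longrightarrow> \<bar>f' x\<bar> \<le> C" using closeE[OF assms(1)] by metis
  have c: "continuous_on {-C..C} g" "continuous_on {-C..C} (deriv g)"
    using continuous_on_subset[OF C_on_continuous[OF assms(2)]] C_on_continuous[OF C_on_real_deriv[of 0 g]] assms(2)
    by (auto intro: continuous_on_subset)
  obtain B where B: "\<And>t. t \<in> {-C..C} \<Longrightarrow> norm (g t) \<le> B"
    using continuous_on_compact_bound[OF compact_Icc c(1)] by blast
  obtain B' where B': "\<And>t. t \<in> {-C..C} \<Longrightarrow> norm (deriv g t) \<le> B'"
    using continuous_on_compact_bound[OF compact_Icc c(2)] by blast
  have d: "(g has_field_derivative deriv g t) (at t within {-C..C})" for t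
    using assms(2) by (simp add: DERIV_deriv_iff_real_differentiable has_field_derivative_at_within)
  have L: "\<bar>g s - g t\<bar> \<le> B' * \<bar>s - t\<bar>" if "s \<in> {-C..C}" "t \<in> {-C..C}" for s t
    using field_differentiable_bound[of "{-C..C}" g "deriv g" B' s t, OF _ d B' that] by simp
  have B'0: "B' \<ge> 0" using B'[of 0] C(1) by auto
  show ?thesis unfolding close_def
  proof (rule exI[of _ "B + B' * C"], intro ballI conjI C(2))
    fix x assume x: "x \<in> T"
    then have i: "f x \<in> {-C..C}" "f' x \<in> {-C..C}" using C by (auto simp: abs_le_iff) (metis abs_le_iff minus_le_iff)+
    show "\<bar>g (f x)\<bar> \<le> B + B' * C" "\<bar>g (f' x)\<bar> \<le> B + B' * C"
      using B[OF i(1)] B[OF i(2)] B'0 C(1) by (simp_all add: add_increasing2)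
    have "\<bar>g (f x) - g (f' x)\<bar> \<le> B' * \<bar>f x - f' x\<bar>" by (rule L[OF i])
    also have "\<dots> \<le> B' * (C * m x)" using C(3)[OF x] B'0 by (rule mult_left_mono)
    also have "\<dots> \<le> (B + B' * C) * m x" using B[OF i(1)] C(2)[OF x] by (simp add: distrib_right)
    finally show "\<bar>g (f x) - g (f' x)\<bar> \<le> (B + B' * C) * m x" .
  qed
qed

lemma close_radial_sum:
  fixes g g' :: "'n::finite \<Rightarrow> real^'n \<Rightarrow> real"
  assumes "\<And>a. close T m (g a) (g' a)"
  obtains C where "C \<ge> 0" "\<And>x. x \<in> T \<Longrightarrow> \<bar>(\<Sum>a\<in>UNIV. x $ a * g a x) - (\<Sum>a\<in>UNIV. x $ a * g' a x)\<bar> \<le> C * (norm x * m x)"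
proof -
  have "\<exists>C\<ge>0. \<forall>x\<in>T. \<bar>g a x - g' a x\<bar> \<le> C * m x \<and> 0 \<le> m x" for a using closeE[OF assms[of a]] by metis
  then obtain C where C: "\<And>a. C a \<ge> 0" "\<And>a x. x \<in> T \<Longrightarrow> \<bar>g a x - g' a x\<bar> \<le> C a * m x" "\<And>x. x \<in> T \<Longrightarrow> 0 \<le> m x" by metis
  show ?thesis
  proof (rule that)
    show "(\<Sum>a\<in>UNIV. C a) \<ge> 0" using C by (simp add: sum_nonneg)
    fix x assume x: "x \<in> T"
    have "\<bar>(\<Sum>a\<in>UNIV. x $ a * g a x) - (\<Sum>a\<in>UNIV. x $ a * g' a x)\<bar> = \<bar>\<Sum>a\<in>UNIV. x $ a * (g a x - g' a x)\<bar>"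
      by (simp add: sum_subtractf right_diff_distrib)
    also have "\<dots> \<le> (\<Sum>a\<in>UNIV. norm x * (C a * m x))"
      by (rule order_trans[OF sum_abs]) (auto simp: abs_mult intro!: sum_mono mult_mono C(2)[OF x] component_le_norm_cart)
    finally show "\<bar>(\<Sum>a\<in>UNIV. x $ a * g a x) - (\<Sum>a\<in>UNIV. x $ a * g' a x)\<bar> \<le> (\<Sum>a\<in>UNIV. C a) * (norm x * m x)"
      by (simp add: sum_distrib_right sum_distrib_left mult_ac)
  qed
qed

lemma radial_growth0:
  fixes f :: "'a::euclidean_space \<Rightarrow> real"
  assumes d: "\<And>x. x \<in> ball 0 \<rho> \<Longrightarrow> f differentiable (at x)" and x: "x \<in> ball 0 \<rho>" and f0: "f 0 = 0"
    and le: "\<And>x. x \<in> ball 0 \<rho> \<Longrightarrow> \<bar>fd f x x\<bar> \<le> C * norm x ^ Suc N" and C: "C \<ge> 0"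
  shows "\<bar>f x\<bar> \<le> C * norm x ^ Suc N"
proof -
  obtain t where t: "0 < t" "t < 1" "t *\<^sub>R x \<in> ball 0 \<rho>" "f x - f 0 = fd f (t *\<^sub>R x) x" using radial_mvt[OF d x] .
  have "t * \<bar>f x\<bar> = \<bar>fd f (t *\<^sub>R x) (t *\<^sub>R x)\<bar>"
    using t f0 by (simp add: fd_scaleR[OF d[OF t(3)]] abs_mult)
  also have "\<dots> \<le> C * (t * norm x) ^ Suc N" using le[OF t(3)] t by simp
  also have "\<dots> = t * (t ^ N * (C * norm x ^ Suc N))" by (simp add: power_mult_distrib)
  also have "\<dots> \<le> t * (1 * (C * norm x ^ Suc N))"
    using t C by (intro mult_left_mono mult_right_mono power_le_one) auto
  finally show ?thesis using t by simp
qed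

text \<open>\<open>fd f x x + f x\<close> is the derivative at \<open>t = 1\<close> of
  \<open>t\<close> times \<open>f\<close> at \<open>t *\<^sub>R x\<close>; the mean value theorem is
  applied to this product, which vanishes at \<open>t = 0\<close>.\<close>

lemma radial_growth1:
  fixes f :: "'a::euclidean_space \<Rightarrow> real"
  assumes d: "\<And>x. x \<in> ball 0 \<rho> \<Longrightarrow> f differentiable (at x)" and x: "x \<in> ball 0 \<rho>"
    and le: "\<And>x. x \<in> ball 0 \<rho> \<Longrightarrow> \<bar>fd f x x + f x\<bar> \<le> C * norm x ^ N" and C: "C \<ge> 0"
  shows "\<bar>f x\<bar> \<le> C * norm x ^ N"
proof (cases "x = 0")
  case True
  have "fd f 0 0 = 0" using linear_0 bounded_linear.linear[OF fd_bounded_linear[OF d[OF x]]] True by blast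
  then show ?thesis using le[OF x] True by simp
next
  case False
  define k where "k y = (y \<bullet> x) * f y" for y
  have kd: "(k has_derivative (\<lambda>v. (y \<bullet> x) * fd f y v + (v \<bullet> x) * f y)) (at y)" if "y \<in> ball 0 \<rho>" for y
    unfolding k_def by (intro has_derivative_mult fd_works d that bounded_linear_imp_has_derivative bounded_linear_inner_left)
  obtain t where t: "0 < t" "t < 1" "t *\<^sub>R x \<in> ball 0 \<rho>" "k x - k 0 = fd k (t *\<^sub>R x) x"
    using radial_mvt[OF differentiableI[OF kd] x] .
  have "(x \<bullet> x) * f x = (x \<bullet> x) * (fd f (t *\<^sub>R x) (t *\<^sub>R x) + f (t *\<^sub>R x))"
    using t(4) unfolding fd_eq[OF kd[OF t(3)]]
    by (simp add: k_def fd_scaleR[OF d[OF t(3)]] algebra_simps)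
  then have "\<bar>f x\<bar> = \<bar>fd f (t *\<^sub>R x) (t *\<^sub>R x) + f (t *\<^sub>R x)\<bar>" using False by simp
  also have "\<dots> \<le> C * (t * norm x) ^ N" using le[OF t(3)] t by simp
  also have "\<dots> \<le> C * norm x ^ N"
    using t C by (intro mult_left_mono power_mono mult_left_le_one_le) auto
  finally show ?thesis .
qed

section \<open>Absorbed quantities\<close>

context radial_weight begin

text \<open>\<open>f\<close> is flat at the origin, and its weighted integral gains a factor
  \<open>\<tau>\<close> against that of \<open>Z\<close>. The notion is closed under sums, so if
  \<open>Z\<close> is a sum of absorbed parts, it absorbs itself and must vanish.\<close>

definition absorbed :: "(real^'n \<Rightarrow> real) \<Rightarrow> (real^'n \<Rightarrow> real) \<Rightarrow> bool" where
  "absorbed Z f \<longleftrightarrow> continuous_on \<Omega> f \<and> (\<forall>M. \<exists>C. \<forall>x\<in>\<Omega>. f x \<le> C * norm x ^ M) \<and>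
     (\<exists>C\<ge>0. \<forall>\<tau> \<zeta> \<gamma>. \<tau> \<ge> 1 \<longrightarrow> cutoff \<zeta> \<gamma> \<longrightarrow>
        \<tau> * I \<tau> (\<lambda>x. (\<zeta> x)^2 * f x) \<le> C * I \<tau> (\<lambda>x. cut2 \<zeta> \<gamma> x * Z x))"

lemma absorbed_add:
  assumes f: "absorbed Z f" and g: "absorbed Z g" shows "absorbed Z (\<lambda>x. f x + g x)"
  unfolding absorbed_def
proof (intro conjI allI)
  have c: "continuous_on \<Omega> f" "continuous_on \<Omega> g" using f g by (auto simp: absorbed_def)
  then show "continuous_on \<Omega> (\<lambda>x. f x + g x)" by (rule continuous_on_add)
  show "\<exists>C. \<forall>x\<in>\<Omega>. f x + g x \<le> C * norm x ^ M" for M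
  proof -
    obtain A B where "\<forall>x\<in>\<Omega>. f x \<le> A * norm x ^ M" "\<forall>x\<in>\<Omega>. g x \<le> B * norm x ^ M"
      using f g unfolding absorbed_def by blast
    then have "\<forall>x\<in>\<Omega>. f x + g x \<le> (A + B) * norm x ^ M" by (auto simp: distrib_right add_mono)
    then show ?thesis ..
  qed
  obtain A where A: "A \<ge> 0" "\<And>\<tau> \<zeta> \<gamma>. \<tau> \<ge> 1 \<Longrightarrow> cutoff \<zeta> \<gamma> \<Longrightarrow>
        \<tau> * I \<tau> (\<lambda>x. (\<zeta> x)^2 * f x) \<le> A * I \<tau> (\<lambda>x. cut2 \<zeta> \<gamma> x * Z x)"
    using f unfolding absorbed_def by blast
  obtain B where B: "B \<ge> 0" "\<And>\<tau> \<zeta> \<gamma>. \<tau> \<ge> 1 \<Longrightarrow> cutoff \<zeta> \<gamma> \<Longrightarrow>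
        \<tau> * I \<tau> (\<lambda>x. (\<zeta> x)^2 * g x) \<le> B * I \<tau> (\<lambda>x. cut2 \<zeta> \<gamma> x * Z x)"
    using g unfolding absorbed_def by blast
  have "I \<tau> (\<lambda>x. (\<zeta> x)^2 * (f x + g x)) = I \<tau> (\<lambda>x. (\<zeta> x)^2 * f x) + I \<tau> (\<lambda>x. (\<zeta> x)^2 * g x)"
    if cut: "cutoff \<zeta> \<gamma>" for \<tau> \<zeta> \<gamma>
    unfolding I_def distrib_left
    by (intro set_integral_add I_integrable[OF cut]) (auto intro!: continuous_intros cutoff_continuous[OF cut] c)
  then show "\<exists>C\<ge>0. \<forall>\<tau> \<zeta> \<gamma>. \<tau> \<ge> 1 \<longrightarrow> cutoff \<zeta> \<gamma> \<longrightarrow>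
     \<tau> * I \<tau> (\<lambda>x. (\<zeta> x)^2 * (f x + g x)) \<le> C * I \<tau> (\<lambda>x. cut2 \<zeta> \<gamma> x * Z x)"
    using A B by (intro exI[of _ "A + B"]) (simp add: distrib_left distrib_right add_mono)
qed

lemma absorbed_zero: "absorbed Z (\<lambda>x. 0)"
  unfolding absorbed_def by (auto simp: I_def set_lebesgue_integral_def intro!: exI[of _ 0])

lemma absorbed_sum: "finite J \<Longrightarrow> (\<And>j. j \<in> J \<Longrightarrow> absorbed Z (f j)) \<Longrightarrow> absorbed Z (\<lambda>x. \<Sum>j\<in>J. f j x)"
  by (induction J rule: finite_induct) (auto intro: absorbed_zero absorbed_add)

lemma absorbed_self:
  assumes "absorbed Z Z" "\<And>x. x \<in> \<Omega> \<Longrightarrow> 0 \<le> Z x" "x \<in> \<Omega>" "norm x < r / 4"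
  shows "Z x = 0"
proof -
  obtain C0 where C0: "C0 \<ge> 0" "\<And>\<tau> \<zeta> \<gamma>. \<tau> \<ge> 1 \<Longrightarrow> cutoff \<zeta> \<gamma> \<Longrightarrow>
        \<tau> * I \<tau> (\<lambda>x. (\<zeta> x)^2 * Z x) \<le> C0 * I \<tau> (\<lambda>x. cut2 \<zeta> \<gamma> x * Z x)"
    using assms(1) unfolding absorbed_def by blast
  show ?thesis
    by (rule unique_continuation[OF _ assms(2) _ C0 assms(3,4)]) (use assms(1) in \<open>auto simp: absorbed_def\<close>)
qed

lemma flat_square:
  assumes "close (ball 0 r) (\<lambda>x. norm x ^ M) f f'"
  shows "\<exists>C. \<forall>x\<in>\<Omega>. (f x - f' x)^2 \<le> C * norm x ^ M"
proof -
  obtain C where C: "C \<ge> 0" "\<And>x. x \<in> ball 0 r \<Longrightarrow> \<bar>f x - f' x\<bar> \<le> C * norm x ^ M" using closeE[OF assms] by metis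
  have "(f x - f' x)^2 \<le> C^2 * norm x ^ M" if x: "x \<in> \<Omega>" for x
  proof -
    have n: "norm x ^ M \<le> 1" using \<Omega>D[OF x] by (intro power_le_one) auto
    have "\<bar>f x - f' x\<bar>\<^sup>2 \<le> (C * norm x ^ M)^2" using C(2)[OF \<Omega>D(1)[OF x]] by (intro power_mono) auto
    also have "\<dots> = C^2 * (norm x ^ M * norm x ^ M)" by (simp add: power2_eq_square mult_ac)
    also have "\<dots> \<le> C^2 * (norm x ^ M * 1)" using n by (intro mult_left_mono) auto
    finally show ?thesis by simp
  qed
  then show ?thesis by blast
qed

text \<open>The difference solves a radial equation whose source is \<open>x\<close> contracted with
  differences of size \<open>sqrt (Z x)\<close>; the factor \<open>|x|\<close> is what
  \<open>transport_cutoff\<close> asks for.\<close>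

lemma absorbed_transport:
  assumes f: "C_on 1 \<Omega> f" "C_on 1 \<Omega> f'" and d: "d \<ge> 0"
    and Z: "continuous_on \<Omega> Z" "\<And>x. x \<in> \<Omega> \<Longrightarrow> (f x - f' x)^2 \<le> Z x"
    and flat: "\<And>M. close (ball 0 r) (\<lambda>x. norm x ^ M) f f'"
    and g: "\<And>a. close \<Omega> (\<lambda>x. sqrt (Z x)) (g a) (g' a)"
    and eq: "\<And>x. x \<in> \<Omega> \<Longrightarrow> fd f x x + d * f x = c + (\<Sum>a\<in>UNIV. x $ a * g a x)"
       "\<And>x. x \<in> \<Omega> \<Longrightarrow> fd f' x x + d * f' x = c + (\<Sum>a\<in>UNIV. x $ a * g' a x)"
  shows "absorbed Z (\<lambda>x. (f x - f' x)^2)"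
proof -
  obtain C where C: "C \<ge> 0" "\<And>x. x \<in> \<Omega> \<Longrightarrow> \<bar>(\<Sum>a\<in>UNIV. x $ a * g a x) - (\<Sum>a\<in>UNIV. x $ a * g' a x)\<bar> \<le> C * (norm x * sqrt (Z x))"
    by (rule close_radial_sum[of \<Omega> "\<lambda>x. sqrt (Z x)" g g', OF g]) (rule that)
  have v: "C_on 1 \<Omega> (\<lambda>x. f x - f' x)" by (intro C_on_diff f open_\<Omega>)
  have le: "(fd (\<lambda>x. f x - f' x) x x + d * (f x - f' x))^2 \<le> C^2 * (norm x)^2 * Z x" if x: "x \<in> \<Omega>" for x
  proof -
    have "fd (\<lambda>x. f x - f' x) x x = fd f x x - fd f' x x"
      by (subst fd_eq[OF has_derivative_diff[OF fd_works fd_works]]) (use f x in auto)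
    then have "fd (\<lambda>x. f x - f' x) x x + d * (f x - f' x) = (\<Sum>a\<in>UNIV. x $ a * g a x) - (\<Sum>a\<in>UNIV. x $ a * g' a x)"
      using eq[OF x] by (simp add: algebra_simps)
    then have "\<bar>fd (\<lambda>x. f x - f' x) x x + d * (f x - f' x)\<bar>\<^sup>2 \<le> (C * (norm x * sqrt (Z x)))^2"
      using C(2)[OF x] by (intro power_mono) auto
    moreover have "0 \<le> Z x" using Z(2)[OF x] by (rule order_trans[rotated]) simp
    ultimately show ?thesis by (simp add: power_mult_distrib)
  qed
  show ?thesis unfolding absorbed_def
  proof (intro conjI allI)
    show "continuous_on \<Omega> (\<lambda>x. (f x - f' x)^2)" using C_on_continuous[OF v] by (rule continuous_on_power)
    show "\<exists>C. \<forall>x\<in>\<Omega>. (f x - f' x)^2 \<le> C * norm x ^ M" for M by (rule flat_square[OF flat])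
    show "\<exists>C\<ge>0. \<forall>\<tau> \<zeta> \<gamma>. \<tau> \<ge> 1 \<longrightarrow> cutoff \<zeta> \<gamma> \<longrightarrow>
     \<tau> * I \<tau> (\<lambda>x. (\<zeta> x)^2 * (f x - f' x)^2) \<le> C * I \<tau> (\<lambda>x. cut2 \<zeta> \<gamma> x * Z x)"
      by (intro exI[of _ "8 * C^2 + 8"] conjI allI impI transport_cutoff[OF v _ _ d Z _ le]) auto
  qed
qed

end

lemma (in carleman) absorbed_elliptic:
  assumes u: "C_on 2 \<Omega> u" and uW: "\<And>y. y \<in> \<Omega> \<Longrightarrow> u y \<in> W"
    and Z: "continuous_on \<Omega> Z" "\<And>x. x \<in> \<Omega> \<Longrightarrow> (norm (u x))^2 \<le> Z x"
    and flat: "\<And>M. \<exists>C. \<forall>x\<in>\<Omega>. (norm (u x))^2 \<le> C * norm x ^ M"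
    and le: "\<exists>C\<ge>0. \<forall>x\<in>\<Omega>. (norm (P u x))^2 \<le> C * Z x"
  shows "absorbed Z (\<lambda>x. (norm (u x))^2)"
proof -
  obtain C where C: "C \<ge> 0" "\<And>x. x \<in> \<Omega> \<Longrightarrow> (norm (P u x))^2 \<le> C * Z x" using le by blast
  show ?thesis unfolding absorbed_def
  proof (intro conjI allI flat)
    show "continuous_on \<Omega> (\<lambda>x. (norm (u x))^2)" using C_on_continuous[OF u] by (intro continuous_intros)
    show "\<exists>C\<ge>0. \<forall>\<tau> \<zeta> \<gamma>. \<tau> \<ge> 1 \<longrightarrow> cutoff \<zeta> \<gamma> \<longrightarrow>
     \<tau> * I \<tau> (\<lambda>x. (\<zeta> x)^2 * (norm (u x))^2) \<le> C * I \<tau> (\<lambda>x. cut2 \<zeta> \<gamma> x * Z x)"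
      by (intro exI[of _ "6 * C + 6"] conjI allI impI elliptic_cutoff[OF u uW _ _ Z C]) (use C in auto)
  qed
qed

section \<open>The Dirac symbols of one-forms and two-forms\<close>

text \<open>The symbol of exterior derivative and divergence on one-forms. A two-form is stored as a
  full antisymmetric matrix, which counts each entry twice; \<open>1 / sqrt 2\<close> corrects for
  that.\<close>

definition dirac1 :: "'n::finite \<Rightarrow> real^'n \<Rightarrow> (real^'n^'n) \<times> real" where
  "dirac1 i w = ((1 / sqrt 2) *\<^sub>R (\<chi> a b. axis i 1 $ a * w $ b - axis i 1 $ b * w $ a), w $ i)"

text \<open>The symbol of exterior derivative and divergence on two-forms. For antisymmetric
  \<open>w\<close> the first factor gives the exterior part the squared norm \<open>|w|^2\<close>
  minus twice that of row \<open>i\<close>, and \<open>sqrt 2\<close> restores the row.\<close>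

definition dirac2 :: "'n::finite \<Rightarrow> real^'n^'n \<Rightarrow> (real^'n^'n^'n) \<times> (real^'n)" where
  "dirac2 i w = ((1 / sqrt 3) *\<^sub>R (\<chi> k a b. axis i 1 $ k * w $ a $ b + axis i 1 $ a * w $ b $ k + axis i 1 $ b * w $ k $ a),
     sqrt 2 *\<^sub>R (\<chi> b. w $ i $ b))"

definition skew :: "(real^'n^'n) set" where "skew = {w. \<forall>a b. w $ a $ b = - w $ b $ a}"

lemma sum_axis: "(\<Sum>a\<in>UNIV. axis i 1 $ a * f a) = (f i :: real)" "(\<Sum>a\<in>UNIV. f a * axis i 1 $ a) = (f i :: real)"
  by (simp_all add: axis_def if_distrib[of "\<lambda>t. t * _"] if_distrib[of "(*) _"] cong: if_cong)

lemma dirac_dirac1: "dirac dirac1 UNIV"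
proof (rule dirac.intro)
  show "linear (dirac1 i)" for i
    by (rule linearI) (auto simp: dirac1_def vec_eq_iff algebra_simps)
  fix w :: "real^'n" and i j
  have "(\<Sum>a\<in>UNIV. \<Sum>b\<in>UNIV. (axis i 1 $ a * w $ b - axis i 1 $ b * w $ a) * (axis j 1 $ a * w $ b - axis j 1 $ b * w $ a))
     = (\<Sum>a\<in>UNIV. \<Sum>b\<in>UNIV. axis i 1 $ a * (axis j 1 $ a * (w $ b * w $ b))) + (\<Sum>a\<in>UNIV. \<Sum>b\<in>UNIV. axis i 1 $ b * (axis j 1 $ b * (w $ a * w $ a)))
      - (\<Sum>a\<in>UNIV. \<Sum>b\<in>UNIV. axis i 1 $ a * (axis j 1 $ b * (w $ a * w $ b))) - (\<Sum>a\<in>UNIV. \<Sum>b\<in>UNIV. axis i 1 $ b * (axis j 1 $ a * (w $ a * w $ b)))"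
    by (simp add: sum.distrib[symmetric] sum_subtractf[symmetric] algebra_simps)
  also have "\<dots> = 2 * (axis j 1 $ i * (w \<bullet> w) - w $ i * w $ j)"
    by (simp add: sum_distrib_left[symmetric] sum_axis inner_vec_def)
  finally show "dirac1 i w \<bullet> dirac1 j w = (if i = j then w \<bullet> w else 0)"
    unfolding dirac1_def inner_Pair inner_scaleR_left inner_scaleR_right
    by (simp add: inner_vec_def) (simp add: axis_def field_simps)
qed simp

lemma dirac_dirac2: "dirac dirac2 skew"
proof (rule dirac.intro)
  show "linear (dirac2 i)" for i
    by (rule linearI) (auto simp: dirac2_def vec_eq_iff algebra_simps)
  show "subspace skew"
  proof (rule subspaceI)
    fix x y :: "real^'n^'n" and c :: real assume x: "x \<in> skew" and y: "y \<in> skew"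
    have "x $ a $ b + y $ a $ b = - (x $ b $ a + y $ b $ a)" "c * x $ a $ b = - (c * x $ b $ a)" for a b
      using x[unfolded skew_def, THEN CollectD, rule_format, of a b] y[unfolded skew_def, THEN CollectD, rule_format, of a b] by simp_all
    then show "x + y \<in> skew" "c *\<^sub>R x \<in> skew" unfolding skew_def mem_Collect_eq vector_add_component vector_scaleR_component real_scaleR_def by blast+
  qed (simp add: skew_def)
  fix w :: "real^'n^'n" and i j assume w: "w \<in> skew"
  have sk: "w $ a $ b = - w $ b $ a" for a b using w unfolding skew_def by blast
  define M where "M = (\<Sum>b\<in>UNIV. w $ i $ b * w $ j $ b)"
  define d where "d = (\<lambda>i k. axis i (1::real) $ (k::'n))"
  have dd: "(\<Sum>a\<in>UNIV. d i a * f a) = f i" for i and f :: "'n \<Rightarrow> real" unfolding d_def by (rule sum_axis)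
  have ww: "w \<bullet> w = (\<Sum>a\<in>UNIV. \<Sum>b\<in>UNIV. w $ a $ b * w $ a $ b)" by (simp add: inner_vec_def)
  have ww': "w \<bullet> w = (\<Sum>a\<in>UNIV. \<Sum>b\<in>UNIV. w $ b $ a * w $ b $ a)" unfolding ww by (rule sum.swap)
  have "(\<Sum>k\<in>UNIV. \<Sum>a\<in>UNIV. \<Sum>b\<in>UNIV. (d i k * w $ a $ b + d i a * w $ b $ k + d i b * w $ k $ a) * (d j k * w $ a $ b + d j a * w $ b $ k + d j b * w $ k $ a))
    = (\<Sum>k\<in>UNIV. \<Sum>a\<in>UNIV. \<Sum>b\<in>UNIV. d i k * (d j k * (w $ a $ b * w $ a $ b))) + (\<Sum>k\<in>UNIV. \<Sum>a\<in>UNIV. \<Sum>b\<in>UNIV. d i a * (d j a * (w $ b $ k * w $ b $ k)))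
    + (\<Sum>k\<in>UNIV. \<Sum>a\<in>UNIV. \<Sum>b\<in>UNIV. d i b * (d j b * (w $ k $ a * w $ k $ a)))
    + ((\<Sum>k\<in>UNIV. \<Sum>a\<in>UNIV. \<Sum>b\<in>UNIV. d i k * (d j a * (w $ a $ b * w $ b $ k))) + (\<Sum>k\<in>UNIV. \<Sum>a\<in>UNIV. \<Sum>b\<in>UNIV. d i k * (d j b * (w $ a $ b * w $ k $ a)))
    + (\<Sum>k\<in>UNIV. \<Sum>a\<in>UNIV. \<Sum>b\<in>UNIV. d i a * (d j k * (w $ b $ k * w $ a $ b))) + (\<Sum>k\<in>UNIV. \<Sum>a\<in>UNIV. \<Sum>b\<in>UNIV. d i a * (d j b * (w $ b $ k * w $ k $ a)))
    + (\<Sum>k\<in>UNIV. \<Sum>a\<in>UNIV. \<Sum>b\<in>UNIV. d i b * (d j k * (w $ k $ a * w $ a $ b))) + (\<Sum>k\<in>UNIV. \<Sum>a\<in>UNIV. \<Sum>b\<in>UNIV. d i b * (d j a * (w $ k $ a * w $ b $ k))))"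
    by (simp add: sum.distrib[symmetric] algebra_simps)
  also have "\<dots> = 3 * (d j i * (w \<bullet> w)) - 6 * M"
    unfolding M_def
    by (simp add: sum_distrib_left[symmetric] dd ww[symmetric] ww'[symmetric] sk[of _ i] sk[of _ j] sum_negf mult.commute)
  finally have 1: "(\<Sum>k\<in>UNIV. \<Sum>a\<in>UNIV. \<Sum>b\<in>UNIV. (d i k * w $ a $ b + d i a * w $ b $ k + d i b * w $ k $ a) * (d j k * w $ a $ b + d j a * w $ b $ k + d j b * w $ k $ a))
    = 3 * (d j i * (w \<bullet> w)) - 6 * M" .
  have "dirac2 i w \<bullet> dirac2 j w = (1 / 3) * (3 * (d j i * (w \<bullet> w)) - 6 * M) + 2 * M"
    unfolding 1[symmetric] unfolding M_def dirac2_def inner_Pair inner_scaleR_left inner_scaleR_right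
    by (simp add: inner_vec_def d_def)
  then show "dirac2 i w \<bullet> dirac2 j w = (if i = j then w \<bullet> w else 0)"
    by (simp add: d_def axis_def field_simps)
qed

text \<open>Summed over \<open>i\<close>, the symbol returns the curl and the divergence of
  \<open>D\<close>, so bounds for these two bound the operator.\<close>

lemma norm_dirac1_sum:
  fixes D :: "'n::finite \<Rightarrow> real^'n"
  assumes B: "B \<ge> 0" and 1: "\<And>a b. \<bar>D a $ b - D b $ a\<bar> \<le> B" and 2: "\<bar>\<Sum>i\<in>UNIV. D i $ i\<bar> \<le> B"
  shows "(norm (\<Sum>i\<in>UNIV. dirac1 i (D i)))^2 \<le> (real CARD('n) * real CARD('n) + 1) * B^2"
proof -
  have e: "(\<Sum>i\<in>UNIV. dirac1 i (D i)) = ((1 / sqrt 2) *\<^sub>R (\<chi> a b. D a $ b - D b $ a), \<Sum>i\<in>UNIV. D i $ i)"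
    by (rule prod_eqI) (simp_all add: dirac1_def fst_sum snd_sum vec_eq_iff sum_divide_distrib[symmetric] sum_subtractf axis_def
        if_distrib[of "\<lambda>t. t * _"] cong: if_cong)
  have sq: "t * t \<le> B^2" if "\<bar>t\<bar> \<le> B" for t using power_mono[OF that, of 2] by (simp add: power2_eq_square abs_mult_self)
  have "(norm (\<Sum>i\<in>UNIV. dirac1 i (D i)))^2 = (1/2) * (\<Sum>a\<in>UNIV. \<Sum>b\<in>UNIV. (D a $ b - D b $ a) * (D a $ b - D b $ a)) + (\<Sum>i\<in>UNIV. D i $ i) * (\<Sum>i\<in>UNIV. D i $ i)"
    unfolding e power2_norm_eq_inner inner_Pair inner_scaleR_left inner_scaleR_right by (simp add: inner_vec_def)
  also have "\<dots> \<le> (1/2) * (\<Sum>a\<in>(UNIV::'n set). \<Sum>b\<in>(UNIV::'n set). B^2) + B^2"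
    by (intro add_mono mult_left_mono sum_mono sq 1 2) simp
  also have "\<dots> \<le> (real CARD('n) * real CARD('n) + 1) * B^2" by (simp add: algebra_simps)
  finally show ?thesis .
qed

lemma norm_dirac2_sum:
  fixes D :: "'n::finite \<Rightarrow> real^'n^'n"
  assumes B: "B \<ge> 0" and 1: "\<And>k a b. \<bar>D k $ a $ b + D a $ b $ k + D b $ k $ a\<bar> \<le> B" and 2: "\<And>b. \<bar>\<Sum>i\<in>UNIV. D i $ i $ b\<bar> \<le> B"
  shows "(norm (\<Sum>i\<in>UNIV. dirac2 i (D i)))^2 \<le> (real CARD('n) * (real CARD('n) * real CARD('n)) + 2 * real CARD('n)) * B^2"
proof -
  have e: "(\<Sum>i\<in>UNIV. dirac2 i (D i)) = ((1 / sqrt 3) *\<^sub>R (\<chi> k a b. D k $ a $ b + D a $ b $ k + D b $ k $ a), sqrt 2 *\<^sub>R (\<chi> b. \<Sum>i\<in>UNIV. D i $ i $ b))"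
    by (rule prod_eqI) (simp_all add: dirac2_def fst_sum snd_sum vec_eq_iff sum_divide_distrib[symmetric] sum_distrib_left[symmetric] sum.distrib axis_def
        if_distrib[of "\<lambda>t. t * _"] cong: if_cong)
  have sq: "t * t \<le> B^2" if "\<bar>t\<bar> \<le> B" for t using power_mono[OF that, of 2] by (simp add: power2_eq_square abs_mult_self)
  have "(norm (\<Sum>i\<in>UNIV. dirac2 i (D i)))^2 = (1/3) * (\<Sum>k\<in>UNIV. \<Sum>a\<in>UNIV. \<Sum>b\<in>UNIV. (D k $ a $ b + D a $ b $ k + D b $ k $ a) * (D k $ a $ b + D a $ b $ k + D b $ k $ a))
     + 2 * (\<Sum>b\<in>UNIV. (\<Sum>i\<in>UNIV. D i $ i $ b) * (\<Sum>i\<in>UNIV. D i $ i $ b))"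
    unfolding e power2_norm_eq_inner inner_Pair inner_scaleR_left inner_scaleR_right by (simp add: inner_vec_def)
  also have "\<dots> \<le> (1/3) * (\<Sum>k\<in>(UNIV::'n set). \<Sum>a\<in>(UNIV::'n set). \<Sum>b\<in>(UNIV::'n set). B^2) + 2 * (\<Sum>b\<in>(UNIV::'n set). B^2)"
    by (intro add_mono mult_left_mono sum_mono sq 1 2) simp_all
  also have "\<dots> \<le> (real CARD('n) * (real CARD('n) * real CARD('n)) + 2 * real CARD('n)) * B^2" by (simp add: algebra_simps)
  finally show ?thesis .
qed

lemma close_cong:
  assumes "close T m g g'" "\<And>x. x \<in> T \<Longrightarrow> f x = g x" "\<And>x. x \<in> T \<Longrightarrow> f' x = g' x" shows "close T m f f'"
  using assms unfolding close_def by simp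

lemma close_bounded:
  fixes f f' :: "real^'n::finite \<Rightarrow> real"
  assumes "continuous_on (cball 0 r) f" "continuous_on (cball 0 r) f'" "T \<subseteq> cball 0 r"
    and m: "\<And>x. x \<in> T \<Longrightarrow> 0 \<le> m x" and le: "\<And>x. x \<in> T \<Longrightarrow> \<bar>f x - f' x\<bar> \<le> K * m x"
  shows "close T m f f'"
proof -
  obtain A where A: "\<And>x. x \<in> cball 0 r \<Longrightarrow> norm (f x) \<le> A"
    using continuous_on_compact_bound[OF compact_cball assms(1)] by blast
  obtain B where B: "\<And>x. x \<in> cball 0 r \<Longrightarrow> norm (f' x) \<le> B"
    using continuous_on_compact_bound[OF compact_cball assms(2)] by blast
  show ?thesis unfolding close_def
  proof (intro exI[of _ "max K (max A B)"] ballI conjI m)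
    fix x assume x: "x \<in> T"
    then have "x \<in> cball 0 r" using assms(3) by blast
    from A[OF this] B[OF this] show "\<bar>f x\<bar> \<le> max K (max A B)" "\<bar>f' x\<bar> \<le> max K (max A B)" by auto
    show "\<bar>f x - f' x\<bar> \<le> max K (max A B) * m x"
      using le[OF x] mult_right_mono[OF max.cobounded1[of K "max A B"] m[OF x]] by linarith
  qed
qed

lemma uniform_bound:
  fixes f :: "'i::finite \<Rightarrow> 'a \<Rightarrow> real"
  assumes "\<And>i. \<exists>C\<ge>0. \<forall>x\<in>T. \<bar>f i x\<bar> \<le> C * m x" and m: "\<And>x. x \<in> T \<Longrightarrow> 0 \<le> m x"
  obtains C where "C \<ge> 0" "\<And>i x. x \<in> T \<Longrightarrow> \<bar>f i x\<bar> \<le> C * m x"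
proof -
  obtain C where C: "\<And>i. C i \<ge> 0" "\<And>i x. x \<in> T \<Longrightarrow> \<bar>f i x\<bar> \<le> C i * m x" using assms(1) by metis
  show ?thesis
  proof (rule that)
    show "(\<Sum>i\<in>UNIV. C i) \<ge> 0" using C by (simp add: sum_nonneg)
    show "\<bar>f i x\<bar> \<le> (\<Sum>i\<in>UNIV. C i) * m x" if x: "x \<in> T" for i x
      using C(2)[OF x, of i] mult_right_mono[OF member_le_sum[of i UNIV C] m[OF x]] C(1) by auto
  qed
qed

lemma le_sum: "(\<And>i. 0 \<le> f i) \<Longrightarrow> f i \<le> (\<Sum>i\<in>(UNIV::'i::finite set). f i :: real)"
  by (rule member_le_sum) auto

context einstein_frame begin

text \<open>Values on the coordinate vectors, which both solutions share, whereas their frames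
  \<open>e\<close> differ.\<close>

definition th :: "'n \<Rightarrow> 'n \<Rightarrow> real^'n \<Rightarrow> real" where "th i j x = \<theta> x (axis j 1) $ i"
definition om :: "'n \<Rightarrow> 'n \<Rightarrow> 'n \<Rightarrow> real^'n \<Rightarrow> real" where "om j p a x = \<omega> x (axis j 1) $ p $ a"

lemma th_C1: "C_on 1 (ball 0 \<rho>) (th i j)" and om_C1: "C_on 1 (ball 0 \<rho>) (om j p a)" and ek_C1: "C_on 1 (ball 0 \<rho>) (\<lambda>x. e k x $ j)"
  unfolding th_def om_def by (intro C_on_nth \<theta>_C1 \<omega>_C1 e_C1 open_ball)+

lemma V_C1: "C_on 1 UNIV (deriv V)" "C_on 1 UNIV (deriv (deriv V))"
proof -
  have 2: "C_on 2 UNIV (deriv V)" by (rule C_on_real_deriv) (use V in \<open>simp add: eval_nat_numeral\<close>)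
  show "C_on 1 UNIV (deriv V)" by (rule C_on_mono[OF 2]) simp
  show "C_on 1 UNIV (deriv (deriv V))" by (rule C_on_real_deriv) (use 2 in \<open>simp add: eval_nat_numeral\<close>)
qed

context
  fixes x :: "real^'n" assumes x: "x \<in> ball 0 \<rho>"
begin

lemma \<theta>_th: "\<theta> x v $ b = (\<Sum>j\<in>UNIV. v $ j * th b j x)"
  by (subst vec_axis_sum[of v, symmetric]) (simp add: linear_sum[OF \<theta>_linear[OF x]] linear_cmul[OF \<theta>_linear[OF x]] th_def)

lemma \<omega>_om: "\<omega> x v $ p $ a = (\<Sum>j\<in>UNIV. v $ j * om j p a x)"
  by (subst vec_axis_sum[of v, symmetric]) (simp add: linear_sum[OF \<omega>_linear[OF x]] linear_cmul[OF \<omega>_linear[OF x]] om_def)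

lemma w_om: "w k p a x = (\<Sum>j\<in>UNIV. e k x $ j * om j p a x)"
  unfolding w_def by (rule \<omega>_om)

lemma th_radial: "fd (th i j) x x + 1 * th i j x = axis j 1 $ i + (\<Sum>b\<in>UNIV. x $ b * om j i b x)"
  using \<theta>_radial_\<omega>[OF x, of "axis j 1" i] by (simp add: th_def[abs_def] om_def)

lemma om_radial: "fd (om j c b) x x + 1 * om j c b x = 0 + (\<Sum>a\<in>UNIV. x $ a * (\<Sum>d\<in>UNIV. th d j x * R a d b c x))"
  using \<omega>_radial_R[OF x, of "axis j 1" c b] by (simp add: th_def[abs_def] om_def[abs_def])

end

end

section \<open>Two solutions with equal jets\<close>

text \<open>Both solutions are read on the same ball of normal coordinates. Equality of frame
  components at the origin is what the isomorphism of tangent spaces provides once the two initial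
  frames correspond.\<close>

locale frame_pair = a: einstein_frame G S F E \<rho> h V \<Lambda> + b: einstein_frame G' S' F' E' \<rho> h' V \<Lambda>
  for G :: "real^'n \<Rightarrow> real^'n^'n::finite" and S F E \<rho> h V \<Lambda> and G' :: "real^'n \<Rightarrow> real^'n^'n" and S' F' E' h' +
  assumes jet_h: "length as = k \<Longrightarrow> a.comp ((cov_deriv G ^^ k) (scalar_field h)) as 0 = b.comp ((cov_deriv G' ^^ k) (scalar_field h')) as 0"
    and jet_R: "length as = k + 4 \<Longrightarrow> a.comp ((cov_deriv G ^^ k) (riemann G)) as 0 = b.comp ((cov_deriv G' ^^ k) (riemann G')) as 0"
begin

text \<open>By \<open>comp_radial\<close>, agreement of the next covariant derivatives to order
  \<open>N\<close> gives agreement of the components to order \<open>Suc N\<close>; induction on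
  \<open>N\<close> for all \<open>k\<close> at once. Order 0 is boundedness on a compact
  ball.\<close>

lemma flat_comp:
  assumes P: "\<And>I k. C_on k S (\<lambda>y. P y I)" and Q: "\<And>I k. C_on k S' (\<lambda>y. Q y I)" and r: "r < \<rho>"
    and jet: "\<And>k as. length as = k + l \<Longrightarrow> a.comp ((cov_deriv G ^^ k) P) as 0 = b.comp ((cov_deriv G' ^^ k) Q) as 0"
  shows "length as = k + l \<Longrightarrow> close (ball 0 r) (\<lambda>x. norm x ^ N) (a.comp ((cov_deriv G ^^ k) P) as) (b.comp ((cov_deriv G' ^^ k) Q) as)"
proof (induction N arbitrary: k as)
  have sub: "cball 0 r \<subseteq> ball (0::real^'n) \<rho>" using r by auto
  have P': "C_on j S (\<lambda>y. (cov_deriv G ^^ k) P y I)" for I j k by (rule a.cov_deriv_pow_C_on[OF P])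
  have Q': "C_on j S' (\<lambda>y. (cov_deriv G' ^^ k) Q y I)" for I j k by (rule b.cov_deriv_pow_C_on[OF Q])
  have ca: "continuous_on (cball 0 r) (a.comp ((cov_deriv G ^^ k) P) as)" for k as
    by (rule continuous_on_subset[OF C_on_continuous[OF a.comp_C2[OF P']] sub])
  have cb: "continuous_on (cball 0 r) (b.comp ((cov_deriv G' ^^ k) Q) as)" for k as
    by (rule continuous_on_subset[OF C_on_continuous[OF b.comp_C2[OF Q']] sub])
  {
    case 0
    obtain K where K: "\<And>x. x \<in> cball 0 r \<Longrightarrow> norm (a.comp ((cov_deriv G ^^ k) P) as x - b.comp ((cov_deriv G' ^^ k) Q) as x) \<le> K"
      using continuous_on_compact_bound[OF compact_cball continuous_on_diff[OF ca cb]] by blast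
    show ?case by (rule close_bounded[where K=K, OF ca cb]) (use K in auto)
  next
    case (Suc N)
    define f where "f = a.comp ((cov_deriv G ^^ k) P) as"
    define f' where "f' = b.comp ((cov_deriv G' ^^ k) Q) as"
    obtain C where C: "C \<ge> 0" "\<And>x. x \<in> ball 0 r \<Longrightarrow> \<bar>(\<Sum>c\<in>UNIV. x $ c * a.comp ((cov_deriv G ^^ Suc k) P) (c # as) x)
       - (\<Sum>c\<in>UNIV. x $ c * b.comp ((cov_deriv G' ^^ Suc k) Q) (c # as) x)\<bar> \<le> C * (norm x * norm x ^ N)"
      by (rule close_radial_sum[of "ball 0 r" "\<lambda>x. norm x ^ N" "\<lambda>c. a.comp ((cov_deriv G ^^ Suc k) P) (c # as)" "\<lambda>c. b.comp ((cov_deriv G' ^^ Suc k) Q) (c # as)"])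
        (rule Suc.IH, use Suc.prems in simp, rule that)
    have d: "f differentiable (at x)" "f' differentiable (at x)" if "x \<in> ball 0 r" for x
    proof -
      have "C_on 2 (ball 0 \<rho>) f" "C_on 2 (ball 0 \<rho>) f'"
        unfolding f_def f'_def by (intro a.comp_C2[OF P'] b.comp_C2[OF Q'])+
      then show "f differentiable (at x)" "f' differentiable (at x)" using that r by (auto simp: numeral_2_eq_2)
    qed
    have fd: "fd (\<lambda>x. f x - f' x) x = (\<lambda>v. fd f x v - fd f' x v)" if "x \<in> ball 0 r" for x
      by (rule fd_eq[OF has_derivative_diff[OF fd_works fd_works]]) (use d that in auto)
    have "\<bar>f x - f' x\<bar> \<le> C * norm x ^ Suc N" if x: "x \<in> ball 0 r" for x
    proof (rule radial_growth0[OF _ x _ _ C(1)])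
      show "(\<lambda>x. f x - f' x) differentiable (at y)" if "y \<in> ball 0 r" for y
        using d[OF that] by (rule differentiable_diff)
      show "f 0 - f' 0 = 0" using jet[OF Suc.prems] by (simp add: f_def f'_def)
      fix y :: "real^'n" assume y: "y \<in> ball 0 r"
      then have y': "y \<in> ball 0 \<rho>" using r by auto
      show "\<bar>fd (\<lambda>x. f x - f' x) y y\<bar> \<le> C * norm y ^ Suc N"
        unfolding fd[OF y] unfolding f_def f'_def a.comp_radial[OF y' P'] b.comp_radial[OF y' Q'] using C(2)[OF y] by simp
    qed
    then show ?case unfolding f_def f'_def
      by (intro close_bounded[where K=C, OF ca cb]) auto
  }
qed

context
  fixes r :: real assumes r: "0 < r" "r < \<rho>"
begin

lemma flat_R: "close (ball 0 r) (\<lambda>x. norm x ^ N) (a.R i j k l) (b.R i j k l)"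
  unfolding a.R_def b.R_def
  using flat_comp[where k=0 and l=4 and N=N and as="[i, j, k, l]", OF a.riemann_C_on b.riemann_C_on r(2) jet_R] by simp

lemma flat_\<phi>: "close (ball 0 r) (\<lambda>x. norm x ^ N) a.\<phi> b.\<phi>"
  and flat_\<alpha>: "close (ball 0 r) (\<lambda>x. norm x ^ N) (a.\<alpha> i) (b.\<alpha> i)"
  and flat_H: "close (ball 0 r) (\<lambda>x. norm x ^ N) (a.H i j) (b.H i j)"
proof -
  note * = flat_comp[where l=0 and N=N, OF a.scalar_C_on[OF a.h] b.scalar_C_on[OF b.h] r(2) jet_h, simplified]
  show "close (ball 0 r) (\<lambda>x. norm x ^ N) a.\<phi> b.\<phi>" unfolding a.\<phi>_def b.\<phi>_def using *[of "[]" 0] by simp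
  show "close (ball 0 r) (\<lambda>x. norm x ^ N) (a.\<alpha> i) (b.\<alpha> i)" unfolding a.\<alpha>_def b.\<alpha>_def using *[of "[i]" 1] by simp
  show "close (ball 0 r) (\<lambda>x. norm x ^ N) (a.H i j) (b.H i j)" unfolding a.H_def b.H_def using *[of "[i, j]" 2] by (simp add: numeral_2_eq_2)
qed

lemma sub: "cball 0 r \<subseteq> ball (0::real^'n) \<rho>" "ball 0 r \<subseteq> ball (0::real^'n) \<rho>" using r by auto

lemma flat_transport:
  fixes f f' :: "real^'n \<Rightarrow> real"
  assumes f: "C_on 1 (ball 0 \<rho>) f" "C_on 1 (ball 0 \<rho>) f'"
    and g: "\<And>i. close (ball 0 r) (\<lambda>x. norm x ^ N) (g i) (g' i)"
    and eq: "\<And>x. x \<in> ball 0 \<rho> \<Longrightarrow> fd f x x + 1 * f x = c + (\<Sum>i\<in>UNIV. x $ i * g i x)"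
       "\<And>x. x \<in> ball 0 \<rho> \<Longrightarrow> fd f' x x + 1 * f' x = c + (\<Sum>i\<in>UNIV. x $ i * g' i x)"
  shows "close (ball 0 r) (\<lambda>x. norm x ^ Suc N) f f'"
proof -
  obtain C where C: "C \<ge> 0" "\<And>x. x \<in> ball 0 r \<Longrightarrow> \<bar>(\<Sum>i\<in>UNIV. x $ i * g i x) - (\<Sum>i\<in>UNIV. x $ i * g' i x)\<bar> \<le> C * (norm x * norm x ^ N)"
    by (rule close_radial_sum[of "ball 0 r" "\<lambda>x. norm x ^ N" g g', OF g]) (rule that)
  have "\<bar>f x - f' x\<bar> \<le> C * norm x ^ Suc N" if x: "x \<in> ball 0 r" for x
  proof (rule radial_growth1[OF _ x _ C(1)])
    fix y :: "real^'n" assume y: "y \<in> ball 0 r"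
    then have d: "f differentiable (at y)" "f' differentiable (at y)" using f sub by auto
    then show "(\<lambda>x. f x - f' x) differentiable (at y)" by (rule differentiable_diff)
    have y': "y \<in> ball 0 \<rho>" using y sub by blast
    have "fd (\<lambda>x. f x - f' x) y y = fd f y y - fd f' y y"
      by (subst fd_eq[OF has_derivative_diff[OF fd_works fd_works]]) (use d in auto)
    then have "fd (\<lambda>x. f x - f' x) y y + (f y - f' y) = (\<Sum>i\<in>UNIV. y $ i * g i y) - (\<Sum>i\<in>UNIV. y $ i * g' i y)"
      using eq(1)[OF y'] eq(2)[OF y'] by simp
    then show "\<bar>fd (\<lambda>x. f x - f' x) y y + (f y - f' y)\<bar> \<le> C * norm y ^ Suc N" using C(2)[OF y] by simp
  qed
  moreover have "continuous_on (cball 0 r) f" "continuous_on (cball 0 r) f'"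
    using f by (auto intro: continuous_on_subset[OF C_on_continuous sub(1)] simp del: C_on.simps)
  ultimately show ?thesis by (intro close_bounded[where K=C and r=r]) auto
qed

text \<open>Each step gains one order through the factor \<open>x\<close> in the radial equations:
  the connection form from the flatness of the curvature and both forms at order \<open>N\<close>,
  the coframe from the connection form at order \<open>N\<close>.\<close>

lemma flat_th_om: "close (ball 0 r) (\<lambda>x. norm x ^ N) (a.th i j) (b.th i j) \<and> close (ball 0 r) (\<lambda>x. norm x ^ N) (a.om i k l) (b.om i k l)"
proof (induction N arbitrary: i j k l)
  case 0
  have "close (ball 0 r) (\<lambda>x. norm x ^ 0) f f'" if c: "C_on 1 (ball 0 \<rho>) f" "C_on 1 (ball 0 \<rho>) f'" for f f' :: "real^'n \<Rightarrow> real"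
  proof -
    have cc: "continuous_on (cball 0 r) f" "continuous_on (cball 0 r) f'"
      using c by (auto intro: continuous_on_subset[OF C_on_continuous sub(1)] simp del: C_on.simps)
    obtain K where K: "\<And>x. x \<in> cball 0 r \<Longrightarrow> norm (f x - f' x) \<le> K"
      using continuous_on_compact_bound[OF compact_cball continuous_on_diff[OF cc]] by blast
    show ?thesis by (rule close_bounded[where K=K, OF cc]) (use K in auto)
  qed
  then show ?case by (simp only: a.th_C1 b.th_C1 a.om_C1 b.om_C1)
next
  case (Suc N)
  show ?case
  proof (intro conjI)
    show "close (ball 0 r) (\<lambda>x. norm x ^ Suc N) (a.th i j) (b.th i j)"
      by (rule flat_transport[OF a.th_C1 b.th_C1 _ a.th_radial b.th_radial]) (use Suc in auto)
    show "close (ball 0 r) (\<lambda>x. norm x ^ Suc N) (a.om i k l) (b.om i k l)"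
      by (rule flat_transport[OF a.om_C1 b.om_C1 _ a.om_radial b.om_radial])
        (use Suc in \<open>auto intro!: close_sum close_mult flat_R\<close>)
  qed
qed

end

end

lemma closeD: "close T m f f' \<Longrightarrow> \<exists>C\<ge>0. \<forall>x\<in>T. \<bar>f x - f' x\<bar> \<le> C * m x"
  by (erule closeE) blast

section \<open>The closed system of inequalities for the differences\<close>

context frame_pair begin

context
  fixes r K0 :: real assumes rw: "radial_weight a.e r K0" and r: "r < \<rho>"
begin

interpretation c1: carleman dirac1 UNIV a.e r K0
  by (intro carleman.intro dirac_dirac1 rw)

interpretation c2: carleman dirac2 skew a.e r K0
  by (intro carleman.intro dirac_dirac2 rw)

definition uR :: "'n \<Rightarrow> 'n \<Rightarrow> real^'n \<Rightarrow> real^'n^'n" where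
  "uR c d x = (\<chi> i j. a.R i j c d x - b.R i j c d x)"
definition uH :: "'n \<Rightarrow> real^'n \<Rightarrow> real^'n" where "uH c x = (\<chi> i. a.H i c x - b.H i c x)"
definition Z :: "real^'n \<Rightarrow> real" where
  "Z x = (\<Sum>c\<in>UNIV. \<Sum>d\<in>UNIV. (norm (uR c d x))^2) + (\<Sum>c\<in>UNIV. (norm (uH c x))^2) + (\<Sum>i\<in>UNIV. (a.\<alpha> i x - b.\<alpha> i x)^2)
     + (a.\<phi> x - b.\<phi> x)^2 + (\<Sum>i\<in>UNIV. \<Sum>j\<in>UNIV. (a.th i j x - b.th i j x)^2)
     + (\<Sum>i\<in>UNIV. \<Sum>j\<in>UNIV. \<Sum>k\<in>UNIV. (a.om i j k x - b.om i j k x)^2)"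

lemma Z_ge: "(norm (uR c d x))^2 \<le> Z x" "(norm (uH c x))^2 \<le> Z x" "(a.\<alpha> i x - b.\<alpha> i x)^2 \<le> Z x" "(a.\<phi> x - b.\<phi> x)^2 \<le> Z x"
  "(a.th i j x - b.th i j x)^2 \<le> Z x" "(a.om i j k x - b.om i j k x)^2 \<le> Z x"
proof -
  have "0 \<le> (\<Sum>c\<in>UNIV. \<Sum>d\<in>UNIV. (norm (uR c d x))^2)" "0 \<le> (\<Sum>c\<in>UNIV. (norm (uH c x))^2)" "0 \<le> (\<Sum>i\<in>UNIV. (a.\<alpha> i x - b.\<alpha> i x)^2)"
     "0 \<le> (a.\<phi> x - b.\<phi> x)^2" "0 \<le> (\<Sum>i\<in>UNIV. \<Sum>j\<in>UNIV. (a.th i j x - b.th i j x)^2)"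
     "0 \<le> (\<Sum>i\<in>UNIV. \<Sum>j\<in>UNIV. \<Sum>k\<in>UNIV. (a.om i j k x - b.om i j k x)^2)"
    by (intro sum_nonneg zero_le_power2)+
  moreover have "(norm (uR c d x))^2 \<le> (\<Sum>c\<in>UNIV. \<Sum>d\<in>UNIV. (norm (uR c d x))^2)"
    by (rule order_trans[OF le_sum[of "\<lambda>d. (norm (uR c d x))^2"] le_sum[of "\<lambda>c. \<Sum>d\<in>UNIV. (norm (uR c d x))^2"]]) (auto intro!: sum_nonneg)
  moreover have "(norm (uH c x))^2 \<le> (\<Sum>c\<in>UNIV. (norm (uH c x))^2)" "(a.\<alpha> i x - b.\<alpha> i x)^2 \<le> (\<Sum>i\<in>UNIV. (a.\<alpha> i x - b.\<alpha> i x)^2)"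
    by (rule le_sum, simp)+
  moreover have "(a.th i j x - b.th i j x)^2 \<le> (\<Sum>i\<in>UNIV. \<Sum>j\<in>UNIV. (a.th i j x - b.th i j x)^2)"
    by (rule order_trans[OF le_sum[of "\<lambda>j. (a.th i j x - b.th i j x)^2"] le_sum[of "\<lambda>i. \<Sum>j\<in>UNIV. (a.th i j x - b.th i j x)^2"]]) (auto intro!: sum_nonneg)
  moreover have "(a.om i j k x - b.om i j k x)^2 \<le> (\<Sum>i\<in>UNIV. \<Sum>j\<in>UNIV. \<Sum>k\<in>UNIV. (a.om i j k x - b.om i j k x)^2)"
    by (rule order_trans[OF le_sum[of "\<lambda>k. (a.om i j k x - b.om i j k x)^2"] order_trans[OF
        le_sum[of "\<lambda>j. \<Sum>k\<in>UNIV. (a.om i j k x - b.om i j k x)^2"] le_sum[of "\<lambda>i. \<Sum>j\<in>UNIV. \<Sum>k\<in>UNIV. (a.om i j k x - b.om i j k x)^2"]]])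
      (auto intro!: sum_nonneg)
  ultimately show "(norm (uR c d x))^2 \<le> Z x" "(norm (uH c x))^2 \<le> Z x" "(a.\<alpha> i x - b.\<alpha> i x)^2 \<le> Z x" "(a.\<phi> x - b.\<phi> x)^2 \<le> Z x"
    "(a.th i j x - b.th i j x)^2 \<le> Z x" "(a.om i j k x - b.om i j k x)^2 \<le> Z x"
    unfolding Z_def by linarith+
qed

lemma Z_nonneg: "0 \<le> Z x" by (rule order_trans[OF zero_le_power2 Z_ge(4)])

lemma \<Omega>_sub: "c1.\<Omega> \<subseteq> ball 0 \<rho>" "c1.\<Omega> \<subseteq> cball 0 r" "cball 0 r \<subseteq> ball (0::real^'n) \<rho>" using r by (auto simp: c1.\<Omega>_def)

lemma r0: "0 < r" by (rule c1.r)

abbreviation m where "m x \<equiv> sqrt (Z x)"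
abbreviation cl where "cl \<equiv> close c1.\<Omega> m"

lemma cl_of:
  assumes "continuous_on (ball 0 \<rho>) f" "continuous_on (ball 0 \<rho>) f'" "\<And>x. (f x - f' x)^2 \<le> Z x"
  shows "cl f f'"
proof (rule close_bounded[where K=1])
  show "\<bar>f x - f' x\<bar> \<le> 1 * m x" for x using real_sqrt_le_mono[OF assms(3)[of x]] by simp
qed (use assms(1,2) \<Omega>_sub continuous_on_subset in \<open>auto simp: Z_nonneg\<close>)

lemma cl_refl: "continuous_on (ball 0 \<rho>) f \<Longrightarrow> cl f f"
  by (rule cl_of) (auto simp: Z_nonneg)

lemma R_le: "(a.R i j c d x - b.R i j c d x)^2 \<le> (norm (uR c d x))^2"
proof -
  have "\<bar>uR c d x $ i $ j\<bar> \<le> norm (uR c d x)"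
    using component_le_norm_cart[of "uR c d x $ i" j] Finite_Cartesian_Product.norm_nth_le[of "uR c d x" i] by linarith
  from power_mono[OF this, of 2] show ?thesis by (simp add: uR_def)
qed

lemma H_le: "(a.H i c x - b.H i c x)^2 \<le> (norm (uH c x))^2"
  using power_mono[OF component_le_norm_cart[of "uH c x" i], of 2] by (simp add: uH_def)

lemma cl_base: "cl (a.R i j k l) (b.R i j k l)" "cl (a.H i j) (b.H i j)" "cl (a.\<alpha> i) (b.\<alpha> i)" "cl a.\<phi> b.\<phi>"
  "cl (a.th i j) (b.th i j)" "cl (a.om i j k) (b.om i j k)"
  by (rule cl_of; (rule C_on_continuous[OF a.R_C2] C_on_continuous[OF b.R_C2] C_on_continuous[OF a.H_C2] C_on_continuous[OF b.H_C2]
      C_on_continuous[OF a.\<alpha>_C2] C_on_continuous[OF b.\<alpha>_C2] C_on_continuous[OF a.\<phi>_C2] C_on_continuous[OF b.\<phi>_C2]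
      C_on_continuous[OF a.th_C1] C_on_continuous[OF b.th_C1] C_on_continuous[OF a.om_C1] C_on_continuous[OF b.om_C1]
      Z_ge order_trans[OF R_le Z_ge(1)] order_trans[OF H_le Z_ge(2)]))+

text \<open>The frames are determined by the coframes: the difference of the two coframes, applied
  to the second frame and expanded in the first, is the difference of the frames.\<close>

lemma cl_e: "cl (\<lambda>x. a.e k x $ i) (\<lambda>x. b.e k x $ i)"
proof -
  define f where "f th x = (\<Sum>c\<in>UNIV. \<Sum>j\<in>UNIV. b.e k x $ j * th c j x * a.e c x $ i)" for th x
  have e1: "a.e k x $ i = f a.th x + a.e k x $ i - f a.th x" for x by simp
  have c: "cl (f b.th) (f a.th)" unfolding f_def
    by (intro close_sum close_mult close_sym[OF cl_base(5)] cl_refl C_on_continuous[OF a.ek_C1] C_on_continuous[OF b.ek_C1])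
      (auto simp: Z_nonneg)
  then obtain C where C: "C \<ge> 0" "\<And>x. x \<in> c1.\<Omega> \<Longrightarrow> \<bar>f b.th x - f a.th x\<bar> \<le> C * m x" using closeD by blast
  have eq: "a.e k x $ i - b.e k x $ i = f b.th x - f a.th x" if x: "x \<in> c1.\<Omega>" for x
  proof -
    have x': "x \<in> ball 0 \<rho>" using x \<Omega>_sub by blast
    have "f a.th x = (\<Sum>c\<in>UNIV. a.\<theta> x (b.e k x) $ c *\<^sub>R a.e c x) $ i"
      by (simp add: f_def a.\<theta>_th[OF x'] sum_distrib_right)
    moreover have "f b.th x = (\<Sum>c\<in>UNIV. b.\<theta> x (b.e k x) $ c *\<^sub>R a.e c x) $ i"
      by (simp add: f_def b.\<theta>_th[OF x'] sum_distrib_right)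
    moreover have "(\<Sum>c\<in>UNIV. axis k 1 $ c *\<^sub>R a.e c x) $ i = a.e k x $ i"
      by (simp add: sum_axis)
    ultimately show ?thesis unfolding a.e_\<theta>[OF x'] b.\<theta>_e[OF x'] by simp
  qed
  show ?thesis
    by (rule close_bounded[where K=C and r=r])
      (use C eq \<Omega>_sub in \<open>auto simp: Z_nonneg intro!: continuous_on_subset[OF C_on_continuous[OF a.ek_C1]] continuous_on_subset[OF C_on_continuous[OF b.ek_C1]]\<close>)
qed

lemma cl_w: "cl (a.w k p q) (b.w k p q)"
proof (rule close_cong)
  show "cl (\<lambda>x. \<Sum>j\<in>UNIV. a.e k x $ j * a.om j p q x) (\<lambda>x. \<Sum>j\<in>UNIV. b.e k x $ j * b.om j p q x)"
    by (intro close_sum close_mult cl_e cl_base) (auto simp: Z_nonneg)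
qed (use a.w_om b.w_om \<Omega>_sub in blast)+

lemma cl_V: "cl (\<lambda>x. deriv V (a.\<phi> x)) (\<lambda>x. deriv V (b.\<phi> x))" "cl (\<lambda>x. deriv (deriv V) (a.\<phi> x)) (\<lambda>x. deriv (deriv V) (b.\<phi> x))"
  by (rule close_lipschitz[OF cl_base(4)] a.V_C1)+

lemma cl_WR: "cl (a.WR k i j c d) (b.WR k i j c d)" and cl_WH: "cl (a.WH k i j) (b.WH k i j)"
  unfolding a.WR_def[abs_def] b.WR_def[abs_def] a.WH_def[abs_def] b.WH_def[abs_def]
  by (intro close_add close_sum close_mult cl_base cl_w; simp add: Z_nonneg)+

lemma cl_dir:
  assumes "C_on 2 (ball 0 \<rho>) f" shows "cl (\<lambda>x. fd f x (a.e k x)) (\<lambda>x. fd f x (b.e k x))"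
proof (rule close_cong)
  have "continuous_on (ball 0 \<rho>) (\<lambda>x. fd f x v)" for v
    by (rule C_on_deriv_continuous[of 1]) (use assms in \<open>simp only: Suc_1\<close>)
  then show "cl (\<lambda>x. \<Sum>j\<in>UNIV. a.e k x $ j * fd f x (axis j 1)) (\<lambda>x. \<Sum>j\<in>UNIV. b.e k x $ j * fd f x (axis j 1))"
    by (intro close_sum close_mult cl_e cl_refl) (auto simp: Z_nonneg)
  fix x assume "x \<in> c1.\<Omega>"
  then have "f differentiable (at x)" using assms \<Omega>_sub by (auto simp: numeral_2_eq_2)
  note d = fd_axis_sum[OF this]
  show "fd f x (a.e k x) = (\<Sum>j\<in>UNIV. a.e k x $ j * fd f x (axis j 1))" by (rule trans[OF d]) simp
  show "fd f x (b.e k x) = (\<Sum>j\<in>UNIV. b.e k x $ j * fd f x (axis j 1))" by (rule trans[OF d]) simp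
qed

text \<open>A combination of derivatives of a difference \<open>f - f'\<close> in the directions of the first frame is
  controlled once the same combination, taken for each function in its own frame, is.\<close>

lemma cl_combination:
  assumes f: "\<And>i. i \<in> J \<Longrightarrow> C_on 2 (ball 0 \<rho>) (f i)" "\<And>i. i \<in> J \<Longrightarrow> C_on 2 (ball 0 \<rho>) (f' i)" and J: "finite J"
    and g: "cl g g'"
    and eq: "\<And>x. x \<in> ball 0 \<rho> \<Longrightarrow> (\<Sum>i\<in>J. s i * fd (f i) x (a.e (k i) x)) = g x"
      "\<And>x. x \<in> ball 0 \<rho> \<Longrightarrow> (\<Sum>i\<in>J. s i * fd (f' i) x (b.e (k i) x)) = g' x"
  shows "\<exists>C\<ge>0. \<forall>x\<in>c1.\<Omega>. \<bar>\<Sum>i\<in>J. s i * fd (\<lambda>x. f i x - f' i x) x (a.e (k i) x)\<bar> \<le> C * m x"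
proof -
  have "cl (\<lambda>x. g x - (\<Sum>i\<in>J. s i * fd (f' i) x (a.e (k i) x))) (\<lambda>x. g' x - (\<Sum>i\<in>J. s i * fd (f' i) x (b.e (k i) x)))"
    by (intro close_diff close_sum close_mult close_const cl_dir g f J) (auto simp: Z_nonneg)
  then obtain C where C: "C \<ge> 0" "\<And>x. x \<in> c1.\<Omega> \<Longrightarrow> \<bar>(g x - (\<Sum>i\<in>J. s i * fd (f' i) x (a.e (k i) x))) - (g' x - (\<Sum>i\<in>J. s i * fd (f' i) x (b.e (k i) x)))\<bar> \<le> C * m x"
    using closeD by blast
  have "(\<Sum>i\<in>J. s i * fd (\<lambda>x. f i x - f' i x) x (a.e (k i) x)) = g x - (\<Sum>i\<in>J. s i * fd (f' i) x (a.e (k i) x))" if "x \<in> ball 0 \<rho>" for x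
  proof -
    have "fd (\<lambda>x. f i x - f' i x) x v = fd (f i) x v - fd (f' i) x v" if i: "i \<in> J" for i v
      by (subst fd_eq[OF has_derivative_diff[OF fd_works fd_works]]) (use f[OF i] \<open>x \<in> ball 0 \<rho>\<close> in \<open>auto simp: numeral_2_eq_2\<close>)
    then show ?thesis unfolding eq(1)[OF that, symmetric] by (simp add: right_diff_distrib sum_subtractf)
  qed
  then show ?thesis using C eq(2) \<Omega>_sub by (intro exI[of _ C]) (auto simp: subset_iff)
qed

lemma uR_C2: "C_on 2 (ball 0 \<rho>) (uR c d)" and uH_C2: "C_on 2 (ball 0 \<rho>) (uH c)"
  unfolding uR_def uH_def
  by (intro C_on_vec open_ball, unfold vec_lambda_beta, intro C_on_diff a.R_C2 b.R_C2 open_ball,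
    intro C_on_vec open_ball, unfold vec_lambda_beta, intro C_on_diff a.H_C2 b.H_C2 open_ball)

lemma fd_uR: "x \<in> c1.\<Omega> \<Longrightarrow> fd (uR c d) x v $ i $ j = fd (\<lambda>x. a.R i j c d x - b.R i j c d x) x v"
  and fd_uH: "x \<in> c1.\<Omega> \<Longrightarrow> fd (uH c) x v $ i = fd (\<lambda>x. a.H i c x - b.H i c x) x v"
proof -
  assume x: "x \<in> c1.\<Omega>"
  then have d: "uR c d differentiable (at x)" "uH c differentiable (at x)"
    using uR_C2[of c d] uH_C2[of c] \<Omega>_sub by (auto simp: numeral_2_eq_2)
  have d': "(\<lambda>x. uR c d x $ i) differentiable (at x)"
    by (rule differentiableI[OF bounded_linear.has_derivative[OF bounded_linear_vec_nth fd_works[OF d(1)]]])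
  show "fd (uR c d) x v $ i $ j = fd (\<lambda>x. a.R i j c d x - b.R i j c d x) x v"
    using fd_nth[OF d(1), of i v] fd_nth[OF d', of j v] by (simp add: uR_def)
  show "fd (uH c) x v $ i = fd (\<lambda>x. a.H i c x - b.H i c x) x v"
    using fd_nth[OF d(2), of i v] by (simp add: uH_def)
qed

text \<open>By \<open>R_curl\<close> and \<open>R_div\<close> the exterior derivative and the
  divergence, each solution being differentiated in its own frame, are algebraic in unknowns that
  are close; \<open>cl_combination\<close> passes to the first frame for the difference.\<close>

lemma P_uR: "\<exists>C\<ge>0. \<forall>x\<in>c1.\<Omega>. (norm (c2.P (uR c d) x))\<^sup>2 \<le> C * Z x"
proof -
  define D where "D x k = fd (uR c d) x (a.e k x)" for x k
  have m: "x \<in> c1.\<Omega> \<Longrightarrow> 0 \<le> m x" for x by (simp add: Z_nonneg)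
  have "\<exists>C\<ge>0. \<forall>x\<in>c1.\<Omega>. \<bar>D x k $ i $ j + D x i $ j $ k + D x j $ k $ i\<bar> \<le> C * m x" for k i j
  proof -
    \<comment> \<open>The three terms of the cyclic sum are listed over \<open>{0, 1, 2}\<close> to
      fit the form of \<open>cl_combination\<close>.\<close>
    have "\<exists>C\<ge>0. \<forall>x\<in>c1.\<Omega>. \<bar>\<Sum>n\<in>{0, 1, 2::nat}. 1 * fd (\<lambda>x. ([a.R i j c d, a.R j k c d, a.R k i c d] ! n) x - ([b.R i j c d, b.R j k c d, b.R k i c d] ! n) x) x (a.e ([k, i, j] ! n) x)\<bar> \<le> C * m x"
    proof (rule cl_combination)
      show "(\<Sum>n\<in>{0, 1, 2::nat}. 1 * fd ([a.R i j c d, a.R j k c d, a.R k i c d] ! n) x (a.e ([k, i, j] ! n) x)) = a.WR k i j c d x + a.WR i j k c d x + a.WR j k i c d x"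
        if "x \<in> ball 0 \<rho>" for x using a.R_curl[OF that, of i j c d k] by simp
      show "(\<Sum>n\<in>{0, 1, 2::nat}. 1 * fd ([b.R i j c d, b.R j k c d, b.R k i c d] ! n) x (b.e ([k, i, j] ! n) x)) = b.WR k i j c d x + b.WR i j k c d x + b.WR j k i c d x"
        if "x \<in> ball 0 \<rho>" for x using b.R_curl[OF that, of i j c d k] by simp
      show "cl (\<lambda>x. a.WR k i j c d x + a.WR i j k c d x + a.WR j k i c d x) (\<lambda>x. b.WR k i j c d x + b.WR i j k c d x + b.WR j k i c d x)"
        by (intro close_add cl_WR)
    qed (auto intro: a.R_C2 b.R_C2)
    then show ?thesis by (simp add: D_def fd_uR add.assoc)
  qed
  \<comment> \<open>Triples serve as the single finite index type of
    \<open>uniform_bound\<close>.\<close>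
  moreover define q where "q t x = (case t of (k, i, j) \<Rightarrow> D x k $ i $ j + D x i $ j $ k + D x j $ k $ i)" for t x
  ultimately have "\<exists>C\<ge>0. \<forall>x\<in>c1.\<Omega>. \<bar>q t x\<bar> \<le> C * m x" for t by (cases t) simp
  then obtain C1 where C1: "C1 \<ge> 0" "\<And>t x. x \<in> c1.\<Omega> \<Longrightarrow> \<bar>q t x\<bar> \<le> C1 * m x"
    using m by (rule uniform_bound[of c1.\<Omega> q m]) (assumption | rule that)+
  have "\<exists>C\<ge>0. \<forall>x\<in>c1.\<Omega>. \<bar>\<Sum>i\<in>UNIV. D x i $ i $ j\<bar> \<le> C * m x" for j
  proof -
    have "\<exists>C\<ge>0. \<forall>x\<in>c1.\<Omega>. \<bar>\<Sum>i\<in>UNIV. 1 * fd (\<lambda>x. a.R i j c d x - b.R i j c d x) x (a.e i x)\<bar> \<le> C * m x"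
    proof (rule cl_combination)
      show "(\<Sum>i\<in>UNIV. 1 * fd (a.R i j c d) x (a.e i x)) = (\<Sum>i\<in>UNIV. a.WR i i j c d x)
    - (a.H c d x * a.\<alpha> j x + a.\<alpha> d x * a.H c j x + (if d = j then 1 else 0) * (deriv V (a.\<phi> x) * a.\<alpha> c x))
    + (a.H d c x * a.\<alpha> j x + a.\<alpha> c x * a.H d j x + (if c = j then 1 else 0) * (deriv V (a.\<phi> x) * a.\<alpha> d x))" if "x \<in> ball 0 \<rho>" for x
        using a.R_div[OF that, of j c d] by simp
      show "(\<Sum>i\<in>UNIV. 1 * fd (b.R i j c d) x (b.e i x)) = (\<Sum>i\<in>UNIV. b.WR i i j c d x)
    - (b.H c d x * b.\<alpha> j x + b.\<alpha> d x * b.H c j x + (if d = j then 1 else 0) * (deriv V (b.\<phi> x) * b.\<alpha> c x))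
    + (b.H d c x * b.\<alpha> j x + b.\<alpha> c x * b.H d j x + (if c = j then 1 else 0) * (deriv V (b.\<phi> x) * b.\<alpha> d x))" if "x \<in> ball 0 \<rho>" for x
        using b.R_div[OF that, of j c d] by simp
    qed ((rule a.R_C2 b.R_C2 finite)+, intro close_add close_diff close_sum close_mult close_const cl_WR cl_base cl_V, simp_all add: Z_nonneg)
    then show ?thesis by (simp add: D_def fd_uR)
  qed
  then obtain C2 where C2: "C2 \<ge> 0" "\<And>j x. x \<in> c1.\<Omega> \<Longrightarrow> \<bar>\<Sum>i\<in>UNIV. D x i $ i $ j\<bar> \<le> C2 * m x"
    using m by (rule uniform_bound[of c1.\<Omega> "\<lambda>j x. \<Sum>i\<in>UNIV. D x i $ i $ j" m]) (assumption | rule that)+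
  define n where "n = real CARD('n) * (real CARD('n) * real CARD('n)) + 2 * real CARD('n)"
  have "(norm (c2.P (uR c d) x))^2 \<le> n * (C1 + C2)^2 * Z x" if x: "x \<in> c1.\<Omega>" for x
  proof -
    have "(norm (\<Sum>i\<in>UNIV. dirac2 i (D x i)))^2 \<le> n * ((C1 + C2) * m x)^2"
      unfolding n_def
    proof (rule norm_dirac2_sum)
      have "0 \<le> C1 * m x" "0 \<le> C2 * m x" using C1(1) C2(1) m[OF x] by auto
      then show "0 \<le> (C1 + C2) * m x" "\<bar>D x k $ i $ j + D x i $ j $ k + D x j $ k $ i\<bar> \<le> (C1 + C2) * m x"
          "\<bar>\<Sum>i\<in>UNIV. D x i $ i $ j\<bar> \<le> (C1 + C2) * m x" for k i j
        using C1(2)[OF x, of "(k, i, j)"] C2(2)[OF x, of j] by (auto simp: distrib_right q_def)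
    qed
    then show ?thesis by (simp add: c2.P_def D_def power_mult_distrib Z_nonneg mult.assoc)
  qed
  then show ?thesis by (intro exI[of _ "n * (C1 + C2)^2"]) (auto simp: n_def)
qed

lemma P_uH: "\<exists>C\<ge>0. \<forall>x\<in>c1.\<Omega>. (norm (c1.P (uH c) x))\<^sup>2 \<le> C * Z x"
proof -
  define D where "D x k = fd (uH c) x (a.e k x)" for x k
  have m: "x \<in> c1.\<Omega> \<Longrightarrow> 0 \<le> m x" for x by (simp add: Z_nonneg)
  have "\<exists>C\<ge>0. \<forall>x\<in>c1.\<Omega>. \<bar>D x i $ j - D x j $ i\<bar> \<le> C * m x" for i j
  proof -
    have "\<exists>C\<ge>0. \<forall>x\<in>c1.\<Omega>. \<bar>\<Sum>n\<in>{0, 1::nat}. ([1, -1] ! n) * fd (\<lambda>x. ([a.H j c, a.H i c] ! n) x - ([b.H j c, b.H i c] ! n) x) x (a.e ([i, j] ! n) x)\<bar> \<le> C * m x"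
    proof (rule cl_combination)
      show "(\<Sum>n\<in>{0, 1::nat}. ([1, -1] ! n) * fd ([a.H j c, a.H i c] ! n) x (a.e ([i, j] ! n) x)) = a.WH i j c x - a.WH j i c x - (\<Sum>d\<in>UNIV. a.R i j c d x * a.\<alpha> d x)"
        if "x \<in> ball 0 \<rho>" for x using a.H_curl[OF that, of j c i] by simp
      show "(\<Sum>n\<in>{0, 1::nat}. ([1, -1] ! n) * fd ([b.H j c, b.H i c] ! n) x (b.e ([i, j] ! n) x)) = b.WH i j c x - b.WH j i c x - (\<Sum>d\<in>UNIV. b.R i j c d x * b.\<alpha> d x)"
        if "x \<in> ball 0 \<rho>" for x using b.H_curl[OF that, of j c i] by simp
      show "cl (\<lambda>x. a.WH i j c x - a.WH j i c x - (\<Sum>d\<in>UNIV. a.R i j c d x * a.\<alpha> d x)) (\<lambda>x. b.WH i j c x - b.WH j i c x - (\<Sum>d\<in>UNIV. b.R i j c d x * b.\<alpha> d x))"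
        by (intro close_diff close_sum close_mult cl_WH cl_base) (simp_all add: Z_nonneg)
    qed (auto intro: a.H_C2 b.H_C2)
    then show ?thesis by (simp add: D_def fd_uH)
  qed
  moreover define q where "q t x = (case t of (i, j) \<Rightarrow> D x i $ j - D x j $ i)" for t x
  ultimately have "\<exists>C\<ge>0. \<forall>x\<in>c1.\<Omega>. \<bar>q t x\<bar> \<le> C * m x" for t by (cases t) simp
  then obtain C1 where C1: "C1 \<ge> 0" "\<And>t x. x \<in> c1.\<Omega> \<Longrightarrow> \<bar>q t x\<bar> \<le> C1 * m x"
    using m by (rule uniform_bound[of c1.\<Omega> q m]) (assumption | rule that)+
  have "\<exists>C\<ge>0. \<forall>x\<in>c1.\<Omega>. \<bar>\<Sum>i\<in>UNIV. 1 * fd (\<lambda>x. a.H i c x - b.H i c x) x (a.e i x)\<bar> \<le> C * m x"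
  proof (rule cl_combination)
    show "(\<Sum>i\<in>UNIV. 1 * fd (a.H i c) x (a.e i x)) = (\<Sum>i\<in>UNIV. a.WH i i c x) + deriv (deriv V) (a.\<phi> x) * a.\<alpha> c x
        - (\<Sum>i\<in>UNIV. \<Sum>d\<in>UNIV. a.R i c i d x * a.\<alpha> d x)" if "x \<in> ball 0 \<rho>" for x
      using a.H_div[OF that, of c] by simp
    show "(\<Sum>i\<in>UNIV. 1 * fd (b.H i c) x (b.e i x)) = (\<Sum>i\<in>UNIV. b.WH i i c x) + deriv (deriv V) (b.\<phi> x) * b.\<alpha> c x
        - (\<Sum>i\<in>UNIV. \<Sum>d\<in>UNIV. b.R i c i d x * b.\<alpha> d x)" if "x \<in> ball 0 \<rho>" for x
      using b.H_div[OF that, of c] by simp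
  qed ((rule a.H_C2 b.H_C2 finite)+, intro close_add close_diff close_sum close_mult cl_WH cl_base cl_V, simp_all add: Z_nonneg)
  then obtain C2 where C2: "C2 \<ge> 0" "\<And>x. x \<in> c1.\<Omega> \<Longrightarrow> \<bar>\<Sum>i\<in>UNIV. D x i $ i\<bar> \<le> C2 * m x" by (auto simp: D_def fd_uH)
  define n where "n = real CARD('n) * real CARD('n) + 1"
  have "(norm (c1.P (uH c) x))^2 \<le> n * (C1 + C2)^2 * Z x" if x: "x \<in> c1.\<Omega>" for x
  proof -
    have "(norm (\<Sum>i\<in>UNIV. dirac1 i (D x i)))^2 \<le> n * ((C1 + C2) * m x)^2"
      unfolding n_def
    proof (rule norm_dirac1_sum)
      have "0 \<le> C1 * m x" "0 \<le> C2 * m x" using C1(1) C2(1) m[OF x] by auto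
      then show "0 \<le> (C1 + C2) * m x" "\<bar>D x i $ j - D x j $ i\<bar> \<le> (C1 + C2) * m x" "\<bar>\<Sum>i\<in>UNIV. D x i $ i\<bar> \<le> (C1 + C2) * m x" for i j
        using C1(2)[OF x, of "(i, j)"] C2(2)[OF x] by (auto simp: distrib_right q_def)
    qed
    then show ?thesis by (simp add: c1.P_def D_def power_mult_distrib Z_nonneg mult.assoc)
  qed
  then show ?thesis by (intro exI[of _ "n * (C1 + C2)^2"]) (auto simp: n_def)
qed

lemma Z_continuous: "continuous_on c1.\<Omega> Z"
proof -
  have sub: "continuous_on (ball 0 \<rho>) f \<Longrightarrow> continuous_on c1.\<Omega> f" for f :: "real^'n \<Rightarrow> 'z::topological_space"
    using \<Omega>_sub(1) continuous_on_subset by blast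
  show ?thesis unfolding Z_def
    by (intro continuous_intros sub C_on_continuous[OF uR_C2] C_on_continuous[OF uH_C2] C_on_continuous[OF a.\<alpha>_C2] C_on_continuous[OF b.\<alpha>_C2]
      C_on_continuous[OF a.\<phi>_C2] C_on_continuous[OF b.\<phi>_C2] C_on_continuous[OF a.th_C1] C_on_continuous[OF b.th_C1] C_on_continuous[OF a.om_C1] C_on_continuous[OF b.om_C1])
qed

lemma flat_sum:
  fixes f :: "'i::finite \<Rightarrow> real^'n \<Rightarrow> real"
  assumes "\<And>i. \<exists>C. \<forall>x\<in>c1.\<Omega>. f i x \<le> C * norm x ^ M" shows "\<exists>C. \<forall>x\<in>c1.\<Omega>. (\<Sum>i\<in>UNIV. f i x) \<le> C * norm x ^ M"
proof -
  obtain C where "\<And>i x. x \<in> c1.\<Omega> \<Longrightarrow> f i x \<le> C i * norm x ^ M" using assms by metis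
  then show ?thesis by (intro exI[of _ "\<Sum>i\<in>UNIV. C i"]) (auto simp: sum_distrib_right intro: sum_mono)
qed

text \<open>Each square in \<open>Z\<close> is absorbed: those of curvature and Hessian through the
  Dirac operators, the others through their radial equations. No derivative outside the list of
  unknowns appears, which closes the system.\<close>

lemma Z_absorbed: "c1.absorbed Z Z"
proof -
  have on: "C_on k (ball 0 \<rho>) f \<Longrightarrow> C_on k c1.\<Omega> f" for k and f :: "real^'n \<Rightarrow> 'z::real_normed_vector"
    using \<Omega>_sub(1) C_on_subset by blast
  have in\<rho>: "x \<in> c1.\<Omega> \<Longrightarrow> x \<in> ball 0 \<rho>" for x using \<Omega>_sub by blast
  have R: "c1.absorbed Z (\<lambda>x. (norm (uR c d x))^2)" for c d
  proof (rule c2.absorbed_elliptic[OF on[OF uR_C2] _ Z_continuous Z_ge(1) _ P_uR])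
    show "uR c d y \<in> skew" if "y \<in> c1.\<Omega>" for y
      unfolding skew_def uR_def mem_Collect_eq vec_lambda_beta
      by (intro allI, subst a.R_sym(1)[OF in\<rho>[OF that]], subst b.R_sym(1)[OF in\<rho>[OF that]]) simp
    have e: "(norm (uR c d x))^2 = (\<Sum>i\<in>UNIV. \<Sum>j\<in>UNIV. (a.R i j c d x - b.R i j c d x)^2)" for x
      unfolding power2_norm_eq_inner inner_vec_def by (simp add: uR_def power2_eq_square)
    show "\<exists>C. \<forall>x\<in>c1.\<Omega>. (norm (uR c d x))\<^sup>2 \<le> C * norm x ^ M" for M
      unfolding e by (intro flat_sum c1.flat_square flat_R r0 r)
  qed
  have H: "c1.absorbed Z (\<lambda>x. (norm (uH c x))^2)" for c
  proof (rule c1.absorbed_elliptic[OF on[OF uH_C2] UNIV_I Z_continuous Z_ge(2) _ P_uH])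
    have e: "(norm (uH c x))^2 = (\<Sum>i\<in>UNIV. (a.H i c x - b.H i c x)^2)" for x
      unfolding power2_norm_eq_inner inner_vec_def by (simp add: uH_def power2_eq_square)
    show "\<exists>C. \<forall>x\<in>c1.\<Omega>. (norm (uH c x))\<^sup>2 \<le> C * norm x ^ M" for M
      unfolding e by (intro flat_sum c1.flat_square flat_H r0 r)
  qed
  have C1: "C_on 1 (ball 0 \<rho>) (a.\<alpha> i)" "C_on 1 (ball 0 \<rho>) (b.\<alpha> i)" "C_on 1 (ball 0 \<rho>) a.\<phi>" "C_on 1 (ball 0 \<rho>) b.\<phi>" for i
    by (rule C_on_mono[OF a.\<alpha>_C2] C_on_mono[OF b.\<alpha>_C2] C_on_mono[OF a.\<phi>_C2] C_on_mono[OF b.\<phi>_C2], simp)+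
  have \<alpha>: "c1.absorbed Z (\<lambda>x. (a.\<alpha> i x - b.\<alpha> i x)^2)" for i
    by (rule c1.absorbed_transport[where d=0 and c=0 and g="\<lambda>j. a.H j i" and g'="\<lambda>j. b.H j i", OF on[OF C1(1)] on[OF C1(2)] _ Z_continuous Z_ge(3) flat_\<alpha>[OF r0 r] cl_base(2)])
      (use in\<rho> a.\<alpha>_radial b.\<alpha>_radial in auto)
  have \<phi>: "c1.absorbed Z (\<lambda>x. (a.\<phi> x - b.\<phi> x)^2)"
    by (rule c1.absorbed_transport[where d=0 and c=0 and g="a.\<alpha>" and g'="b.\<alpha>", OF on[OF C1(3)] on[OF C1(4)] _ Z_continuous Z_ge(4) flat_\<phi>[OF r0 r] cl_base(3)])
      (use in\<rho> a.\<phi>_radial b.\<phi>_radial in auto)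
  have th: "c1.absorbed Z (\<lambda>x. (a.th i j x - b.th i j x)^2)" for i j
    by (rule c1.absorbed_transport[OF on[OF a.th_C1] on[OF b.th_C1] zero_le_one Z_continuous Z_ge(5) conjunct1[OF flat_th_om[OF r0 r]] cl_base(6) a.th_radial[OF in\<rho>] b.th_radial[OF in\<rho>]])
  have om: "c1.absorbed Z (\<lambda>x. (a.om i j k x - b.om i j k x)^2)" for i j k
    by (rule c1.absorbed_transport[OF on[OF a.om_C1] on[OF b.om_C1] zero_le_one Z_continuous Z_ge(6) conjunct2[OF flat_th_om[OF r0 r]] _ a.om_radial[OF in\<rho>] b.om_radial[OF in\<rho>]])
      (intro close_sum close_mult cl_base; simp add: Z_nonneg)
  show ?thesis
    by (subst (2) Z_def[abs_def]) (intro c1.absorbed_add c1.absorbed_sum R H \<alpha> \<phi> th om finite)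
qed

lemma frames_agree:
  assumes x: "x \<in> ball 0 (r / 4)"
  shows "a.\<theta> x v = b.\<theta> x v \<and> a.\<omega> x v = b.\<omega> x v \<and> h (F x) = h' (F' x)"
proof -
  have x': "x \<in> ball 0 r" "x \<in> ball 0 \<rho>" using x r r0 by auto
  have "a.th i j x = b.th i j x \<and> a.om k p q x = b.om k p q x \<and> a.\<phi> x = b.\<phi> x" for i j k p q
  \<comment> \<open>The punctured ball omits the origin, where flatness of order one gives
    equality.\<close>
  proof (cases "x = 0")
    case True
    have z: "f 0 = f' 0" if "close (ball 0 r) (\<lambda>x. norm x ^ 1) f f'" for f f' :: "real^'n \<Rightarrow> real"
      using closeD[OF that] r0 by (force dest!: bspec[where x=0])
    show ?thesis unfolding True
      by (intro conjI z conjunct1[OF flat_th_om] conjunct2[OF flat_th_om] flat_\<phi> r0 r)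
  next
    case False
    then have "x \<in> c1.\<Omega>" using x' by (simp add: c1.\<Omega>_def)
    then have "Z x = 0" by (rule c1.absorbed_self[OF Z_absorbed Z_nonneg]) (use x in simp)
    then show ?thesis using Z_ge(4)[of x] Z_ge(5)[of i j x] Z_ge(6)[of k p q x] by (simp add: power2_less_eq_zero_iff)
  qed
  then show ?thesis using x' by (simp add: vec_eq_iff a.\<theta>_th b.\<theta>_th a.\<omega>_om b.\<omega>_om a.\<phi>_eq[symmetric] b.\<phi>_eq[symmetric])
qed

end

lemma agree:
  obtains r where "0 < r" "r < \<rho>" "\<And>x v. x \<in> ball 0 r \<Longrightarrow> a.\<theta> x v = b.\<theta> x v"
    "\<And>x v. x \<in> ball 0 r \<Longrightarrow> a.\<omega> x v = b.\<omega> x v" "\<And>x. x \<in> ball 0 r \<Longrightarrow> h (F x) = h' (F' x)"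
proof -
  obtain r K0 where r: "0 < r" "r < \<rho>" "radial_weight a.e r K0" by (rule a.radial_weight_exists)
  show ?thesis
    by (rule that[of "r / 4"]) (use frames_agree[OF r(3,2)] r in auto)
qed

end

section \<open>The local isometry\<close>

context normal_frame begin

lemma locally_injective:
  obtains r where "0 < r" "r \<le> \<rho>" "inj_on F (ball 0 r)"
proof -
  have z: "0 \<in> ball (0::real^'n) \<rho>" using \<rho> by simp
  have L: "linear (fd F 0)" by (rule F_linear[OF z])
  have "inj (fd F 0)" using F_nondegenerate[OF z] linear_injective_0[OF L] by blast
  then obtain g where g: "linear g" "g \<circ> fd F 0 = id" using linear_injective_left_inverse[OF L] by blast
  obtain r where r: "r > 0" "ball (0::real^'n) r \<subseteq> ball 0 \<rho>" "inj_on F (ball 0 r)"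
  proof (rule has_derivative_locally_injective[OF z open_ball _ g(2) F_deriv])
    show "bounded_linear g" using g(1) by (simp add: linear_conv_bounded_linear)
    fix \<epsilon> :: real assume \<epsilon>: "\<epsilon> > 0"
    define s where "s x = (\<Sum>b\<in>Basis. norm (fd F x b - fd F 0 b))" for x
    have "continuous_on (ball 0 \<rho>) s"
      unfolding s_def by (intro continuous_intros C_on_continuous[OF fdF_C1])
    then obtain d where d: "d > 0" "\<And>x. x \<in> ball 0 \<rho> \<Longrightarrow> dist x 0 < d \<Longrightarrow> dist (s x) (s 0) < \<epsilon>"
      unfolding continuous_on_iff using z \<epsilon> by metis
    have "onorm (\<lambda>v. fd F x v - fd F 0 v) < \<epsilon>" if x: "dist 0 x < min d \<rho>" for x
    proof -
      have x': "x \<in> ball 0 \<rho>" using x by simp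
      have "onorm (\<lambda>v. fd F x v - fd F 0 v) \<le> s x"
        unfolding s_def by (rule onorm_componentwise) (intro bounded_linear_sub has_derivative_bounded_linear[OF F_deriv] x' z)
      also have "s x < \<epsilon>" using d(2)[OF x'] x by (auto simp: s_def dist_commute)
      finally show ?thesis .
    qed
    then show "\<exists>d>0. \<forall>x. dist 0 x < d \<longrightarrow> onorm (\<lambda>v. fd F x v - fd F 0 v) < \<epsilon>"
      using d(1) \<rho> by (intro exI[of _ "min d \<rho>"]) auto
  qed (assumption | rule that)+
  show ?thesis by (rule that[of "min r \<rho>"]) (use r \<rho> in \<open>auto intro: inj_on_subset\<close>)
qed

end

section \<open>The transition between the two normal coordinate systems\<close>

locale normal_chart = normal_frame G S F E \<rho>
  for G :: "real^'n \<Rightarrow> real^'n^'n::finite" and S F E \<rho> +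
  assumes F_inj: "inj_on F (ball 0 \<rho>)"
begin

definition W :: "(real^'n) set" where "W = F ` ball 0 \<rho>"
definition K :: "real^'n \<Rightarrow> real^'n" where "K = inv_into (ball 0 \<rho>) F"

lemma W_open: "open W"
  unfolding W_def by (intro invariance_of_domain C_on_continuous[OF F_C2] open_ball F_inj)

lemma W_S: "y \<in> W \<Longrightarrow> y \<in> S" using F_in by (auto simp: W_def)

lemma KF: "x \<in> ball 0 \<rho> \<Longrightarrow> K (F x) = x" unfolding K_def by (rule inv_into_f_f[OF F_inj])

lemma K_in: "y \<in> W \<Longrightarrow> K y \<in> ball 0 \<rho>" and FK: "y \<in> W \<Longrightarrow> F (K y) = y"
  unfolding W_def K_def by (auto intro: inv_into_into f_inv_into_f simp del: mem_ball mem_ball_0)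

text \<open>The inverse of \<open>fd F (K y)\<close>, written through the orthonormal frame, so that
  its continuity in \<open>y\<close> is visible.\<close>

definition DK :: "real^'n \<Rightarrow> real^'n \<Rightarrow> real^'n" where
  "DK y u = (\<Sum>a\<in>UNIV. gdot G y u (E (K y) $ a) *\<^sub>R e a (K y))"

lemma F_DK: assumes y: "y \<in> W" shows "fd F (K y) (DK y u) = u"
  unfolding DK_def by (simp add: linear_sum[OF F_linear[OF K_in[OF y]]] linear_cmul[OF F_linear[OF K_in[OF y]]] F_e[OF K_in[OF y]])
    (use expand[OF K_in[OF y], of u] in \<open>simp add: FK[OF y]\<close>)

lemma K_deriv: assumes y: "y \<in> W" shows "(K has_derivative DK y) (at y)"
proof -
  have "(K has_derivative DK (F (K y))) (at (F (K y)))"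
    by (rule has_derivative_inverse_on[OF open_ball F_deriv KF _ K_in[OF y], where g'="\<lambda>x. DK (F x)"])
      (auto simp: fun_eq_iff FK[OF y] F_DK[OF y] simp del: mem_ball mem_ball_0)
  then show ?thesis by (simp add: FK[OF y])
qed

lemma K_C1: "C_on 1 W K"
proof -
  have K: "continuous_on W K" by (rule has_derivative_continuous_on[OF has_derivative_at_withinI[OF K_deriv]])
  have "continuous_on W (\<lambda>y. DK y v)" for v
    unfolding DK_def
    by (intro continuous_intros continuous_on_compose2[OF C_on_continuous[OF E_C2] K] continuous_on_compose2[OF C_on_continuous[OF e_C1] K]
        C_on_continuous[of 0] C_on_gdot_along C_on_const) (auto simp: K_in W_open W_S intro!: continuous_intros continuous_on_compose2[OF C_on_continuous[OF E_C2] K] simp del: mem_ball mem_ball_0)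
  then show ?thesis using C_on_SucI[OF K_deriv _ W_open, of 0] by simp
qed

end

locale frame_match = a: normal_chart G S F E \<rho> + b: normal_chart G' S' F' E' \<rho>
  for G :: "real^'n \<Rightarrow> real^'n^'n::finite" and S F E \<rho> and G' :: "real^'n \<Rightarrow> real^'n^'n" and S' F' E' +
  assumes \<theta>_eq: "x \<in> ball 0 \<rho> \<Longrightarrow> a.\<theta> x v = b.\<theta> x v" and \<omega>_eq: "x \<in> ball 0 \<rho> \<Longrightarrow> a.\<omega> x v = b.\<omega> x v"
begin

definition f :: "real^'n \<Rightarrow> real^'n" where "f y = F' (a.K y)"
text \<open>The linear map that takes the first frame to the second at equal normal coordinates;
  \<open>f_deriv\<close> identifies it as the derivative of \<open>f\<close>.\<close>

definition J :: "real^'n \<Rightarrow> real^'n \<Rightarrow> real^'n" where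
  "J y u = (\<Sum>c\<in>UNIV. gdot G y u (E (a.K y) $ c) *\<^sub>R E' (a.K y) $ c)"

lemma f_in: "y \<in> a.W \<Longrightarrow> f y \<in> b.W" by (auto simp: f_def b.W_def intro: a.K_in simp del: mem_ball mem_ball_0)

text \<open>As the coframes agree, \<open>fd F'\<close> takes the frame \<open>a.e\<close> to
  \<open>E'\<close>, just as \<open>fd F\<close> takes it to \<open>E\<close>.\<close>

lemma f_deriv: assumes y: "y \<in> a.W" shows "(f has_derivative J y) (at y)"
proof -
  note x = a.K_in[OF y]
  have F'e: "fd F' (a.K y) (a.e c (a.K y)) = E' (a.K y) $ c" for c
    unfolding b.F_\<theta>[OF x] \<theta>_eq[OF x, symmetric] a.\<theta>_e[OF x]
    by (simp add: axis_def if_distrib[of "\<lambda>c. c *\<^sub>R _"] cong: if_cong)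
  have "fd F' (a.K y) (a.DK y u) = J y u" for u
    unfolding a.DK_def J_def by (simp add: linear_sum[OF b.F_linear[OF x]] linear_cmul[OF b.F_linear[OF x]] F'e)
  then show ?thesis using diff_chain_at[OF a.K_deriv[OF y] b.F_deriv[OF x]] by (simp add: o_def f_def[abs_def])
qed

lemma J_linear: "linear (J y)"
  unfolding J_def by (rule linearI) (simp_all add: a.gdot_simps a.gdot_sum scaleR_add_left sum.distrib scaleR_sum_right)

lemma J_isometry: assumes y: "y \<in> a.W" shows "gdot G' (f y) (J y u) (J y v) = gdot G y u v"
proof -
  note x = a.K_in[OF y]
  have 1: "gdot G' (f y) (J y u) (E' (a.K y) $ c) = gdot G y u (E (a.K y) $ c)" for c
    unfolding f_def J_def by (rule b.gdot_E[OF x])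
  have "gdot G' (f y) (J y u) (J y v) = (\<Sum>c\<in>UNIV. gdot G y v (E (a.K y) $ c) * gdot G y u (E (a.K y) $ c))"
    unfolding J_def[of y v] by (simp add: b.gdot_sum 1)
  also have "\<dots> = gdot G y u (\<Sum>c\<in>UNIV. gdot G y v (E (a.K y) $ c) *\<^sub>R E (a.K y) $ c)" by (simp add: a.gdot_sum)
  finally show ?thesis using a.expand[OF x, of v] by (simp add: a.FK[OF y])
qed

lemma f_C1: "C_on 1 a.W f" and J_C1: "C_on 1 a.W (\<lambda>y. J y u)"
proof -
  have id: "C_on 1 a.W (\<lambda>y. y)" by (rule C_on_linear) (rule bounded_linear_ident)
  have c: "C_on 1 a.W (\<lambda>y. E (a.K y))" "C_on 1 a.W (\<lambda>y. E' (a.K y))"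
    by (rule C_on_compose[OF a.K_C1 a.E_C1 a.W_open open_ball a.K_in] C_on_compose[OF a.K_C1 b.E_C1 a.W_open open_ball a.K_in], assumption)+
  show "C_on 1 a.W f" unfolding f_def by (rule C_on_compose[OF a.K_C1 b.F_C1 a.W_open open_ball a.K_in])
  show "C_on 1 a.W (\<lambda>y. J y u)" unfolding J_def
    by (intro C_on_sum C_on_scaleR a.C_on_gdot_along id C_on_const C_on_nth c a.W_open a.W_S)
qed

text \<open>An isometry satisfies a second order equation that expresses its second derivatives through the
  first ones, and hence is as smooth as the Christoffel symbols allow.\<close>

lemma J_deriv:
  assumes y: "y \<in> a.W"
  shows "((\<lambda>y. J y u) has_derivative (\<lambda>w. J y (Gam G y w u) - Gam G' (f y) (J y w) (J y u))) (at y)"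
proof -
  define x where "x = a.K y"
  have x: "x \<in> ball 0 \<rho>" unfolding x_def by (rule a.K_in[OF y])
  have Fx: "F x = y" unfolding x_def by (rule a.FK[OF y])
  have dE: "((\<lambda>y. E (a.K y) $ c) has_derivative (\<lambda>w. fd E x (a.DK y w) $ c)) (at y)" for c
    using diff_chain_at[OF a.K_deriv[OF y] a.Eb_deriv[OF x[unfolded x_def]]] by (simp add: o_def x_def)
  have dE': "((\<lambda>y. E' (a.K y) $ c) has_derivative (\<lambda>w. fd E' x (a.DK y w) $ c)) (at y)" for c
    using diff_chain_at[OF a.K_deriv[OF y] b.Eb_deriv[OF x[unfolded x_def]]] by (simp add: o_def x_def)
  have "((\<lambda>y. J y u) has_derivative (\<lambda>w. \<Sum>c\<in>UNIV. gdot G y u (E x $ c) *\<^sub>R fd E' x (a.DK y w) $ c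
     + (gdot G y (0 + Gam G y w u) (E x $ c) + gdot G y u (fd E x (a.DK y w) $ c + Gam G y w (E x $ c))) *\<^sub>R E' x $ c)) (at y)"
    unfolding J_def x_def
    by (intro has_derivative_sum has_derivative_scaleR dE'[unfolded x_def] a.gdot_along[OF a.W_S[OF y] has_derivative_ident has_derivative_const dE[unfolded x_def]])
  moreover have "(\<Sum>c\<in>UNIV. gdot G y u (E x $ c) *\<^sub>R fd E' x (a.DK y w) $ c
     + (gdot G y (0 + Gam G y w u) (E x $ c) + gdot G y u (fd E x (a.DK y w) $ c + Gam G y w (E x $ c))) *\<^sub>R E' x $ c)
    = J y (Gam G y w u) - Gam G' (f y) (J y w) (J y u)" for w
  proof -
    define v where "v = a.DK y w"
    have 1: "fd E x v $ c + Gam G y w (E x $ c) = (\<Sum>d\<in>UNIV. a.\<omega> x v $ d $ c *\<^sub>R E x $ d)" for c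
      using a.CD_\<omega>[OF x, of v c] a.F_DK[OF y, of w] by (simp add: a.CD_def Fx v_def x_def[symmetric])
    have Jw: "fd F' x v = J y w"
      using has_derivative_unique[OF f_deriv[OF y] diff_chain_at[OF a.K_deriv[OF y] b.F_deriv[OF x[unfolded x_def]], unfolded o_def, folded f_def]]
      by (simp add: v_def x_def fun_eq_iff)
    have 2: "fd E' x v $ c = (\<Sum>d\<in>UNIV. a.\<omega> x v $ d $ c *\<^sub>R E' x $ d) - Gam G' (f y) (J y w) (E' x $ c)" for c
      using b.CD_\<omega>[OF x, of v c] by (simp add: b.CD_def Jw \<omega>_eq[OF x] f_def x_def[symmetric] eq_diff_eq)
    have 3: "(\<Sum>c\<in>UNIV. gdot G y u (E x $ c) *\<^sub>R Gam G' (f y) (J y w) (E' x $ c)) = Gam G' (f y) (J y w) (J y u)"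
      by (simp add: J_def x_def[symmetric] bounded_bilinear.sum_right[OF b.Gam_bilinear] bounded_bilinear.scaleR_right[OF b.Gam_bilinear])
    \<comment> \<open>The connection forms agree and are skew, so their contributions through
      \<open>E\<close> and through \<open>E'\<close> cancel; only the Christoffel terms
      remain.\<close>
    have "(\<Sum>c\<in>UNIV. gdot G y u (\<Sum>d\<in>UNIV. a.\<omega> x v $ d $ c *\<^sub>R E x $ d) *\<^sub>R E' x $ c)
       = (\<Sum>c\<in>UNIV. \<Sum>d\<in>UNIV. (gdot G y u (E x $ c) * a.\<omega> x v $ c $ d) *\<^sub>R E' x $ d)"
      by (simp add: a.gdot_sum scaleR_sum_left mult.commute) (rule sum.swap)
    also have "\<dots> = - (\<Sum>c\<in>UNIV. gdot G y u (E x $ c) *\<^sub>R (\<Sum>d\<in>UNIV. a.\<omega> x v $ d $ c *\<^sub>R E' x $ d))"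
      by (subst a.\<omega>_skew[OF x]) (simp add: scaleR_sum_right sum_negf)
    finally show ?thesis
      unfolding v_def[symmetric] 1 2 by (simp add: scaleR_diff_right scaleR_add_left sum.distrib sum_subtractf 3 J_def[of y "Gam G y w u"] x_def[symmetric] a.gdot_simps)
  qed
  ultimately show ?thesis by simp
qed

text \<open>A joint bootstrap: \<open>J\<close> is the derivative of \<open>f\<close>, and
  \<open>J_deriv\<close> expresses the derivative of \<open>J\<close> by \<open>f\<close>,
  \<open>J\<close> and smooth coefficients, so each round raises both classes by one.\<close>

lemma f_smooth: "smooth_on a.W f"
proof -
  have "C_on k a.W f \<and> (\<forall>u. C_on k a.W (\<lambda>y. J y u))" for k
  proof (induction k)
    case 0
    show ?case using C_on_mono[OF f_C1, of 0] C_on_mono[OF J_C1, of 0] by blast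
  next
    case (Suc k)
    have id: "C_on k a.W (\<lambda>y. y)" by (rule C_on_linear) (rule bounded_linear_ident)
    have J: "C_on k a.W (\<lambda>y. J y (z y))" if "C_on k a.W z" for z
    proof -
      have "J y (z y) = (\<Sum>i\<in>UNIV. z y $ i *\<^sub>R J y (axis i 1))" for y
        by (subst vec_axis_sum[of "z y", symmetric]) (simp only: linear_sum[OF J_linear] linear_cmul[OF J_linear])
      then show ?thesis using Suc that by (simp only:) (intro C_on_sum C_on_scaleR C_on_nth a.W_open; simp)
    qed
    show ?case
    proof (intro conjI allI)
      show "C_on (Suc k) a.W f" by (rule C_on_SucI[OF f_deriv]) (use Suc a.W_open in auto)
      show "C_on (Suc k) a.W (\<lambda>y. J y u)" for u
      proof (rule C_on_SucI[OF J_deriv])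
        show "C_on k a.W (\<lambda>y. J y (Gam G y w u) - Gam G' (f y) (J y w) (J y u))" for w
          by (intro C_on_diff J a.C_on_Gam_along b.C_on_Gam_along id C_on_const a.W_open a.W_S b.W_S f_in) (use Suc in auto)
      qed (auto simp: a.W_open)
    qed
  qed
  then show ?thesis by (simp add: smooth_on_def)
qed

end

lemma frame_match_sym: "frame_match G S F E \<rho> G' S' F' E' \<Longrightarrow> frame_match G' S' F' E' \<rho> G S F E"
  unfolding frame_match_def frame_match_axioms_def by simp

context frame_pair begin

theorem local_isometry:
  obtains r where "0 < r" "frame_match G S F E r G' S' F' E'" "\<And>x. x \<in> ball 0 r \<Longrightarrow> h (F x) = h' (F' x)"
proof -
  obtain r1 where r1: "0 < r1" "r1 < \<rho>" "\<And>x v. x \<in> ball 0 r1 \<Longrightarrow> a.\<theta> x v = b.\<theta> x v"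
    "\<And>x v. x \<in> ball 0 r1 \<Longrightarrow> a.\<omega> x v = b.\<omega> x v" "\<And>x. x \<in> ball 0 r1 \<Longrightarrow> h (F x) = h' (F' x)" using agree by metis
  obtain r2 where r2: "0 < r2" "r2 \<le> \<rho>" "inj_on F (ball 0 r2)" by (rule a.locally_injective)
  obtain r3 where r3: "0 < r3" "r3 \<le> \<rho>" "inj_on F' (ball 0 r3)" by (rule b.locally_injective)
  define r where "r = min r1 (min r2 r3)"
  have r: "0 < r" "r \<le> \<rho>" using r1 r2 r3 by (auto simp: r_def)
  have "normal_chart G S F E r"
    by (intro normal_chart.intro a.shrink r normal_chart_axioms.intro inj_on_subset[OF r2(3)]) (auto simp: r_def)
  moreover have "normal_chart G' S' F' E' r"
    by (intro normal_chart.intro b.shrink r normal_chart_axioms.intro inj_on_subset[OF r3(3)]) (auto simp: r_def)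
  ultimately have "frame_match G S F E r G' S' F' E'"
    by (intro frame_match.intro frame_match_axioms.intro r1(3,4)) (auto simp: r_def)
  then show ?thesis by (rule that[OF r(1)]) (rule r1(5), simp add: r_def)
qed

end

section \<open>From charts to manifolds\<close>

context metric_patch begin

text \<open>Gram-Schmidt over the index set; fewer than \<open>CARD('n)\<close> vectors do not span,
  which supplies the next one.\<close>

lemma orthonormal_frame_exists:
  assumes y: "y \<in> S"
  obtains E :: "real^'n^'n" where "\<And>i j. gdot G y (E $ i) (E $ j) = (if i = j then 1 else 0)"
proof -
  have "\<exists>E. \<forall>i\<in>I. \<forall>j\<in>I. gdot G y (E i) (E j) = (if i = j then 1 else 0)" if "finite I" for I :: "'n set"
    using that
  proof (induction I rule: finite_induct)
    case (insert k I)
    then obtain E where E: "\<And>i j. i \<in> I \<Longrightarrow> j \<in> I \<Longrightarrow> gdot G y (E i) (E j) = (if i = j then 1 else 0)" by blast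
    have "card (E ` I) < CARD('n)"
      using card_image_le[OF insert.hyps(1), of E] psubset_card_mono[of "UNIV :: 'n set" I] insert.hyps(2) by fastforce
    then have "span (E ` I) \<noteq> UNIV"
      using dim_le_card[of "E ` I" "E ` I"] insert.hyps(1) by (metis dim_UNIV dim_span DIM_cart DIM_real finite_imageI leD mult.right_neutral span_superset)
    then obtain v where v: "v \<notin> span (E ` I)" by blast
    define u where "u = v - (\<Sum>i\<in>I. gdot G y v (E i) *\<^sub>R E i)"
    have "(\<Sum>i\<in>I. gdot G y v (E i) *\<^sub>R E i) \<in> span (E ` I)" by (intro span_sum span_scale span_base) auto
    then have "u \<noteq> 0" using v by (auto simp: u_def)
    then have pos: "gdot G y u u > 0" by (rule G_pos[OF y])
    have uE: "gdot G y u (E j) = 0" if "j \<in> I" for j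
      using that insert.hyps(1)
      by (simp add: u_def gdot_simps gdot.sum_left gdot.scaleR_left E
          if_distrib[of "(*) _"] cong: if_cong)
    have Eu: "gdot G y (E j) u = 0" if "j \<in> I" for j using uE[OF that] gdot_sym[OF y] by simp
    let ?E = "E(k := (1 / sqrt (gdot G y u u)) *\<^sub>R u)"
    have "gdot G y (?E i) (?E j) = (if i = j then 1 else 0)" if "i \<in> insert k I" "j \<in> insert k I" for i j
      using that pos E insert.hyps(2)
      by (auto simp: gdot.scaleR_left gdot.scaleR_right uE Eu real_divide_square_eq)
    then show ?case by blast
  qed simp
  from this[OF finite, of UNIV] obtain E :: "'n \<Rightarrow> real^'n" where E: "\<forall>i\<in>UNIV. \<forall>j\<in>UNIV. gdot G y (E i) (E j) = (if i = j then 1 else 0)" by blast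
  show ?thesis by (rule that[of "\<chi> i. E i"]) (use E in simp)
qed

end

lemma smooth_on_compose:
  fixes f :: "'a::euclidean_space \<Rightarrow> 'b::euclidean_space" and g :: "'b \<Rightarrow> 'c::real_normed_vector"
  assumes "smooth_on S f" "smooth_on T g" "open S" "open T" "\<And>x. x \<in> S \<Longrightarrow> f x \<in> T"
  shows "smooth_on S (\<lambda>x. g (f x))"
  using assms C_on_compose unfolding smooth_on_def by blast

lemma smooth_on_subset: "smooth_on S f \<Longrightarrow> T \<subseteq> S \<Longrightarrow> smooth_on T f"
  using C_on_subset unfolding smooth_on_def by blast

lemma smooth_on_cong: "smooth_on S f \<Longrightarrow> open S \<Longrightarrow> (\<And>x. x \<in> S \<Longrightarrow> f x = g x) \<Longrightarrow> smooth_on S g"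
  unfolding smooth_on_def using C_on_cong[of _ S f g] by blast

context smooth_manifold begin

lemma chart_inv_in: "x \<in> chart_image c \<Longrightarrow> chart_inv c x \<in> fst c" and chart_chart_inv: "x \<in> chart_image c \<Longrightarrow> snd c (chart_inv c x) = x"
  unfolding chart_image_def chart_inv_def by (auto intro: inv_into_into f_inv_into_f)

lemma chart_inv_charts_at: "c \<in> A \<Longrightarrow> x \<in> chart_image c \<Longrightarrow> c \<in> charts_at A (chart_inv c x)"
  by (simp add: charts_at_def chart_inv_in)

lemma chart_at: "q \<in> topspace X \<Longrightarrow> chart_at A q \<in> charts_at A q"
  unfolding chart_at_def by (rule someI_ex) (use charts_cover in \<open>unfold charts_at_def, blast\<close>)

lemma chart_mem: "c \<in> charts_at A q \<Longrightarrow> c \<in> A" "c \<in> charts_at A q \<Longrightarrow> q \<in> fst c" "c \<in> charts_at A q \<Longrightarrow> snd c q \<in> chart_image c"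
  "c \<in> charts_at A q \<Longrightarrow> q \<in> topspace X"
  using charts_cover by (auto simp: charts_at_def chart_image_def)

lemma open_chart_image:
  assumes "c \<in> A" "openin X V" "V \<subseteq> fst c" shows "open (snd c ` V)"
proof -
  have "openin (subtopology X (fst c)) V" using assms(2,3) by (simp add: openin_subset_topspace_eq openin_subtopology_Int2 subset_openin_subtopology)
  then have "openin (top_of_set (chart_image c)) (snd c ` V)"
    using homeomorphic_imp_open_map[OF chart_homeo[OF assms(1)]] by (simp add: open_map_def)
  then show ?thesis using chart_image_open[OF assms(1)] openin_open_trans by blast
qed

lemma chart_inv_image: "c \<in> A \<Longrightarrow> Y \<subseteq> chart_image c \<Longrightarrow> chart_inv c ` Y = {q \<in> fst c. snd c q \<in> Y}"
proof (intro set_eqI iffI)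
  show "q \<in> {q \<in> fst c. snd c q \<in> Y}" if Y: "Y \<subseteq> chart_image c" "q \<in> chart_inv c ` Y" for q
  proof -
    obtain x where x: "x \<in> chart_image c" "x \<in> Y" "q = chart_inv c x" using Y by blast
    then show ?thesis using chart_inv_in[OF x(1)] chart_chart_inv[OF x(1)] by simp
  qed
  show "q \<in> chart_inv c ` Y" if "c \<in> A" "q \<in> {q \<in> fst c. snd c q \<in> Y}" for q
    using that chart_inv_chart[of c q] by (intro image_eqI[of _ _ "snd c q"]) auto
qed

lemma open_chart_inv:
  assumes "c \<in> A" "open Y" "Y \<subseteq> chart_image c" shows "openin X (chart_inv c ` Y)"
proof -
  have "openin (top_of_set (chart_image c)) Y" using assms(2,3) by (simp add: open_subset)
  then have "openin (subtopology X (fst c)) {q \<in> topspace (subtopology X (fst c)). snd c q \<in> Y}"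
    using homeomorphic_imp_continuous_map[OF chart_homeo[OF assms(1)]] by (rule openin_continuous_map_preimage[rotated])
  moreover have "{q \<in> topspace (subtopology X (fst c)). snd c q \<in> Y} = chart_inv c ` Y"
    unfolding chart_inv_image[OF assms(1,3)] using chart_dom_open[OF assms(1)] openin_subset by fastforce
  ultimately show ?thesis using openin_trans_full[OF _ chart_dom_open[OF assms(1)]] by simp
qed

lemma coord_vec_lin:
  assumes "c \<in> charts_at A q"
  shows "coord_vec A c q (a *\<^sub>R u + b *\<^sub>R v) = lin_comb a (coord_vec A c q u) b (coord_vec A c q v)"
proof -
  have "linear (frechet_derivative (transition c d) (at (snd c q)))" if "d \<in> charts_at A q" for d
    by (rule has_derivative_linear[OF transition_has_derivative[OF assms that]])
  then show ?thesis by (auto simp: coord_vec_def lin_comb_def fun_eq_iff linear_add linear_cmul)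
qed

lemma metric_components:
  assumes g: "riemannian_metric X A g" and c: "c \<in> charts_at A q" and u: "u \<in> tangent_space A q" and v: "v \<in> tangent_space A q"
  shows "g q u v = gdot (metric_matrix A g c) (snd c q) (u c) (v c)"
proof -
  let ?C = "coord_vec A c q"
  note T = coord_vec_in_tangent_space[OF c]
  have lin: "g q (lin_comb s x t y) z = s * g q x z + t * g q y z" and sym: "g q x z = g q z x"
    if "x \<in> tangent_space A q" "y \<in> tangent_space A q" "z \<in> tangent_space A q" for s x t y z
    using g that chart_mem(4)[OF c] unfolding riemannian_metric_def by blast+
  have L: "linear (\<lambda>x. g q (?C x) z)" if z: "z \<in> tangent_space A q" for z
  proof (rule linearI)
    show "g q (?C (x + y)) z = g q (?C x) z + g q (?C y) z" for x y
      using lin[OF T T z, of 1 x 1 y] coord_vec_lin[OF c, of 1 x 1 y] by simp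
    show "g q (?C (s *\<^sub>R x)) z = s *\<^sub>R g q (?C x) z" for s x
      using lin[OF T T z, of s x 0 x] coord_vec_lin[OF c, of s x 0 x] by simp
  qed
  have e: "g q (?C x) z = (\<Sum>i\<in>UNIV. x $ i * g q (?C (axis i 1)) z)" if "z \<in> tangent_space A q" for x z
    by (subst vec_axis_sum[of x, symmetric]) (simp only: linear_sum[OF L[OF that]] linear_cmul[OF L[OF that]] real_scaleR_def)
  have "g q u v = g q (?C (u c)) (?C (v c))" using coord_vec_components[OF u c] coord_vec_components[OF v c] by simp
  also have "\<dots> = (\<Sum>i\<in>UNIV. u c $ i * (\<Sum>j\<in>UNIV. v c $ j * g q (?C (axis j 1)) (?C (axis i 1))))"
    unfolding e[OF T, of "u c"] by (subst sym[OF T T T], subst e[OF T], rule refl)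
  also have "\<dots> = gdot (metric_matrix A g c) (snd c q) (u c) (v c)"
    unfolding gdot_def metric_matrix_def Let_def sum_distrib_left
    using c sym[OF T T T] by (intro sum.cong refl) (simp add: charts_at_def mult_ac)
  finally show ?thesis .
qed

lemma metric_patch_chart:
  assumes g: "riemannian_metric X A g" and c: "c \<in> A"
  shows "metric_patch (metric_matrix A g c) (chart_image c)"
proof
  show "open (chart_image c)" by (rule chart_image_open[OF c])
  show "smooth_on (chart_image c) (\<lambda>x. metric_matrix A g c x $ i $ j)" for i j
    using g c unfolding riemannian_metric_def by blast
  fix x assume x: "x \<in> chart_image c"
  let ?q = "chart_inv c x"
  note ca = chart_inv_charts_at[OF c x]
  note T = coord_vec_in_tangent_space[OF ca]
  show "metric_matrix A g c x $ i $ j = metric_matrix A g c x $ j $ i" for i j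
    using g T chart_mem(4)[OF ca] unfolding riemannian_metric_def metric_matrix_def Let_def by simp
  show "gdot (metric_matrix A g c) x v v > 0" if "v \<noteq> 0" for v
  proof -
    have "coord_vec A c ?q v \<noteq> (\<lambda>_. 0)" using coord_vec_self[OF ca, of v] that by metis
    then have "g ?q (coord_vec A c ?q v) (coord_vec A c ?q v) > 0"
      using g T chart_mem(4)[OF ca] unfolding riemannian_metric_def by blast
    then show ?thesis unfolding metric_components[OF g ca T T] by (simp add: coord_vec_self[OF ca] chart_chart_inv[OF x])
  qed
qed

lemma einstein_frame_chart:
  assumes sol: "einstein_scalar_solution X A \<Lambda> V g \<phi>" and V: "C31 V" and c: "c \<in> A"
    and nf: "normal_frame (metric_matrix A g c) (chart_image c) F E \<rho>"
  shows "einstein_frame (metric_matrix A g c) (chart_image c) F E \<rho> (\<phi> \<circ> chart_inv c) V \<Lambda>"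
  using sol c V nf
  by (intro einstein_frame.intro einstein_frame_axioms.intro)
    (auto simp: einstein_scalar_solution_def Let_def smooth_fun_def C31_def)

end

section \<open>Maps given in a single pair of charts\<close>

locale manifold_pair = M: smooth_manifold X A + N: smooth_manifold X' A'
  for X :: "'a topology" and A :: "('a, 'n::finite) chart set" and X' :: "'b topology" and A' :: "('b, 'n) chart set"
begin

context
  fixes c c' Y \<Phi> f
  assumes c: "c \<in> A" "c' \<in> A'" and Y: "open Y" "Y \<subseteq> chart_image c" and \<Phi>: "smooth_on Y \<Phi>" "\<And>y. y \<in> Y \<Longrightarrow> \<Phi> y \<in> chart_image c'"
    and f: "\<And>q. q \<in> chart_inv c ` Y \<Longrightarrow> f q = chart_inv c' (\<Phi> (snd c q))"
begin

lemma W_iff: "q \<in> chart_inv c ` Y \<longleftrightarrow> q \<in> fst c \<and> snd c q \<in> Y"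
  unfolding M.chart_inv_image[OF c(1) Y(2)] by simp

lemma f_in: "q \<in> chart_inv c ` Y \<Longrightarrow> f q \<in> fst c'" and f_chart: "q \<in> chart_inv c ` Y \<Longrightarrow> snd c' (f q) = \<Phi> (snd c q)"
  using f[of q] \<Phi>(2)[of "snd c q"] N.chart_inv_in[of _ c'] N.chart_chart_inv[of _ c'] by (auto simp: W_iff)

lemma f_continuous: "continuous_map (subtopology X (chart_inv c ` Y)) X' f"
  unfolding continuous_map
proof (intro conjI allI impI)
  have tW: "topspace (subtopology X (chart_inv c ` Y)) = chart_inv c ` Y"
    using openin_subset[OF M.open_chart_inv[OF c(1) Y]] by auto
  show "f ` topspace (subtopology X (chart_inv c ` Y)) \<subseteq> topspace X'"
    unfolding tW using f_in c(2) N.charts_cover by blast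
  fix V assume V: "openin X' V"
  have o: "open (snd c' ` (V \<inter> fst c'))" by (rule N.open_chart_image[OF c(2)]) (use V N.chart_dom_open[OF c(2)] in auto)
  have "open (Y \<inter> \<Phi> -` (snd c' ` (V \<inter> fst c')))"
    by (rule continuous_open_preimage[OF C_on_continuous[OF smooth_on_C_on[OF \<Phi>(1), of 0]] Y(1) o])
  moreover have "Y \<inter> \<Phi> -` (snd c' ` (V \<inter> fst c')) = {y \<in> Y. \<Phi> y \<in> snd c' ` (V \<inter> fst c')}" by blast
  ultimately have "open {y \<in> Y. \<Phi> y \<in> snd c' ` (V \<inter> fst c')}" by (simp only:)
  then have "openin X (chart_inv c ` {y \<in> Y. \<Phi> y \<in> snd c' ` (V \<inter> fst c')})"
    by (rule M.open_chart_inv[OF c(1)]) (use Y(2) in blast)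
  moreover have "chart_inv c ` {y \<in> Y. \<Phi> y \<in> snd c' ` (V \<inter> fst c')} = {q \<in> chart_inv c ` Y. f q \<in> V}"
  proof -
    have "\<Phi> (snd c q) \<in> snd c' ` (V \<inter> fst c') \<longleftrightarrow> f q \<in> V" if q: "q \<in> chart_inv c ` Y" for q
    proof
      show "f q \<in> V" if r: "\<Phi> (snd c q) \<in> snd c' ` (V \<inter> fst c')"
      proof -
        obtain p where p: "p \<in> V" "p \<in> fst c'" "snd c' (f q) = snd c' p" using r unfolding f_chart[OF q, symmetric] by blast
        then show ?thesis using inj_onD[OF N.chart_inj[OF c(2)] p(3) f_in[OF q] p(2)] by simp
      qed
      show "\<Phi> (snd c q) \<in> snd c' ` (V \<inter> fst c')" if "f q \<in> V"
        unfolding f_chart[OF q, symmetric] using that f_in[OF q] by blast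
    qed
    moreover have "{y \<in> Y. \<Phi> y \<in> snd c' ` (V \<inter> fst c')} \<subseteq> chart_image c" using Y(2) by blast
    ultimately show ?thesis by (auto simp: M.chart_inv_image[OF c(1)] W_iff)
  qed
  ultimately show "openin (subtopology X (chart_inv c ` Y)) {q \<in> topspace (subtopology X (chart_inv c ` Y)). f q \<in> V}"
    unfolding tW by (simp add: openin_subtopology_Int2 openin_open_subtopology M.open_chart_inv[OF c(1) Y])
qed

context
  fixes d d' assumes d: "d \<in> A" "d' \<in> A'"
begin

lemma open_dom: "openin X {q \<in> chart_inv c ` Y \<inter> fst d. f q \<in> fst d'}"
proof -
  have "openin (subtopology X (chart_inv c ` Y)) {q \<in> topspace (subtopology X (chart_inv c ` Y)). f q \<in> fst d'}"
    by (rule openin_continuous_map_preimage[OF f_continuous N.chart_dom_open[OF d(2)]])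
  then have "openin X {q \<in> topspace (subtopology X (chart_inv c ` Y)). f q \<in> fst d'}"
    using openin_trans_full M.open_chart_inv[OF c(1) Y] by blast
  then have "openin X ({q \<in> topspace (subtopology X (chart_inv c ` Y)). f q \<in> fst d'} \<inter> fst d)"
    using M.chart_dom_open[OF d(1)] by (rule openin_Int)
  moreover have "{q \<in> topspace (subtopology X (chart_inv c ` Y)). f q \<in> fst d'} \<inter> fst d = {q \<in> chart_inv c ` Y \<inter> fst d. f q \<in> fst d'}"
    using openin_subset[OF M.open_chart_inv[OF c(1) Y]] by auto
  ultimately show ?thesis by simp
qed

lemma chart_expression:
  assumes "x \<in> snd d ` {q \<in> chart_inv c ` Y \<inter> fst d. f q \<in> fst d'}"
  shows "(snd d' \<circ> f \<circ> chart_inv d) x = transition c' d' (\<Phi> (transition d c x))"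
    "x \<in> snd d ` (fst d \<inter> fst c)" "transition d c x \<in> Y" "\<Phi> (transition d c x) \<in> snd c' ` (fst c' \<inter> fst d')"
proof -
  obtain q where q: "q \<in> chart_inv c ` Y" "q \<in> fst d" "f q \<in> fst d'" "x = snd d q" using assms by auto
  show "(snd d' \<circ> f \<circ> chart_inv d) x = transition c' d' (\<Phi> (transition d c x))"
    using q f[OF q(1)] d by (simp add: transition_def)
  show "x \<in> snd d ` (fst d \<inter> fst c)" "transition d c x \<in> Y" using q d by (auto simp: W_iff transition_def)
  show "\<Phi> (transition d c x) \<in> snd c' ` (fst c' \<inter> fst d')"
    using q d f_in[OF q(1)] f_chart[OF q(1)] by (auto simp: transition_def intro!: image_eqI[of _ _ "f q"])
qed

text \<open>In any other pair of charts \<open>f\<close> is \<open>\<Phi>\<close> composed with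
  transition maps on both sides.\<close>

lemma chart_expression_smooth:
  "smooth_on (snd d ` {q \<in> chart_inv c ` Y \<inter> fst d. f q \<in> fst d'}) (snd d' \<circ> f \<circ> chart_inv d)"
proof -
  let ?T = "snd d ` {q \<in> chart_inv c ` Y \<inter> fst d. f q \<in> fst d'}"
  have o: "open ?T" by (rule M.open_chart_image[OF d(1) open_dom]) auto
  have "smooth_on ?T (transition d c)"
    by (rule smooth_on_subset[OF M.charts_compatible[OF d(1) c(1)]]) (use chart_expression(2) in blast)
  from smooth_on_compose[OF this \<Phi>(1) o Y(1) chart_expression(3)] have "smooth_on ?T (\<lambda>x. \<Phi> (transition d c x))" .
  from smooth_on_compose[OF this N.charts_compatible[OF c(2) d(2)] o N.open_overlap[OF c(2) d(2)] chart_expression(4)]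
  have "smooth_on ?T (\<lambda>x. transition c' d' (\<Phi> (transition d c x)))" .
  then show ?thesis by (rule smooth_on_cong[OF _ o]) (rule chart_expression(1)[symmetric])
qed

end

lemma smooth_map: "smooth_map_on X A X' A' (chart_inv c ` Y) f"
  unfolding smooth_map_on_def using f_continuous chart_expression_smooth by blast

text \<open>\<open>differential\<close> uses the chart chosen by \<open>chart_at\<close>; the chain
  rule through the transition maps passes from it to \<open>c\<close> and \<open>c'\<close>.\<close>

lemma differential_eq:
  assumes q: "q \<in> chart_inv c ` Y" and D: "(\<Phi> has_derivative D) (at (snd c q))" and v: "v \<in> tangent_space A q"
  shows "differential A A' f q v = coord_vec A' c' (f q) (D (v c))"
proof -
  have ca: "c \<in> charts_at A q" "c' \<in> charts_at A' (f q)" using q f_in[OF q] c by (auto simp: charts_at_def W_iff)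
  define d where "d = chart_at A q"
  have d: "d \<in> charts_at A q" unfolding d_def by (rule M.chart_at[OF M.chart_mem(4)[OF ca(1)]])
  have vc: "v c = fd (transition d c) (snd d q) (v d)"
    using v ca(1) d unfolding tangent_space_def by blast
  have "fd (snd d' \<circ> f \<circ> chart_inv d) (snd d q) (v d) = fd (transition c' d') (snd c' (f q)) (D (v c))"
    if d': "d' \<in> charts_at A' (f q)" for d'
  proof -
    let ?T = "snd d ` {q \<in> chart_inv c ` Y \<inter> fst d. f q \<in> fst d'}"
    have m: "d \<in> A" "d' \<in> A'" using d d' by (auto simp: charts_at_def)
    have o: "open ?T" by (rule M.open_chart_image[OF m(1) open_dom[OF m]]) auto
    have x: "snd d q \<in> ?T" using q d d' by (auto simp: charts_at_def)
    have t: "transition d c (snd d q) = snd c q" using d m by (simp add: transition_def charts_at_def)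
    have "((\<lambda>x. transition c' d' (\<Phi> (transition d c x))) has_derivative
       (\<lambda>u. fd (transition c' d') (snd c' (f q)) (D (fd (transition d c) (snd d q) u)))) (at (snd d q))"
    proof -
      have e: "\<Phi> (transition d c (snd d q)) = snd c' (f q)" by (simp add: t f_chart[OF q])
      note 1 = diff_chain_at[OF M.transition_has_derivative[OF d ca(1)] D[folded t], unfolded o_def]
      show ?thesis
        using diff_chain_at[OF 1 N.transition_has_derivative[OF ca(2) d', folded e]] by (simp add: o_def e)
    qed
    moreover have "fd (snd d' \<circ> f \<circ> chart_inv d) (snd d q) = fd (\<lambda>x. transition c' d' (\<Phi> (transition d c x))) (snd d q)"
      by (rule fd_cong[OF o x]) (rule chart_expression(1)[OF m])
    ultimately show ?thesis unfolding vc by (simp add: fd_eq)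
  qed
  then show ?thesis unfolding differential_def coord_vec_def Let_def d_def[symmetric] by auto
qed

end

end

theorem theorem3p1:
  fixes U :: "'a topology" and A :: "('a, 'n::finite) chart set"
    and g :: "('a, 'n) metric_field" and \<phi> :: "'a \<Rightarrow> real" and p :: 'a
    and U' :: "'b topology" and A' :: "('b, 'n) chart set"
    and g' :: "('b, 'n) metric_field" and \<phi>' :: "'b \<Rightarrow> real" and p' :: 'b
    and \<Lambda> :: real and V :: "real \<Rightarrow> real"
    and \<Psi> :: "('a, 'n) tvec \<Rightarrow> ('b, 'n) tvec"
  assumes "CARD('n) \<ge> 3"
    and "C31 V"
    and "smooth_manifold U A"
    and "smooth_manifold U' A'"
    and "einstein_scalar_solution U A \<Lambda> V g \<phi>"
    and "einstein_scalar_solution U' A' \<Lambda> V g' \<phi>'"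
    and "p \<in> topspace U"
    and "p' \<in> topspace U'"
    and "tangent_isomorphism A p A' p' \<Psi>"
    and "\<And>X1 X2. X1 \<in> tangent_space A p \<Longrightarrow> X2 \<in> tangent_space A p \<Longrightarrow>
           g p X1 X2 = g' p' (\<Psi> X1) (\<Psi> X2)"
    and "\<And>k Xs. set Xs \<subseteq> tangent_space A p \<Longrightarrow> length Xs = k \<Longrightarrow>
           nabla_scalar A g \<phi> k p Xs = nabla_scalar A' g' \<phi>' k p' (map \<Psi> Xs)"
    and "\<And>k Xs. set Xs \<subseteq> tangent_space A p \<Longrightarrow> length Xs = k + 4 \<Longrightarrow>
           nabla_riemann A g k p Xs = nabla_riemann A' g' k p' (map \<Psi> Xs)"
  shows "\<exists>W W' f. p \<in> W \<and> p' \<in> W' \<and> diffeomorphism_on U A U' A' W W' f \<and>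
           (\<forall>q\<in>W. (\<forall>X\<in>tangent_space A q. \<forall>Y\<in>tangent_space A q.
                      g q X Y = g' (f q) (differential A A' f q X) (differential A A' f q Y)) \<and>
                   \<phi> q = \<phi>' (f q))"
proof -
  interpret manifold_pair U A U' A' by (intro manifold_pair.intro assms)
  interpret rev: manifold_pair U' A' U A by (intro manifold_pair.intro assms)
  have rm: "riemannian_metric U A g" "riemannian_metric U' A' g'"
    using assms(5,6) unfolding einstein_scalar_solution_def by blast+
  define c where "c = chart_at A p"
  define c' where "c' = chart_at A' p'"
  have ca: "c \<in> charts_at A p" "c' \<in> charts_at A' p'"
    unfolding c_def c'_def using M.chart_at[OF assms(7)] N.chart_at[OF assms(8)] .
  have cA: "c \<in> A" "c' \<in> A'" using ca by (auto simp: charts_at_def)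
  let ?G = "metric_matrix A g c" and ?G' = "metric_matrix A' g' c'" and ?S = "chart_image c" and ?S' = "chart_image c'"
  let ?h = "\<phi> \<circ> chart_inv c" and ?h' = "\<phi>' \<circ> chart_inv c'"
  interpret mp: metric_patch ?G ?S by (rule M.metric_patch_chart[OF rm(1) cA(1)])
  interpret mp': metric_patch ?G' ?S' by (rule N.metric_patch_chart[OF rm(2) cA(2)])
  obtain E0 :: "real^'n^'n" where E0: "\<And>i j. gdot ?G (snd c p) (E0 $ i) (E0 $ j) = (if i = j then 1 else 0)"
    by (rule mp.orthonormal_frame_exists[OF M.chart_mem(3)[OF ca(1)]]) (rule that)
  \<comment> \<open>The tangent vectors at \<open>p\<close> whose components in \<open>c\<close> are
    the rows of \<open>E0\<close>; the hypotheses on \<open>\<Psi>\<close> are evaluated on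
    them.\<close>
  define B where "B i = coord_vec A c p (E0 $ i)" for i
  have B: "B i \<in> tangent_space A p" "B i c = E0 $ i" for i
    unfolding B_def by (rule M.coord_vec_in_tangent_space[OF ca(1)] M.coord_vec_self[OF ca(1)])+
  have \<Psi>B: "\<Psi> (B i) \<in> tangent_space A' p'" for i
    using assms(9) B(1) unfolding tangent_isomorphism_def bij_betw_def by blast
  \<comment> \<open>The image of the first frame under \<open>\<Psi>\<close>, orthonormal because
    \<open>\<Psi>\<close> preserves the inner products.\<close>
  define E0' :: "real^'n^'n" where "E0' = (\<chi> i. \<Psi> (B i) c')"
  have E0': "gdot ?G' (snd c' p') (E0' $ i) (E0' $ j) = (if i = j then 1 else 0)" for i j
    using assms(10)[OF B(1) B(1), of i j] M.metric_components[OF rm(1) ca(1) B(1) B(1), of i j]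
      N.metric_components[OF rm(2) ca(2) \<Psi>B \<Psi>B, of i j] E0[of i j] by (simp add: B(2) E0'_def)
  obtain F E \<rho>1 where nf: "normal_frame ?G ?S F E \<rho>1" "F 0 = snd c p" "E 0 = E0"
    by (rule mp.normal_frame_exists[OF M.chart_mem(3)[OF ca(1)] E0])
  obtain F' E' \<rho>2 where nf': "normal_frame ?G' ?S' F' E' \<rho>2" "F' 0 = snd c' p'" "E' 0 = E0'"
    by (rule mp'.normal_frame_exists[OF N.chart_mem(3)[OF ca(2)] E0'])
  define \<rho> where "\<rho> = min \<rho>1 \<rho>2"
  have \<rho>: "0 < \<rho>" "\<rho> \<le> \<rho>1" "\<rho> \<le> \<rho>2"
    using normal_frame.\<rho>[OF nf(1)] normal_frame.\<rho>[OF nf'(1)] by (auto simp: \<rho>_def)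
  have ef: "einstein_frame ?G ?S F E \<rho> ?h V \<Lambda>" "einstein_frame ?G' ?S' F' E' \<rho> ?h' V \<Lambda>"
    by (rule M.einstein_frame_chart[OF assms(5,2) cA(1) normal_frame.shrink[OF nf(1) \<rho>(1,2)]]
        N.einstein_frame_chart[OF assms(6,2) cA(2) normal_frame.shrink[OF nf'(1) \<rho>(1,3)]])+
  have E0'_nth: "($) E0' = (\<lambda>i. \<Psi> (B i) c')" by (simp add: E0'_def fun_eq_iff)
  \<comment> \<open>At the origin the frames are \<open>B\<close> and its image under
    \<open>\<Psi>\<close>, so frame components there are the values compared in the hypotheses on
    covariant derivatives.\<close>
  have comp: "normal_frame.comp F E T as 0 = tensor_apply (T (snd c p)) (map (\<lambda>v. v c) (map B as))"
    "normal_frame.comp F' E' T as 0 = tensor_apply (T (snd c' p')) (map (\<lambda>v. v c') (map \<Psi> (map B as)))" for T as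
    unfolding normal_frame.comp_def[OF nf(1)] normal_frame.comp_def[OF nf'(1)] by (simp_all add: nf nf' o_def B(2) E0'_nth)
  have Bs: "set (map B as) \<subseteq> tangent_space A p" for as using B(1) by auto
  interpret fp: frame_pair ?G ?S F E \<rho> ?h V \<Lambda> ?G' ?S' F' E' ?h'
  proof (intro frame_pair.intro ef frame_pair_axioms.intro)
    fix as :: "'n list" and k
    show "normal_frame.comp F E ((cov_deriv ?G ^^ k) (scalar_field ?h)) as 0 = normal_frame.comp F' E' ((cov_deriv ?G' ^^ k) (scalar_field ?h')) as 0"
      if "length as = k" using assms(11)[OF Bs, of as k] that unfolding comp nabla_scalar_def Let_def c_def c'_def by simp
    show "normal_frame.comp F E ((cov_deriv ?G ^^ k) (riemann ?G)) as 0 = normal_frame.comp F' E' ((cov_deriv ?G' ^^ k) (riemann ?G')) as 0"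
      if "length as = k + 4" using assms(12)[OF Bs, of as k] that unfolding comp nabla_riemann_def Let_def c_def c'_def by simp
  qed
  obtain r where r: "0 < r" "frame_match ?G ?S F E r ?G' ?S' F' E'" "\<And>x. x \<in> ball 0 r \<Longrightarrow> ?h (F x) = ?h' (F' x)"
    by (rule fp.local_isometry) (rule that)
  interpret fm: frame_match ?G ?S F E r ?G' ?S' F' E' by (rule r(2))
  \<comment> \<open>The same construction with the roles exchanged provides the smooth
    inverse.\<close>
  interpret fm': frame_match ?G' ?S' F' E' r ?G ?S F E by (rule frame_match_sym[OF r(2)])
  have sub: "fm.a.W \<subseteq> ?S" "fm.b.W \<subseteq> ?S'" using fm.a.W_S fm.b.W_S by blast+
  define W where "W = chart_inv c ` fm.a.W"
  define W' where "W' = chart_inv c' ` fm.b.W"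
  define f where "f q = chart_inv c' (fm.f (snd c q))" for q
  define f' where "f' q = chart_inv c (fm'.f (snd c' q))" for q
  have W: "q \<in> W \<Longrightarrow> snd c q \<in> fm.a.W" "q \<in> W \<Longrightarrow> q \<in> fst c" for q
    unfolding W_def M.chart_inv_image[OF cA(1) sub(1)] by auto
  have W': "q \<in> W' \<Longrightarrow> snd c' q \<in> fm.b.W" "q \<in> W' \<Longrightarrow> q \<in> fst c'" for q
    unfolding W'_def N.chart_inv_image[OF cA(2) sub(2)] by auto
  have ff: "fm'.f (fm.f y) = y" if "y \<in> fm.a.W" for y
    unfolding fm'.f_def fm.f_def fm.b.KF[OF fm.a.K_in[OF that]] by (rule fm.a.FK[OF that])
  have ff': "fm.f (fm'.f y) = y" if "y \<in> fm.b.W" for y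
    unfolding fm'.f_def fm.f_def fm.a.KF[OF fm.b.K_in[OF that]] by (rule fm.b.FK[OF that])
  have f_chart: "snd c' (f q) = fm.f (snd c q)" "f q \<in> W'" "f' (f q) = q" if "q \<in> W" for q
  proof -
    have y: "fm.f (snd c q) \<in> fm.b.W" by (rule fm.f_in[OF W(1)[OF that]])
    show 1: "snd c' (f q) = fm.f (snd c q)" unfolding f_def using N.chart_chart_inv y sub(2) by blast
    show "f q \<in> W'" unfolding f_def W'_def using y by blast
    show "f' (f q) = q" unfolding f'_def 1 ff[OF W(1)[OF that]] by (rule M.chart_inv_chart[OF cA(1) W(2)[OF that]])
  qed
  have f'_chart: "snd c (f' q) = fm'.f (snd c' q)" "f' q \<in> W" "f (f' q) = q" if "q \<in> W'" for q
  proof -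
    have y: "fm'.f (snd c' q) \<in> fm.a.W" by (rule fm'.f_in[OF W'(1)[OF that]])
    show 1: "snd c (f' q) = fm'.f (snd c' q)" unfolding f'_def using M.chart_chart_inv y sub(1) by blast
    show "f' q \<in> W" unfolding f'_def W_def using y by blast
    show "f (f' q) = q" unfolding f_def 1 ff'[OF W'(1)[OF that]] by (rule N.chart_inv_chart[OF cA(2) W'(2)[OF that]])
  qed
  have bij: "bij_betw f W W'"
    by (rule bij_betw_byWitness[where f'=f']) (use f_chart f'_chart in blast)+
  have inv: "inv_into W f q = f' q" if "q \<in> W'" for q
    using inv_into_f_f[OF bij_betw_imp_inj_on[OF bij] f'_chart(2)[OF that]] by (simp add: f'_chart(3)[OF that])
  have "smooth_map_on U A U' A' W f"
    unfolding W_def by (rule smooth_map[OF cA fm.a.W_open sub(1) fm.f_smooth]) (use sub fm.f_in f_def in blast)+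
  moreover have "smooth_map_on U' A' U A W' (inv_into W f)"
    unfolding W'_def
    by (rule rev.smooth_map[OF cA(2,1) fm.b.W_open sub(2) fm'.f_smooth]) (use sub fm'.f_in inv[unfolded W'_def f'_def] in blast)+
  ultimately have "diffeomorphism_on U A U' A' W W' f"
    unfolding diffeomorphism_on_def W_def W'_def
    using bij[unfolded W_def W'_def] M.open_chart_inv[OF cA(1) fm.a.W_open sub(1)] N.open_chart_inv[OF cA(2) fm.b.W_open sub(2)] by blast
  moreover have "p \<in> W" "p' \<in> W'"
  proof -
    have "0 \<in> ball (0::real^'n) r" using r(1) by simp
    then have "snd c p \<in> fm.a.W" "snd c' p' \<in> fm.b.W" unfolding fm.a.W_def fm.b.W_def using nf(2) nf'(2) by (metis imageI)+
    then show "p \<in> W" "p' \<in> W'"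
      unfolding W_def W'_def M.chart_inv_image[OF cA(1) sub(1)] N.chart_inv_image[OF cA(2) sub(2)]
      using M.chart_mem(2)[OF ca(1)] N.chart_mem(2)[OF ca(2)] by auto
  qed
  moreover have "g q X Y = g' (f q) (differential A A' f q X) (differential A A' f q Y)"
    if q: "q \<in> W" and X: "X \<in> tangent_space A q" and Y: "Y \<in> tangent_space A q" for q X Y
  proof -
    have cq: "c \<in> charts_at A q" "c' \<in> charts_at A' (f q)"
      using W(2)[OF q] W'(2)[OF f_chart(2)[OF q]] cA by (auto simp: charts_at_def)
    have d: "differential A A' f q X = coord_vec A' c' (f q) (fm.J (snd c q) (X c))" if "X \<in> tangent_space A q" for X
      by (rule differential_eq[OF cA fm.a.W_open sub(1) fm.f_smooth _ _ q[unfolded W_def] fm.f_deriv[OF W(1)[OF q]] that])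
        (use sub fm.f_in f_def in blast)+
    note T = N.coord_vec_in_tangent_space[OF cq(2)]
    show ?thesis
      unfolding d[OF X] d[OF Y] M.metric_components[OF rm(1) cq(1) X Y] N.metric_components[OF rm(2) cq(2) T T]
        N.coord_vec_self[OF cq(2)] f_chart(1)[OF q] fm.J_isometry[OF W(1)[OF q]] ..
  qed
  moreover have "\<phi> q = \<phi>' (f q)" if q: "q \<in> W" for q
  proof -
    have "?h (snd c q) = ?h' (fm.f (snd c q))"
      using r(3)[OF fm.a.K_in[OF W(1)[OF q]]] by (simp add: fm.a.FK[OF W(1)[OF q]] fm.f_def)
    then show ?thesis using M.chart_inv_chart[OF cA(1) W(2)[OF q]] by (simp add: f_def)
  qed
  ultimately show ?thesis by blast
qed

end
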